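(* Let $(R,\mathfrak m)$ be a Cohen-Macaulay local ring of dimension $d$, let $I_1,\ldots,I_d$ be $\mathfrak m$-primary ideals of $R$, put $\mathbf I=(I_1,\ldots,I_d)$, and let $\mathcal F=\{\mathcal F(\mathbf n):\mathbf n\in\mathbb Z^d\}$ be an $\mathbf I$-admissible filtration. Let $(x_{ij})_{1\le i,j\le d}$ (with $x_{ij}\in I_i$) be a complete reduction of $\mathcal F$, put $a_i=x_{ii}$ for $i=1,\ldots,d$, and let $M=\mathcal R'(\mathcal F)=\bigoplus_{\mathbf n\in\mathbb Z^d}\mathcal F(\mathbf n)\mathbf t^{\mathbf n}$ be the extended Rees algebra of $\mathcal F$ and $\mathcal I=(a_1t_1,a_2t_2,\ldots,a_dt_d)$. Then: (1) for all $i\ge 0$, $[H^i_{\mathcal I}(M)]_{\mathbf n}=0$ for all $\mathbf n\gg\mathbf 0$; (2) if $(x_{ij})$ is moreover a strict complete reduction of $\mathcal F$, then $\lambda_R\big([H^d_{\mathcal I}(M)]_{\mathbf n}\big)<\infty$ for all $\mathbf n\in\mathbb Z^d$ with $\mathbf n\ge\mathbf 0$.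
   Context: $\lambda_R$ denotes length of $R$-modules. Vectors in $\mathbb Z^d$ are compared componentwise; $\mathbf e_i$ is the $i$-th standard basis vector and $\mathbf e=\mathbf e_1+\cdots+\mathbf e_d$. A statement holds "for all $\mathbf n\gg\mathbf 0$" if there is $\mathbf m\in\mathbb N^d$ such that it holds for all $\mathbf n\ge\mathbf m$. For $\mathbf n\in\mathbb Z^d$ put $\mathbf I^{\mathbf n}=I_1^{n_1}\cdots I_d^{n_d}$, with $I_i^{k}=R$ for $k\le 0$, and $\mathbf t^{\mathbf n}=t_1^{n_1}\cdots t_d^{n_d}$ for indeterminates $t_1,\ldots,t_d$. An $\mathbf I$-filtration is a family of ideals $\mathcal F=\{\mathcal F(\mathbf n):\mathbf n\in\mathbb Z^d\}$ such that $\mathcal F(\mathbf n)\subseteq\mathcal F(\mathbf m)$ whenever $\mathbf n\ge\mathbf m$, $\mathbf I^{\mathbf n}\subseteq\mathcal F(\mathbf n)$ for all $\mathbf n$, and $\mathcal F(\mathbf n)\mathcal F(\mathbf m)\subseteq\mathcal F(\mathbf n+\mathbf m)$ for all $\mathbf n,\mathbf m$. It is $\mathbf I$-admissible if $\mathcal R'(\mathcal F)=\bigoplus_{\mathbf n\in\mathbb Z^d}\mathcal F(\mathbf n)\mathbf t^{\mathbf n}$ is a finite module over $\mathcal R'(\mathbf I)=\bigoplus_{\mathbf n\in\mathbb Z^d}\mathbf I^{\mathbf n}\mathbf t^{\mathbf n}$. A $d\times d$ matrix $(x_{ij})$ with $x_{ij}\in I_i$ is a complete reduction of $\mathcal F$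 if, with $y_j=\prod_{i=1}^d x_{ij}$, one has $\mathcal F(\mathbf n+\mathbf e)=(y_1,\ldots,y_d)\mathcal F(\mathbf n)$ for all large $\mathbf n\in\mathbb N^d$. It is a strict complete reduction if in addition $(y_1,\ldots,y_j)\cap\mathcal F(\mathbf n)=(y_1,\ldots,y_j)\mathcal F(\mathbf n-\mathbf e)$ for all $\mathbf n\ge j\mathbf e$ and all $j=1,\ldots,d-1$. $H^i_{\mathcal I}(M)$ is local cohomology with support in $\mathcal I$, with its natural $\mathbb Z^d$-grading, and $[\;]_{\mathbf n}$ is its degree $\mathbf n$ component. *)

theory Defs
  imports
    "HOL-Algebra.Ideal_Product"
    "HOL-Algebra.Ring_Divisibility"
    "HOL-Algebra.Module"
    "HOL-Algebra.QuotRing"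
    "HOL-Algebra.Algebraic_Closure_Type"
    "HOL-Analysis.Finite_Cartesian_Product"
    "HOL-Library.Poly_Mapping"
    "HOL-Library.Extended_Nat"
begin

section \<open>Noetherian local rings, depth, dimension and length\<close>

definition noetherian_local_ring :: "('a, 'r) ring_scheme \<Rightarrow> 'a set \<Rightarrow> bool" where
  "noetherian_local_ring R \<mm> \<longleftrightarrow>
     cring R \<and> noetherian_ring R \<and> maximalideal \<mm> R \<and> (\<forall>J. maximalideal J R \<longrightarrow> J = \<mm>)"

definition krull_dim :: "('a, 'r) ring_scheme \<Rightarrow> enat" where
  "krull_dim R = Sup {enat n | n. \<exists>P. (\<forall>i\<le>n. primeideal (P i) R) \<and> (\<forall>i<n. P i \<subset> P (Suc i))}"

definition regular_sequence :: "('a, 'r) ring_scheme \<Rightarrow> 'a list \<Rightarrow> bool" where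
  "regular_sequence R xs \<longleftrightarrow>
     set xs \<subseteq> carrier R \<and> Idl\<^bsub>R\<^esub> (set xs) \<noteq> carrier R \<and>
     (\<forall>k<length xs. \<forall>a\<in>carrier R.
        (xs ! k) \<otimes>\<^bsub>R\<^esub> a \<in> Idl\<^bsub>R\<^esub> (set (take k xs)) \<longrightarrow> a \<in> Idl\<^bsub>R\<^esub> (set (take k xs)))"

definition ring_depth :: "('a, 'r) ring_scheme \<Rightarrow> 'a set \<Rightarrow> enat" where
  "ring_depth R \<mm> = Sup {enat (length xs) | xs. set xs \<subseteq> \<mm> \<and> regular_sequence R xs}"

definition cohen_macaulay_local_ring :: "('a, 'r) ring_scheme \<Rightarrow> 'a set \<Rightarrow> bool" where
  "cohen_macaulay_local_ring R \<mm> \<longleftrightarrow>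
     noetherian_local_ring R \<mm> \<and> ring_depth R \<mm> = krull_dim R"

definition primary_to :: "('a, 'r) ring_scheme \<Rightarrow> 'a set \<Rightarrow> 'a set \<Rightarrow> bool" where
  "primary_to R P J \<longleftrightarrow>
     ideal J R \<and> J \<noteq> carrier R \<and>
     (\<forall>a\<in>carrier R. \<forall>b\<in>carrier R.
        a \<otimes>\<^bsub>R\<^esub> b \<in> J \<longrightarrow> a \<in> J \<or> (\<exists>k::nat. b [^]\<^bsub>R\<^esub> k \<in> J)) \<and>
     {b \<in> carrier R. \<exists>k::nat. b [^]\<^bsub>R\<^esub> k \<in> J} = P"

definition module_length :: "('a, 'r) ring_scheme \<Rightarrow> ('a, 'b, 'm) module_scheme \<Rightarrow> enat" where
  "module_length R N =
     Sup {enat n | n. \<exists>H. (\<forall>i\<le>n. submodule (H i) R N) \<and> (\<forall>i<n. H i \<subset> H (Suc i))}"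

definition finitely_generated_module ::
  "('a, 'r) ring_scheme \<Rightarrow> ('a, 'b, 'm) module_scheme \<Rightarrow> bool" where
  "finitely_generated_module S M \<longleftrightarrow>
     (\<exists>G\<subseteq>carrier M. finite G \<and>
        carrier M = {(\<Oplus>\<^bsub>M\<^esub>g\<in>G. c g \<odot>\<^bsub>M\<^esub> g) | c. c \<in> G \<rightarrow> carrier S})"

section \<open>Multigraded filtrations\<close>

text \<open>
  Multidegrees are elements of \<open>int ^ 'd\<close> with the componentwise order of the library, where
  \<open>'d\<close> is the index set of the ideals; \<open>axis i 1\<close> is the basis vector with index \<open>i\<close> and
  \<open>vec 1\<close> is the sum of all of them.
\<close>

definition for_all_large :: "(int ^ 'd::finite \<Rightarrow> bool) \<Rightarrow> bool" where
  "for_all_large P \<longleftrightarrow> (\<exists>m\<ge>0. \<forall>n\<ge>m. P n)"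

text \<open>Since \<open>nat\<close> truncates, exponents that are not positive give the unit ideal.\<close>

definition ideal_powers ::
  "('a, 'r) ring_scheme \<Rightarrow> ('d::finite \<Rightarrow> 'a set) \<Rightarrow> int ^ 'd \<Rightarrow> 'a set" where
  "ideal_powers R I n =
     (\<Otimes>\<^bsub>ideals_set R\<^esub>i\<in>UNIV. I i [^]\<^bsub>ideals_set R\<^esub> nat (vec_nth n i))"

definition multi_filtration ::
  "('a, 'r) ring_scheme \<Rightarrow> ('d::finite \<Rightarrow> 'a set) \<Rightarrow> (int ^ 'd \<Rightarrow> 'a set) \<Rightarrow> bool" where
  "multi_filtration R I F \<longleftrightarrow>
     (\<forall>n. ideal (F n) R) \<and>
     (\<forall>n m. m \<le> n \<longrightarrow> F n \<subseteq> F m) \<and>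
     (\<forall>n. ideal_powers R I n \<subseteq> F n) \<and>
     (\<forall>n m. F n \<cdot>\<^bsub>R\<^esub> F m \<subseteq> F (n + m))"

text \<open>
  \<open>(int ^ 'd) \<Rightarrow>\<^sub>0 'a\<close> is the Laurent polynomial ring in the variables \<open>t i\<close> with coefficients in
  \<open>'a\<close>; \<open>Poly_Mapping.single n r\<close> is the monomial \<open>r t^n\<close>.
\<close>

definition extended_rees :: "(int ^ 'd::finite \<Rightarrow> 'a set) \<Rightarrow> ((int ^ 'd) \<Rightarrow>\<^sub>0 'a::zero) set" where
  "extended_rees F = {p. \<forall>n. Poly_Mapping.lookup p n \<in> F n}"

definition extended_rees_ring ::
  "(int ^ 'd::finite \<Rightarrow> 'a set) \<Rightarrow> ((int ^ 'd) \<Rightarrow>\<^sub>0 'a::comm_ring_1) ring" where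
  "extended_rees_ring F = ring_of_type_algebra \<lparr>carrier := extended_rees F\<rparr>"

text \<open>
  The same object as a module over a subring of the Laurent polynomial ring, which acts by
  multiplication.
\<close>

definition extended_rees_module ::
  "(int ^ 'd::finite \<Rightarrow> 'a set)
   \<Rightarrow> ((int ^ 'd) \<Rightarrow>\<^sub>0 'a, (int ^ 'd) \<Rightarrow>\<^sub>0 'a::comm_ring_1) module" where
  "extended_rees_module F =
     \<lparr>carrier = extended_rees F, monoid.mult = (*), one = 1, ring.zero = 0, add = (+), module.smult = (*)\<rparr>"

definition extended_rees_component ::
  "(int ^ 'd::finite \<Rightarrow> 'a set) \<Rightarrow> int ^ 'd \<Rightarrow> ((int ^ 'd) \<Rightarrow>\<^sub>0 'a::zero) set" where
  "extended_rees_component F n = Poly_Mapping.single n ` F n"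

definition admissible_filtration ::
  "('d::finite \<Rightarrow> 'a::comm_ring_1 set) \<Rightarrow> (int ^ 'd \<Rightarrow> 'a set) \<Rightarrow> bool" where
  "admissible_filtration I F \<longleftrightarrow>
     multi_filtration ring_of_type_algebra I F \<and>
     finitely_generated_module (extended_rees_ring (ideal_powers ring_of_type_algebra I))
       (extended_rees_module F)"

section \<open>Complete reductions\<close>

definition column_product ::
  "('a, 'r) ring_scheme \<Rightarrow> ('d::finite \<Rightarrow> 'd \<Rightarrow> 'a) \<Rightarrow> 'd \<Rightarrow> 'a" where
  "column_product R x j = (\<Otimes>\<^bsub>R\<^esub>i\<in>UNIV. x i j)"

text \<open>
  The ideal generated by the products of the first \<open>j\<close> columns, in the order of the index
  type: the set \<open>{i. i \<le> k}\<close> has as many elements as the position of \<open>k\<close>, counted from 1.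
\<close>

definition column_ideal ::
  "('a, 'r) ring_scheme \<Rightarrow> ('d::{finite,linorder} \<Rightarrow> 'd \<Rightarrow> 'a) \<Rightarrow> nat \<Rightarrow> 'a set" where
  "column_ideal R x j = Idl\<^bsub>R\<^esub> (column_product R x ` {k. card {i. i \<le> k} \<le> j})"

definition complete_reduction ::
  "('a, 'r) ring_scheme \<Rightarrow> ('d::{finite,linorder} \<Rightarrow> 'a set) \<Rightarrow> (int ^ 'd::{finite,linorder} \<Rightarrow> 'a set)
   \<Rightarrow> ('d \<Rightarrow> 'd \<Rightarrow> 'a) \<Rightarrow> bool" where
  "complete_reduction R I F x \<longleftrightarrow>
     (\<forall>i j. x i j \<in> I i) \<and>
     for_all_large (\<lambda>n. F (n + vec 1) = column_ideal R x CARD('d) \<cdot>\<^bsub>R\<^esub> F n)"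

definition strict_complete_reduction ::
  "('a, 'r) ring_scheme \<Rightarrow> ('d::{finite,linorder} \<Rightarrow> 'a set) \<Rightarrow> (int ^ 'd::{finite,linorder} \<Rightarrow> 'a set)
   \<Rightarrow> ('d \<Rightarrow> 'd \<Rightarrow> 'a) \<Rightarrow> bool" where
  "strict_complete_reduction R I F x \<longleftrightarrow>
     complete_reduction R I F x \<and>
     (\<forall>j\<in>{1..<CARD('d)}. \<forall>n\<ge>vec (int j).
        column_ideal R x j \<inter> F n = column_ideal R x j \<cdot>\<^bsub>R\<^esub> F (n - vec 1))"

section \<open>Localization of a module at the powers of an element\<close>

text \<open>The pair \<open>(m, k)\<close> stands for the fraction \<open>m / s^k\<close>.\<close>

definition fraction_rel ::
  "('s, 'r) ring_scheme \<Rightarrow> ('s, 'b, 'm) module_scheme \<Rightarrow> 's \<Rightarrow> (('b \<times> nat) \<times> ('b \<times> nat)) set" where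
  "fraction_rel S M s =
     {((m, k), (m', k')). m \<in> carrier M \<and> m' \<in> carrier M \<and>
        (\<exists>l::nat. (s [^]\<^bsub>S\<^esub> (l + k')) \<odot>\<^bsub>M\<^esub> m = (s [^]\<^bsub>S\<^esub> (l + k)) \<odot>\<^bsub>M\<^esub> m')}"

definition fraction ::
  "('s, 'r) ring_scheme \<Rightarrow> ('s, 'b, 'm) module_scheme \<Rightarrow> 's \<Rightarrow> 'b \<Rightarrow> nat \<Rightarrow> ('b \<times> nat) set" where
  "fraction S M s m k = fraction_rel S M s `` {(m, k)}"

text \<open>
  The multiplicative fields of the record have no meaning for a module and are left undefined,
  here and below.
\<close>

definition localization ::
  "('s, 'r) ring_scheme \<Rightarrow> ('s, 'b, 'm) module_scheme \<Rightarrow> 's \<Rightarrow> ('s, ('b \<times> nat) set) module" where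
  "localization S M s =
     \<lparr>carrier = (carrier M \<times> UNIV) // fraction_rel S M s,
      monoid.mult = undefined, one = undefined,
      ring.zero = fraction S M s \<zero>\<^bsub>M\<^esub> 0,
      add = (\<lambda>A B. \<Union>(m, k)\<in>A. \<Union>(m', k')\<in>B.
        fraction S M s ((s [^]\<^bsub>S\<^esub> k') \<odot>\<^bsub>M\<^esub> m \<oplus>\<^bsub>M\<^esub> (s [^]\<^bsub>S\<^esub> k) \<odot>\<^bsub>M\<^esub> m') (k + k')),
      module.smult = (\<lambda>r A. \<Union>(m, k)\<in>A. fraction S M s (r \<odot>\<^bsub>M\<^esub> m) k)\<rparr>"

text \<open>The canonical map from the localization at \<open>s\<close> to the one at the product of \<open>s\<close> and \<open>u\<close>.\<close>

definition localization_map ::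
  "('s, 'r) ring_scheme \<Rightarrow> ('s, 'b, 'm) module_scheme \<Rightarrow> 's \<Rightarrow> 's
   \<Rightarrow> ('b \<times> nat) set \<Rightarrow> ('b \<times> nat) set" where
  "localization_map S M s u A =
     (\<Union>(m, k)\<in>A. fraction S M (s \<otimes>\<^bsub>S\<^esub> u) ((u [^]\<^bsub>S\<^esub> k) \<odot>\<^bsub>M\<^esub> m) k)"

section \<open>Local cohomology\<close>

text \<open>
  Local cohomology with support in the ideal generated by the finite family \<open>x\<close>, as the
  cohomology of the Cech complex of \<open>x\<close>. The term in degree \<open>p\<close> is the product, over the sets \<open>T\<close>
  of \<open>p\<close> indices, of the localizations of \<open>M\<close> at the product of the \<open>x i\<close> with \<open>i\<close> in \<open>T\<close>.
\<close>

definition cech_loc ::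
  "('s, 'r) ring_scheme \<Rightarrow> ('s, 'b, 'm) module_scheme \<Rightarrow> ('i \<Rightarrow> 's) \<Rightarrow> 'i set
   \<Rightarrow> ('s, ('b \<times> nat) set) module" where
  "cech_loc S M x T = localization S M (\<Otimes>\<^bsub>S\<^esub>i\<in>T. x i)"

definition cech_module ::
  "('s, 'r) ring_scheme \<Rightarrow> ('s, 'b, 'm) module_scheme \<Rightarrow> ('i::finite \<Rightarrow> 's) \<Rightarrow> nat
   \<Rightarrow> ('s, 'i set \<Rightarrow> ('b \<times> nat) set) module" where
  "cech_module S M x p =
     \<lparr>carrier = (\<Pi>\<^sub>E T\<in>{T. card T = p}. carrier (cech_loc S M x T)),
      monoid.mult = undefined, one = undefined,
      ring.zero = (\<lambda>T\<in>{T. card T = p}. \<zero>\<^bsub>cech_loc S M x T\<^esub>),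
      add = (\<lambda>c c'. \<lambda>T\<in>{T. card T = p}. c T \<oplus>\<^bsub>cech_loc S M x T\<^esub> c' T),
      module.smult = (\<lambda>r c. \<lambda>T\<in>{T. card T = p}. r \<odot>\<^bsub>cech_loc S M x T\<^esub> c T)\<rparr>"

definition cech_diff ::
  "('s, 'r) ring_scheme \<Rightarrow> ('s, 'b, 'm) module_scheme \<Rightarrow> ('i::{finite,linorder} \<Rightarrow> 's) \<Rightarrow> nat
   \<Rightarrow> ('i set \<Rightarrow> ('b \<times> nat) set) \<Rightarrow> 'i set \<Rightarrow> ('b \<times> nat) set" where
  "cech_diff S M x p c =
     (\<lambda>T\<in>{T. card T = Suc p}. \<Oplus>\<^bsub>cech_loc S M x T\<^esub>i\<in>T.
        (let z = localization_map S M (\<Otimes>\<^bsub>S\<^esub>j\<in>T - {i}. x j) (x i) (c (T - {i}))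
         in if even (card {j \<in> T. j < i}) then z else \<ominus>\<^bsub>cech_loc S M x T\<^esub> z))"

definition cech_cocycles ::
  "('s, 'r) ring_scheme \<Rightarrow> ('s, 'b, 'm) module_scheme \<Rightarrow> ('i::{finite,linorder} \<Rightarrow> 's) \<Rightarrow> nat
   \<Rightarrow> ('i set \<Rightarrow> ('b \<times> nat) set) set" where
  "cech_cocycles S M x p =
     {c \<in> carrier (cech_module S M x p). cech_diff S M x p c = \<zero>\<^bsub>cech_module S M x (Suc p)\<^esub>}"

definition cech_coboundaries ::
  "('s, 'r) ring_scheme \<Rightarrow> ('s, 'b, 'm) module_scheme \<Rightarrow> ('i::{finite,linorder} \<Rightarrow> 's) \<Rightarrow> nat
   \<Rightarrow> ('i set \<Rightarrow> ('b \<times> nat) set) set" where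
  "cech_coboundaries S M x p =
     (case p of 0 \<Rightarrow> {\<zero>\<^bsub>cech_module S M x 0\<^esub>}
      | Suc q \<Rightarrow> cech_diff S M x q ` carrier (cech_module S M x q))"

definition local_cohomology ::
  "('s, 'r) ring_scheme \<Rightarrow> ('s, 'b, 'm) module_scheme \<Rightarrow> ('i::{finite,linorder} \<Rightarrow> 's) \<Rightarrow> nat
   \<Rightarrow> ('s, ('i set \<Rightarrow> ('b \<times> nat) set) set) module" where
  "local_cohomology S M x p =
     \<lparr>carrier = (\<lambda>c. cech_coboundaries S M x p +>\<^bsub>cech_module S M x p\<^esub> c) ` cech_cocycles S M x p,
      monoid.mult = undefined, one = undefined,
      ring.zero = cech_coboundaries S M x p,
      add = set_add (cech_module S M x p),
      module.smult = (\<lambda>r A. \<Union>c\<in>A.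
        cech_coboundaries S M x p +>\<^bsub>cech_module S M x p\<^esub> (r \<odot>\<^bsub>cech_module S M x p\<^esub> c))\<rparr>"

subsection \<open>The multigrading\<close>

text \<open>
  Let \<open>Mc n\<close> be the component of degree \<open>n\<close> of \<open>M\<close> and let \<open>x i\<close> be homogeneous of degree \<open>w i\<close>.
  A fraction \<open>m / s^k\<close> with \<open>s\<close> homogeneous has degree \<open>deg m - k deg s\<close>, a cochain is homogeneous
  if all its entries are homogeneous of the same degree, and the component of degree \<open>n\<close> of the
  cohomology consists of the classes of the cocycles of degree \<open>n\<close>.
\<close>

definition cech_component ::
  "('s, 'r) ring_scheme \<Rightarrow> ('s, 'b, 'm) module_scheme \<Rightarrow> (int ^ 'd::finite \<Rightarrow> 'b set)
   \<Rightarrow> ('i::finite \<Rightarrow> 's) \<Rightarrow> ('i \<Rightarrow> int ^ 'd) \<Rightarrow> nat \<Rightarrow> int ^ 'd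
   \<Rightarrow> ('i set \<Rightarrow> ('b \<times> nat) set) set" where
  "cech_component S M Mc x w p n =
     (\<Pi>\<^sub>E T\<in>{T. card T = p}.
        {fraction S M (\<Otimes>\<^bsub>S\<^esub>i\<in>T. x i) m k | m k. m \<in> Mc (n + int k *s (\<Sum>i\<in>T. w i))})"

definition local_cohomology_component ::
  "('s, 'r) ring_scheme \<Rightarrow> ('s, 'b, 'm) module_scheme \<Rightarrow> (int ^ 'd::finite \<Rightarrow> 'b set)
   \<Rightarrow> ('i::{finite,linorder} \<Rightarrow> 's) \<Rightarrow> ('i \<Rightarrow> int ^ 'd) \<Rightarrow> nat \<Rightarrow> int ^ 'd
   \<Rightarrow> ('i set \<Rightarrow> ('b \<times> nat) set) set set" where
  "local_cohomology_component S M Mc x w p n =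
     (\<lambda>c. cech_coboundaries S M x p +>\<^bsub>cech_module S M x p\<^esub> c) `
       (cech_cocycles S M x p \<inter> cech_component S M Mc x w p n)"

text \<open>
  The local cohomology of the extended Rees algebra of \<open>F\<close> with support in the ideal generated by
  the \<open>a i t i\<close>. The ring is the extended Rees algebra of \<open>I\<close>. The component of degree \<open>n\<close> is a
  module over the coefficient ring, which acts through the constants.
\<close>

definition rees_local_cohomology_component ::
  "('d::{finite,linorder} \<Rightarrow> 'a::comm_ring_1 set) \<Rightarrow> (int ^ 'd::{finite,linorder} \<Rightarrow> 'a set) \<Rightarrow> ('d \<Rightarrow> 'a)
   \<Rightarrow> nat \<Rightarrow> int ^ 'd::{finite,linorder}
   \<Rightarrow> ('a, ('d set \<Rightarrow> (((int ^ 'd::{finite,linorder}) \<Rightarrow>\<^sub>0 'a) \<times> nat) set) set) module" where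
  "rees_local_cohomology_component I F a p n =
     (let S = extended_rees_ring (ideal_powers ring_of_type_algebra I);
          M = extended_rees_module F;
          x = (\<lambda>i. Poly_Mapping.single (axis i 1) (a i));
          H = local_cohomology S M x p
      in \<lparr>carrier = local_cohomology_component S M (extended_rees_component F) x
                      (\<lambda>i. axis i 1) p n,
          monoid.mult = undefined, one = undefined,
          ring.zero = \<zero>\<^bsub>H\<^esub>, add = add H,
          module.smult = (\<lambda>r A. Poly_Mapping.single 0 r \<odot>\<^bsub>H\<^esub> A)\<rparr>)"

end

theory Submission
  imports Defs "HOL-Library.Function_Algebras"
begin

text \<open>
  The entries \<open>a\<^sub>i\<close> and the column products \<open>y\<^sub>j\<close> are nonzerodivisors, since the \<open>y\<^sub>j\<close> generate an ideal
  with radical \<open>\<mm>\<close> and form a regular sequence in any order. So all localizations in the Cech complex are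
  subgroups of the total ring of fractions of the Laurent polynomial ring, and cochains are functions
  with values in that ring.

  For part (1), let \<open>B \<subseteq> A\<close> be graded ideals of \<open>M\<close> such that the \<open>a\<^sub>i t\<^sub>i\<close> with \<open>i \<notin> J\<close> kill \<open>A / B\<close>. Then the
  cohomology of \<open>A / B\<close> for the \<open>a\<^sub>i t\<^sub>i\<close> with \<open>i \<in> J\<close> vanishes in large degrees, by induction on \<open>J\<close>. If \<open>J\<close> is
  empty, then \<open>A / B\<close> is zero in large degrees by the reduction property. Otherwise choose \<open>i \<in> J\<close>. The
  ideals \<open>{x \<in> A. (a\<^sub>i t\<^sub>i)\<^sup>k x \<in> B}\<close> are stationary from some \<open>G\<close> on, and \<open>a\<^sub>i t\<^sub>i\<close> kills their successive quotients,
  to which the induction hypothesis applies. As it is injective on \<open>A / G\<close>, the induction hypothesis for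
  \<open>A / (a\<^sub>i t\<^sub>i A + G)\<close> shows that it is injective on the cohomology of \<open>A / G\<close>, all of whose elements it kills
  after taking a power.

  For part (2), strictness and the same descent show that the cohomology below \<open>d\<close> for the elements
  \<open>y\<^sub>j t\<^sub>1 \<cdots> t\<^sub>d\<close> vanishes in degrees \<open>n \<ge> 0\<close>. Changing these elements one at a time into the \<open>a\<^sub>j t\<^sub>j\<close>, one
  finds that the top cohomology for the \<open>a\<^sub>j t\<^sub>j\<close> embeds into the one for the \<open>y\<^sub>j t\<^sub>1 \<cdots> t\<^sub>d\<close>. In a fixed degree the
  latter comes, by the reduction property, from fractions with bounded denominators; it is finitely
  generated and killed by a power of \<open>\<mm>\<close>.
\<close>

section \<open>Noetherian modules\<close>

text \<open>The induction of part (1) can start at \<open>J\<close> empty because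
  \<open>y\<^sub>i\<close> is a multiple of \<open>a\<^sub>i\<close>: for large \<open>n\<close> the
  reduction puts \<open>F(n)\<close> into the sum of the \<open>a\<^sub>i F(n - e\<^sub>i)\<close>,
  while graded ideals are generated in bounded degrees, \<open>M\<close> being finite over a
  finitely generated algebra. Regularity of the \<open>y\<^sub>j\<close> in any order is a matter of
  Koszul cohomology: depth \<open>d\<close> makes it vanish below \<open>d\<close>, and Nakayama's
  lemma passes this on to subfamilies. Part (2) takes the way through the \<open>y\<^sub>j\<close>
  because strictness speaks of these only. With regularity it says that
  \<open>y\<^sub>j\<^sub>+\<^sub>1 r \<in> (y\<^sub>1,...,y\<^sub>j) F(n)\<close> forces
  \<open>r \<in> (y\<^sub>1,...,y\<^sub>j) F(n - e)\<close> for \<open>r \<in> F(n)\<close> and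
  \<open>n \<ge> j e\<close>. Every step of the descent raises both \<open>j\<close> and the degree,
  so a start in degree \<open>n \<ge> 0\<close> never leaves this range. Replacing an element by a
  multiple enlarges the localizations. Moving a primitive back to the smaller ones costs the
  vanishing one degree below, which is why vanishing below \<open>d\<close> is proved for every
  mixture of \<open>a\<^sub>j t\<^sub>j\<close> and
  \<open>y\<^sub>j t\<^sub>1 \<cdots> t\<^sub>d\<close>.\<close>

definition subring_of :: "'s::comm_ring_1 set \<Rightarrow> bool" where
  "subring_of S \<longleftrightarrow> 1 \<in> S \<and> (\<forall>x\<in>S. \<forall>y\<in>S. x - y \<in> S \<and> x * y \<in> S)"

definition submod :: "'s::comm_ring_1 set \<Rightarrow> ('s \<Rightarrow> 'b::ab_group_add \<Rightarrow> 'b) \<Rightarrow> 'b set \<Rightarrow> bool" where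
  "submod S f N \<longleftrightarrow> 0 \<in> N \<and> (\<forall>x\<in>N. \<forall>y\<in>N. x + y \<in> N) \<and> (\<forall>s\<in>S. \<forall>x\<in>N. f s x \<in> N)"

text \<open>The chains consist of submodules contained in \<open>M\<close>, while \<open>M\<close>
  itself may be any set, so the property passes to subsets. The action \<open>f\<close> is a
  parameter since it is used for rings and for spaces of functions.\<close>

definition noeth :: "'s::comm_ring_1 set \<Rightarrow> ('s \<Rightarrow> 'b::ab_group_add \<Rightarrow> 'b) \<Rightarrow> 'b set \<Rightarrow> bool" where
  "noeth S f M \<longleftrightarrow>
     (\<forall>A :: nat \<Rightarrow> 'b set. (\<forall>k. submod S f (A k) \<and> A k \<subseteq> A (Suc k) \<and> A k \<subseteq> M)
        \<longrightarrow> (\<exists>K. \<forall>k\<ge>K. A k = A K))"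

lemma subring_of_closed:
  assumes "subring_of S"
  shows "1 \<in> S" "0 \<in> S" "x \<in> S \<Longrightarrow> y \<in> S \<Longrightarrow> x - y \<in> S" "x \<in> S \<Longrightarrow> y \<in> S \<Longrightarrow> x * y \<in> S"
    "x \<in> S \<Longrightarrow> - x \<in> S" "x \<in> S \<Longrightarrow> y \<in> S \<Longrightarrow> x + y \<in> S"
proof -
  have 1: "1 \<in> S" and d: "\<And>x y. x \<in> S \<Longrightarrow> y \<in> S \<Longrightarrow> x - y \<in> S" and m: "\<And>x y. x \<in> S \<Longrightarrow> y \<in> S \<Longrightarrow> x * y \<in> S"
    using assms by (auto simp: subring_of_def)
  have 0: "0 \<in> S" using d[OF 1 1] by simp
  have n: "- x \<in> S" if "x \<in> S" for x using d[OF 0 that] by simp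
  show "1 \<in> S" "0 \<in> S" "x \<in> S \<Longrightarrow> y \<in> S \<Longrightarrow> x - y \<in> S" "x \<in> S \<Longrightarrow> y \<in> S \<Longrightarrow> x * y \<in> S"
    "x \<in> S \<Longrightarrow> - x \<in> S" by (auto intro: 0 1 d m n)
  show "x \<in> S \<Longrightarrow> y \<in> S \<Longrightarrow> x + y \<in> S" using d[OF _ n] by fastforce
qed

lemma submodD:
  assumes "submod S f N"
  shows "0 \<in> N" "x \<in> N \<Longrightarrow> y \<in> N \<Longrightarrow> x + y \<in> N" "s \<in> S \<Longrightarrow> x \<in> N \<Longrightarrow> f s x \<in> N"
  using assms by (auto simp: submod_def)

lemma submod_diff:
  assumes "subring_of S" "Modules.module f" "submod S f N" "x \<in> N" "y \<in> N"
  shows "x - y \<in> N"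
proof -
  have "f (- 1) y \<in> N"
    using assms by (meson subring_of_closed submodD)
  then have "- y \<in> N"
    by (simp add: module.scale_minus_left[OF assms(2)] module.scale_one[OF assms(2)])
  then show ?thesis using submodD(2)[OF assms(3,4)] by force
qed

lemma module_mult: "Modules.module ((*) :: 's::comm_ring_1 \<Rightarrow> _)"
  by unfold_locales (auto simp: algebra_simps)

lemma noethD:
  assumes "noeth S f M" "\<And>k. submod S f (A k)" "\<And>k. A k \<subseteq> A (Suc k)" "\<And>k. A k \<subseteq> M"
  shows "\<exists>K::nat. \<forall>k\<ge>K. A k = A K"
  using assms unfolding noeth_def by simp

lemma noeth_maximal:
  assumes "noeth S f M" "N0 \<in> P" "\<And>N. N \<in> P \<Longrightarrow> submod S f N \<and> N \<subseteq> M"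
  obtains N where "N \<in> P" "\<And>N'. N' \<in> P \<Longrightarrow> N \<subseteq> N' \<Longrightarrow> N' = N"
proof (rule ccontr)
  assume nt: "\<not> thesis"
  note max = that
  have nm: "\<exists>N'. N' \<in> P \<and> N \<subset> N'" if "N \<in> P" for N
    using max[OF that] nt by blast
  have "\<exists>A. \<forall>k::nat. A k \<in> P \<and> A k \<subset> A (Suc k)"
    by (rule dependent_nat_choice) (use assms(2) nm in auto)
  then obtain A where A: "\<And>k::nat. A k \<in> P" "\<And>k. A k \<subset> A (Suc k)" by blast
  have "\<exists>K. \<forall>k\<ge>K. A k = A K"
    by (rule noethD[OF assms(1)]) (use A assms(3) in auto)
  then obtain K where "\<forall>k\<ge>K. A k = A K" by blast
  then have "A (Suc K) = A K" using le_SucI by blast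
  then show False using A(2)[of K] by auto
qed

lemma noeth_subset: "noeth S f M \<Longrightarrow> N \<subseteq> M \<Longrightarrow> noeth S f N"
  unfolding noeth_def by (meson order_trans)

text \<open>Within an ascending chain, a submodule of \<open>S g + M\<close> is determined by its
  intersection with \<open>M\<close> and by the ideal of the possible coefficients of
  \<open>g\<close>; the chain is stationary once both are.\<close>

lemma noeth_insert:
  assumes S: "subring_of S" "noeth S (*) S" and f: "Modules.module f"
    and M: "submod S f M" "noeth S f M"
  shows "noeth S f {f s g + m | s m. s \<in> S \<and> m \<in> M}"
  unfolding noeth_def
proof (intro allI impI)
  fix A :: "nat \<Rightarrow> 'b set"
  interpret f: Modules.module f by fact
  assume A: "\<forall>k. submod S f (A k) \<and> A k \<subseteq> A (Suc k) \<and> A k \<subseteq> {f s g + m |s m. s \<in> S \<and> m \<in> M}"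
  define C where "C k = {s \<in> S. \<exists>m\<in>M. f s g + m \<in> A k}" for k
  have mono: "A k \<subseteq> A l" if "k \<le> l" for k l
    using A by (intro lift_Suc_mono_le[OF _ that]) auto
  have "submod S f (A k \<inter> M)" for k
    using A M unfolding submod_def by blast
  then have "\<exists>K. \<forall>k\<ge>K. A k \<inter> M = A K \<inter> M"
    by (intro noethD[OF M(2)]) (use A in auto)
  then obtain K1 where K1: "\<And>k. k \<ge> K1 \<Longrightarrow> A k \<inter> M = A K1 \<inter> M" by blast
  have "submod S (*) (C k)" for k
    unfolding submod_def C_def mem_Collect_eq
  proof (safe)
    show "0 \<in> S" using S by (simp add: subring_of_closed)
    show "\<exists>m\<in>M. f 0 g + m \<in> A k"
      using A M by (intro bexI[of _ 0]) (auto simp: submod_def)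
  next
    fix x y m m' assume *: "x \<in> S" "y \<in> S" "m \<in> M" "f x g + m \<in> A k" "m' \<in> M" "f y g + m' \<in> A k"
    show "x + y \<in> S" using * S by (simp add: subring_of_closed)
    show "\<exists>m\<in>M. f (x + y) g + m \<in> A k"
    proof (intro bexI[of _ "m + m'"])
      have "(f x g + m) + (f y g + m') \<in> A k" using * A submodD(2) by blast
      then show "f (x + y) g + (m + m') \<in> A k" by (simp add: f.scale_left_distrib algebra_simps)
      show "m + m' \<in> M" using * M submodD(2) by blast
    qed
  next
    fix x s m assume *: "s \<in> S" "x \<in> S" "m \<in> M" "f x g + m \<in> A k"
    show "s * x \<in> S" using * S by (simp add: subring_of_closed)
    show "\<exists>m\<in>M. f (s * x) g + m \<in> A k"
    proof (intro bexI[of _ "f s m"])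
      have "f s (f x g + m) \<in> A k" using * A submodD(3) by blast
      then show "f (s * x) g + f s m \<in> A k" by (simp add: f.scale_right_distrib)
      show "f s m \<in> M" using * M submodD(3) by blast
    qed
  qed
  moreover have "C k \<subseteq> C (Suc k)" "C k \<subseteq> S" for k using A by (auto simp: C_def)
  ultimately have "\<exists>K. \<forall>k\<ge>K. C k = C K" by (intro noethD[OF S(2)]) auto
  then obtain K2 where K2: "\<And>k. k \<ge> K2 \<Longrightarrow> C k = C K2" by blast
  show "\<exists>K. \<forall>k\<ge>K. A k = A K"
  proof (intro exI allI impI antisym subsetI)
    fix k x assume k: "max K1 K2 \<le> k" and x: "x \<in> A k"
    obtain s m where sm: "s \<in> S" "m \<in> M" "x = f s g + m" using A x by blast
    then have "s \<in> C k" using x by (auto simp: C_def)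
    then have "s \<in> C (max K1 K2)" using K2[of k] K2[of "max K1 K2"] k by simp
    \<comment> \<open>An element of the stable member with the same coefficient of \<open>g\<close>
      as \<open>x\<close>; the difference of the two lies in \<open>M\<close>.\<close>
    then obtain m' where m': "m' \<in> M" "f s g + m' \<in> A (max K1 K2)" by (auto simp: C_def)
    have "m - m' \<in> M" using sm m' submod_diff[OF S(1) f M(1)] by blast
    moreover have "x - (f s g + m') \<in> A k"
      using x m' mono[OF k] A by (intro submod_diff[OF S(1) f]) auto
    ultimately have "m - m' \<in> A k \<inter> M" using sm by simp
    then have "m - m' \<in> A (max K1 K2)" using K1[of k] K1[of "max K1 K2"] k by auto
    then have "(f s g + m') + (m - m') \<in> A (max K1 K2)" using m' A submodD(2) by blast
    then show "x \<in> A (max K1 K2)" using sm by simp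
  qed (use mono in blast)
qed

lemma submod_insert:
  assumes "subring_of S" "Modules.module f" "submod S f M"
  shows "submod S f {f s g + m | s m. s \<in> S \<and> m \<in> M}"
proof -
  interpret f: Modules.module f by fact
  show ?thesis unfolding submod_def mem_Collect_eq
  proof (safe)
    show "\<exists>s m. 0 = f s g + m \<and> s \<in> S \<and> m \<in> M"
      using assms by (intro exI[of _ 0]) (auto simp: submod_def subring_of_closed)
  next
    fix s m s' m' assume "s \<in> S" "m \<in> M" "s' \<in> S" "m' \<in> M"
    then show "\<exists>sa ma. f s g + m + (f s' g + m') = f sa g + ma \<and> sa \<in> S \<and> ma \<in> M"
      using assms by (intro exI[of _ "s + s'"] exI[of _ "m + m'"])
        (auto simp: f.scale_left_distrib algebra_simps subring_of_closed submod_def)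
  next
    fix s m s' assume "s \<in> S" "m \<in> M" "s' \<in> S"
    then show "\<exists>sa ma. f s' (f s g + m) = f sa g + ma \<and> sa \<in> S \<and> ma \<in> M"
      using assms by (intro exI[of _ "s' * s"] exI[of _ "f s' m"])
        (auto simp: f.scale_right_distrib subring_of_closed submod_def)
  qed
qed

text \<open>Induction on the generators. That the span is a submodule is carried along because
  \<open>noeth_insert\<close> asks for it.\<close>

lemma noeth_finite_span:
  assumes S: "subring_of S" "noeth S (*) S" and f: "Modules.module f" and "finite G"
  shows "noeth S f {\<Sum>g\<in>G. f (c g) g | c. c \<in> G \<rightarrow> S} \<and> submod S f {\<Sum>g\<in>G. f (c g) g | c. c \<in> G \<rightarrow> S}"
  using \<open>finite G\<close>
proof induction
  case empty
  interpret f: Modules.module f by fact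
  have "submod S f {0}" by (auto simp: submod_def)
  moreover have "noeth S f {0}"
    unfolding noeth_def submod_def by (metis empty_iff subset_singletonD)
  ultimately show ?case by simp
next
  case (insert g G)
  let ?M = "{\<Sum>g\<in>G. f (c g) g | c. c \<in> G \<rightarrow> S}"
  have "{\<Sum>h\<in>insert g G. f (c h) h | c. c \<in> insert g G \<rightarrow> S} = {f s g + m | s m. s \<in> S \<and> m \<in> ?M}"
  proof safe
    fix c assume c: "c \<in> insert g G \<rightarrow> S"
    then show "\<exists>s m. (\<Sum>h\<in>insert g G. f (c h) h) = f s g + m \<and> s \<in> S \<and> m \<in> ?M"
      using insert(1,2) by (intro exI[of _ "c g"] exI[of _ "\<Sum>g\<in>G. f (c g) g"]) auto
  next
    fix s c assume c: "s \<in> S" "c \<in> G \<rightarrow> S"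
    show "\<exists>c'. f s g + (\<Sum>g\<in>G. f (c g) g) = (\<Sum>h\<in>insert g G. f (c' h) h) \<and> c' \<in> insert g G \<rightarrow> S"
      using insert(1,2) c by (intro exI[of _ "c(g := s)"]) (auto intro!: sum.cong)
  qed
  then show ?case using noeth_insert[OF S f, of ?M g] submod_insert[OF S(1) f, of ?M g] insert.IH by auto
qed

section \<open>Hilbert's basis theorem for subrings generated by finitely many elements\<close>

definition adjoin :: "'s::comm_ring_1 set \<Rightarrow> 's \<Rightarrow> 's set" where
  "adjoin S s = {\<Sum>i<n. c i * s ^ i | n c. range c \<subseteq> S}"

lemma adjoinI: "range c \<subseteq> S \<Longrightarrow> (\<Sum>i<n. c i * s ^ i) \<in> adjoin S s"
  by (auto simp: adjoin_def)

lemma adjoin_base: assumes "subring_of S" "x \<in> S" shows "x \<in> adjoin S s"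
  using adjoinI[of "\<lambda>_. x" S s 1] assms by auto

lemma adjoin_elem: assumes "subring_of S" shows "s \<in> adjoin S s"
  using adjoinI[of "\<lambda>i. of_nat i" S s 2] subring_of_closed[OF assms]
proof -
  have "range (\<lambda>i::nat. if i = 1 then 1 else 0) \<subseteq> S" using subring_of_closed[OF assms] by auto
  from adjoinI[OF this, of s 2] show ?thesis by (simp add: numeral_2_eq_2)
qed

text \<open>Padding with zero coefficients gives two polynomial expressions the same length.\<close>

lemma adjoin_extend:
  assumes "subring_of S" "range c \<subseteq> S"
  shows "(\<Sum>i<n. c i * s ^ i) = (\<Sum>i<n+k. (if i < n then c i else 0) * s ^ i)"
  by (rule sum.mono_neutral_cong_left) auto

lemma adjoin_scale:
  assumes "subring_of S" "x \<in> adjoin S s" "a \<in> S" shows "a * x \<in> adjoin S s"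
proof -
  obtain n c where c: "range c \<subseteq> S" "x = (\<Sum>i<n. c i * s ^ i)" using assms by (auto simp: adjoin_def)
  show ?thesis using adjoinI[of "\<lambda>i. a * c i" S s n] c assms
    by (auto simp: sum_distrib_left mult.assoc subring_of_closed image_subset_iff)
qed

lemma adjoin_shift:
  assumes "subring_of S" "x \<in> adjoin S s" shows "s * x \<in> adjoin S s"
proof -
  obtain n c where c: "range c \<subseteq> S" "x = (\<Sum>i<n. c i * s ^ i)" using assms by (auto simp: adjoin_def)
  define c' where "c' i = (case i of 0 \<Rightarrow> 0 | Suc j \<Rightarrow> c j)" for i
  have "range c' \<subseteq> S" using c subring_of_closed(2)[OF assms(1)] by (auto simp: c'_def image_subset_iff split: nat.splits)
  moreover have "s * x = (\<Sum>i<Suc n. c' i * s ^ i)"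
    by (simp add: sum.lessThan_Suc_shift c'_def c sum_distrib_left mult_ac del: sum.lessThan_Suc)
  ultimately show ?thesis using adjoinI by metis
qed

lemma adjoin_diff:
  assumes "subring_of S" "x \<in> adjoin S s" "y \<in> adjoin S s" shows "x - y \<in> adjoin S s"
proof -
  obtain n c where c: "range c \<subseteq> S" "x = (\<Sum>i<n. c i * s ^ i)" using assms by (auto simp: adjoin_def)
  obtain m d where d: "range d \<subseteq> S" "y = (\<Sum>i<m. d i * s ^ i)" using assms by (auto simp: adjoin_def)
  have "x - y = (\<Sum>i<n+m. ((if i < n then c i else 0) - (if i < m then d i else 0)) * s ^ i)"
    using adjoin_extend[OF assms(1) c(1), of s n m] adjoin_extend[OF assms(1) d(1), of s m n]
    by (simp add: c d left_diff_distrib sum_subtractf add.commute)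
  moreover have "range (\<lambda>i. (if i < n then c i else 0) - (if i < m then d i else 0)) \<subseteq> S"
    using c d subring_of_closed[OF assms(1)] by (auto simp: image_subset_iff)
  ultimately show ?thesis using adjoinI by metis
qed

lemma subring_adjoin:
  assumes "subring_of S" shows "subring_of (adjoin S s)"
  unfolding subring_of_def
proof (intro conjI ballI)
  show "1 \<in> adjoin S s" using adjoin_base assms subring_of_closed(1) by blast
next
  fix x y assume x: "x \<in> adjoin S s" and y: "y \<in> adjoin S s"
  show "x - y \<in> adjoin S s" using adjoin_diff[OF assms x y] .
  have plus: "u + v \<in> adjoin S s" if "u \<in> adjoin S s" "v \<in> adjoin S s" for u v
  proof -
    have "- 1 * v \<in> adjoin S s" using that assms by (intro adjoin_scale) (auto simp: subring_of_closed)
    from adjoin_diff[OF assms that(1) this] show ?thesis by simp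
  qed
  have pow: "s ^ i * y \<in> adjoin S s" for i
    by (induction i) (use y adjoin_shift[OF assms] in \<open>auto simp: mult.assoc\<close>)
  obtain n c where c: "range c \<subseteq> S" "x = (\<Sum>i<n. c i * s ^ i)" using x by (auto simp: adjoin_def)
  have "(\<Sum>i<m. c i * s ^ i) * y \<in> adjoin S s" for m
  proof (induction m)
    case 0
    then show ?case using adjoin_base[OF assms] subring_of_closed[OF assms] by simp
  next
    case (Suc m)
    have "c m * (s ^ m * y) \<in> adjoin S s" using adjoin_scale[OF assms pow] c by blast
    then show ?case using plus[OF Suc] by (simp add: distrib_right mult.assoc)
  qed
  then show "x * y \<in> adjoin S s" using c by simp
qed

lemma adjoin_least: "subring_of T \<Longrightarrow> S \<subseteq> T \<Longrightarrow> s \<in> T \<Longrightarrow> adjoin S s \<subseteq> T"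
proof -
  assume T: "subring_of T" "S \<subseteq> T" "s \<in> T"
  have pow: "s ^ i \<in> T" for i by (induction i) (use T in \<open>auto simp: subring_of_closed\<close>)
  have "(\<Sum>i<n. c i * s ^ i) \<in> T" if "range c \<subseteq> S" for n :: nat and c
    by (induction n) (use T pow that in \<open>auto simp: subring_of_closed image_subset_iff subset_iff\<close>)
  then show ?thesis by (auto simp: adjoin_def)
qed

text \<open>Hilbert's basis theorem: for an ideal of \<open>S[s]\<close>, compare the ideals of \<open>S\<close> formed by the possible
  coefficients of \<open>s^n\<close> in the elements that are polynomials of degree at most \<open>n\<close> in \<open>s\<close>.\<close>

lemma noeth_adjoin:
  assumes S: "subring_of S" "noeth S (*) S"
  shows "noeth (adjoin S s) (*) (adjoin S s)"
  unfolding noeth_def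
proof (intro allI impI)
  fix A :: "nat \<Rightarrow> 'a set"
  assume A: "\<forall>k. submod (adjoin S s) (*) (A k) \<and> A k \<subseteq> A (Suc k) \<and> A k \<subseteq> adjoin S s"
  define L where "L n J = {c \<in> S. \<exists>d. range d \<subseteq> S \<and> c * s ^ n + (\<Sum>i<n. d i * s ^ i) \<in> J}" for n J
  have mono: "A k \<subseteq> A l" if "k \<le> l" for k l
    using A by (intro lift_Suc_mono_le[OF _ that]) auto
  have subL: "submod S (*) (L n (A k))" for n k
    unfolding submod_def
  proof (intro conjI ballI)
    show "0 \<in> L n (A k)"
      using A by (auto simp: L_def subring_of_closed[OF S(1)] submod_def intro!: exI[of _ "\<lambda>_. 0"])
  next
    fix x y assume "x \<in> L n (A k)" "y \<in> L n (A k)"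
    then obtain d d' where *: "x \<in> S" "range d \<subseteq> S" "x * s ^ n + (\<Sum>i<n. d i * s ^ i) \<in> A k"
        "y \<in> S" "range d' \<subseteq> S" "y * s ^ n + (\<Sum>i<n. d' i * s ^ i) \<in> A k"
      by (auto simp: L_def)
    have "(x * s ^ n + (\<Sum>i<n. d i * s ^ i)) + (y * s ^ n + (\<Sum>i<n. d' i * s ^ i)) \<in> A k"
      using A * submodD(2) by blast
    then have "(x + y) * s ^ n + (\<Sum>i<n. (d i + d' i) * s ^ i) \<in> A k"
      by (simp add: algebra_simps sum.distrib)
    moreover have "range (\<lambda>i. d i + d' i) \<subseteq> S" "x + y \<in> S" using * S by (auto simp: subring_of_closed image_subset_iff)
    ultimately show "x + y \<in> L n (A k)" unfolding L_def by blast
  next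
    fix a x assume "a \<in> S" "x \<in> L n (A k)"
    then obtain d where *: "a \<in> S" "x \<in> S" "range d \<subseteq> S" "x * s ^ n + (\<Sum>i<n. d i * s ^ i) \<in> A k"
      by (auto simp: L_def)
    have "a * (x * s ^ n + (\<Sum>i<n. d i * s ^ i)) \<in> A k"
      using A * submodD(3) adjoin_base[OF S(1)] by blast
    then have "(a * x) * s ^ n + (\<Sum>i<n. (a * d i) * s ^ i) \<in> A k"
      by (simp add: algebra_simps sum_distrib_left)
    moreover have "range (\<lambda>i. a * d i) \<subseteq> S" "a * x \<in> S" using * S by (auto simp: subring_of_closed image_subset_iff)
    ultimately show "a * x \<in> L n (A k)" unfolding L_def by blast
  qed
  have L1: "L n J \<subseteq> L n J'" if "J \<subseteq> J'" for n J J' using that by (auto simp: L_def)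
  have L2: "L n (A k) \<subseteq> L (Suc n) (A k)" for n k
  proof
    fix x assume "x \<in> L n (A k)"
    then obtain d where *: "x \<in> S" "range d \<subseteq> S" "x * s ^ n + (\<Sum>i<n. d i * s ^ i) \<in> A k"
      by (auto simp: L_def)
    define d' where "d' i = (case i of 0 \<Rightarrow> 0 | Suc j \<Rightarrow> d j)" for i
    have "s * (x * s ^ n + (\<Sum>i<n. d i * s ^ i)) \<in> A k"
      using A * submodD(3) adjoin_elem[OF S(1)] by blast
    then have "x * s ^ Suc n + (\<Sum>i<Suc n. d' i * s ^ i) \<in> A k"
      by (simp add: sum.lessThan_Suc_shift d'_def sum_distrib_left algebra_simps del: sum.lessThan_Suc)
    moreover have "range d' \<subseteq> S" using * subring_of_closed(2)[OF S(1)] by (auto simp: d'_def image_subset_iff split: nat.splits)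
    ultimately show "x \<in> L (Suc n) (A k)" using * unfolding L_def by blast
  qed
  have L3: "L n (A k) \<subseteq> L m (A k)" if "n \<le> m" for n m k
    by (rule lift_Suc_mono_le[OF _ that]) (rule L2)
  have LS: "L n J \<subseteq> S" for n J by (auto simp: L_def)
  \<comment> \<open>The diagonal chain controls both indices at once: the ideals
    \<open>L n (A k)\<close> agree for all \<open>n, k \<ge> K0\<close>. The finitely many
    \<open>n < K0\<close> are treated separately.\<close>
  have "L k (A k) \<subseteq> L (Suc k) (A (Suc k))" for k
    using L2[of k k] L1[OF mono[of k "Suc k"], of "Suc k"] by auto
  then have "\<exists>K. \<forall>k\<ge>K. L k (A k) = L K (A K)"
    using subL LS by (intro noethD[OF S(2)]) auto
  then obtain K0 where K0: "\<And>k. k \<ge> K0 \<Longrightarrow> L k (A k) = L K0 (A K0)" by blast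
  have "\<exists>K. \<forall>k\<ge>K. L n (A k) = L n (A K)" for n
    by (intro noethD[OF S(2)] subL LS L1 mono) simp
  then obtain Kn where Kn: "\<And>n k. k \<ge> Kn n \<Longrightarrow> L n (A k) = L n (A (Kn n))" by metis
  define K where "K = Max (insert K0 (Kn ` {..<K0}))"
  have K: "K0 \<le> K" "n < K0 \<Longrightarrow> Kn n \<le> K" for n by (auto simp: K_def)
  have stable: "L n (A k) \<subseteq> L n (A K)" if "k \<ge> K" for n k
  proof (cases "n < K0")
    case True
    then show ?thesis using Kn[of n k] Kn[of n K] K(2)[OF True] that by simp
  next
    case False
    have "L n (A k) \<subseteq> L (max n k) (A (max n k))"
      using L3[of n "max n k" k] L1[OF mono[of k "max n k"]] by (meson max.cobounded1 max.cobounded2 order_trans)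
    also have "\<dots> = L K0 (A K0)" using False by (intro K0) auto
    also have "\<dots> \<subseteq> L n (A K)" using L3[of K0 n] L1[OF mono[OF K(1)]] False by (meson linorder_not_le order_trans)
    finally show ?thesis .
  qed
  show "\<exists>K. \<forall>k\<ge>K. A k = A K"
  proof (intro exI allI impI)
    fix k assume k: "K \<le> k"
    \<comment> \<open>Induction on the number of terms: subtracting an element of \<open>A K\<close>
      with the same top coefficient lowers the degree.\<close>
    have "(\<Sum>i<n. c i * s ^ i) \<in> A K" if "range c \<subseteq> S" "(\<Sum>i<n. c i * s ^ i) \<in> A k" for n :: nat and c
      using that
    proof (induction n arbitrary: c)
      case 0
      then show ?case using A by (simp add: submod_def)
    next
      case (Suc n)
      then have "c n \<in> L n (A k)" by (auto simp: L_def add.commute)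
      then have "c n \<in> L n (A K)" using stable[OF k] by blast
      then obtain d where d: "range d \<subseteq> S" "c n * s ^ n + (\<Sum>i<n. d i * s ^ i) \<in> A K" by (auto simp: L_def)
      have "(\<Sum>i<Suc n. c i * s ^ i) - (c n * s ^ n + (\<Sum>i<n. d i * s ^ i)) \<in> A k"
        using Suc.prems d mono[OF k] A by (intro submod_diff[OF subring_adjoin[OF S(1)] module_mult]) auto
      then have "(\<Sum>i<n. (c i - d i) * s ^ i) \<in> A k"
        by (simp add: left_diff_distrib sum_subtractf)
      moreover have "range (\<lambda>i. c i - d i) \<subseteq> S" using Suc.prems d S by (auto simp: subring_of_closed image_subset_iff)
      ultimately have "(\<Sum>i<n. (c i - d i) * s ^ i) \<in> A K" using Suc.IH by blast
      then have "(\<Sum>i<n. (c i - d i) * s ^ i) + (c n * s ^ n + (\<Sum>i<n. d i * s ^ i)) \<in> A K"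
        using d A submodD(2) by blast
      then show ?case by (simp add: left_diff_distrib sum_subtractf)
    qed
    moreover have "A k \<subseteq> adjoin S s" using A by blast
    ultimately have "A k \<subseteq> A K" unfolding adjoin_def by blast
    then show "A k = A K" using mono[OF k] by (rule antisym)
  qed
qed

text \<open>The minimality of \<open>S'\<close> is stated so that inclusions of \<open>S'\<close> in
  other subrings can be checked on generators.\<close>

lemma noeth_adjoin_finite:
  assumes S: "subring_of S" "noeth S (*) S" and "finite P"
  obtains S' where "subring_of S'" "noeth S' (*) S'" "S \<subseteq> S'" "P \<subseteq> S'"
    "\<And>T. subring_of T \<Longrightarrow> S \<subseteq> T \<Longrightarrow> P \<subseteq> T \<Longrightarrow> S' \<subseteq> T"
  using \<open>finite P\<close>
proof (induction arbitrary: thesis)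
  case empty
  then show ?case using S by blast
next
  case (insert s P)
  obtain S' where S': "subring_of S'" "noeth S' (*) S'" "S \<subseteq> S'" "P \<subseteq> S'"
    "\<And>T. subring_of T \<Longrightarrow> S \<subseteq> T \<Longrightarrow> P \<subseteq> T \<Longrightarrow> S' \<subseteq> T" using insert.IH by metis
  show ?case
  proof (rule insert.prems)
    show "subring_of (adjoin S' s)" "noeth (adjoin S' s) (*) (adjoin S' s)"
      using subring_adjoin noeth_adjoin S' by auto
    show "S \<subseteq> adjoin S' s" "insert s P \<subseteq> adjoin S' s"
      using S' adjoin_base adjoin_elem by blast+
    fix T assume "subring_of T" "S \<subseteq> T" "insert s P \<subseteq> T"
    then show "adjoin S' s \<subseteq> T" using S'(5) by (intro adjoin_least) auto
  qed
qed

text \<open>A chain in the image is recovered from its preimages. This is applied to the constants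
  in the Laurent polynomial ring.\<close>

lemma noeth_image:
  fixes h :: "'a::comm_ring_1 \<Rightarrow> 's::comm_ring_1"
  assumes h: "\<And>x y. h (x + y) = h x + h y" "\<And>x y. h (x * y) = h x * h y" "h 0 = 0"
    and R: "noeth UNIV (*) (UNIV :: 'a set)"
  shows "noeth (range h) (*) (range h)"
  unfolding noeth_def
proof (intro allI impI)
  fix A :: "nat \<Rightarrow> 's set"
  assume A: "\<forall>k. submod (range h) (*) (A k) \<and> A k \<subseteq> A (Suc k) \<and> A k \<subseteq> range h"
  have "submod UNIV (*) (h -` A k)" for k using A by (auto simp: submod_def h)
  then have "\<exists>K. \<forall>k\<ge>K. h -` A k = h -` A K"
    by (intro noethD[OF R]) (use A in auto)
  then obtain K where K: "\<And>k. k \<ge> K \<Longrightarrow> h -` A k = h -` A K" by blast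
  have "A k = h ` (h -` A k)" for k using A by (simp add: image_vimage_eq inf.absorb1)
  then show "\<exists>K. \<forall>k\<ge>K. A k = A K" using K by metis
qed

section \<open>Koszul cochains\<close>

text \<open>Homogeneous components are additive subgroups of the ambient ring; closure under scalars
  is asked for separately through \<open>submod\<close>.\<close>

definition addsub :: "'r::ab_group_add set \<Rightarrow> bool" where
  "addsub N \<longleftrightarrow> 0 \<in> N \<and> (\<forall>x\<in>N. \<forall>y\<in>N. x - y \<in> N)"

lemma addsubD:
  assumes "addsub N"
  shows "0 \<in> N" "x \<in> N \<Longrightarrow> y \<in> N \<Longrightarrow> x - y \<in> N" "x \<in> N \<Longrightarrow> - x \<in> N" "x \<in> N \<Longrightarrow> y \<in> N \<Longrightarrow> x + y \<in> N"
proof -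
  have 0: "0 \<in> N" and d: "\<And>x y. x \<in> N \<Longrightarrow> y \<in> N \<Longrightarrow> x - y \<in> N"
    using assms by (auto simp: addsub_def)
  have n: "- x \<in> N" if "x \<in> N" for x using d[OF 0 that] by simp
  have p: "x + y \<in> N" if "x \<in> N" "y \<in> N" for x y using d[OF that(1) n[OF that(2)]] by simp
  show "0 \<in> N" "x \<in> N \<Longrightarrow> y \<in> N \<Longrightarrow> x - y \<in> N" "x \<in> N \<Longrightarrow> - x \<in> N" "x \<in> N \<Longrightarrow> y \<in> N \<Longrightarrow> x + y \<in> N"
    by (auto intro: 0 d n p)
qed

lemma addsub_sum: "addsub N \<Longrightarrow> (\<And>i. i \<in> S \<Longrightarrow> f i \<in> N) \<Longrightarrow> sum f S \<in> N"
  by (induction S rule: infinite_finite_induct) (auto simp: addsubD)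

definition koszul_sign :: "'i::linorder \<Rightarrow> 'i set \<Rightarrow> 'r::comm_ring_1" where
  "koszul_sign i T = (- 1) ^ card {j \<in> T. j < i}"

text \<open>A cochain is a function on all index sets; its degree is expressed by conditions on the
  size of the sets. For \<open>q\<close> constantly \<open>1\<close> this is the Cech differential,
  because localization maps become inclusions in the ring of fractions.\<close>

definition koszul_diff :: "('i::linorder \<Rightarrow> 'r::comm_ring_1) \<Rightarrow> ('i set \<Rightarrow> 'r) \<Rightarrow> 'i set \<Rightarrow> 'r" where
  "koszul_diff q c T = (\<Sum>i\<in>T. koszul_sign i T * q i * c (T - {i}))"

text \<open>Interior product with the vector \<open>s\<close>; it lowers the cochain degree by one
  and serves as a homotopy.\<close>

definition contraction :: "('i::{finite,linorder} \<Rightarrow> 'r::comm_ring_1) \<Rightarrow> ('i set \<Rightarrow> 'r) \<Rightarrow> 'i set \<Rightarrow> 'r" where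
  "contraction s c T = (\<Sum>i\<in>-T. koszul_sign i (insert i T) * s i * c (insert i T))"

lemma koszul_sign_square [simp]: "koszul_sign i T * koszul_sign i T = (1::'r::comm_ring_1)"
  by (simp add: koszul_sign_def flip: power_add mult_2)

lemma koszul_sign_square_left [simp]: "koszul_sign i T * (koszul_sign i T * x) = (x::'r::comm_ring_1)"
  by (simp flip: mult.assoc)

lemma koszul_sign_mem:
  assumes "addsub N" "x \<in> N" shows "koszul_sign i T * x \<in> N"
proof -
  have "koszul_sign i T = (1::'a) \<or> koszul_sign i T = (-1::'a)"
    unfolding koszul_sign_def using minus_one_power_iff by metis
  then show ?thesis using assms addsubD by auto
qed

text \<open>Removing the smaller of the two indices shifts the position of the larger one by one,
  while removing the larger one leaves the position of the smaller one.\<close>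

lemma koszul_sign_anticomm:
  fixes i j :: "'i::{finite,linorder}"
  assumes "i \<in> T" "j \<in> T" "i \<noteq> j"
  shows "koszul_sign i T * koszul_sign j (T - {i}) = - (koszul_sign j T * (koszul_sign i (T - {j}) :: 'r::comm_ring_1))"
proof -
  have *: "koszul_sign i T * koszul_sign j (T - {i}) = - (koszul_sign j T * (koszul_sign i (T - {j}) :: 'r))"
    if "i \<in> T" "j \<in> T" "i < j" for i j :: 'i
  proof -
    have "{k \<in> T. k < j} = insert i {k \<in> T - {i}. k < j}" using that by auto
    then have "card {k \<in> T. k < j} = Suc (card {k \<in> T - {i}. k < j})" by simp
    moreover have "{k \<in> T - {j}. k < i} = {k \<in> T. k < i}" using that by auto
    ultimately show ?thesis by (simp add: koszul_sign_def)
  qed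
  show ?thesis
  proof (cases "i < j")
    case True
    then show ?thesis using * assms by blast
  next
    case False
    then have "j < i" using assms by auto
    from *[OF assms(2,1) this] show ?thesis by simp
  qed
qed

lemma koszul_diff_cong: "(\<And>i. i \<in> T \<Longrightarrow> c (T - {i}) = c' (T - {i})) \<Longrightarrow> koszul_diff q c T = koszul_diff q c' T"
  by (simp add: koszul_diff_def)

lemma koszul_diff_add: "koszul_diff q (\<lambda>T. c T + c' T) T = koszul_diff q c T + koszul_diff q c' T"
  by (simp add: koszul_diff_def algebra_simps sum.distrib)

lemma koszul_diff_diff: "koszul_diff q (\<lambda>T. c T - c' T) T = koszul_diff q c T - koszul_diff q c' T"
  by (simp add: koszul_diff_def algebra_simps sum_subtractf)

lemma koszul_diff_scale: "koszul_diff q (\<lambda>T. u * c T) T = u * koszul_diff q c T"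
  by (simp add: koszul_diff_def sum_distrib_left mult_ac)

lemma koszul_diff_zero [simp]: "koszul_diff q (\<lambda>T. 0) T = 0"
  by (simp add: koszul_diff_def)

lemma koszul_diff_empty [simp]: "koszul_diff q c {} = 0"
  by (simp add: koszul_diff_def)

lemma koszul_diff_mem:
  assumes "addsub N" "\<And>i. i \<in> T \<Longrightarrow> q i * c (T - {i}) \<in> N"
  shows "koszul_diff q c T \<in> N"
  unfolding koszul_diff_def using assms by (intro addsub_sum) (auto simp: mult.assoc intro: koszul_sign_mem)

text \<open>The two orders of removing a pair of indices carry opposite signs; splitting the double
  sum into \<open>i < j\<close> and \<open>j < i\<close> makes them cancel.\<close>

lemma koszul_diff_kd:
  fixes q :: "'i::{finite,linorder} \<Rightarrow> 'r::comm_ring_1"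
  shows "koszul_diff q (koszul_diff q c) T = 0"
proof -
  define g where "g i j = koszul_sign i T * koszul_sign j (T - {i}) * (q i * q j * c (T - {i} - {j}))" for i j
  have anti: "g j i = - g i j" if "i \<in> T" "j \<in> T" "i \<noteq> j" for i j
  proof -
    have "T - {j} - {i} = T - {i} - {j}" by auto
    then show ?thesis
      unfolding g_def koszul_sign_anticomm[OF that, where 'r='r] by (simp add: mult.commute)
  qed
  have "koszul_diff q (koszul_diff q c) T = (\<Sum>i\<in>T. \<Sum>j\<in>T-{i}. g i j)"
    by (simp add: koszul_diff_def g_def sum_distrib_left mult_ac)
  also have "\<dots> = (\<Sum>i\<in>T. (\<Sum>j\<in>{j\<in>T. i < j}. g i j) + (\<Sum>j\<in>{j\<in>T. j < i}. g i j))"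
    by (intro sum.cong refl, subst sum.union_disjoint[symmetric]) (auto intro!: sum.cong)
  also have "\<dots> = (\<Sum>i\<in>T. \<Sum>j\<in>{j\<in>T. i < j}. g i j) + (\<Sum>i\<in>T. \<Sum>j\<in>{j\<in>T. j < i}. g i j)"
    by (rule sum.distrib)
  also have "(\<Sum>i\<in>T. \<Sum>j\<in>{j\<in>T. j < i}. g i j) = (\<Sum>j\<in>T. \<Sum>i\<in>{i\<in>T. j < i}. g i j)"
    by (rule sum.swap_restrict) auto
  also have "\<dots> = (\<Sum>j\<in>T. \<Sum>i\<in>{i\<in>T. j < i}. - g j i)"
    by (intro sum.cong refl anti) auto
  finally show ?thesis by (simp add: sum_negf)
qed

text \<open>Cartan's homotopy formula. The diagonal terms add up to the scalar; the terms in which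
  one index is removed and another one inserted cancel by the sign rule.\<close>

lemma koszul_diff_contraction:
  fixes q :: "'i::{finite,linorder} \<Rightarrow> 'r::comm_ring_1"
  shows "koszul_diff q (contraction s c) T + contraction s (koszul_diff q c) T = (\<Sum>i\<in>UNIV. q i * s i) * c T"
proof -
  have 1: "koszul_sign i T * koszul_sign j (insert j (T - {i})) + koszul_sign j (insert j T) * koszul_sign i (insert j T) = (0::'r)"
    if "i \<in> T" "j \<notin> T" for i j
  proof -
    let ?U = "insert j T"
    have "koszul_sign j ?U * koszul_sign i (?U - {j}) = - (koszul_sign i ?U * (koszul_sign j (?U - {i}) :: 'r))"
      using that by (intro koszul_sign_anticomm) auto
    moreover have "?U - {j} = T" "?U - {i} = insert j (T - {i})" using that by auto
    ultimately have "koszul_sign j ?U * koszul_sign i T = - (koszul_sign i ?U * (koszul_sign j (insert j (T - {i})) :: 'r))" by simp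
    then have "koszul_sign j ?U * koszul_sign j (insert j (T - {i})) * (koszul_sign j ?U * koszul_sign i T)
       = - (koszul_sign j ?U * koszul_sign j (insert j (T - {i})) * (koszul_sign i ?U * (koszul_sign j (insert j (T - {i})) :: 'r)))"
      by (metis mult_minus_right)
    then show ?thesis by (simp add: mult_ac)
  qed
  have "koszul_diff q (contraction s c) T =
      (\<Sum>i\<in>T. q i * s i * c T + (\<Sum>j\<in>-T. koszul_sign i T * koszul_sign j (insert j (T - {i})) * (q i * s j * c (insert j (T - {i})))))"
    unfolding koszul_diff_def
  proof (intro sum.cong refl)
    fix i assume i: "i \<in> T"
    have "- (T - {i}) = insert i (- T)" using i by auto
    then have "contraction s c (T - {i}) = koszul_sign i T * s i * c T +
        (\<Sum>j\<in>-T. koszul_sign j (insert j (T - {i})) * s j * c (insert j (T - {i})))"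
      using i by (simp add: contraction_def insert_absorb)
    then show "koszul_sign i T * q i * contraction s c (T - {i}) = q i * s i * c T + (\<Sum>j\<in>-T. koszul_sign i T * koszul_sign j (insert j (T - {i})) * (q i * s j * c (insert j (T - {i}))))"
      by (simp add: distrib_left sum_distrib_left mult_ac)
  qed
  moreover have "contraction s (koszul_diff q c) T =
      (\<Sum>j\<in>-T. q j * s j * c T + (\<Sum>i\<in>T. koszul_sign j (insert j T) * koszul_sign i (insert j T) * (q i * s j * c (insert j (T - {i})))))"
    unfolding contraction_def
  proof (intro sum.cong refl)
    fix j assume j: "j \<in> - T"
    have "koszul_diff q c (insert j T) = koszul_sign j (insert j T) * q j * c T + (\<Sum>i\<in>T. koszul_sign i (insert j T) * q i * c (insert j T - {i}))"
      using j by (simp add: koszul_diff_def)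
    moreover have "insert j T - {i} = insert j (T - {i})" if "i \<in> T" for i using that j by auto
    ultimately have "koszul_diff q c (insert j T) = koszul_sign j (insert j T) * q j * c T + (\<Sum>i\<in>T. koszul_sign i (insert j T) * q i * c (insert j (T - {i})))"
      by simp
    then show "koszul_sign j (insert j T) * s j * koszul_diff q c (insert j T) = q j * s j * c T + (\<Sum>i\<in>T. koszul_sign j (insert j T) * koszul_sign i (insert j T) * (q i * s j * c (insert j (T - {i}))))"
      by (simp add: distrib_left sum_distrib_left mult_ac)
  qed
  moreover have "(\<Sum>j\<in>-T. \<Sum>i\<in>T. koszul_sign j (insert j T) * koszul_sign i (insert j T) * (q i * s j * c (insert j (T - {i}))))
      = (\<Sum>i\<in>T. \<Sum>j\<in>-T. koszul_sign j (insert j T) * koszul_sign i (insert j T) * (q i * s j * c (insert j (T - {i}))))"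
    by (rule sum.swap)
  moreover have "(\<Sum>i\<in>T. \<Sum>j\<in>-T. koszul_sign i T * koszul_sign j (insert j (T - {i})) * (q i * s j * c (insert j (T - {i}))))
    + (\<Sum>i\<in>T. \<Sum>j\<in>-T. koszul_sign j (insert j T) * koszul_sign i (insert j T) * (q i * s j * c (insert j (T - {i})))) = 0"
    unfolding sum.distrib[symmetric] distrib_right[symmetric] using 1 by (intro sum.neutral ballI) simp
  moreover have "(\<Sum>i\<in>UNIV. q i * s i) * c T = (\<Sum>i\<in>T. q i * s i * c T) + (\<Sum>j\<in>-T. q j * s j * c T)"
    unfolding sum_distrib_right Compl_eq_Diff_UNIV by (intro sum.subset_diff[of T UNIV, simplified add.commute]) auto
  ultimately show ?thesis by (simp add: sum.distrib algebra_simps)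
qed

definition single_at :: "'i \<Rightarrow> 'i \<Rightarrow> 'r::comm_ring_1" where
  "single_at i j = (if j = i then 1 else 0)"

lemma contraction_single_at:
  fixes i :: "'i::{finite,linorder}"
  shows "contraction (single_at i) c T = (if i \<in> T then 0 else koszul_sign i (insert i T) * c (insert i T) :: 'r::comm_ring_1)"
proof -
  have "contraction (single_at i) c T = (\<Sum>j\<in>-T. if j = i then koszul_sign i (insert i T) * c (insert i T) else 0)"
    unfolding contraction_def by (intro sum.cong) (auto simp: single_at_def)
  then show ?thesis by (simp add: sum.delta)
qed

text \<open>For \<open>q i = 1\<close> the contraction at \<open>i\<close> is a contracting homotopy
  of functions. Its values at \<open>T\<close> come from \<open>insert i T\<close>, however, so for
  a Cech complex they lie in too large a localization, and a power of the \<open>i\<close>-th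
  element is needed to bring them back.\<close>

lemma koszul_diff_contraction_single:
  fixes q :: "'i::{finite,linorder} \<Rightarrow> 'r::comm_ring_1"
  shows "koszul_diff q (contraction (single_at i) c) T + contraction (single_at i) (koszul_diff q c) T = q i * c T"
proof -
  have "(\<Sum>j\<in>UNIV. q j * single_at i j) = q i" by (simp add: single_at_def if_distrib sum.delta cong: if_cong)
  then show ?thesis using koszul_diff_contraction[of q "single_at i" c T] by simp
qed

text \<open>Vanishing of the cohomology in degree \<open>p\<close> of the quotient of the complex with entries in \<open>A T\<close> by
  the one with entries in \<open>B T\<close>.\<close>

definition vanish :: "('i::linorder \<Rightarrow> 'r::comm_ring_1) \<Rightarrow> 'i set \<Rightarrow> ('i set \<Rightarrow> 'r set) \<Rightarrow> ('i set \<Rightarrow> 'r set) \<Rightarrow> nat \<Rightarrow> bool" where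
  "vanish q J A B p \<longleftrightarrow>
     (\<forall>c. (\<forall>T. T \<subseteq> J \<longrightarrow> card T = p \<longrightarrow> c T \<in> A T) \<longrightarrow> (\<forall>T. T \<subseteq> J \<longrightarrow> card T = Suc p \<longrightarrow> koszul_diff q c T \<in> B T) \<longrightarrow>
       (\<exists>b. (\<forall>T. T \<subseteq> J \<longrightarrow> Suc (card T) = p \<longrightarrow> b T \<in> A T) \<and> (\<forall>T. T \<subseteq> J \<longrightarrow> card T = p \<longrightarrow> c T - koszul_diff q b T \<in> B T)))"

lemma vanishI:
  assumes "\<And>c. (\<And>T. T \<subseteq> J \<Longrightarrow> card T = p \<Longrightarrow> c T \<in> A T) \<Longrightarrow> (\<And>T. T \<subseteq> J \<Longrightarrow> card T = Suc p \<Longrightarrow> koszul_diff q c T \<in> B T) \<Longrightarrow>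
       \<exists>b. (\<forall>T. T \<subseteq> J \<longrightarrow> Suc (card T) = p \<longrightarrow> b T \<in> A T) \<and> (\<forall>T. T \<subseteq> J \<longrightarrow> card T = p \<longrightarrow> c T - koszul_diff q b T \<in> B T)"
  shows "vanish q J A B p"
  unfolding vanish_def using assms by simp

lemma vanishD:
  assumes "vanish q J A B p" "\<And>T. T \<subseteq> J \<Longrightarrow> card T = p \<Longrightarrow> c T \<in> A T"
    "\<And>T. T \<subseteq> J \<Longrightarrow> card T = Suc p \<Longrightarrow> koszul_diff q c T \<in> B T"
  shows "\<exists>b. (\<forall>T. T \<subseteq> J \<longrightarrow> Suc (card T) = p \<longrightarrow> b T \<in> A T) \<and> (\<forall>T. T \<subseteq> J \<longrightarrow> card T = p \<longrightarrow> c T - koszul_diff q b T \<in> B T)"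
  by (rule assms(1)[unfolded vanish_def, rule_format]) (use assms(2,3) in auto)

text \<open>The middle term of the exact sequence for \<open>B \<subseteq> G \<subseteq> A\<close>:
  a primitive modulo \<open>G\<close> leaves a remainder with entries in \<open>G\<close>, which is
  a cocycle modulo \<open>B\<close>.\<close>

lemma vanish_trans:
  fixes q :: "'i::{finite,linorder} \<Rightarrow> 'r::comm_ring_1"
  assumes "vanish q J A G p" "vanish q J G B p" "\<And>T. G T \<subseteq> A T" "\<And>T. B T \<subseteq> G T" "\<And>T. addsub (A T)"
  shows "vanish q J A B p"
proof (rule vanishI)
  fix c assume c: "\<And>T. T \<subseteq> J \<Longrightarrow> card T = p \<Longrightarrow> c T \<in> A T" "\<And>T. T \<subseteq> J \<Longrightarrow> card T = Suc p \<Longrightarrow> koszul_diff q c T \<in> B T"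
  have "\<exists>b. (\<forall>T. T \<subseteq> J \<longrightarrow> Suc (card T) = p \<longrightarrow> b T \<in> A T) \<and> (\<forall>T. T \<subseteq> J \<longrightarrow> card T = p \<longrightarrow> c T - koszul_diff q b T \<in> G T)"
    by (rule vanishD[OF assms(1)]) (use c assms(4) in blast)+
  then obtain b where b: "\<And>T. T \<subseteq> J \<Longrightarrow> Suc (card T) = p \<Longrightarrow> b T \<in> A T" "\<And>T. T \<subseteq> J \<Longrightarrow> card T = p \<Longrightarrow> c T - koszul_diff q b T \<in> G T"
    by blast
  have "koszul_diff q (\<lambda>T. c T - koszul_diff q b T) T = koszul_diff q c T" for T
    by (simp add: koszul_diff_diff koszul_diff_kd)
  then have "\<exists>b'. (\<forall>T. T \<subseteq> J \<longrightarrow> Suc (card T) = p \<longrightarrow> b' T \<in> G T) \<and> (\<forall>T. T \<subseteq> J \<longrightarrow> card T = p \<longrightarrow> c T - koszul_diff q b T - koszul_diff q b' T \<in> B T)"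
    by (intro vanishD[OF assms(2)]) (use c b in auto)
  then obtain b' where b': "\<And>T. T \<subseteq> J \<Longrightarrow> Suc (card T) = p \<Longrightarrow> b' T \<in> G T"
      "\<And>T. T \<subseteq> J \<Longrightarrow> card T = p \<Longrightarrow> c T - koszul_diff q b T - koszul_diff q b' T \<in> B T"
    by blast
  show "\<exists>b. (\<forall>T. T \<subseteq> J \<longrightarrow> Suc (card T) = p \<longrightarrow> b T \<in> A T) \<and> (\<forall>T. T \<subseteq> J \<longrightarrow> card T = p \<longrightarrow> c T - koszul_diff q b T \<in> B T)"
  proof (intro exI conjI allI impI)
    fix T assume "T \<subseteq> J" "Suc (card T) = p"
    then show "b T + b' T \<in> A T"
      by (intro addsubD(4)[OF assms(5)] b(1) subsetD[OF assms(3) b'(1)])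
  next
    fix T assume "T \<subseteq> J" "card T = p"
    then show "c T - koszul_diff q (\<lambda>T. b T + b' T) T \<in> B T" using b'(2) by (simp add: koszul_diff_add diff_diff_eq)
  qed
qed

text \<open>Index sets containing \<open>i\<close> contribute nothing to the quotient complex, so
  admitting \<open>i\<close> creates no cohomology; a primitive for \<open>J\<close> is extended by
  zero.\<close>

lemma vanish_killed:
  fixes q :: "'i::{finite,linorder} \<Rightarrow> 'r::comm_ring_1"
  assumes "vanish q J A B p" "\<And>T. i \<in> T \<Longrightarrow> A T \<subseteq> B T" "\<And>T. addsub (A T)" "\<And>T j x. j \<in> T \<Longrightarrow> x \<in> A (T - {j}) \<Longrightarrow> q j * x \<in> A T"
  shows "vanish q (insert i J) A B p"
proof (rule vanishI)
  fix c assume c: "\<And>T. T \<subseteq> insert i J \<Longrightarrow> card T = p \<Longrightarrow> c T \<in> A T" "\<And>T. T \<subseteq> insert i J \<Longrightarrow> card T = Suc p \<Longrightarrow> koszul_diff q c T \<in> B T"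
  have "\<exists>b. (\<forall>T. T \<subseteq> J \<longrightarrow> Suc (card T) = p \<longrightarrow> b T \<in> A T) \<and> (\<forall>T. T \<subseteq> J \<longrightarrow> card T = p \<longrightarrow> c T - koszul_diff q b T \<in> B T)"
    by (rule vanishD[OF assms(1)]) (use c in blast)+
  then obtain b where b: "\<And>T. T \<subseteq> J \<Longrightarrow> Suc (card T) = p \<Longrightarrow> b T \<in> A T" "\<And>T. T \<subseteq> J \<Longrightarrow> card T = p \<Longrightarrow> c T - koszul_diff q b T \<in> B T"
    by blast
  define b' where "b' T = (if T \<subseteq> J then b T else 0)" for T
  have b'A: "b' T \<in> A T" if "Suc (card T) = p" for T
    using b that assms(3) by (auto simp: b'_def addsubD)
  show "\<exists>b. (\<forall>T. T \<subseteq> insert i J \<longrightarrow> Suc (card T) = p \<longrightarrow> b T \<in> A T) \<and> (\<forall>T. T \<subseteq> insert i J \<longrightarrow> card T = p \<longrightarrow> c T - koszul_diff q b T \<in> B T)"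
  proof (intro exI conjI allI impI)
    fix T assume T: "T \<subseteq> insert i J" "card T = p"
    show "c T - koszul_diff q b' T \<in> B T"
    proof (cases "T \<subseteq> J")
      case True
      then have "koszul_diff q b' T = koszul_diff q b T" by (intro koszul_diff_cong) (auto simp: b'_def)
      then show ?thesis using b(2)[OF True T(2)] by simp
    next
      case False
      have "Suc (card (T - {j})) = p" if "j \<in> T" for j
        using T that by (metis card_Suc_Diff1 finite)
      then have "koszul_diff q b' T \<in> A T" using assms(3,4) b'A by (intro koszul_diff_mem) auto
      then have "c T - koszul_diff q b' T \<in> A T" using c(1)[OF T] assms(3) addsubD by blast
      then show ?thesis using assms(2)[of T] False T by blast
    qed
  qed (use b'A in auto)
qed

text \<open>The induction step on the number of elements already factored out: if \<open>u\<close> is a nonzerodivisor on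
  the quotient \<open>A / G\<close> and the cohomology of \<open>A / (u A + G)\<close> vanishes in degree \<open>p - 1\<close>, then \<open>u\<close> acts
  injectively on the cohomology of \<open>A / G\<close> in degree \<open>p\<close>; so that one is zero if it is \<open>u\<close>-torsion.
  The additional index \<open>k\<close> keeps track of the multidegree.\<close>

lemma vanish_descent:
  fixes q :: "'i::{finite,linorder} \<Rightarrow> 'r::comm_ring_1"
  assumes sub: "\<And>k T. addsub (A k T)" "\<And>k T. addsub (G k T)"
    and qA: "\<And>k T j x. j \<in> T \<Longrightarrow> x \<in> A k (T - {j}) \<Longrightarrow> q j * x \<in> A k T"
    and qG: "\<And>k T j x. j \<in> T \<Longrightarrow> x \<in> G k (T - {j}) \<Longrightarrow> q j * x \<in> G k T"
    and uA: "\<And>k T x. x \<in> A k T \<Longrightarrow> u * x \<in> A (Suc k) T"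
    and sat: "\<And>k T x. x \<in> A k T \<Longrightarrow> u * x \<in> G (Suc k) T \<Longrightarrow> x \<in> G k T"
    and van: "\<And>k p'. p = Suc p' \<Longrightarrow> vanish q J (A (Suc k)) (\<lambda>T. {u * x + g | x g. x \<in> A k T \<and> g \<in> G (Suc k) T}) p'"
    and tors: "\<And>c. (\<And>T. T \<subseteq> J \<Longrightarrow> card T = p \<Longrightarrow> c T \<in> A 0 T) \<Longrightarrow> (\<And>T. T \<subseteq> J \<Longrightarrow> card T = Suc p \<Longrightarrow> koszul_diff q c T \<in> G 0 T) \<Longrightarrow>
       \<exists>K b. (\<forall>T. T \<subseteq> J \<longrightarrow> Suc (card T) = p \<longrightarrow> b T \<in> A K T) \<and> (\<forall>T. T \<subseteq> J \<longrightarrow> card T = p \<longrightarrow> u ^ K * c T - koszul_diff q b T \<in> G K T)"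
  shows "vanish q J (A 0) (G 0) p"
proof (rule vanishI)
  fix c assume c: "\<And>T. T \<subseteq> J \<Longrightarrow> card T = p \<Longrightarrow> c T \<in> A 0 T" "\<And>T. T \<subseteq> J \<Longrightarrow> card T = Suc p \<Longrightarrow> koszul_diff q c T \<in> G 0 T"
  \<comment> \<open>\<open>P K\<close> says that \<open>u ^ K * c\<close> is a coboundary modulo
    \<open>G\<close>. Torsion provides some \<open>K\<close>, which is then lowered to
    \<open>0\<close> one by one.\<close>
  define P where "P K \<longleftrightarrow> (\<exists>b. (\<forall>T. T \<subseteq> J \<longrightarrow> Suc (card T) = p \<longrightarrow> b T \<in> A K T) \<and> (\<forall>T. T \<subseteq> J \<longrightarrow> card T = p \<longrightarrow> u ^ K * c T - koszul_diff q b T \<in> G K T))" for K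
  have cK: "u ^ K * c T \<in> A K T" if "T \<subseteq> J" "card T = p" for K T
    using that by (induction K) (use c uA in \<open>auto simp: mult.assoc\<close>)
  have step: "P K" if PK: "P (Suc K)" for K
  proof -
    obtain b where b: "\<And>T. T \<subseteq> J \<Longrightarrow> Suc (card T) = p \<Longrightarrow> b T \<in> A (Suc K) T"
      "\<And>T. T \<subseteq> J \<Longrightarrow> card T = p \<Longrightarrow> u ^ Suc K * c T - koszul_diff q b T \<in> G (Suc K) T" using PK unfolding P_def by blast
    show ?thesis
    proof (cases p)
      case 0
      have "u ^ K * c {} \<in> G K {}"
      proof (rule sat)
        show "u ^ K * c {} \<in> A K {}" using 0 by (intro cK) auto
        show "u * (u ^ K * c {}) \<in> G (Suc K) {}" using b(2)[of "{}"] 0 by (simp add: mult.assoc)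
      qed
      then show ?thesis using 0 unfolding P_def by (intro exI[of _ "\<lambda>_. 0"]) auto
    next
      case (Suc p')
      \<comment> \<open>A primitive \<open>b\<close> of \<open>u ^ Suc K * c\<close> is itself a
        cocycle modulo \<open>u A + G\<close>, one degree lower.\<close>
      have "koszul_diff q b T \<in> {u * x + g | x g. x \<in> A K T \<and> g \<in> G (Suc K) T}" if T: "T \<subseteq> J" "card T = Suc p'" for T
      proof -
        have "koszul_diff q b T = u * (u ^ K * c T) + - (u ^ Suc K * c T - koszul_diff q b T)" by (simp add: mult.assoc)
        moreover have "- (u ^ Suc K * c T - koszul_diff q b T) \<in> G (Suc K) T" using b(2)[OF T(1)] T Suc by (intro addsubD(3)[OF sub(2)]) auto
        ultimately show ?thesis using cK[of T K] T Suc by blast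
      qed
      then have "\<exists>b'. (\<forall>T. T \<subseteq> J \<longrightarrow> Suc (card T) = p' \<longrightarrow> b' T \<in> A (Suc K) T) \<and>
          (\<forall>T. T \<subseteq> J \<longrightarrow> card T = p' \<longrightarrow> b T - koszul_diff q b' T \<in> {u * x + g | x g. x \<in> A K T \<and> g \<in> G (Suc K) T})"
        by (intro vanishD[OF van[OF Suc, of K]]) (use b(1) Suc in auto)
      then obtain b' where b': "\<And>T. T \<subseteq> J \<Longrightarrow> card T = p' \<Longrightarrow> b T - koszul_diff q b' T \<in> {u * x + g | x g. x \<in> A K T \<and> g \<in> G (Suc K) T}"
        by blast
      then have "\<forall>T. \<exists>x g. T \<subseteq> J \<longrightarrow> card T = p' \<longrightarrow> b T - koszul_diff q b' T = u * x + g \<and> x \<in> A K T \<and> g \<in> G (Suc K) T"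
        by blast
      then obtain v g where vg: "\<And>T. T \<subseteq> J \<Longrightarrow> card T = p' \<Longrightarrow> b T - koszul_diff q b' T = u * v T + g T \<and> v T \<in> A K T \<and> g T \<in> G (Suc K) T"
        by metis
      \<comment> \<open>Up to a coboundary \<open>b\<close> is \<open>u * v + g\<close>, so
        \<open>u\<close> times this difference lies in \<open>G\<close>. Saturation cancels
        \<open>u\<close>, and \<open>v\<close> is the new primitive.\<close>
      have "u ^ K * c T - koszul_diff q v T \<in> G K T" if T: "T \<subseteq> J" "card T = p" for T
      proof (rule sat)
        have Ti: "T - {i} \<subseteq> J" "card (T - {i}) = p'" if "i \<in> T" for i using T Suc that by auto
        have "koszul_diff q v T \<in> A K T" using vg[OF Ti] by (intro koszul_diff_mem sub qA) auto
        then show "u ^ K * c T - koszul_diff q v T \<in> A K T" using cK T sub(1) addsubD(2) by blast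
        have "koszul_diff q b T = koszul_diff q (\<lambda>T. koszul_diff q b' T + (u * v T + g T)) T"
          using vg[OF Ti] by (intro koszul_diff_cong) (simp add: algebra_simps)
        then have "koszul_diff q b T = u * koszul_diff q v T + koszul_diff q g T" by (simp add: koszul_diff_add koszul_diff_scale koszul_diff_kd)
        then have "u * (u ^ K * c T - koszul_diff q v T) = (u ^ Suc K * c T - koszul_diff q b T) + koszul_diff q g T" by (simp add: algebra_simps)
        moreover have "koszul_diff q g T \<in> G (Suc K) T" using vg[OF Ti] by (intro koszul_diff_mem sub qG) auto
        ultimately show "u * (u ^ K * c T - koszul_diff q v T) \<in> G (Suc K) T" using b(2)[OF T] addsubD(4)[OF sub(2)] by simp
      qed
      then show ?thesis using vg Suc unfolding P_def by (intro exI[of _ v]) auto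
    qed
  qed
  obtain K where "P K" using tors[OF c] unfolding P_def by blast
  then have "P 0" by (induction K) (use step in auto)
  then show "\<exists>b. (\<forall>T. T \<subseteq> J \<longrightarrow> Suc (card T) = p \<longrightarrow> b T \<in> A 0 T) \<and> (\<forall>T. T \<subseteq> J \<longrightarrow> card T = p \<longrightarrow> c T - koszul_diff q b T \<in> G 0 T)"
    by (simp add: P_def)
qed

section \<open>Multigraded localizations\<close>

lemma vscale_zero [simp]:
  fixes v :: "int ^ 'd::finite"
  shows "0 *s v = 0"
  by (simp_all add: vec_eq_iff)

lemma vscale_add: "int (k + l) *s v = int k *s v + int l *s (v :: int ^ 'd::finite)"
  by (simp add: vec_eq_iff distrib_right)

lemma vscale_Suc: "int (Suc k) *s v = v + int k *s (v :: int ^ 'd::finite)"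
  by (simp add: vec_eq_iff distrib_right)

lemma vscale_plus: "a *s (v + w) = a *s v + a *s (w :: int ^ 'd::finite)"
  by (simp add: vec_eq_iff distrib_left)

lemma vscale_nonneg: "0 \<le> v \<Longrightarrow> 0 \<le> int k *s (v :: int ^ 'd::finite)"
  by (simp add: less_eq_vec_def)

lemma vec_le_add: "0 \<le> v \<Longrightarrow> n \<le> n + (v :: int ^ 'd::finite)"
  by (simp add: less_eq_vec_def)

lemma vec_sum_nonneg: "(\<And>i. i \<in> T \<Longrightarrow> 0 \<le> w i) \<Longrightarrow> 0 \<le> (sum w T :: int ^ 'd::finite)"
  by (simp add: less_eq_vec_def sum_nonneg)

text \<open>The structure on which localization in a single degree relies: subgroups indexed by
  degrees, with each \<open>q i\<close> raising the degree by \<open>w i\<close>.\<close>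

definition graded_op :: "('i \<Rightarrow> 'r::comm_ring_1) \<Rightarrow> ('i \<Rightarrow> int ^ 'd::finite) \<Rightarrow> (int ^ 'd \<Rightarrow> 'r set) \<Rightarrow> bool" where
  "graded_op q w A \<longleftrightarrow> (\<forall>n. addsub (A n)) \<and> (\<forall>i n. \<forall>x\<in>A n. q i * x \<in> A (n + w i))"

text \<open>If the \<open>q i\<close> are units, this is the component of degree \<open>n\<close> of the localization of the graded
  group \<open>A\<close> at the \<open>q i\<close>, of degree \<open>w i\<close>, with \<open>i\<close> in \<open>T\<close>.\<close>

definition loc :: "('i \<Rightarrow> 'r::comm_ring_1) \<Rightarrow> ('i \<Rightarrow> int ^ 'd::finite) \<Rightarrow> (int ^ 'd \<Rightarrow> 'r set) \<Rightarrow> 'i set \<Rightarrow> int ^ 'd \<Rightarrow> 'r set" where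
  "loc q w A T n = {t. \<exists>k::nat. prod q T ^ k * t \<in> A (n + int k *s sum w T)}"

lemma locI: "prod q T ^ k * t \<in> A (n + int k *s sum w T) \<Longrightarrow> t \<in> loc q w A T n"
  by (auto simp: loc_def)

lemma loc_subset: "(\<And>m. A m \<subseteq> B m) \<Longrightarrow> loc q w A T n \<subseteq> loc q w B T n"
  by (auto simp: loc_def)

lemma loc_empty [simp]: "loc q w A {} n = A n"
  by (auto simp: loc_def)

lemma graded_op_addsub: "graded_op q w A \<Longrightarrow> addsub (A n)"
  by (simp add: graded_op_def)

lemma graded_op_mult: "graded_op q w A \<Longrightarrow> x \<in> A n \<Longrightarrow> q i * x \<in> A (n + w i)"
  by (simp add: graded_op_def)

lemma graded_op_prod:
  assumes "graded_op q w A" "x \<in> A n" "finite T"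
  shows "prod q T * x \<in> A (n + sum w T)"
  using assms(3)
proof induction
  case (insert i T)
  from graded_op_mult[OF assms(1) insert.IH, of i] insert(1,2) show ?case
    by (simp add: ac_simps)
qed (use assms in auto)

lemma graded_op_prod_power:
  assumes "graded_op q w A" "x \<in> A n" "finite T"
  shows "prod q T ^ k * x \<in> A (n + int k *s sum w T)"
proof (induction k)
  case (Suc k)
  from graded_op_prod[OF assms(1) Suc assms(3)] show ?case
    by (simp add: vscale_Suc ac_simps del: of_nat_Suc)
qed (use assms in auto)

lemma graded_op_power:
  assumes "graded_op q w A" "x \<in> A n"
  shows "q i ^ k * x \<in> A (n + int k *s w i)"
  using graded_op_prod_power[OF assms, of "{i}" k] by simp

text \<open>This provides common denominators: raising the exponent of the denominator keeps the
  numerator in \<open>A\<close>.\<close>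

lemma loc_level_mono:
  assumes "graded_op q w A" "finite T" "prod q T ^ k * t \<in> A (n + int k *s sum w T)" "k \<le> l"
  shows "prod q T ^ l * t \<in> A (n + int l *s sum w T)"
proof -
  obtain j where l: "l = k + j" using assms(4) le_Suc_ex by blast
  show ?thesis using graded_op_prod_power[OF assms(1,3,2), of j]
    by (simp add: l vscale_add power_add ac_simps del: of_nat_add)
qed

lemma loc_mono_set:
  assumes "graded_op q w A" "finite T'" "T \<subseteq> T'"
  shows "loc q w A T n \<subseteq> loc q w A T' n"
proof
  fix t assume "t \<in> loc q w A T n"
  then obtain k where k: "prod q T ^ k * t \<in> A (n + int k *s sum w T)" by (auto simp: loc_def)
  have "prod q (T' - T) ^ k * (prod q T ^ k * t) \<in> A (n + int k *s sum w T + int k *s sum w (T' - T))"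
    using assms finite_subset by (intro graded_op_prod_power[OF assms(1) k]) auto
  moreover have "prod q T' = prod q (T' - T) * prod q T" "sum w T' = sum w T + sum w (T' - T)"
    using prod.subset_diff[OF assms(3,2), of q] sum.subset_diff[OF assms(3,2), of w] by (auto simp: add.commute)
  ultimately show "t \<in> loc q w A T' n"
    by (intro locI[of _ _ k]) (simp add: vscale_plus power_mult_distrib ac_simps)
qed

lemma loc_addsub:
  assumes "graded_op q w A" "finite T"
  shows "addsub (loc q w A T n)"
  unfolding addsub_def
proof (intro conjI ballI)
  show "0 \<in> loc q w A T n"
    using addsubD(1)[OF graded_op_addsub[OF assms(1)]] by (intro locI[of _ _ 0]) simp
next
  fix x y assume "x \<in> loc q w A T n" "y \<in> loc q w A T n"
  then obtain k l where "prod q T ^ k * x \<in> A (n + int k *s sum w T)" "prod q T ^ l * y \<in> A (n + int l *s sum w T)"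
    by (auto simp: loc_def)
  then have "prod q T ^ max k l * x \<in> A (n + int (max k l) *s sum w T)" "prod q T ^ max k l * y \<in> A (n + int (max k l) *s sum w T)"
    using loc_level_mono[OF assms] by auto
  from addsubD(2)[OF graded_op_addsub[OF assms(1)] this] show "x - y \<in> loc q w A T n"
    by (intro locI[of _ _ "max k l"]) (simp add: right_diff_distrib)
qed

lemma loc_mult:
  assumes "\<And>m x. x \<in> A m \<Longrightarrow> u * x \<in> B (m + v)" "x \<in> loc q w A T n"
  shows "u * x \<in> loc q w B T (n + v)"
proof -
  obtain k where k: "prod q T ^ k * x \<in> A (n + int k *s sum w T)" using assms by (auto simp: loc_def)
  from assms(1)[OF this] show ?thesis by (intro locI[of _ _ k]) (simp add: ac_simps)
qed

lemma loc_graded_mult: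
  "graded_op q w A \<Longrightarrow> x \<in> loc q w A T n \<Longrightarrow> q i * x \<in> loc q w A T (n + w i)"
  by (rule loc_mult) (auto intro: graded_op_mult)

text \<open>Supplying the other factors of \<open>prod q T\<close> turns the given factor
  \<open>q i\<close> into one more power of the denominator.\<close>

lemma loc_divide:
  assumes "graded_op q w A" "finite T" "i \<in> T" "q i * x \<in> loc q w A T (n + w i)"
  shows "x \<in> loc q w A T n"
proof -
  obtain k where k: "prod q T ^ k * (q i * x) \<in> A (n + w i + int k *s sum w T)" using assms by (auto simp: loc_def)
  from graded_op_prod[OF assms(1) this, of "T - {i}"] assms(2)
  have "prod q (T - {i}) * (prod q T ^ k * (q i * x)) \<in> A (n + w i + int k *s sum w T + sum w (T - {i}))" by simp
  moreover have "prod q T = q i * prod q (T - {i})" "sum w T = w i + sum w (T - {i})"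
    using assms prod.remove[of T i q] sum.remove[of T i w] by auto
  ultimately show ?thesis by (intro locI[of _ _ "Suc k"]) (simp add: vscale_Suc vscale_plus ac_simps del: of_nat_Suc)
qed

lemma loc_divide_power:
  assumes "graded_op q w A" "finite T" "i \<in> T" "q i ^ k * x \<in> loc q w A T (n + int k *s w i)"
  shows "x \<in> loc q w A T n"
  using assms(4)
proof (induction k arbitrary: x)
  case (Suc k)
  have "q i * (q i ^ k * x) \<in> loc q w A T ((n + int k *s w i) + w i)"
    using Suc.prems by (simp add: vscale_Suc ac_simps del: of_nat_Suc)
  then show ?case using Suc.IH loc_divide[OF assms(1-3)] by blast
qed simp

text \<open>The denominator \<open>q i\<close> is cleared. The form with \<open>eventually\<close>
  lets finitely many fractions share one exponent.\<close>

lemma loc_eventually: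
  assumes "graded_op q w A" "finite T" "i \<notin> T" "x \<in> loc q w A (insert i T) n"
  shows "\<forall>\<^sub>F k in sequentially. q i ^ k * x \<in> loc q w A T (n + int k *s w i)"
proof -
  obtain k0 where k0: "prod q (insert i T) ^ k0 * x \<in> A (n + int k0 *s sum w (insert i T))" using assms by (auto simp: loc_def)
  have "q i ^ k * x \<in> loc q w A T (n + int k *s w i)" if "k \<ge> k0" for k
    using loc_level_mono[OF assms(1) _ k0 that] assms(2,3)
    by (intro locI[of _ _ k]) (simp add: vscale_plus power_mult_distrib ac_simps)
  then show ?thesis unfolding eventually_sequentially by blast
qed

text \<open>As \<open>w i \<ge> 0\<close>, the numerators of a fraction of degree \<open>n\<close>
  have degree at least \<open>n\<close>. So cancellation of \<open>u\<close> is asked for in degrees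
  \<open>m \<ge> n\<close> only, which makes the lemma applicable to strict reductions.\<close>

lemma loc_saturated:
  assumes "graded_op q w A" "graded_op q w B" "finite T" "\<And>i. 0 \<le> w i"
    "\<And>m x. n \<le> m \<Longrightarrow> x \<in> A m \<Longrightarrow> u * x \<in> B (m + v) \<Longrightarrow> x \<in> B m"
    "x \<in> loc q w A T n" "u * x \<in> loc q w B T (n + v)"
  shows "x \<in> loc q w B T n"
proof -
  obtain k l where k: "prod q T ^ k * x \<in> A (n + int k *s sum w T)" and l: "prod q T ^ l * (u * x) \<in> B (n + v + int l *s sum w T)"
    using assms by (auto simp: loc_def)
  let ?k = "max k l"
  show ?thesis
  proof (rule locI[of _ _ ?k], rule assms(5))
    show "prod q T ^ ?k * x \<in> A (n + int ?k *s sum w T)"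
      by (rule loc_level_mono[OF assms(1,3) k]) simp
    have "prod q T ^ ?k * (u * x) \<in> B (n + v + int ?k *s sum w T)"
      by (rule loc_level_mono[OF assms(2,3) l]) simp
    then show "u * (prod q T ^ ?k * x) \<in> B (n + int ?k *s sum w T + v)" by (simp add: ac_simps)
    show "n \<le> n + int ?k *s sum w T"
      by (intro vec_le_add vscale_nonneg vec_sum_nonneg assms(4))
  qed
qed

lemma dvd_one_cancel: "(u::'r::comm_ring_1) dvd 1 \<Longrightarrow> u * x = u * y \<Longrightarrow> x = y"
proof -
  assume "u dvd 1" "u * x = u * y"
  then obtain v where "1 = u * v" by (auto simp: dvd_def)
  then have "x = v * (u * x)" "y = v * (u * y)" by (simp_all add: mult.assoc[symmetric] mult.commute[of v])
  then show "x = y" using \<open>u * x = u * y\<close> by simp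
qed

lemma dvd_one_prod: "(\<And>i. (q i :: 'r::comm_ring_1) dvd 1) \<Longrightarrow> prod q T dvd 1"
proof (induction T rule: infinite_finite_induct)
  case (insert i T)
  then show ?case using mult_dvd_mono[of "q i" 1 "prod q T" 1] by simp
qed auto

lemma dvd_one_power: "(q :: 'r::comm_ring_1) dvd 1 \<Longrightarrow> q ^ k dvd 1"
  using dvd_one_prod[of "\<lambda>_. q" "{..<k}"] by simp

lemma loc_zero:
  assumes "\<And>i. q i dvd 1"
  shows "loc q w (\<lambda>_. {0}) T n = {0}"
proof -
  have "t = 0" if "prod q T ^ k * t = 0" for t k
  proof (rule dvd_one_cancel)
    show "prod q T ^ k dvd 1" by (intro dvd_one_power dvd_one_prod assms)
  qed (use that in simp)
  then show ?thesis by (auto simp: loc_def)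
qed

definition add_multiples :: "'r::comm_ring_1 \<Rightarrow> int ^ 'd::finite \<Rightarrow> (int ^ 'd \<Rightarrow> 'r set) \<Rightarrow> (int ^ 'd \<Rightarrow> 'r set) \<Rightarrow> int ^ 'd \<Rightarrow> 'r set" where
  "add_multiples u v A G n = {u * x + g | x g. x \<in> A (n - v) \<and> g \<in> G n}"

text \<open>Localization commutes with multiples and sums: one direction divides a decomposed
  numerator, the other brings the two summands to a common denominator.\<close>

lemma loc_add_multiples:
  assumes "graded_op q w A" "graded_op q w G" "finite T" "\<And>i. q i dvd 1"
  shows "loc q w (add_multiples u v A G) T n = {u * x + g | x g. x \<in> loc q w A T (n - v) \<and> g \<in> loc q w G T n}"
proof (intro equalityI subsetI)
  fix t assume "t \<in> loc q w (add_multiples u v A G) T n"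
  then obtain k x g where t: "prod q T ^ k * t = u * x + g" "x \<in> A (n + int k *s sum w T - v)" "g \<in> G (n + int k *s sum w T)"
    by (auto simp: loc_def add_multiples_def)
  have "prod q T ^ k dvd 1" by (intro dvd_one_power dvd_one_prod assms)
  then obtain z where z: "1 = prod q T ^ k * z" by (auto simp: dvd_def)
  have "t = z * (prod q T ^ k * t)" using z by (metis mult.assoc mult.commute mult_1)
  also have "\<dots> = z * (u * x + g)" using t(1) by simp
  finally have "t = u * (z * x) + z * g" by (simp add: algebra_simps)
  moreover have "prod q T ^ k * (z * x) = x" "prod q T ^ k * (z * g) = g"
    using z[symmetric] by (simp_all flip: mult.assoc)
  then have "z * x \<in> loc q w A T (n - v)" "z * g \<in> loc q w G T n"
    using t(2,3) by (auto intro!: locI[of _ _ k] simp: algebra_simps)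
  ultimately show "t \<in> {u * x + g | x g. x \<in> loc q w A T (n - v) \<and> g \<in> loc q w G T n}" by blast
next
  fix t assume "t \<in> {u * x + g | x g. x \<in> loc q w A T (n - v) \<and> g \<in> loc q w G T n}"
  then obtain x g k l where t: "t = u * x + g" and k: "prod q T ^ k * x \<in> A (n - v + int k *s sum w T)"
      and l: "prod q T ^ l * g \<in> G (n + int l *s sum w T)"
    by (auto simp: loc_def)
  let ?k = "max k l"
  have "prod q T ^ ?k * x \<in> A (n - v + int ?k *s sum w T)" "prod q T ^ ?k * g \<in> G (n + int ?k *s sum w T)"
    by (rule loc_level_mono[OF assms(1,3) k], simp) (rule loc_level_mono[OF assms(2,3) l], simp)
  moreover have "prod q T ^ ?k * t = u * (prod q T ^ ?k * x) + prod q T ^ ?k * g" by (simp add: t algebra_simps)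
  ultimately show "t \<in> loc q w (add_multiples u v A G) T n"
    unfolding add_multiples_def by (intro locI[of _ _ ?k]) (auto simp: diff_add_eq)
qed

text \<open>The elements \<open>q\<close> enter only through the localizations; the differential has
  coefficients \<open>1\<close>, as the maps between the localizations are inclusions.\<close>

definition cech_vanish ::
  "('i::linorder \<Rightarrow> 'r::comm_ring_1) \<Rightarrow> ('i \<Rightarrow> int ^ 'd::finite) \<Rightarrow> 'i set \<Rightarrow> (int ^ 'd \<Rightarrow> 'r set) \<Rightarrow> (int ^ 'd \<Rightarrow> 'r set) \<Rightarrow> nat \<Rightarrow> int ^ 'd \<Rightarrow> bool" where
  "cech_vanish q w J A B p n = vanish (\<lambda>_. 1) J (\<lambda>T. loc q w A T n) (\<lambda>T. loc q w B T n) p"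

text \<open>The torsion hypothesis of \<open>vanish_descent\<close> is automatic for
  \<open>i \<in> J\<close>: contraction at \<open>i\<close> is a homotopy up to denominators
  \<open>q i\<close>, and one power of \<open>q i\<close> clears these for all index sets. Level
  \<open>k\<close> of that lemma stands for the degree \<open>n + int k *s w i\<close>.\<close>

lemma cech_vanish_descent:
  fixes q :: "'i::{finite,linorder} \<Rightarrow> 'r::comm_ring_1"
  assumes A: "graded_op q w A" and G: "graded_op q w G"
    and unit: "\<And>i. q i dvd 1" and w: "\<And>i. 0 \<le> w i" and iJ: "i \<in> J"
    and sat: "\<And>m x. n \<le> m \<Longrightarrow> x \<in> A m \<Longrightarrow> q i * x \<in> G (m + w i) \<Longrightarrow> x \<in> G m"
    and van: "\<And>m p'. p = Suc p' \<Longrightarrow> n + w i \<le> m \<Longrightarrow> cech_vanish q w J A (add_multiples (q i) (w i) A G) p' m"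
  shows "cech_vanish q w J A G p n"
proof -
  have ge: "n \<le> n + int k *s w i" for k by (intro vec_le_add vscale_nonneg w)
  define A' where "A' = (\<lambda>k T. loc q w A T (n + int k *s w i))"
  define G' where "G' = (\<lambda>k T. loc q w G T (n + int k *s w i))"
  have mono1: "x \<in> loc q w B T m" if "graded_op q w B" "x \<in> loc q w B (T - {j}) m" for B T x m and j :: 'i
    using loc_mono_set[OF that(1), of T "T - {j}" m] that(2) by auto
  have "vanish (\<lambda>_. 1) J (A' 0) (G' 0) p"
  proof (rule vanish_descent[where u = "q i"])
    fix k T show "addsub (A' k T)" "addsub (G' k T)" unfolding A'_def G'_def using A G by (auto intro: loc_addsub)
  next
    fix k T x and j :: 'i assume x: "x \<in> A' k (T - {j})"
    from mono1[OF A x[unfolded A'_def]] show "1 * x \<in> A' k T" by (simp add: A'_def)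
  next
    fix k T x and j :: 'i assume x: "x \<in> G' k (T - {j})"
    from mono1[OF G x[unfolded G'_def]] show "1 * x \<in> G' k T" by (simp add: G'_def)
  next
    fix k T x assume "x \<in> A' k T"
    then have "q i * x \<in> loc q w A T ((n + int k *s w i) + w i)" unfolding A'_def by (rule loc_graded_mult[OF A])
    then show "q i * x \<in> A' (Suc k) T" by (simp add: A'_def vscale_Suc ac_simps del: of_nat_Suc)
  next
    fix k T x assume x: "x \<in> A' k T" "q i * x \<in> G' (Suc k) T"
    have "q i * x \<in> loc q w G T ((n + int k *s w i) + w i)"
      using x(2) by (simp add: G'_def vscale_Suc ac_simps del: of_nat_Suc)
    then show "x \<in> G' k T" unfolding G'_def
    proof (rule loc_saturated[OF A G _ w, rotated -1])
      show "x \<in> loc q w A T (n + int k *s w i)" using x(1) by (simp add: A'_def)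
      show "y \<in> G m" if "n + int k *s w i \<le> m" "y \<in> A m" "q i * y \<in> G (m + w i)" for m y
        by (rule sat[OF order_trans[OF ge that(1)] that(2,3)])
    qed simp
  next
    fix k p' assume p: "p = Suc p'"
    have "n + w i \<le> n + w i + int k *s w i" by (intro vec_le_add vscale_nonneg w)
    then have "n + w i \<le> n + int (Suc k) *s w i" by (simp add: vscale_Suc add.assoc del: of_nat_Suc)
    from van[OF p this] have "vanish (\<lambda>_. 1) J (A' (Suc k)) (\<lambda>T. loc q w (add_multiples (q i) (w i) A G) T (n + int (Suc k) *s w i)) p'"
      by (simp add: cech_vanish_def A'_def del: of_nat_Suc)
    moreover have nk: "n + int (Suc k) *s w i - w i = n + int k *s w i" by (simp add: vscale_Suc del: of_nat_Suc)
    have "loc q w (add_multiples (q i) (w i) A G) T (n + int (Suc k) *s w i) = {q i * x + g |x g. x \<in> A' k T \<and> g \<in> G' (Suc k) T}" for T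
      using loc_add_multiples[OF A G _ unit, of T "q i" "w i" "n + int (Suc k) *s w i"]
      unfolding nk A'_def G'_def by simp
    ultimately show "vanish (\<lambda>_. 1) J (A' (Suc k)) (\<lambda>T. {q i * x + g |x g. x \<in> A' k T \<and> g \<in> G' (Suc k) T}) p'"
      by simp
  next
    fix c assume c: "\<And>T. T \<subseteq> J \<Longrightarrow> card T = p \<Longrightarrow> c T \<in> A' 0 T"
      "\<And>T. T \<subseteq> J \<Longrightarrow> card T = Suc p \<Longrightarrow> koszul_diff (\<lambda>_. 1) c T \<in> G' 0 T"
    let ?h = "contraction (single_at i)"
    \<comment> \<open>For \<open>i \<in> T\<close> the contraction is zero. Otherwise its value is,
      up to sign, the entry at \<open>insert i T\<close>, whose denominator \<open>q i\<close> is
      removed by a high power of \<open>q i\<close>.\<close>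
    have ev: "\<forall>\<^sub>F k in sequentially. (Suc (card T) = p \<longrightarrow> q i ^ k * ?h c T \<in> A' k T) \<and> (card T = p \<longrightarrow> q i ^ k * ?h (koszul_diff (\<lambda>_. 1) c) T \<in> G' k T)"
      if "T \<in> Pow J" for T
    proof (cases "i \<in> T")
      case True
      have "addsub (A' k T)" "addsub (G' k T)" for k unfolding A'_def G'_def using A G by (auto intro: loc_addsub)
      then show ?thesis using True by (auto simp: contraction_single_at addsubD)
    next
      case False
      let ?T = "insert i T"
      have T: "?T \<subseteq> J" "card ?T = Suc (card T)" using that iJ False by auto
      have "\<forall>\<^sub>F k in sequentially. Suc (card T) = p \<longrightarrow> q i ^ k * ?h c T \<in> A' k T"
      proof (cases "Suc (card T) = p")
        case True
        then have "?h c T \<in> loc q w A ?T n"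
          using c(1)[OF T(1)] T(2) False loc_addsub[OF A]
          by (auto simp: A'_def contraction_single_at intro!: koszul_sign_mem)
        from loc_eventually[OF A _ False this] show ?thesis by (auto simp: A'_def)
      qed simp
      moreover have "\<forall>\<^sub>F k in sequentially. card T = p \<longrightarrow> q i ^ k * ?h (koszul_diff (\<lambda>_. 1) c) T \<in> G' k T"
      proof (cases "card T = p")
        case True
        then have "?h (koszul_diff (\<lambda>_. 1) c) T \<in> loc q w G ?T n"
          using c(2)[OF T(1)] T(2) False loc_addsub[OF G]
          by (auto simp: G'_def contraction_single_at intro!: koszul_sign_mem)
        from loc_eventually[OF G _ False this] show ?thesis by (auto simp: G'_def)
      qed simp
      ultimately show ?thesis by (rule eventually_conj)
    qed
    have "\<forall>\<^sub>F k in sequentially. \<forall>T\<in>Pow J. (Suc (card T) = p \<longrightarrow> q i ^ k * ?h c T \<in> A' k T) \<and> (card T = p \<longrightarrow> q i ^ k * ?h (koszul_diff (\<lambda>_. 1) c) T \<in> G' k T)"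
      using ev by (intro eventually_ball_finite) auto
    then obtain K where K: "\<forall>T\<in>Pow J. (Suc (card T) = p \<longrightarrow> q i ^ K * ?h c T \<in> A' K T) \<and> (card T = p \<longrightarrow> q i ^ K * ?h (koszul_diff (\<lambda>_. 1) c) T \<in> G' K T)"
      using eventually_happens'[OF sequentially_bot] by blast
    have hom: "q i ^ K * c T - koszul_diff (\<lambda>_. 1) (\<lambda>T. q i ^ K * ?h c T) T = q i ^ K * ?h (koszul_diff (\<lambda>_. 1) c) T" for T
    proof -
      have "koszul_diff (\<lambda>_. 1) (?h c) T + ?h (koszul_diff (\<lambda>_. 1) c) T = c T" using koszul_diff_contraction_single[of "\<lambda>_. 1" i c T] by simp
      then have "q i ^ K * c T = q i ^ K * koszul_diff (\<lambda>_. 1) (?h c) T + q i ^ K * ?h (koszul_diff (\<lambda>_. 1) c) T"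
        by (metis distrib_left)
      then show ?thesis by (simp add: koszul_diff_scale)
    qed
    show "\<exists>K b. (\<forall>T. T \<subseteq> J \<longrightarrow> Suc (card T) = p \<longrightarrow> b T \<in> A' K T) \<and> (\<forall>T. T \<subseteq> J \<longrightarrow> card T = p \<longrightarrow> q i ^ K * c T - koszul_diff (\<lambda>_. 1) b T \<in> G' K T)"
      using K hom by (intro exI[of _ K] exI[of _ "\<lambda>T. q i ^ K * ?h c T"]) simp
  qed
  then show ?thesis by (simp add: cech_vanish_def A'_def G'_def)
qed

lemma cech_vanish_trans:
  fixes q :: "'i::{finite,linorder} \<Rightarrow> 'r::comm_ring_1"
  assumes "cech_vanish q w J A G p n" "cech_vanish q w J G B p n" "\<And>m. G m \<subseteq> A m" "\<And>m. B m \<subseteq> G m" "graded_op q w A"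
  shows "cech_vanish q w J A B p n"
  unfolding cech_vanish_def
  by (rule vanish_trans[OF assms(1,2)[unfolded cech_vanish_def] loc_subset[OF assms(3)] loc_subset[OF assms(4)]
        loc_addsub[OF assms(5) finite]])

text \<open>At index sets containing \<open>i\<close> one can divide by \<open>q i\<close>, so
  \<open>q i A \<subseteq> B\<close> becomes an inclusion of the localization of \<open>A\<close> in
  that of \<open>B\<close>.\<close>

lemma cech_vanish_killed:
  fixes q :: "'i::{finite,linorder} \<Rightarrow> 'r::comm_ring_1"
  assumes "cech_vanish q w J A B p n" "graded_op q w A" "graded_op q w B" "\<And>m x. x \<in> A m \<Longrightarrow> q i * x \<in> B (m + w i)"
  shows "cech_vanish q w (insert i J) A B p n"
  unfolding cech_vanish_def
proof (rule vanish_killed)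
  show "vanish (\<lambda>_. 1) J (\<lambda>T. loc q w A T n) (\<lambda>T. loc q w B T n) p" using assms(1) by (simp add: cech_vanish_def)
  show "loc q w A T n \<subseteq> loc q w B T n" if "i \<in> T" for T
  proof
    fix x assume "x \<in> loc q w A T n"
    then have "q i * x \<in> loc q w B T (n + w i)" by (rule loc_mult[rotated]) (fact assms(4))
    then show "x \<in> loc q w B T n" using loc_divide[OF assms(3) _ that] by simp
  qed
  show "addsub (loc q w A T n)" for T using assms(2) by (simp add: loc_addsub)
  show "1 * x \<in> loc q w A T n" if "x \<in> loc q w A (T - {j}) n" for T x j
    using loc_mono_set[OF assms(2), of T "T - {j}" n] that by auto
qed

section \<open>Vanishing in large degrees\<close>

lemma vec_upper_bound:
  obtains m :: "int ^ 'd::finite" where "m1 \<le> m" "m2 \<le> m"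
  by (rule that[of "\<chi> i. max (vec_nth m1 i) (vec_nth m2 i)"]) (auto simp: less_eq_vec_def)

text \<open>The components of a graded ring, as subsets of one ambient ring. The direct sum is not
  formed here: graded ideals are families of components.\<close>

locale graded_family =
  fixes F :: "int ^ 'd::{finite,linorder} \<Rightarrow> 'q::comm_ring_1 set"
  assumes F_addsub: "addsub (F n)"
    and F_one: "1 \<in> F 0"
    and F_mult: "r \<in> F m \<Longrightarrow> s \<in> F n \<Longrightarrow> r * s \<in> F (m + n)"
begin

definition graded_ideal :: "((int, 'd) vec \<Rightarrow> 'q set) \<Rightarrow> bool" where
  "graded_ideal A \<longleftrightarrow> (\<forall>n. addsub (A n) \<and> A n \<subseteq> F n) \<and> (\<forall>m n. \<forall>r\<in>F m. \<forall>x\<in>A n. r * x \<in> A (m + n))"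

lemma graded_idealD:
  assumes "graded_ideal A"
  shows "addsub (A n)" "A n \<subseteq> F n" "r \<in> F m \<Longrightarrow> x \<in> A n \<Longrightarrow> r * x \<in> A (m + n)"
  using assms by (auto simp: graded_ideal_def)

lemma graded_ideal_F: "graded_ideal F"
  by (simp add: graded_ideal_def F_addsub F_mult)

lemma graded_ideal_zero: "graded_ideal (\<lambda>_. {0})"
  using addsubD(1)[OF F_addsub] by (simp add: graded_ideal_def addsub_def)

lemma graded_ideal_op:
  assumes "graded_ideal A" "\<And>i. q i \<in> F (w i)"
  shows "graded_op q w A"
  using graded_idealD(3)[OF assms(1) assms(2)] graded_idealD(1)[OF assms(1)]
  by (simp add: graded_op_def add.commute[of _ "w _"])

lemma graded_ideal_add_multiples:
  assumes A: "graded_ideal A" and G: "graded_ideal G" and u: "u \<in> F v"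
  shows "graded_ideal (add_multiples u v A G)"
  unfolding graded_ideal_def
proof (intro conjI allI ballI)
  fix n
  show "addsub (add_multiples u v A G n)"
    unfolding addsub_def
  proof (intro conjI ballI)
    have "0 = u * 0 + 0" by simp
    then show "0 \<in> add_multiples u v A G n"
      unfolding add_multiples_def using addsubD(1)[OF graded_idealD(1)[OF A]] addsubD(1)[OF graded_idealD(1)[OF G]] by blast
  next
    fix s t assume "s \<in> add_multiples u v A G n" "t \<in> add_multiples u v A G n"
    then obtain x g y h where *: "s = u * x + g" "x \<in> A (n - v)" "g \<in> G n" "t = u * y + h" "y \<in> A (n - v)" "h \<in> G n"
      by (auto simp: add_multiples_def)
    have "s - t = u * (x - y) + (g - h)" using * by (simp add: algebra_simps)
    moreover have "x - y \<in> A (n - v)" "g - h \<in> G n" using * addsubD(2) graded_idealD(1) A G by blast+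
    ultimately show "s - t \<in> add_multiples u v A G n" by (auto simp: add_multiples_def)
  qed
  show "add_multiples u v A G n \<subseteq> F n"
  proof
    fix t assume "t \<in> add_multiples u v A G n"
    then obtain x g where *: "t = u * x + g" "x \<in> A (n - v)" "g \<in> G n" by (auto simp: add_multiples_def)
    then have "u * x \<in> F (v + (n - v))" using F_mult u graded_idealD(2)[OF A] by blast
    moreover have "g \<in> F n" using *(3) graded_idealD(2)[OF G] by blast
    ultimately show "t \<in> F n" using *(1) addsubD(4)[OF F_addsub] by simp
  qed
next
  fix m n r t assume "r \<in> F m" "t \<in> add_multiples u v A G n"
  then obtain x g where *: "r \<in> F m" "t = u * x + g" "x \<in> A (n - v)" "g \<in> G n" by (auto simp: add_multiples_def)
  then have "r * x \<in> A (m + n - v)" "r * g \<in> G (m + n)"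
    using graded_idealD(3)[OF A *(1,3)] graded_idealD(3)[OF G *(1,4)] by (auto simp: add_diff_eq)
  moreover have "r * t = u * (r * x) + r * g" using * by (simp add: algebra_simps)
  ultimately show "r * t \<in> add_multiples u v A G (m + n)" by (auto simp: add_multiples_def)
qed

lemma F_power: "x \<in> F v \<Longrightarrow> x ^ k \<in> F (int k *s v)"
  by (induction k) (auto simp: F_one vscale_Suc F_mult simp del: of_nat_Suc)

definition torsion_part :: "'q \<Rightarrow> (int, 'd) vec \<Rightarrow> ((int, 'd) vec \<Rightarrow> 'q set) \<Rightarrow> ((int, 'd) vec \<Rightarrow> 'q set) \<Rightarrow> nat \<Rightarrow> (int, 'd) vec \<Rightarrow> 'q set" where
  "torsion_part u v A B k n = {x \<in> A n. u ^ k * x \<in> B (n + int k *s v)}"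

lemma graded_ideal_torsion_part:
  assumes A: "graded_ideal A" and B: "graded_ideal B"
  shows "graded_ideal (torsion_part u v A B k)"
  unfolding graded_ideal_def
proof (intro conjI allI ballI)
  fix n
  show "addsub (torsion_part u v A B k n)"
    using graded_idealD(1)[OF A, of n] graded_idealD(1)[OF B, of "n + int k *s v"]
    unfolding torsion_part_def addsub_def by (auto simp: right_diff_distrib)
  show "torsion_part u v A B k n \<subseteq> F n" using graded_idealD(2)[OF A] by (auto simp: torsion_part_def)
next
  fix m n r x assume *: "r \<in> F m" "x \<in> torsion_part u v A B k n"
  then have "r * (u ^ k * x) \<in> B (m + (n + int k *s v))" "r * x \<in> A (m + n)"
    using graded_idealD(3) A B by (auto simp: torsion_part_def)
  then show "r * x \<in> torsion_part u v A B k (m + n)" by (simp add: torsion_part_def ac_simps)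
qed

text \<open>The part of \<open>A\<close> generated by its components with degrees in the box of
  radius \<open>k\<close>. These parts exhaust \<open>A\<close>, so the ascending chain condition
  bounds the degrees of generators.\<close>

definition generated_part :: "((int, 'd) vec \<Rightarrow> 'q set) \<Rightarrow> nat \<Rightarrow> (int, 'd) vec \<Rightarrow> 'q set" where
  "generated_part A k n =
     \<Inter>{N. addsub N \<and> (\<forall>c. (\<forall>i. \<bar>vec_nth c i\<bar> \<le> int k) \<longrightarrow> (\<forall>r\<in>F (n - c). \<forall>x\<in>A c. r * x \<in> N))}"

lemma generated_partI:
  assumes "\<And>i. \<bar>vec_nth c i\<bar> \<le> int k" "r \<in> F (n - c)" "x \<in> A c"
  shows "r * x \<in> generated_part A k n"
  using assms unfolding generated_part_def by blast

lemma generated_part_least: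
  assumes "addsub N" "\<And>c r x. (\<And>i. \<bar>vec_nth c i\<bar> \<le> int k) \<Longrightarrow> r \<in> F (n - c) \<Longrightarrow> x \<in> A c \<Longrightarrow> r * x \<in> N"
  shows "generated_part A k n \<subseteq> N"
  unfolding generated_part_def using assms by (intro Inter_lower) blast

lemma graded_ideal_generated_part:
  assumes A: "graded_ideal A"
  shows "graded_ideal (generated_part A k)"
  unfolding graded_ideal_def
proof (intro conjI allI ballI)
  fix n
  show "addsub (generated_part A k n)"
    unfolding generated_part_def addsub_def by simp
  show "generated_part A k n \<subseteq> F n"
  proof (rule generated_part_least[OF F_addsub])
    fix c r x assume "r \<in> F (n - c)" "x \<in> A c"
    then have "r * x \<in> F (n - c + c)" using F_mult graded_idealD(2)[OF A] by blast
    then show "r * x \<in> F n" by simp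
  qed
next
  fix m n r x assume r: "r \<in> F m" and x: "x \<in> generated_part A k n"
  have gen: "addsub (generated_part A k (m + n))" unfolding generated_part_def addsub_def by simp
  have "generated_part A k n \<subseteq> {y. r * y \<in> generated_part A k (m + n)}"
  proof (rule generated_part_least)
    show "addsub {y. r * y \<in> generated_part A k (m + n)}"
      using gen by (simp add: addsub_def right_diff_distrib)
    fix c s y assume *: "\<And>i. \<bar>vec_nth c i\<bar> \<le> int k" "s \<in> F (n - c)" "y \<in> A c"
    have "r * s \<in> F (m + n - c)" using F_mult[OF r *(2)] by (simp add: add_diff_eq)
    with *(1,3) have "r * s * y \<in> generated_part A k (m + n)" by (intro generated_partI)
    then show "s * y \<in> {y. r * y \<in> generated_part A k (m + n)}" by (simp add: mult.assoc)
  qed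
  then show "r * x \<in> generated_part A k (m + n)" using x by auto
qed

end

text \<open>Being units of the ambient ring, the \<open>a i\<close> act as nonzerodivisors.
  \<open>acc\<close> is the noetherian property for graded ideals, and \<open>reduction\<close> says
  that the ideal of the \<open>a i\<close> contains everything of large degree.\<close>

locale joint_reduction = graded_family F for F :: "int ^ 'd::{finite,linorder} \<Rightarrow> 'q::comm_ring_1 set" +
  fixes a :: "'d \<Rightarrow> 'q"
  assumes a_mem: "a i \<in> F (axis i 1)"
    and a_unit: "a i dvd 1"
    and acc: "(\<And>k::nat. graded_ideal (A k)) \<Longrightarrow> (\<And>k n. A k n \<subseteq> A (Suc k) n) \<Longrightarrow> \<exists>K. \<forall>k\<ge>K. A k = A K"
    and reduction: "\<exists>m. \<forall>n\<ge>m. \<forall>r\<in>F n. \<exists>f. (\<forall>i. f i \<in> F (n - axis i 1)) \<and> r = (\<Sum>i\<in>UNIV. a i * f i)"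
begin

lemma a_op: "graded_ideal A \<Longrightarrow> graded_op a (\<lambda>i. axis i 1) A"
  by (rule graded_ideal_op) (auto intro: a_mem)

text \<open>\<open>A\<close> is generated in bounded degrees. In a large degree the coefficient
  \<open>r\<close> of a generator \<open>x\<close> has large degree too, so it is a combination of
  the \<open>a i\<close>, each of which maps the rest of the term from \<open>A\<close> into
  \<open>B\<close>.\<close>

lemma eventually_killed:
  assumes A: "graded_ideal A" and B: "graded_ideal B"
    and kill: "\<And>i n x. x \<in> A n \<Longrightarrow> a i * x \<in> B (n + axis i 1)"
  shows "\<exists>m. \<forall>n\<ge>m. A n \<subseteq> B n"
proof -
  have "generated_part A k n \<subseteq> generated_part A (Suc k) n" for k n
  proof (rule generated_part_least)
    fix c r x assume c: "\<And>i. \<bar>vec_nth c i\<bar> \<le> int k" and *: "r \<in> F (n - c)" "x \<in> A c"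
    have "\<bar>vec_nth c i\<bar> \<le> int (Suc k)" for i using c[of i] by simp
    then show "r * x \<in> generated_part A (Suc k) n" using * by (intro generated_partI)
  qed (rule graded_idealD(1)[OF graded_ideal_generated_part[OF A]])
  then have "\<exists>K. \<forall>k\<ge>K. generated_part A k = generated_part A K"
    by (intro acc graded_ideal_generated_part A)
  then obtain K where K: "\<And>k. k \<ge> K \<Longrightarrow> generated_part A k = generated_part A K" by blast
  have AK: "A n \<subseteq> generated_part A K n" for n
  proof
    fix x assume x: "x \<in> A n"
    \<comment> \<open>Chosen at least \<open>K\<close> and such that the box contains the degree
      \<open>n\<close>, so that \<open>x = 1 * x\<close> is one of the generators.\<close>
    define k where "k = K + nat (\<Sum>i\<in>UNIV. \<bar>vec_nth n i\<bar>)"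
    have "\<bar>vec_nth n i\<bar> \<le> int k" for i
    proof -
      have "\<bar>vec_nth n i\<bar> \<le> (\<Sum>i\<in>UNIV. \<bar>vec_nth n i\<bar>)" by (rule member_le_sum) auto
      then show ?thesis by (simp add: k_def)
    qed
    then have "1 * x \<in> generated_part A k n" using x F_one by (intro generated_partI) auto
    then show "x \<in> generated_part A K n" using K[of k] by (simp add: k_def)
  qed
  obtain m where m: "\<And>n r. m \<le> n \<Longrightarrow> r \<in> F n \<Longrightarrow> \<exists>f. (\<forall>i. f i \<in> F (n - axis i 1)) \<and> r = (\<Sum>i\<in>UNIV. a i * f i)"
    using reduction by blast
  \<comment> \<open>The shift by \<open>K\<close> ensures \<open>n - c \<ge> m\<close> for every
    degree \<open>c\<close> in the box.\<close>
  have "A n \<subseteq> B n" if n: "n \<ge> m + vec (int K)" for n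
  proof (rule order_trans[OF AK generated_part_least])
    show "addsub (B n)" using B by (rule graded_idealD)
    fix c r x assume c: "\<And>i. \<bar>vec_nth c i\<bar> \<le> int K" and r: "r \<in> F (n - c)" and x: "x \<in> A c"
    have "vec_nth m i \<le> vec_nth (n - c) i" for i
    proof -
      have "vec_nth m i + int K \<le> vec_nth n i" using n by (simp add: less_eq_vec_def)
      then show ?thesis using c[of i] by simp
    qed
    then have "m \<le> n - c" by (simp add: less_eq_vec_def)
    from m[OF this r] obtain f where f: "\<And>i. f i \<in> F (n - c - axis i 1)" "r = (\<Sum>i\<in>UNIV. a i * f i)" by blast
    have "a i * (f i * x) \<in> B n" for i
      using kill[OF graded_idealD(3)[OF A f(1)[of i] x], of i] by simp
    then show "r * x \<in> B n"
      unfolding f(2) sum_distrib_right mult.assoc using graded_idealD(1)[OF B] by (intro addsub_sum)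
  qed
  then show ?thesis by blast
qed

text \<open>The statement is about all pairs \<open>A\<close>, \<open>B\<close> because the
  induction step passes to several other pairs, and the bound \<open>m\<close> is uniform in
  \<open>p\<close> because the descent lowers \<open>p\<close>.\<close>

lemma vanishing_large:
  fixes J :: "'d set"
  assumes "graded_ideal A" "graded_ideal B" "\<And>n. B n \<subseteq> A n"
    "\<And>i n x. i \<notin> J \<Longrightarrow> x \<in> A n \<Longrightarrow> a i * x \<in> B (n + axis i 1)"
  shows "\<exists>m. \<forall>n\<ge>m. \<forall>p. cech_vanish a (\<lambda>i. axis i 1) J A B p n"
  using finite[of J] assms
proof (induction J arbitrary: A B)
  case empty
  from eventually_killed[OF empty(1,2)] empty(4) obtain m where m: "\<And>n. m \<le> n \<Longrightarrow> A n \<subseteq> B n" by auto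
  have "cech_vanish a (\<lambda>i. axis i 1) {} A B p n" if "m \<le> n" for n p
    unfolding cech_vanish_def
  proof (rule vanishI)
    fix c :: "'d set \<Rightarrow> 'q" assume "\<And>T. T \<subseteq> {} \<Longrightarrow> card T = p \<Longrightarrow> c T \<in> loc a (\<lambda>i. axis i 1) A T n"
    then show "\<exists>b. (\<forall>T. T \<subseteq> {} \<longrightarrow> Suc (card T) = p \<longrightarrow> b T \<in> loc a (\<lambda>i. axis i 1) A T n) \<and>
                   (\<forall>T. T \<subseteq> {} \<longrightarrow> card T = p \<longrightarrow> c T - koszul_diff (\<lambda>_. 1) b T \<in> loc a (\<lambda>i. axis i 1) B T n)"
      using m[OF that] addsubD(1)[OF graded_idealD(1)[OF empty(1)], of n] by (intro exI[of _ "\<lambda>_. 0"]) auto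
  qed
  then show ?case by blast
next
  case (insert i J)
  note A = insert.prems(1) and B = insert.prems(2)
  define G where "G = torsion_part (a i) (axis i 1) A B"
  have G: "graded_ideal (G k)" for k unfolding G_def by (rule graded_ideal_torsion_part[OF A B])
  have GA: "G k n \<subseteq> A n" for k n by (auto simp: G_def torsion_part_def)
  have BG: "B n \<subseteq> G k n" for k n
    using insert.prems(3) graded_op_power[OF a_op[OF B]] by (fastforce simp: G_def torsion_part_def)
  have G0: "G 0 = B"
    using insert.prems(3) by (auto simp: G_def torsion_part_def fun_eq_iff)
  have Gstep: "a i * x \<in> G k (n + axis i 1)" if "x \<in> G (Suc k) n" for x k n
    using that graded_op_mult[OF a_op[OF A], of x n i]
    by (simp add: G_def torsion_part_def vscale_Suc ac_simps del: of_nat_Suc)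
  have Gstep': "x \<in> G (Suc k) n" if "x \<in> A n" "a i * x \<in> G k (n + axis i 1)" for x k n
    using that by (simp add: G_def torsion_part_def vscale_Suc ac_simps del: of_nat_Suc)
  have Gmono: "G k n \<subseteq> G (Suc k) n" for k n
  proof
    fix x assume x: "x \<in> G k n"
    have "a i * x \<in> G k (n + axis i 1)" using graded_op_mult[OF a_op[OF G] x] .
    then show "x \<in> G (Suc k) n" using Gstep' GA x by blast
  qed
  obtain K where K: "\<And>k. k \<ge> K \<Longrightarrow> G k = G K" using acc[of G] G Gmono by blast
  have killG: "a j * x \<in> G k (n + axis j 1)" if "j \<notin> insert i J" "x \<in> A n" for j x n k
    using insert.prems(4)[OF that] BG by blast
  \<comment> \<open>Climbing the chain of torsion parts; as finitely many layers lie below each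
    \<open>k\<close>, their bounds have a common upper bound.\<close>
  have "\<exists>m. \<forall>n\<ge>m. \<forall>p. cech_vanish a (\<lambda>i. axis i 1) (insert i J) (G k) B p n" for k
  proof (induction k)
    case 0
    have "cech_vanish a (\<lambda>i. axis i 1) (insert i J) B B p n" for p n
      unfolding cech_vanish_def
      by (rule vanishI) (use loc_addsub[OF a_op[OF B]] in \<open>auto intro!: exI[of _ "\<lambda>_. 0"] simp: addsubD\<close>)
    then show ?case by (simp add: G0)
  next
    case (Suc k)
    obtain m1 where m1: "\<And>n p. m1 \<le> n \<Longrightarrow> cech_vanish a (\<lambda>i. axis i 1) (insert i J) (G k) B p n" using Suc by blast
    have "\<exists>m. \<forall>n\<ge>m. \<forall>p. cech_vanish a (\<lambda>i. axis i 1) J (G (Suc k)) (G k) p n"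
    \<comment> \<open>The layer is killed by \<open>a i\<close>, so the induction hypothesis for
      \<open>J\<close> applies to it; \<open>cech_vanish_killed\<close> then readmits the index
      \<open>i\<close>.\<close>
    proof (rule insert.IH[OF G G Gmono])
      fix j n x assume "j \<notin> J" "x \<in> G (Suc k) n"
      then show "a j * x \<in> G k (n + axis j 1)" using Gstep killG GA by (cases "j = i") blast+
    qed
    then obtain m2 where m2: "\<And>n p. m2 \<le> n \<Longrightarrow> cech_vanish a (\<lambda>i. axis i 1) J (G (Suc k)) (G k) p n" by blast
    obtain m where m: "m1 \<le> m" "m2 \<le> m" by (rule vec_upper_bound)
    have "cech_vanish a (\<lambda>i. axis i 1) (insert i J) (G (Suc k)) B p n" if "n \<ge> m" for n p
    proof (rule cech_vanish_trans[OF _ _ Gmono BG a_op[OF G]])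
      show "cech_vanish a (\<lambda>i. axis i 1) (insert i J) (G (Suc k)) (G k) p n"
        by (rule cech_vanish_killed[OF m2[OF order_trans[OF m(2) that]] a_op[OF G] a_op[OF G] Gstep])
      show "cech_vanish a (\<lambda>i. axis i 1) (insert i J) (G k) B p n" by (rule m1[OF order_trans[OF m(1) that]])
    qed
    then show ?case by blast
  qed
  from this[of K] obtain m1 where m1: "\<And>n p. m1 \<le> n \<Longrightarrow> cech_vanish a (\<lambda>i. axis i 1) (insert i J) (G K) B p n" by blast
  \<comment> \<open>The descent on \<open>A / G K\<close> requires vanishing for the quotient by
    \<open>a i\<close>. As \<open>a i\<close> kills that quotient, the induction hypothesis for
    \<open>J\<close> provides it.\<close>
  define G' where "G' = add_multiples (a i) (axis i 1) A (G K)"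
  have G': "graded_ideal G'" unfolding G'_def by (rule graded_ideal_add_multiples[OF A G a_mem])
  have G'A: "G' n \<subseteq> A n" for n
  proof
    fix t assume "t \<in> G' n"
    then obtain x g where t: "t = a i * x + g" "x \<in> A (n - axis i 1)" "g \<in> G K n" by (auto simp: G'_def add_multiples_def)
    from graded_op_mult[OF a_op[OF A] t(2), of i] have "a i * x \<in> A n" by simp
    then show "t \<in> A n" using t GA addsubD(4)[OF graded_idealD(1)[OF A]] by blast
  qed
  have GG': "G K n \<subseteq> G' n" for n
  proof
    fix g assume "g \<in> G K n"
    moreover have "g = a i * 0 + g" by simp
    ultimately show "g \<in> G' n"
      unfolding G'_def add_multiples_def using addsubD(1)[OF graded_idealD(1)[OF A]] by blast
  qed
  have AG': "a i * x \<in> G' (n + axis i 1)" if "x \<in> A n" for x n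
  proof -
    have "a i * x = a i * x + 0" by simp
    then show ?thesis unfolding G'_def add_multiples_def
      using that addsubD(1)[OF graded_idealD(1)[OF G]] by force
  qed
  have "\<exists>m. \<forall>n\<ge>m. \<forall>p. cech_vanish a (\<lambda>i. axis i 1) J A G' p n"
  proof (rule insert.IH[OF A G' G'A])
    fix j n x assume "j \<notin> J" "x \<in> A n"
    then show "a j * x \<in> G' (n + axis j 1)" using AG' killG GG' by (cases "j = i") blast+
  qed
  then obtain m2 where m2: "\<And>n p. m2 \<le> n \<Longrightarrow> cech_vanish a (\<lambda>i. axis i 1) J A G' p n" by blast
  have axis_nonneg: "0 \<le> (axis j 1 :: (int, 'd) vec)" for j by (simp add: less_eq_vec_def axis_def)
  obtain m0 where m0: "m1 \<le> m0" "m2 \<le> m0" by (rule vec_upper_bound)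
  have "cech_vanish a (\<lambda>i. axis i 1) (insert i J) A B p n" if n: "n \<ge> m0" for n p
  proof (rule cech_vanish_trans[OF _ _ GA BG a_op[OF A]])
    show "cech_vanish a (\<lambda>i. axis i 1) (insert i J) (G K) B p n" by (rule m1[OF order_trans[OF m0(1) n]])
    show "cech_vanish a (\<lambda>i. axis i 1) (insert i J) A (G K) p n"
    proof (rule cech_vanish_descent[OF a_op[OF A] a_op[OF G] a_unit axis_nonneg, of i])
      fix m x assume "x \<in> A m" "a i * x \<in> G K (m + axis i 1)"
      then have "x \<in> G (Suc K) m" by (rule Gstep')
      \<comment> \<open>Stationarity of the chain at \<open>K\<close> is the injectivity of
        \<open>a i\<close> on \<open>A / G K\<close>.\<close>
      then show "x \<in> G K m" using K[of "Suc K"] by simp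
    next
      fix m p' assume "n + axis i 1 \<le> m"
      then have "m2 \<le> m" using m0(2) n vec_le_add[OF axis_nonneg[of i], of n] by (meson order_trans)
      then show "cech_vanish a (\<lambda>i. axis i 1) (insert i J) A (add_multiples (a i) (axis i 1) A (G K)) p' m"
        using cech_vanish_killed[OF m2 a_op[OF A] a_op[OF G'] AG'] by (simp add: G'_def)
    qed simp
  qed
  then show ?case by blast
qed

end

section \<open>Koszul cohomology and regular sequences\<close>

text \<open>In place of the determinant trick: take \<open>N\<close> maximal among the submodules
  that contain \<open>B\<close> and are properly contained in \<open>Z\<close>. Adjoining some
  \<open>z\<close> outside \<open>N\<close> gives all of \<open>Z\<close>, and
  \<open>z = b + y (s z + m)\<close> shows \<open>(1 - y s) z \<in> N\<close>.\<close>

lemma nakayama: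
  fixes f :: "'s::comm_ring_1 \<Rightarrow> 'b::ab_group_add \<Rightarrow> 'b"
  assumes f: "Modules.module f" and Z: "noeth UNIV f Z" "submod UNIV f Z" and B: "submod UNIV f B" "B \<subseteq> Z"
    and dec: "\<And>z. z \<in> Z \<Longrightarrow> \<exists>b\<in>B. \<exists>z'\<in>Z. z = b + f y z'"
    and unit: "\<And>r. (1 - y * r) dvd 1"
  shows "Z \<subseteq> B"
proof (rule ccontr)
  assume nZB: "\<not> Z \<subseteq> B"
  interpret f: Modules.module f by fact
  have U: "subring_of (UNIV :: 's set)" by (simp add: subring_of_def)
  define P where "P = {N. submod UNIV f N \<and> B \<subseteq> N \<and> N \<subseteq> Z \<and> N \<noteq> Z}"
  have "B \<in> P" using B nZB by (auto simp: P_def)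
  then obtain N where N: "N \<in> P" and max: "\<And>N'. N' \<in> P \<Longrightarrow> N \<subseteq> N' \<Longrightarrow> N' = N"
    using noeth_maximal[OF Z(1), of B P] unfolding P_def by blast
  then have sN: "submod UNIV f N" "B \<subseteq> N" "N \<subseteq> Z" by (auto simp: P_def)
  obtain z where z: "z \<in> Z" "z \<notin> N" using N by (auto simp: P_def)
  let ?N = "{f s z + m | s m. s \<in> UNIV \<and> m \<in> N}"
  have "N \<subseteq> ?N"
  proof
    fix m assume "m \<in> N"
    moreover have "m = f 0 z + m" by simp
    ultimately show "m \<in> ?N" by blast
  qed
  moreover have "z = f 1 z + 0" by simp
  then have "z \<in> ?N" using submodD(1)[OF sN(1)] by blast
  moreover have "?N \<subseteq> Z" using z sN Z(2) by (auto simp: submod_def)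
  moreover have "submod UNIV f ?N" by (rule submod_insert[OF U f sN(1)])
  ultimately have "?N = Z" using max[of ?N] z sN unfolding P_def by blast
  obtain b z' where bz: "b \<in> B" "z' \<in> Z" "z = b + f y z'" using dec[OF z(1)] by blast
  then obtain s m where sm: "z' = f s z + m" "m \<in> N" using \<open>?N = Z\<close> by blast
  have "f (1 - y * s) z = b + f y m"
    using bz(3) sm(1) by (simp add: f.scale_left_diff_distrib f.scale_right_distrib algebra_simps)
  moreover have "b + f y m \<in> N" using bz sm sN submodD(2,3) by blast
  ultimately have *: "f (1 - y * s) z \<in> N" by simp
  obtain v where "1 = (1 - y * s) * v" using unit[of s] by (auto simp: dvd_def)
  then have "f v (f (1 - y * s) z) = z" by (simp add: mult.commute)
  then show False using submodD(3)[OF sN(1) _ *, of v] z by simp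
qed

lemma module_pointwise: "Modules.module (\<lambda>(r::'a::comm_ring_1) (c::'x \<Rightarrow> 'a) x. r * c x)"
  by unfold_locales (auto simp: algebra_simps fun_eq_iff)

text \<open>The indicator functions of the points span all functions.\<close>

lemma noeth_functions:
  assumes "noeth UNIV (*) (UNIV :: 'a::comm_ring_1 set)"
  shows "noeth UNIV (\<lambda>(r::'a) (c::'x::finite \<Rightarrow> 'a) x. r * c x) M"
proof -
  let ?f = "\<lambda>(r::'a) (c::'x \<Rightarrow> 'a) x. r * c x"
  let ?e = "\<lambda>(x::'x) y. if x = y then 1 else (0::'a)"
  have inj: "inj ?e" by (auto simp: inj_def fun_eq_iff split: if_splits)
  have sum_apply: "(\<Sum>x\<in>S. g x) y = (\<Sum>x\<in>S. g x y)" for g :: "'x \<Rightarrow> 'x \<Rightarrow> 'a" and S y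
    by (induction S rule: infinite_finite_induct) auto
  have "c \<in> {\<Sum>g\<in>range ?e. ?f (d g) g | d. d \<in> range ?e \<rightarrow> UNIV}" for c :: "'x \<Rightarrow> 'a"
  proof -
    have "(\<Sum>g\<in>range ?e. ?f (c (inv_into UNIV ?e g)) g) = (\<Sum>x\<in>UNIV. ?f (c x) (?e x))"
      by (simp add: sum.reindex[OF inj] inv_f_f[OF inj])
    also have "\<dots> = c" by (auto simp: fun_eq_iff sum_apply if_distrib sum.delta cong: if_cong)
    finally show ?thesis by (intro CollectI exI[of _ "\<lambda>g. c (inv_into UNIV ?e g)"]) auto
  qed
  then have U: "{\<Sum>g\<in>range ?e. ?f (d g) g | d. d \<in> range ?e \<rightarrow> UNIV} = UNIV" by blast
  have "subring_of (UNIV :: 'a set)" by (simp add: subring_of_def)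
  from noeth_finite_span[OF this assms module_pointwise, of "range ?e"]
  have "noeth UNIV ?f UNIV" unfolding U by simp
  then show ?thesis by (rule noeth_subset) simp
qed

text \<open>Depth sensitivity of Koszul cohomology. The \<open>b l\<close> grow by a sequence
  \<open>u\<close> whose members are regular modulo the preceding ones; the descent lowers
  \<open>p\<close> while \<open>l\<close> grows. A power of \<open>u l\<close> lies in the ideal of
  the \<open>y i\<close>, and contraction with its coefficients shows that it kills the
  cohomology.\<close>

lemma koszul_vanish:
  fixes y :: "'i::{finite,linorder} \<Rightarrow> 'a::comm_ring_1"
  assumes b: "\<And>l. addsub (b l)" "\<And>l r x. x \<in> b l \<Longrightarrow> r * x \<in> b l"
    and bSuc: "\<And>l. l < d \<Longrightarrow> b (Suc l) = {u l * x + g | x g. g \<in> b l}"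
    and reg: "\<And>l x. l < d \<Longrightarrow> u l * x \<in> b l \<Longrightarrow> x \<in> b l"
    and tors: "\<And>l. l < d \<Longrightarrow> \<exists>N s. u l ^ N = (\<Sum>i\<in>UNIV. y i * s i)"
  shows "p + l < d \<Longrightarrow> vanish y UNIV (\<lambda>_. UNIV) (\<lambda>_. b l) p"
proof (induction p arbitrary: l rule: less_induct)
  case (less p)
  then have l: "l < d" by simp
  show ?case
  proof (rule vanish_descent[where A = "\<lambda>_ _. UNIV" and G = "\<lambda>_ _. b l" and u = "u l"])
    show "addsub (UNIV :: 'a set)" by (simp add: addsub_def)
    show "addsub (b l)" by (rule b)
    show "y j * x \<in> b l" if "x \<in> b l" for j x using b(2)[OF that] .
    show "x \<in> b l" if "u l * x \<in> b l" for x using reg[OF l that] .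
    show "vanish y UNIV (\<lambda>_. UNIV) (\<lambda>T. {u l * x + g | x g. x \<in> UNIV \<and> g \<in> b l}) p'" if "p = Suc p'" for p'
      using less.IH[of p' "Suc l"] less.prems that bSuc[OF l] by simp
  next
    fix c :: "'i set \<Rightarrow> 'a"
    assume c: "\<And>T. T \<subseteq> UNIV \<Longrightarrow> card T = Suc p \<Longrightarrow> koszul_diff y c T \<in> b l"
    obtain N s where s: "u l ^ N = (\<Sum>i\<in>UNIV. y i * s i)" using tors[OF l] by blast
    have "u l ^ N * c T - koszul_diff y (contraction s c) T \<in> b l" if T: "card T = p" for T
    proof -
      have "contraction s (koszul_diff y c) T \<in> b l"
        unfolding contraction_def using c T b by (intro addsub_sum b) auto
      moreover have "koszul_diff y (contraction s c) T + contraction s (koszul_diff y c) T = u l ^ N * c T"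
        unfolding s by (rule koszul_diff_contraction)
      ultimately show ?thesis by (metis add_diff_cancel_left')
    qed
    then show "\<exists>K b'. (\<forall>T. T \<subseteq> UNIV \<longrightarrow> Suc (card T) = p \<longrightarrow> b' T \<in> UNIV) \<and> (\<forall>T. T \<subseteq> UNIV \<longrightarrow> card T = p \<longrightarrow> u l ^ K * c T - koszul_diff y b' T \<in> b l)"
      by (intro exI[of _ N] exI[of _ "contraction s c"]) auto
  qed auto
qed

section \<open>Koszul exactness of subfamilies and regularity in any order\<close>

lemma koszul_diff_minus: "koszul_diff q (\<lambda>T. - c T) T = - koszul_diff q c T"
  by (simp add: koszul_diff_def sum_negf)

abbreviation koszul_exact :: "('i::linorder \<Rightarrow> 'a::comm_ring_1) \<Rightarrow> 'i set \<Rightarrow> nat \<Rightarrow> bool" where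
  "koszul_exact y J p \<equiv> vanish y J (\<lambda>_. UNIV) (\<lambda>_. {0}) p"

text \<open>The exact sequence relating the Koszul complexes of \<open>J\<close> and
  \<open>insert i J\<close>: vanishing for the larger family in degree \<open>p + 1\<close> makes
  \<open>y i\<close> act surjectively on the cohomology of \<open>J\<close> in degree
  \<open>p\<close>, which is then zero by Nakayama's lemma.\<close>

lemma koszul_exact_remove:
  fixes y :: "'i::{finite,linorder} \<Rightarrow> 'a::comm_ring_1"
  assumes R: "noeth UNIV (*) (UNIV :: 'a set)" and unit: "\<And>r. (1 - y i * r) dvd 1"
    and ex: "koszul_exact y (insert i J) (Suc p)" and iJ: "i \<notin> J"
  shows "koszul_exact y J p"
proof (rule vanishI)
  fix c0 :: "'i set \<Rightarrow> 'a" assume c0: "\<And>T. T \<subseteq> J \<Longrightarrow> card T = Suc p \<Longrightarrow> koszul_diff y c0 T \<in> {0}"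
  let ?f = "\<lambda>(r::'a) (c::'i set \<Rightarrow> 'a) x. r * c x"
  let ?res = "\<lambda>c T. if T \<subseteq> J \<and> card T = p then c T else (0::'a)"
  \<comment> \<open>Cochains are required to vanish off the \<open>p\<close>-element subsets of
    \<open>J\<close>, so that cocycles and coboundaries are determined by the entries that
    count.\<close>
  define Z where "Z = {c :: 'i set \<Rightarrow> 'a. (\<forall>T. \<not> (T \<subseteq> J \<and> card T = p) \<longrightarrow> c T = 0) \<and> (\<forall>T. T \<subseteq> J \<longrightarrow> card T = Suc p \<longrightarrow> koszul_diff y c T = 0)}"
  define B where "B = {c \<in> Z. \<exists>b. \<forall>T. T \<subseteq> J \<longrightarrow> card T = p \<longrightarrow> c T = koszul_diff y b T}"
  have koszul_diff_res: "koszul_diff y (?res c) T = koszul_diff y c T" if "T \<subseteq> J" "card T = Suc p" for c T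
    using that by (intro koszul_diff_cong) auto
  have subZ: "submod UNIV ?f Z" unfolding submod_def
  proof (intro conjI ballI)
    show "0 \<in> Z" by (simp add: Z_def koszul_diff_def)
    show "c + c' \<in> Z" if "c \<in> Z" "c' \<in> Z" for c c'
      using that by (simp add: Z_def plus_fun_def koszul_diff_add)
    show "?f r c \<in> Z" if "c \<in> Z" for c r
      using that by (simp add: Z_def koszul_diff_scale)
  qed
  have subB: "submod UNIV ?f B" unfolding submod_def
  proof (intro conjI ballI)
    show "0 \<in> B" using submodD(1)[OF subZ] by (auto simp: B_def intro!: exI[of _ "\<lambda>_. 0"])
    show "c + c' \<in> B" if cc: "c \<in> B" "c' \<in> B" for c c'
    proof -
      obtain b b' where "\<forall>T. T \<subseteq> J \<longrightarrow> card T = p \<longrightarrow> c T = koszul_diff y b T" "\<forall>T. T \<subseteq> J \<longrightarrow> card T = p \<longrightarrow> c' T = koszul_diff y b' T"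
        using cc by (auto simp: B_def)
      then have "\<forall>T. T \<subseteq> J \<longrightarrow> card T = p \<longrightarrow> (c + c') T = koszul_diff y (\<lambda>T. b T + b' T) T" by (simp add: koszul_diff_add)
      moreover have "c + c' \<in> Z" using cc submodD(2)[OF subZ] by (auto simp: B_def)
      ultimately show ?thesis unfolding B_def by blast
    qed
    show "?f r c \<in> B" if cB: "c \<in> B" for c r
    proof -
      obtain b where "\<forall>T. T \<subseteq> J \<longrightarrow> card T = p \<longrightarrow> c T = koszul_diff y b T" using cB by (auto simp: B_def)
      then have "\<forall>T. T \<subseteq> J \<longrightarrow> card T = p \<longrightarrow> r * c T = koszul_diff y (\<lambda>T. r * b T) T" by (simp add: koszul_diff_scale)
      moreover have "?f r c \<in> Z" using cB submodD(3)[OF subZ] by (auto simp: B_def)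
      ultimately show ?thesis unfolding B_def by blast
    qed
  qed
  have "\<exists>b\<in>B. \<exists>z'\<in>Z. z = b + ?f (y i) z'" if z: "z \<in> Z" for z
  proof -
    let ?h = "contraction (single_at i)"
    \<comment> \<open>The cocycle \<open>z\<close> as a cochain of the larger family, one degree
      higher and supported on the sets containing \<open>i\<close>.\<close>
    define zh where "zh T = (if i \<in> T then koszul_sign i T * z (T - {i}) else 0)" for T
    have hz: "?h zh S = z S" if "i \<notin> S" for S using that by (simp add: contraction_single_at zh_def)
    have "koszul_diff y zh T \<in> {0}" if T: "T \<subseteq> insert i J" "card T = Suc (Suc p)" for T
    proof (cases "i \<in> T")
      case False
      then show ?thesis by (simp add: koszul_diff_def zh_def)
    next
      case True
      let ?S = "T - {i}"
      have S: "?S \<subseteq> J" "card ?S = Suc p" "insert i ?S = T" using T True by auto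
      have "koszul_diff y (?h zh) ?S + ?h (koszul_diff y zh) ?S = y i * zh ?S" by (rule koszul_diff_contraction_single)
      moreover have "koszul_diff y (?h zh) ?S = koszul_diff y z ?S" by (intro koszul_diff_cong hz) auto
      moreover have "koszul_diff y z ?S = 0" using z S by (simp add: Z_def)
      ultimately have "koszul_sign i T * koszul_diff y zh T = 0" using S(3) by (simp add: contraction_single_at zh_def)
      then show ?thesis using koszul_sign_square_left[of i T "koszul_diff y zh T"] by simp
    qed
    then have "\<exists>b. (\<forall>T. T \<subseteq> insert i J \<longrightarrow> Suc (card T) = Suc p \<longrightarrow> b T \<in> UNIV) \<and> (\<forall>T. T \<subseteq> insert i J \<longrightarrow> card T = Suc p \<longrightarrow> zh T - koszul_diff y b T \<in> {0})"
      by (intro vanishD[OF ex]) auto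
    then obtain b where b: "\<And>T. T \<subseteq> insert i J \<Longrightarrow> card T = Suc p \<Longrightarrow> zh T = koszul_diff y b T" by auto
    \<comment> \<open>At the sets containing \<open>i\<close>, the equation for \<open>zh\<close>
      exhibits \<open>z\<close> as \<open>y i * b\<close> minus a coboundary; at the other sets it
      says that \<open>b\<close> is a cocycle of \<open>J\<close>.\<close>
    have zb: "z T = y i * b T - koszul_diff y (?h b) T" if T: "T \<subseteq> J" "card T = p" for T
    proof -
      have iT: "i \<notin> T" using T iJ by auto
      have "zh (insert i T) = koszul_diff y b (insert i T)" by (rule b) (use T iT in auto)
      then have "?h (koszul_diff y b) T = ?h zh T" using iT by (simp add: contraction_single_at)
      then show ?thesis using hz[OF iT] koszul_diff_contraction_single[of y i b T] by (simp add: algebra_simps)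
    qed
    have z': "?res b \<in> Z"
      unfolding Z_def
    proof (intro CollectI conjI allI impI)
      fix T assume T: "T \<subseteq> J" "card T = Suc p"
      then have "koszul_diff y b T = zh T" using b[OF subset_insertI2[OF T(1)] T(2)] by simp
      then show "koszul_diff y (?res b) T = 0" using koszul_diff_res[OF T] T iJ by (auto simp: zh_def)
    qed auto
    let ?b0 = "z - ?f (y i) (?res b)"
    have U: "subring_of (UNIV :: 'a set)" by (simp add: subring_of_def)
    have "?b0 \<in> Z" using submod_diff[OF U module_pointwise subZ z] submodD(3)[OF subZ _ z'] by blast
    moreover have "?b0 T = koszul_diff y (\<lambda>T. - 1 * ?h b T) T" if "T \<subseteq> J" "card T = p" for T
      using zb[OF that] that by (simp add: koszul_diff_minus)
    ultimately have "?b0 \<in> B" unfolding B_def by blast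
    then show ?thesis using z' by (intro bexI[of _ ?b0] bexI[of _ "?res b"]) auto
  qed
  then have ZB: "Z \<subseteq> B"
    by (intro nakayama[OF module_pointwise noeth_functions[OF R] subZ subB _ _ unit]) (auto simp: B_def)
  have "?res c0 \<in> Z" using c0 koszul_diff_res by (auto simp: Z_def)
  then have "?res c0 \<in> B" using ZB by blast
  then obtain b where b: "\<forall>T. T \<subseteq> J \<longrightarrow> card T = p \<longrightarrow> ?res c0 T = koszul_diff y b T" unfolding B_def by blast
  show "\<exists>b. (\<forall>T. T \<subseteq> J \<longrightarrow> Suc (card T) = p \<longrightarrow> b T \<in> UNIV) \<and> (\<forall>T. T \<subseteq> J \<longrightarrow> card T = p \<longrightarrow> c0 T - koszul_diff y b T \<in> {0})"
    using b by (intro exI[of _ b]) auto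
qed

text \<open>The indices outside \<open>J\<close> are removed one at a time; each removal lowers the
  range of exact degrees by one, in step with the size of the family.\<close>

lemma koszul_exact_subset:
  fixes y :: "'i::{finite,linorder} \<Rightarrow> 'a::comm_ring_1"
  assumes R: "noeth UNIV (*) (UNIV :: 'a set)" and unit: "\<And>i r. (1 - y i * r) dvd 1"
    and ex: "\<And>p. p < CARD('i) \<Longrightarrow> koszul_exact y UNIV p"
  shows "p < card J \<Longrightarrow> koszul_exact y J p"
proof -
  have "p < card (- K) \<Longrightarrow> koszul_exact y (- K) p" for K :: "'i set"
    using finite[of K]
  proof (induction K arbitrary: p)
    case empty
    then show ?case using ex by simp
  next
    case (insert i K)
    have *: "insert i (- insert i K) = - K" using insert(2) by auto
    then have "card (- K) = Suc (card (- insert i K))" by (metis ComplD card_insert_disjoint finite insertI1)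
    then have "koszul_exact y (insert i (- insert i K)) (Suc p)"
      using insert.IH[of "Suc p"] insert.prems by (simp add: *)
    from koszul_exact_remove[OF R unit this] show ?case by simp
  qed
  from this[of "- J"] show "p < card J \<Longrightarrow> koszul_exact y J p" by simp
qed

text \<open>A relation among the \<open>y\<close> on \<open>insert i J\<close> is a Koszul cocycle
  of degree \<open>card J\<close> with the entry \<open>r\<close> at \<open>J\<close>. Reading at
  \<open>J\<close> that it is a coboundary puts \<open>r\<close> into the ideal of the
  \<open>y j\<close>.\<close>

lemma koszul_exact_regular:
  fixes y :: "'i::{finite,linorder} \<Rightarrow> 'a::comm_ring_1"
  assumes ex: "koszul_exact y (insert i J) (card J)" and iJ: "i \<notin> J"
    and r: "y i * r = (\<Sum>j\<in>J. y j * s j)"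
  shows "\<exists>s'. r = (\<Sum>j\<in>J. y j * s' j)"
proof -
  let ?U = "insert i J"
  \<comment> \<open>The signs turn the relation into \<open>koszul_diff y c ?U = 0\<close>. The sum
    over \<open>j\<close> only selects the value for a set of the form
    \<open>?U - {j}\<close>.\<close>
  define c where "c T = (if T = J then r else \<Sum>j\<in>J. if T = ?U - {j} then - (koszul_sign j ?U * koszul_sign i ?U * s j) else 0)" for T
  have cj: "c (?U - {j}) = - (koszul_sign j ?U * koszul_sign i ?U * s j)" if "j \<in> J" for j
  proof -
    have ne: "?U - {j} \<noteq> J" using that iJ by auto
    have eq: "?U - {j} = ?U - {k} \<longleftrightarrow> k = j" if "k \<in> J" for k using that \<open>j \<in> J\<close> by auto
    have "(\<Sum>k\<in>J. if ?U - {j} = ?U - {k} then - (koszul_sign k ?U * koszul_sign i ?U * s k) else 0)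
       = (\<Sum>k\<in>J. if k = j then - (koszul_sign k ?U * koszul_sign i ?U * s k) else 0)"
      by (intro sum.cong refl) (simp add: eq)
    then show ?thesis using ne that by (simp add: c_def)
  qed
  have "koszul_diff y c ?U = koszul_sign i ?U * y i * c (?U - {i}) + (\<Sum>j\<in>J. koszul_sign j ?U * y j * c (?U - {j}))"
    using iJ by (simp add: koszul_diff_def)
  also have "?U - {i} = J" using iJ by auto
  also have "(\<Sum>j\<in>J. koszul_sign j ?U * y j * c (?U - {j})) = (\<Sum>j\<in>J. - koszul_sign i ?U * (y j * s j))"
    by (intro sum.cong refl) (simp add: cj mult_ac)
  also have "koszul_sign i ?U * y i * c J = koszul_sign i ?U * (\<Sum>j\<in>J. y j * s j)" by (simp add: c_def r mult.assoc)
  finally have "koszul_diff y c ?U = 0" by (simp add: sum_distrib_left sum_negf)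
  moreover have "T = ?U" if "T \<subseteq> ?U" "card T = Suc (card J)" for T
    using that iJ by (intro card_subset_eq) auto
  ultimately have "\<exists>b. (\<forall>T. T \<subseteq> ?U \<longrightarrow> Suc (card T) = card J \<longrightarrow> b T \<in> UNIV) \<and> (\<forall>T. T \<subseteq> ?U \<longrightarrow> card T = card J \<longrightarrow> c T - koszul_diff y b T \<in> {0})"
    by (intro vanishD[OF ex]) auto
  then obtain b where "\<forall>T. T \<subseteq> ?U \<longrightarrow> card T = card J \<longrightarrow> c T - koszul_diff y b T \<in> {0}" by blast
  then have "c J = koszul_diff y b J" by auto
  then have "r = (\<Sum>j\<in>J. y j * (koszul_sign j J * b (J - {j})))" by (simp add: c_def koszul_diff_def mult_ac)
  then show ?thesis by (rule exI[of _ "\<lambda>j. koszul_sign j J * b (J - {j})"])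
qed

section \<open>Change of the elements in a Cech complex\<close>

lemma loc_fun_upd: "i \<notin> T \<Longrightarrow> loc (q(i := z)) (w(i := v)) A T n = loc q w A T n"
proof -
  assume "i \<notin> T"
  then have "prod (q(i := z)) T = prod q T" "sum (w(i := v)) T = sum w T" by (auto intro!: prod.cong sum.cong)
  then show ?thesis by (simp add: loc_def)
qed

text \<open>A denominator \<open>q i\<close> can be expanded to \<open>u * q i\<close>, as
  \<open>u\<close> acts on \<open>A\<close>.\<close>

lemma loc_subset_fun_upd:
  assumes u: "\<And>m x. x \<in> A m \<Longrightarrow> u * x \<in> A (m + v)" and T: "finite T"
  shows "loc q w A T n \<subseteq> loc (q(i := u * q i)) (w(i := w i + v)) A T n"
proof (cases "i \<in> T")
  case True
  show ?thesis
  proof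
    fix t assume "t \<in> loc q w A T n"
    then obtain k where k: "prod q T ^ k * t \<in> A (n + int k *s sum w T)" by (auto simp: loc_def)
    have uk: "u ^ k * x \<in> A (m + int k *s v)" if "x \<in> A m" for m x
      by (induction k) (use u that in \<open>auto simp: vscale_Suc mult.assoc simp del: of_nat_Suc dest: u\<close>, metis add.commute add.left_commute u)
    have "prod (q(i := z)) (T - {i}) = prod q (T - {i})" "sum (w(i := z')) (T - {i}) = sum w (T - {i})" for z z'
      by (auto intro!: prod.cong sum.cong)
    then have "prod (q(i := u * q i)) T = u * prod q T" "sum (w(i := w i + v)) T = sum w T + v"
      unfolding prod.remove[OF T True] sum.remove[OF T True] by (simp_all add: ac_simps)
    then show "t \<in> loc (q(i := u * q i)) (w(i := w i + v)) A T n"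
      using uk[OF k] by (intro locI[of _ _ k]) (simp add: power_mult_distrib vscale_plus mult.assoc add.assoc)
  qed
qed (simp add: loc_fun_upd)

text \<open>Assume that a cochain \<open>c\<close> for the elements \<open>q\<close> is a coboundary after \<open>q i\<close> has been replaced by its
  multiple \<open>u * q i\<close>. The entries of \<open>b\<close> at the sets that contain \<open>i\<close> form a cocycle modulo the smaller
  localizations; a power of \<open>q i\<close> carries it to a coboundary, and subtracting the latter corrects \<open>b\<close>.\<close>

lemma coboundary_fun_upd:
  fixes q :: "'i::{finite,linorder} \<Rightarrow> 'r::comm_ring_1"
    and w :: "'i \<Rightarrow> int ^ 'd::finite" and u :: 'r and i :: 'i and v :: "int ^ 'd"
  defines "q' \<equiv> q(i := u * q i)" and "w' \<equiv> w(i := w i + v)"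
  assumes A: "graded_op q w A" and unit: "q i dvd 1"
    and u: "\<And>m x. x \<in> A m \<Longrightarrow> u * x \<in> A (m + v)"
    and van: "\<And>k j. p = Suc (Suc j) \<Longrightarrow> cech_vanish q' w' UNIV A (\<lambda>_. {0}) (Suc j) (n + int k *s w i)"
    and zero: "\<And>T m. loc q' w' (\<lambda>_. {0}) T m = {0}"
    and c: "\<And>T. card T = p \<Longrightarrow> c T \<in> loc q w A T n" "\<And>T. card T = p \<Longrightarrow> c T = koszul_diff (\<lambda>_. 1) b T"
    and b: "\<And>T. Suc (card T) = p \<Longrightarrow> b T \<in> loc q' w' A T n"
  shows "\<exists>b'. (\<forall>T. Suc (card T) = p \<longrightarrow> b' T \<in> loc q w A T n) \<and> (\<forall>T. card T = p \<longrightarrow> c T = koszul_diff (\<lambda>_. 1) b' T)"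
proof (cases "\<exists>j. p = Suc (Suc j)")
  \<comment> \<open>For \<open>p \<le> 1\<close> only the entry of \<open>b\<close> at the empty set
    can matter, and there both localizations are \<open>A n\<close>.\<close>
  case False
  then have "b T \<in> loc q w A T n" if "Suc (card T) = p" for T
  proof -
    have "card T = 0" using False that by (cases "card T") auto
    then show ?thesis using b[OF that] by simp
  qed
  then show ?thesis using c by blast
next
  case True
  then obtain j where p: "p = Suc (Suc j)" by blast
  let ?h = "contraction (single_at i)" and ?d = "koszul_diff (\<lambda>_. 1)"
  have same: "loc q' w' A T m = loc q w A T m" if "i \<notin> T" for T m
    using that by (simp add: q'_def w'_def loc_fun_upd)
  have ho: "?d (?h b) T + ?h (?d b) T = b T" for T using koszul_diff_contraction_single[of "\<lambda>_. 1" i b T] by simp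
  \<comment> \<open>For \<open>i \<notin> T\<close> the homotopy formula writes this entry as
    \<open>b T\<close> minus an entry of \<open>c\<close> at \<open>insert i T\<close>, up to sign.
    Both lie in the localization for \<open>q\<close> at \<open>insert i T\<close>, and a power of
    \<open>q i\<close> leads from there to the one at \<open>T\<close>.\<close>
  have "\<forall>\<^sub>F k in sequentially. q i ^ k * ?d (?h b) T \<in> loc q w A T (n + int k *s w i)"
    if T: "T \<in> {T. i \<notin> T \<and> card T = Suc j}" for T
  proof (rule loc_eventually[OF A])
    show "i \<notin> T" using T by simp
    have iT: "card (insert i T) = p" using T p by simp
    have "b T \<in> loc q w A T n" using b[of T] T p same by auto
    then have "b T \<in> loc q w A (insert i T) n" using loc_mono_set[OF A, of "insert i T" T] by auto
    moreover have "?h (?d b) T \<in> loc q w A (insert i T) n"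
      using c[OF iT] T loc_addsub[OF A] by (auto simp: contraction_single_at intro: koszul_sign_mem)
    moreover have "?d (?h b) T = b T - ?h (?d b) T" using ho[of T] by (simp add: algebra_simps)
    ultimately show "?d (?h b) T \<in> loc q w A (insert i T) n" using addsubD(2)[OF loc_addsub[OF A]] by auto
  qed simp
  then have "\<forall>\<^sub>F k in sequentially. \<forall>T\<in>{T. i \<notin> T \<and> card T = Suc j}. q i ^ k * ?d (?h b) T \<in> loc q w A T (n + int k *s w i)"
    by (intro eventually_ball_finite) auto
  then obtain K where K: "\<And>T. i \<notin> T \<Longrightarrow> card T = Suc j \<Longrightarrow> q i ^ K * ?d (?h b) T \<in> loc q w A T (n + int K *s w i)"
    using eventually_happens'[OF sequentially_bot] by fastforce
  have dhb: "?d (?h b) T = b T" if "i \<in> T" for T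
    using ho[of T] that by (simp add: contraction_single_at)
  \<comment> \<open>A multiple of a coboundary of functions, hence a cocycle. Its entries now lie in
    the localizations for \<open>q'\<close>, so the vanishing hypothesis applies.\<close>
  let ?z = "\<lambda>T. q i ^ K * ?d (?h b) T"
  have "?z T \<in> loc q' w' A T (n + int K *s w i)" if T: "card T = Suc j" for T
  proof (cases "i \<in> T")
    case True
    have "b T \<in> loc q' w' A T n" using b T p by auto
    then show ?thesis unfolding dhb[OF True] by (rule loc_mult[rotated]) (rule graded_op_power[OF A])
  next
    case False
    then show ?thesis using K T same by simp
  qed
  then have "\<exists>x. (\<forall>T. T \<subseteq> UNIV \<longrightarrow> Suc (card T) = Suc j \<longrightarrow> x T \<in> loc q' w' A T (n + int K *s w i)) \<and>
      (\<forall>T. T \<subseteq> UNIV \<longrightarrow> card T = Suc j \<longrightarrow> ?z T - ?d x T \<in> loc q' w' (\<lambda>_. {0}) T (n + int K *s w i))"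
    by (intro vanishD[OF van[OF p, of K, unfolded cech_vanish_def]]) (auto simp: zero koszul_diff_scale koszul_diff_kd)
  then obtain x where x: "\<And>T. card T = j \<Longrightarrow> x T \<in> loc q' w' A T (n + int K *s w i)"
      "\<And>T. card T = Suc j \<Longrightarrow> ?z T = ?d x T" by (auto simp: zero)
  obtain r where r: "1 = q i ^ K * r" using dvd_one_power[OF unit, of K] by (auto simp: dvd_def)
  \<comment> \<open>Keeping only the sets that contain \<open>i\<close> leaves \<open>b T\<close>
    unchanged for \<open>i \<notin> T\<close>, where the two localizations agree. For
    \<open>i \<in> T\<close> the corrected entry is, up to sign and a power of \<open>q i\<close>,
    the entry of \<open>x\<close> at \<open>T - {i}\<close>, again a set without
    \<open>i\<close>.\<close>
  define x' where "x' T = (if i \<in> T then r * x T else 0)" for T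
  show ?thesis
  proof (intro exI conjI allI impI)
    fix T :: "'i set" assume "card T = p"
    then show "c T = ?d (\<lambda>T. b T - ?d x' T) T" using c(2) by (simp add: koszul_diff_diff koszul_diff_kd)
  next
    fix T :: "'i set" assume T: "Suc (card T) = p"
    show "b T - ?d x' T \<in> loc q w A T n"
    proof (cases "i \<in> T")
      case False
      then have "?d x' T = 0" by (simp add: koszul_diff_def x'_def)
      then show ?thesis using b[OF T] same[OF False] by simp
    next
      case True
      have cT: "card T = Suc j" using T p by simp
      have "q i ^ K * b T = ?d x T" using x(2)[OF cT] dhb[OF True] by simp
      also have "\<dots> = koszul_sign i T * x (T - {i}) + (\<Sum>l\<in>T-{i}. koszul_sign l T * x (T - {l}))"
        using True by (simp add: koszul_diff_def sum.remove[of T i])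
      also have "(\<Sum>l\<in>T-{i}. koszul_sign l T * x (T - {l})) = q i ^ K * ?d x' T"
      proof -
        have "x' (T - {i}) = 0" "\<And>l. l \<in> T - {i} \<Longrightarrow> x' (T - {l}) = r * x (T - {l})"
          using True by (auto simp: x'_def)
        then have "?d x' T = (\<Sum>l\<in>T-{i}. koszul_sign l T * (r * x (T - {l})))"
          unfolding koszul_diff_def sum.remove[OF finite True] by simp
        moreover have "q i ^ K * (koszul_sign l T * (r * x (T - {l}))) = koszul_sign l T * x (T - {l})" for l
        proof -
          have "q i ^ K * (koszul_sign l T * (r * x (T - {l}))) = (q i ^ K * r) * (koszul_sign l T * x (T - {l}))" by (simp add: mult_ac)
          then show ?thesis using r by simp
        qed
        ultimately show ?thesis by (simp add: sum_distrib_left)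
      qed
      finally have "q i ^ K * (b T - ?d x' T) = koszul_sign i T * x (T - {i})" by (simp add: right_diff_distrib)
      moreover have "koszul_sign i T * x (T - {i}) \<in> loc q w A T (n + int K *s w i)"
      proof (rule koszul_sign_mem[OF loc_addsub[OF A]])
        have "x (T - {i}) \<in> loc q w A (T - {i}) (n + int K *s w i)" using x(1)[of "T - {i}"] cT True same[of "T - {i}"] by simp
        then show "x (T - {i}) \<in> loc q w A T (n + int K *s w i)" using loc_mono_set[OF A, of T "T - {i}"] by auto
      qed simp
      ultimately show ?thesis using loc_divide_power[OF A _ True, of K] by simp
    qed
  qed
qed

section \<open>Submodules of bounded rank\<close>

definition addgen :: "'s::comm_ring_1 set \<Rightarrow> 's set \<Rightarrow> 's \<Rightarrow> 's set" where
  "addgen S V g = {s * g + m | s m. s \<in> S \<and> m \<in> V}"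

lemma submod_addgen: "subring_of S \<Longrightarrow> submod S (*) V \<Longrightarrow> submod S (*) (addgen S V g)"
  unfolding addgen_def by (rule submod_insert[OF _ module_mult])

lemma addgen_superset: "subring_of S \<Longrightarrow> V \<subseteq> addgen S V g"
proof
  fix m assume "subring_of S" "m \<in> V"
  moreover have "m = 0 * g + m" by simp
  ultimately show "m \<in> addgen S V g" unfolding addgen_def using subring_of_closed(2) by blast
qed

lemma addgen_mem: "subring_of S \<Longrightarrow> submod S (*) V \<Longrightarrow> g \<in> addgen S V g"
proof -
  assume "subring_of S" "submod S (*) V"
  moreover have "g = 1 * g + 0" by simp
  ultimately show "g \<in> addgen S V g" unfolding addgen_def using subring_of_closed(1) submodD(1) by blast
qed

lemma addgen_least: "submod S (*) W \<Longrightarrow> V \<subseteq> W \<Longrightarrow> g \<in> W \<Longrightarrow> addgen S V g \<subseteq> W"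
  unfolding addgen_def submod_def by blast

text \<open>Finite length of \<open>W / V\<close>, in a form for which additivity is easy.\<close>

definition bounded_rank :: "'s::comm_ring_1 set \<Rightarrow> 's set \<Rightarrow> 's set \<Rightarrow> bool" where
  "bounded_rank S V W \<longleftrightarrow> (\<exists>\<phi> b::nat. (\<forall>N. \<phi> N \<le> b) \<and>
     (\<forall>N N'. submod S (*) N \<longrightarrow> submod S (*) N' \<longrightarrow> V \<subseteq> N \<longrightarrow> N \<subset> N' \<longrightarrow> N' \<subseteq> W \<longrightarrow> \<phi> N < (\<phi> N' :: nat)))"

lemma bounded_rankI:
  assumes "\<And>N. \<phi> N \<le> b"
    "\<And>N N'. submod S (*) N \<Longrightarrow> submod S (*) N' \<Longrightarrow> V \<subseteq> N \<Longrightarrow> N \<subset> N' \<Longrightarrow> N' \<subseteq> W \<Longrightarrow> \<phi> N < (\<phi> N' :: nat)"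
  shows "bounded_rank S V W"
  unfolding bounded_rank_def by (rule exI[of _ \<phi>], rule exI[of _ b]) (use assms in simp)

lemma bounded_rank_refl: "bounded_rank S V V"
  by (rule bounded_rankI[of "\<lambda>_. 0"]) auto

lemma bounded_rank_mono: "bounded_rank S V W \<Longrightarrow> W' \<subseteq> W \<Longrightarrow> bounded_rank S V W'"
  unfolding bounded_rank_def by (meson order_trans)

definition set_sum :: "'s::comm_ring_1 set \<Rightarrow> 's set \<Rightarrow> 's set" where
  "set_sum N W = {x + y | x y. x \<in> N \<and> y \<in> W}"

lemma submod_set_sum:
  assumes "submod S (*) N" "submod S (*) W"
  shows "submod S (*) (set_sum N W)"
  unfolding submod_def
proof (intro conjI ballI)
  have "0 + 0 \<in> set_sum N W" using assms unfolding set_sum_def submod_def by blast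
  then show "0 \<in> set_sum N W" by simp
next
  fix s t assume "s \<in> set_sum N W" "t \<in> set_sum N W"
  then obtain x y x' y' where *: "x \<in> N" "y \<in> W" "s = x + y" "x' \<in> N" "y' \<in> W" "t = x' + y'" by (auto simp: set_sum_def)
  then have "s + t = (x + x') + (y + y')" "x + x' \<in> N" "y + y' \<in> W" using assms by (auto simp: submod_def)
  then show "s + t \<in> set_sum N W" unfolding set_sum_def by blast
next
  fix r s assume "r \<in> S" "s \<in> set_sum N W"
  then obtain x y where *: "r \<in> S" "x \<in> N" "y \<in> W" "s = x + y" by (auto simp: set_sum_def)
  then have "r * s = r * x + r * y" "r * x \<in> N" "r * y \<in> W" using assms by (auto simp: submod_def distrib_left)
  then show "r * s \<in> set_sum N W" unfolding set_sum_def by blast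
qed

lemma set_sum_superset: "submod S (*) N \<Longrightarrow> W \<subseteq> set_sum N W" "submod S (*) W \<Longrightarrow> N \<subseteq> set_sum N W"
proof -
  show "W \<subseteq> set_sum N W" if "submod S (*) N"
  proof
    fix x assume "x \<in> W"
    moreover have "x = 0 + x" by simp
    ultimately show "x \<in> set_sum N W" using submodD(1)[OF that] unfolding set_sum_def by blast
  qed
  show "N \<subseteq> set_sum N W" if "submod S (*) W"
  proof
    fix x assume "x \<in> N"
    moreover have "x = x + 0" by simp
    ultimately show "x \<in> set_sum N W" using submodD(1)[OF that] unfolding set_sum_def by blast
  qed
qed

lemma set_sum_least: "submod S (*) Z \<Longrightarrow> N \<subseteq> Z \<Longrightarrow> W \<subseteq> Z \<Longrightarrow> set_sum N W \<subseteq> Z"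
  unfolding set_sum_def submod_def by blast

text \<open>The rank of \<open>N\<close> is the sum of the ranks of \<open>N \<inter> W\<close> and
  \<open>N + W\<close>. If both stay the same from \<open>N\<close> to \<open>N'\<close>, then
  \<open>N = N'\<close> by the modular law.\<close>

lemma bounded_rank_trans:
  assumes S: "subring_of S" and VW: "bounded_rank S V W" and WX: "bounded_rank S W Z"
    and W: "submod S (*) W" "V \<subseteq> W" "W \<subseteq> Z" and Z: "submod S (*) Z"
  shows "bounded_rank S V Z"
proof -
  obtain \<phi> b where \<phi>: "\<And>N. \<phi> N \<le> (b::nat)"
    "\<And>N N'. submod S (*) N \<Longrightarrow> submod S (*) N' \<Longrightarrow> V \<subseteq> N \<Longrightarrow> N \<subset> N' \<Longrightarrow> N' \<subseteq> W \<Longrightarrow> \<phi> N < (\<phi> N' :: nat)"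
    using VW unfolding bounded_rank_def by blast
  obtain \<psi> c where \<psi>: "\<And>N. \<psi> N \<le> (c::nat)"
    "\<And>N N'. submod S (*) N \<Longrightarrow> submod S (*) N' \<Longrightarrow> W \<subseteq> N \<Longrightarrow> N \<subset> N' \<Longrightarrow> N' \<subseteq> Z \<Longrightarrow> \<psi> N < (\<psi> N' :: nat)"
    using WX unfolding bounded_rank_def by blast
  show ?thesis
  proof (rule bounded_rankI[of "\<lambda>N. \<phi> (N \<inter> W) + \<psi> (set_sum N W)" "b + c"])
    show "\<phi> (N \<inter> W) + \<psi> (set_sum N W) \<le> b + c" for N by (rule add_mono[OF \<phi>(1) \<psi>(1)])
    fix N N' assume N: "submod S (*) N" "submod S (*) N'" "V \<subseteq> N" "N \<subset> N'" "N' \<subseteq> Z"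
    have sub: "submod S (*) (N \<inter> W)" "submod S (*) (N' \<inter> W)" using N W by (auto simp: submod_def)
    have 1: "\<phi> (N \<inter> W) < \<phi> (N' \<inter> W)" if "N \<inter> W \<noteq> N' \<inter> W"
      using that N W by (intro \<phi>(2) sub) auto
    have 2: "\<psi> (set_sum N W) < \<psi> (set_sum N' W)" if "set_sum N W \<noteq> set_sum N' W"
    proof (rule \<psi>(2))
      show "submod S (*) (set_sum N W)" "submod S (*) (set_sum N' W)" by (intro submod_set_sum N(1,2) W(1))+
      show "W \<subseteq> set_sum N W" using set_sum_superset(1) N by blast
      have "set_sum N W \<subseteq> set_sum N' W" using N(4) unfolding set_sum_def by blast
      then show "set_sum N W \<subset> set_sum N' W" using that by blast
      show "set_sum N' W \<subseteq> Z" using N W Z by (intro set_sum_least) auto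
    qed
    have "N \<inter> W \<noteq> N' \<inter> W \<or> set_sum N W \<noteq> set_sum N' W"
    proof (rule ccontr)
      assume "\<not> ?thesis"
      then have eq: "N \<inter> W = N' \<inter> W" "set_sum N W = set_sum N' W" by auto
      have "N' \<subseteq> N"
      proof
        fix x assume x: "x \<in> N'"
        then have "x \<in> set_sum N W" using set_sum_superset(2)[OF W(1), of N'] eq by blast
        then obtain y w where yw: "x = y + w" "y \<in> N" "w \<in> W" by (auto simp: set_sum_def)
        have "x - y \<in> N'" using submod_diff[OF S module_mult N(2) x] yw(2) N(4) by blast
        then have "w \<in> N'" using yw(1) by simp
        then have "w \<in> N" using yw eq by blast
        then show "x \<in> N" using yw N(1) by (auto simp: submod_def)
      qed
      then show False using N(4) by blast
    qed
    then show "\<phi> (N \<inter> W) + \<psi> (set_sum N W) < \<phi> (N' \<inter> W) + \<psi> (set_sum N' W)"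
      using 1 2 by fastforce
  qed
qed

text \<open>The quotient is zero or simple, since a scalar either maps \<open>g\<close> into
  \<open>V\<close> or is invertible. A submodule in between is thus determined by whether it
  contains \<open>g\<close>.\<close>

lemma bounded_rank_simple:
  assumes S: "subring_of S" and V: "submod S (*) V"
    and loc: "\<And>s. s \<in> S \<Longrightarrow> s * g \<in> V \<or> (\<exists>v\<in>S. v * s = 1)"
  shows "bounded_rank S V (addgen S V g)"
proof (rule bounded_rankI[of "\<lambda>N. if g \<in> N then 1 else 0" 1])
  fix N N' assume N: "submod S (*) N" "submod S (*) N'" "V \<subseteq> N" "N \<subset> N'" "N' \<subseteq> addgen S V g"
  have full: "g \<in> M" if M: "submod S (*) M" "V \<subseteq> M" "x \<in> M" "x \<in> addgen S V g" "x \<notin> V" for M x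
  proof -
    obtain s m where x: "x = s * g + m" "s \<in> S" "m \<in> V" using M by (auto simp: addgen_def)
    have "s * g \<notin> V" using x M V by (auto simp: submod_def)
    then obtain v where v: "v \<in> S" "v * s = 1" using loc x by blast
    have "x - m \<in> M" using submod_diff[OF S module_mult M(1,3)] x(3) M(2) by blast
    then have "s * g \<in> M" using x by simp
    then have "v * (s * g) \<in> M" using v M(1) by (auto simp: submod_def)
    then show ?thesis using v by (simp flip: mult.assoc)
  qed
  obtain x where x: "x \<in> N'" "x \<notin> N" using N by blast
  have "g \<in> N'" using full[OF N(2) _ x(1)] N x by blast
  moreover have "g \<notin> N"
  proof
    assume "g \<in> N"
    then have "addgen S V g \<subseteq> N" using N by (intro addgen_least) auto
    then show False using N by blast
  qed
  ultimately show "(if g \<in> N then 1 else 0) < (if g \<in> N' then 1 else 0::nat)" by simp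
qed auto

text \<open>\<open>M\<close> generates the maximal ideal of the local ring \<open>S\<close>.
  Induction on the sum of the exponents: adjoining the elements \<open>\<mu> * g\<close> in turn
  needs one exponent less each time, and modulo all of them \<open>g\<close> is killed by the
  maximal ideal.\<close>

lemma bounded_rank_addgen:
  assumes S: "subring_of S" and M: "finite M" "M \<subseteq> S"
    and loc: "\<And>s. s \<in> S \<Longrightarrow> (\<exists>r. (\<forall>\<mu>. r \<mu> \<in> S) \<and> s = (\<Sum>\<mu>\<in>M. r \<mu> * \<mu>)) \<or> (\<exists>v\<in>S. v * s = 1)"
  shows "submod S (*) V \<Longrightarrow> (\<And>\<mu>. \<mu> \<in> M \<Longrightarrow> \<mu> ^ k \<mu> * g \<in> V) \<Longrightarrow> bounded_rank S V (addgen S V g)"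
proof (induction "sum k M" arbitrary: k V g rule: less_induct)
  case (less k V g)
  note V = less.prems(1)
  show ?case
  proof (cases "\<exists>\<mu>\<in>M. k \<mu> = 0")
    case True
    then have "g \<in> V" using less.prems(2) by force
    then have "addgen S V g \<subseteq> V" using V by (intro addgen_least) auto
    then show ?thesis using bounded_rank_mono[OF bounded_rank_refl] by blast
  next
    case False
    have G: "submod S (*) (addgen S V g)" "V \<subseteq> addgen S V g" "g \<in> addgen S V g"
      using submod_addgen[OF S V] addgen_superset[OF S] addgen_mem[OF S V] by auto
    have "\<exists>W. submod S (*) W \<and> V \<subseteq> W \<and> W \<subseteq> addgen S V g \<and> bounded_rank S V W \<and> (\<forall>\<mu>\<in>D. \<mu> * g \<in> W)" if "D \<subseteq> M" for D
      using finite_subset[OF that M(1)] that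
    proof induction
      case empty
      then show ?case using V G(2) bounded_rank_refl by (intro exI[of _ V]) auto
    next
      case (insert \<mu> D)
      then obtain W where W: "submod S (*) W" "V \<subseteq> W" "W \<subseteq> addgen S V g" "bounded_rank S V W" "\<forall>\<mu>\<in>D. \<mu> * g \<in> W" by auto
      have mu: "\<mu> \<in> M" "\<mu> \<in> S" using insert.prems M by auto
      let ?W = "addgen S W (\<mu> * g)"
      have W': "submod S (*) ?W" "W \<subseteq> ?W" "\<mu> * g \<in> ?W"
        using submod_addgen[OF S W(1)] addgen_superset[OF S] addgen_mem[OF S W(1)] by auto
      have "bounded_rank S W ?W"
      proof (rule less.hyps[of "k(\<mu> := k \<mu> - 1)"])
        have "k \<mu> > 0" using False mu by auto
        then show "sum (k(\<mu> := k \<mu> - 1)) M < sum k M"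
          using mu by (intro sum_strict_mono_ex1[OF M(1)]) auto
        show "submod S (*) W" by (rule W)
        fix \<nu> assume \<nu>: "\<nu> \<in> M"
        show "\<nu> ^ (k(\<mu> := k \<mu> - 1)) \<nu> * (\<mu> * g) \<in> W"
        proof (cases "\<nu> = \<mu>")
          case True
          then have "\<nu> ^ (k \<mu> - 1) * (\<mu> * g) = \<mu> ^ k \<mu> * g" using \<open>k \<mu> > 0\<close>
            by (simp flip: power_Suc2 mult.assoc)
          then show ?thesis using less.prems(2)[OF mu(1)] W(2) True by auto
        next
          case nu: False
          have "\<mu> * (\<nu> ^ k \<nu> * g) \<in> V" using less.prems(2)[OF \<nu>] V mu by (auto simp: submod_def)
          then show ?thesis using nu W(2) by (auto simp: mult_ac)
        qed
      qed
      then have "bounded_rank S V ?W" using bounded_rank_trans[OF S W(4)] W W' by blast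
      moreover have "?W \<subseteq> addgen S V g"
        using W G mu by (intro addgen_least) (auto simp: submod_def)
      ultimately show ?case using W W' by (intro exI[of _ ?W]) auto
    qed
    from this[of M] obtain W where W: "submod S (*) W" "V \<subseteq> W" "W \<subseteq> addgen S V g" "bounded_rank S V W" "\<And>\<mu>. \<mu> \<in> M \<Longrightarrow> \<mu> * g \<in> W" by auto
    have "bounded_rank S W (addgen S W g)"
    proof (rule bounded_rank_simple[OF S W(1)])
      fix s assume "s \<in> S"
      from loc[OF this] show "s * g \<in> W \<or> (\<exists>v\<in>S. v * s = 1)"
      proof
        assume "\<exists>r. (\<forall>\<mu>. r \<mu> \<in> S) \<and> s = (\<Sum>\<mu>\<in>M. r \<mu> * \<mu>)"
        then obtain r where r: "\<And>\<mu>. r \<mu> \<in> S" "s = (\<Sum>\<mu>\<in>M. r \<mu> * \<mu>)" by blast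
        have "addsub W" unfolding addsub_def using submodD(1)[OF W(1)] submod_diff[OF S module_mult W(1)] by blast
        then have "(\<Sum>\<mu>\<in>M. r \<mu> * (\<mu> * g)) \<in> W" using r W by (intro addsub_sum) (auto simp: submod_def)
        then show ?thesis by (simp add: r(2) sum_distrib_right mult.assoc)
      qed simp
    qed
    moreover have "addgen S V g \<subseteq> addgen S W g" using W(2) by (auto simp: addgen_def)
    moreover have "W \<subseteq> addgen S W g" "submod S (*) (addgen S W g)" using addgen_superset[OF S] submod_addgen[OF S W(1)] by auto
    ultimately show ?thesis using bounded_rank_trans[OF S W(4) _ W(1,2)] bounded_rank_mono by blast
  qed
qed

lemma bounded_rank_finite:
  assumes S: "subring_of S" and M: "finite M" "M \<subseteq> S"
    and loc: "\<And>s. s \<in> S \<Longrightarrow> (\<exists>r. (\<forall>\<mu>. r \<mu> \<in> S) \<and> s = (\<Sum>\<mu>\<in>M. r \<mu> * \<mu>)) \<or> (\<exists>v\<in>S. v * s = 1)"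
    and V: "submod S (*) V" and G: "finite G" "\<And>g \<mu>. g \<in> G \<Longrightarrow> \<mu> \<in> M \<Longrightarrow> \<exists>k::nat. \<mu> ^ k * g \<in> V"
  shows "\<exists>W. submod S (*) W \<and> V \<subseteq> W \<and> G \<subseteq> W \<and> bounded_rank S V W"
  using G
proof (induction G)
  case empty
  then show ?case using V bounded_rank_refl by blast
next
  case (insert g G)
  then obtain W where W: "submod S (*) W" "V \<subseteq> W" "G \<subseteq> W" "bounded_rank S V W" by (metis insertCI)
  have "\<forall>\<mu>\<in>M. \<exists>k::nat. \<mu> ^ k * g \<in> V" using insert.prems by blast
  then obtain k :: "'a \<Rightarrow> nat" where k: "\<And>\<mu>. \<mu> \<in> M \<Longrightarrow> \<mu> ^ k \<mu> * g \<in> V" by metis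
  have "bounded_rank S W (addgen S W g)"
    by (rule bounded_rank_addgen[OF S M loc W(1)]) (use k W(2) in auto)
  moreover have "W \<subseteq> addgen S W g" "submod S (*) (addgen S W g)" "g \<in> addgen S W g"
    using addgen_superset[OF S] submod_addgen[OF S W(1)] addgen_mem[OF S W(1)] by auto
  ultimately have "bounded_rank S V (addgen S W g)" using bounded_rank_trans[OF S W(4) _ W(1,2)] by blast
  then show ?case using W \<open>W \<subseteq> addgen S W g\<close> \<open>submod S (*) (addgen S W g)\<close> \<open>g \<in> addgen S W g\<close>
    by (intro exI[of _ "addgen S W g"]) auto
qed

text \<open>Each monomial of degree \<open>sum k I\<close> in the \<open>y i\<close> contains some
  \<open>y i ^ k i\<close>. The induction takes out one factor of the power at a time and replaces
  \<open>g\<close> by \<open>y i * g\<close>; as \<open>I\<close> is nonempty, \<open>N = 0\<close>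
  forces some exponent to be zero.\<close>

lemma torsion_combination:
  fixes y :: "'i \<Rightarrow> 's::comm_ring_1"
  assumes S: "subring_of S" and V: "submod S (*) V" and s: "\<And>i. s i \<in> S" and y: "\<And>i. y i \<in> S" and I: "finite I"
    and g: "\<And>i. i \<in> I \<Longrightarrow> y i ^ k i * g \<in> V" "sum k I = N" "I \<noteq> {}"
  shows "(\<Sum>i\<in>I. y i * s i) ^ N * g \<in> V"
  using g
proof (induction N arbitrary: k g)
  case 0
  then obtain i where "i \<in> I" "k i = 0" using I by auto
  then show ?case using 0 by force
next
  case (Suc N)
  let ?z = "\<Sum>i\<in>I. y i * s i"
  have az: "addsub V" unfolding addsub_def using submodD(1)[OF V] submod_diff[OF S module_mult V] by blast
  have "addsub S" using subring_of_closed[OF S] by (simp add: addsub_def)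
  then have "?z \<in> S" using s y subring_of_closed(4)[OF S] by (intro addsub_sum) auto
  then have zp: "?z ^ m \<in> S" for m by (induction m) (auto simp: subring_of_closed[OF S])
  show ?case
  proof (cases "\<exists>i\<in>I. k i = 0")
    case True
    then have "g \<in> V" using Suc.prems(1) by force
    then show ?thesis using submodD(3)[OF V zp] by blast
  next
    case False
    have "s i * (?z ^ N * (y i * g)) \<in> V" if i: "i \<in> I" for i
    proof (rule submodD(3)[OF V s], rule Suc.IH[of "k(i := k i - 1)"])
      have ki: "k i > 0" using False i by auto
      have "sum (k(i := k i - 1)) (I - {i}) = sum k (I - {i})" by (intro sum.cong) auto
      then have "sum (k(i := k i - 1)) I = k i - 1 + sum k (I - {i})"
        using sum.remove[OF I i, of "k(i := k i - 1)"] by simp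
      then show "sum (k(i := k i - 1)) I = N" using sum.remove[OF I i, of k] Suc.prems(2) ki by simp
      fix j assume j: "j \<in> I"
      show "y j ^ (k(i := k i - 1)) j * (y i * g) \<in> V"
      proof (cases "j = i")
        case True
        then have "y j ^ (k i - 1) * (y i * g) = y i ^ k i * g" using ki by (simp flip: power_Suc2 mult.assoc)
        then show ?thesis using Suc.prems(1)[OF i] True by simp
      next
        case nj: False
        have "y i * (y j ^ k j * g) \<in> V" using submodD(3)[OF V y Suc.prems(1)[OF j]] .
        then show ?thesis using nj by (simp add: mult_ac)
      qed
    qed (use i in auto)
    then have "(\<Sum>i\<in>I. s i * (?z ^ N * (y i * g))) \<in> V" using az by (intro addsub_sum)
    moreover have "?z ^ Suc N * g = (\<Sum>i\<in>I. s i * (?z ^ N * (y i * g)))"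
    proof -
      have "?z ^ Suc N * g = ?z * (?z ^ N * g)" by (simp add: mult.assoc)
      also have "\<dots> = (\<Sum>i\<in>I. y i * s i * (?z ^ N * g))" by (rule sum_distrib_right)
      also have "\<dots> = (\<Sum>i\<in>I. s i * (?z ^ N * (y i * g)))" by (intro sum.cong) (simp_all add: mult_ac)
      finally show ?thesis .
    qed
    ultimately show ?thesis by simp
  qed
qed

section \<open>Strict reductions\<close>

text \<open>The part of the ideal of \<open>z 0, ..., z (l - 1)\<close> in degree \<open>n\<close>
  whose coefficients lie in \<open>F (n - v)\<close>. It can be smaller than the intersection of
  that ideal with \<open>F n\<close>; strictness makes the two agree. The recursion follows the
  descent, which adds one element at a time.\<close>

primrec iterated_multiples :: "(nat \<Rightarrow> 'r::comm_ring_1) \<Rightarrow> int ^ 'd::finite \<Rightarrow> (int ^ 'd \<Rightarrow> 'r set) \<Rightarrow> nat \<Rightarrow> int ^ 'd \<Rightarrow> 'r set" where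
  "iterated_multiples z v F 0 = (\<lambda>_. {0})"
| "iterated_multiples z v F (Suc l) = add_multiples (z l) v F (iterated_multiples z v F l)"

context graded_family
begin

lemma subring_F0: "subring_of (F 0)"
  unfolding subring_of_def using F_one addsubD(2)[OF F_addsub] F_mult[of _ 0 _ 0] by simp

lemma F_scale: "r \<in> F 0 \<Longrightarrow> x \<in> F n \<Longrightarrow> r * x \<in> F n"
  using F_mult[of r 0 x n] by simp

lemma submod_loc:
  assumes "\<And>i. q i \<in> F (w i)" "finite T"
  shows "submod (F 0) (*) (loc q w F T n)"
  unfolding submod_def
proof (intro conjI ballI)
  have "graded_op q w F" using graded_ideal_op[OF graded_ideal_F assms(1)] .
  from loc_addsub[OF this assms(2)] have *: "addsub (loc q w F T n)" .
  show "0 \<in> loc q w F T n" using addsubD(1)[OF *] .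
  show "x + y \<in> loc q w F T n" if "x \<in> loc q w F T n" "y \<in> loc q w F T n" for x y using addsubD(4)[OF * that] .
  show "s * x \<in> loc q w F T n" if "s \<in> F 0" "x \<in> loc q w F T n" for s x
    using loc_mult[of F s F 0 x q w T n] F_scale[OF that(1)] that(2) by simp
qed

end

text \<open>The top coboundaries. \<open>UNIV\<close> is the only index set of full size, so the top
  cohomology in degree \<open>n\<close> is the quotient of \<open>loc q w A UNIV n\<close> by this
  group.\<close>

definition cech_image ::
  "('i::linorder \<Rightarrow> 'r::comm_ring_1) \<Rightarrow> ('i \<Rightarrow> int ^ 'd::finite) \<Rightarrow> (int ^ 'd \<Rightarrow> 'r set) \<Rightarrow> int ^ 'd \<Rightarrow> 'r set" where
  "cech_image q w A n = {koszul_diff (\<lambda>_. 1) b UNIV | b. \<forall>T. Suc (card T) = CARD('i) \<longrightarrow> b T \<in> loc q w A T n}"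

lemma (in graded_family) submod_cech_image:
  fixes q :: "'i::{finite,linorder} \<Rightarrow> 'q"
  assumes q: "\<And>i. q i \<in> F (w i)"
  shows "submod (F 0) (*) (cech_image q w F n)"
  unfolding submod_def
proof (intro conjI ballI)
  have L: "submod (F 0) (*) (loc q w F T n)" for T by (rule submod_loc[OF q finite])
  show "0 \<in> cech_image q w F n"
    unfolding cech_image_def using submodD(1)[OF L] by (auto intro!: exI[of _ "\<lambda>_. 0"])
  show "x + y \<in> cech_image q w F n" if xy: "x \<in> cech_image q w F n" "y \<in> cech_image q w F n" for x y
  proof -
    obtain b c where b: "x = koszul_diff (\<lambda>_. 1) b UNIV" "\<forall>T. Suc (card T) = CARD('i) \<longrightarrow> b T \<in> loc q w F T n"
      and c: "y = koszul_diff (\<lambda>_. 1) c UNIV" "\<forall>T. Suc (card T) = CARD('i) \<longrightarrow> c T \<in> loc q w F T n"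
      using xy unfolding cech_image_def by blast
    have "\<forall>T. Suc (card T) = CARD('i) \<longrightarrow> b T + c T \<in> loc q w F T n" using b c submodD(2)[OF L] by blast
    moreover have "x + y = koszul_diff (\<lambda>_. 1) (\<lambda>T. b T + c T) UNIV" by (simp add: b c koszul_diff_add)
    ultimately show ?thesis unfolding cech_image_def by blast
  qed
  show "s * x \<in> cech_image q w F n" if s: "s \<in> F 0" and x: "x \<in> cech_image q w F n" for s x
  proof -
    obtain b where b: "x = koszul_diff (\<lambda>_. 1) b UNIV" "\<forall>T. Suc (card T) = CARD('i) \<longrightarrow> b T \<in> loc q w F T n"
      using x unfolding cech_image_def by blast
    have "\<forall>T. Suc (card T) = CARD('i) \<longrightarrow> s * b T \<in> loc q w F T n" using b submodD(3)[OF L s] by blast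
    moreover have "s * x = koszul_diff (\<lambda>_. 1) (\<lambda>T. s * b T) UNIV" by (simp add: b koszul_diff_scale)
    ultimately show ?thesis unfolding cech_image_def by blast
  qed
qed

text \<open>The primitive has a single nonzero entry, at \<open>UNIV - {i}\<close>, with the sign
  that the differential cancels.\<close>

lemma (in graded_family) loc_in_cech_image:
  fixes q :: "'i::{finite,linorder} \<Rightarrow> 'q"
  assumes q: "\<And>i. q i \<in> F (w i)" and x: "x \<in> loc q w F (UNIV - {i}) n"
  shows "x \<in> cech_image q w F n"
proof -
  let ?b = "\<lambda>T. if T = UNIV - {i} then koszul_sign i (UNIV :: 'i set) * x else 0"
  have L: "addsub (loc q w F T n)" for T by (rule loc_addsub[OF graded_ideal_op[OF graded_ideal_F q] finite])
  have b: "?b T \<in> loc q w F T n" for T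
    using x addsubD(1)[OF L] koszul_sign_mem[OF L x] by auto
  have "koszul_diff (\<lambda>_. 1) ?b UNIV = (\<Sum>j\<in>UNIV. if j = i then x else 0)"
    unfolding koszul_diff_def
  proof (intro sum.cong refl)
    fix j :: 'i
    have "UNIV - {j} = UNIV - {i} \<longleftrightarrow> j = i" by auto
    then show "koszul_sign j UNIV * 1 * ?b (UNIV - {j}) = (if j = i then x else 0)" by simp
  qed
  then have "x = koszul_diff (\<lambda>_. 1) ?b UNIV" by simp
  then show ?thesis unfolding cech_image_def using b by blast
qed

text \<open>\<open>u i\<close> is the product of the other entries of the \<open>i\<close>-th
  column, \<open>e\<close> lists the indices in order, and \<open>M\<close> generates the maximal
  ideal. \<open>e_saturated\<close> combines strictness with the regularity of the column products.
  In \<open>M_radical\<close> the coefficients have degree \<open>- vec 1\<close>, which makes each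
  summand an element of degree zero.\<close>

locale strict_reduction = graded_family F for F :: "int ^ 'd::{finite,linorder} \<Rightarrow> 'q::comm_ring_1 set" +
  fixes a u :: "'d \<Rightarrow> 'q" and e :: "nat \<Rightarrow> 'd" and M :: "'q set"
  assumes a_mem: "a i \<in> F (axis i 1)"
    and u_mem: "u i \<in> F (vec 1 - axis i 1)"
    and y_unit: "u i * a i dvd 1"
    and e_saturated: "l < CARD('d) \<Longrightarrow> vec (int l) \<le> n \<Longrightarrow> r \<in> F n \<Longrightarrow>
        u (e l) * a (e l) * r \<in> iterated_multiples (\<lambda>l. u (e l) * a (e l)) (vec 1) F l (n + vec 1) \<Longrightarrow>
        r \<in> iterated_multiples (\<lambda>l. u (e l) * a (e l)) (vec 1) F l n"
    and reduction: "\<exists>m. \<forall>n\<ge>m. \<forall>r\<in>F (n + vec 1). \<exists>f. (\<forall>i. f i \<in> F n) \<and> r = (\<Sum>i\<in>UNIV. u i * a i * f i)"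
    and F_fg: "\<exists>G. finite G \<and> G \<subseteq> F n \<and> (\<forall>W. submod (F 0) (*) W \<longrightarrow> G \<subseteq> W \<longrightarrow> F n \<subseteq> W)"
    and M_finite: "finite M" "M \<subseteq> F 0"
    and M_local: "s \<in> F 0 \<Longrightarrow> (\<exists>r. (\<forall>\<mu>. r \<mu> \<in> F 0) \<and> s = (\<Sum>\<mu>\<in>M. r \<mu> * \<mu>)) \<or> (\<exists>v\<in>F 0. v * s = 1)"
    and M_radical: "\<mu> \<in> M \<Longrightarrow> \<exists>N s. (\<forall>i. s i \<in> F (- vec 1)) \<and> \<mu> ^ N = (\<Sum>i\<in>UNIV. u i * a i * s i)"
begin

abbreviation "y i \<equiv> u i * a i"
abbreviation "wy \<equiv> (\<lambda>_::'d. vec 1 :: (int, 'd) vec)"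
abbreviation "wa \<equiv> (\<lambda>i::'d. axis i 1 :: (int, 'd) vec)"

lemma y_mem: "y i \<in> F (vec 1)"
  using F_mult[OF u_mem a_mem, of i i] by simp

lemma a_unit: "a i dvd 1"
  using y_unit[of i] dvd_trans by (metis dvd_triv_right)

lemma vec_one_nonneg: "0 \<le> (vec 1 :: (int, 'd) vec)"
  by (simp add: less_eq_vec_def)

lemma vec_Suc: "vec (int (Suc l)) = vec (int l) + (vec 1 :: (int, 'd) vec)"
  by (simp add: vec_eq_iff)

lemma graded_ideal_iterated: "graded_ideal (iterated_multiples (\<lambda>l. y (e l)) (vec 1) F l)"
proof (induction l)
  case (Suc l)
  show ?case unfolding iterated_multiples.simps by (rule graded_ideal_add_multiples[OF graded_ideal_F Suc y_mem])
qed (simp add: graded_ideal_zero)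

lemma y_op: "graded_ideal A \<Longrightarrow> graded_op y wy A"
  by (rule graded_ideal_op[OF _ y_mem])

text \<open>Passing to \<open>p - 1\<close> replaces \<open>l\<close> by \<open>l + 1\<close> and
  raises the degree by at least \<open>vec 1\<close>, so the bound
  \<open>vec (int l) \<le> n\<close>, under which saturation holds, is preserved.\<close>

lemma vanishing_nonneg:
  "p + l < CARD('d) \<Longrightarrow> vec (int l) \<le> n \<Longrightarrow> cech_vanish y wy UNIV F (iterated_multiples (\<lambda>l. y (e l)) (vec 1) F l) p n"
proof (induction p arbitrary: l n rule: less_induct)
  case (less p)
  then have l: "l < CARD('d)" by simp
  let ?B = "iterated_multiples (\<lambda>l. y (e l)) (vec 1) F"
  show ?case
  proof (rule cech_vanish_descent[OF y_op[OF graded_ideal_F] y_op[OF graded_ideal_iterated] y_unit vec_one_nonneg, of "e l"])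
    fix m x assume m: "n \<le> m" "x \<in> F m" "y (e l) * x \<in> ?B l (m + vec 1)"
    then show "x \<in> ?B l m" using e_saturated[OF l order_trans[OF less.prems(2) m(1)]] by blast
  next
    fix m p' assume p: "p = Suc p'" and m: "n + vec 1 \<le> m"
    have "vec (int (Suc l)) \<le> m"
      unfolding vec_Suc using less.prems(2) m by (auto simp: less_eq_vec_def intro: order_trans[rotated])
    then show "cech_vanish y wy UNIV F (add_multiples (y (e l)) (vec 1) F (?B l)) p' m"
      using less.IH[of p' "Suc l" m] less.prems(1) p by simp
  qed simp
qed

text \<open>The elements are changed one at a time from \<open>y i\<close> into \<open>a i\<close>; \<open>S\<close> is the set of the indices already done.\<close>

definition "qmix S i = (if i \<in> S then a i else y i)"
definition "wmix S i = (if i \<in> S then axis i 1 else (vec 1 :: (int, 'd) vec))"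

lemma qmix_mem: "qmix S i \<in> F (wmix S i)"
  by (cases "i \<in> S") (simp_all add: qmix_def wmix_def a_mem y_mem[simplified])

lemma qmix_op: "graded_op (qmix S) (wmix S) F"
  by (rule graded_ideal_op[OF graded_ideal_F qmix_mem])

lemma qmix_unit: "qmix S i dvd 1"
  by (simp add: qmix_def a_unit y_unit)

lemma mix_insert:
  assumes "i \<notin> S"
  shows "qmix S = (qmix (insert i S))(i := u i * qmix (insert i S) i)"
    "wmix S = (wmix (insert i S))(i := wmix (insert i S) i + (vec 1 - axis i 1))"
  using assms by (auto simp: qmix_def wmix_def fun_eq_iff)

lemma u_mult: "x \<in> F m \<Longrightarrow> u i * x \<in> F (m + (vec 1 - axis i 1))"
  using F_mult[OF u_mem, of x m i] by (simp add: add.commute)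

lemma loc_mix_insert:
  assumes "i \<notin> S"
  shows "loc (qmix (insert i S)) (wmix (insert i S)) F T n \<subseteq> loc (qmix S) (wmix S) F T n"
proof -
  have "loc (qmix (insert i S)) (wmix (insert i S)) F T n
      \<subseteq> loc ((qmix (insert i S))(i := u i * qmix (insert i S) i)) ((wmix (insert i S))(i := wmix (insert i S) i + (vec 1 - axis i 1))) F T n"
    by (rule loc_subset_fun_upd) (rule u_mult, simp_all)
  then show ?thesis unfolding mix_insert[OF assms, symmetric] .
qed

lemma coboundary_mix_insert:
  assumes i: "i \<notin> S" and n: "0 \<le> n"
    and van: "\<And>n j. 0 \<le> n \<Longrightarrow> Suc j < p \<Longrightarrow> cech_vanish (qmix S) (wmix S) UNIV F (\<lambda>_. {0}) (Suc j) n"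
    and c: "\<And>T. card T = p \<Longrightarrow> c T \<in> loc (qmix (insert i S)) (wmix (insert i S)) F T n"
      "\<And>T. card T = p \<Longrightarrow> c T = koszul_diff (\<lambda>_. 1) b T"
    and b: "\<And>T. Suc (card T) = p \<Longrightarrow> b T \<in> loc (qmix S) (wmix S) F T n"
  shows "\<exists>b'. (\<forall>T. Suc (card T) = p \<longrightarrow> b' T \<in> loc (qmix (insert i S)) (wmix (insert i S)) F T n) \<and> (\<forall>T. card T = p \<longrightarrow> c T = koszul_diff (\<lambda>_. 1) b' T)"
proof (rule coboundary_fun_upd[OF qmix_op qmix_unit u_mult, where i = i])
  fix k j assume "p = Suc (Suc j)"
  moreover have "0 \<le> n + int k *s wmix (insert i S) i"
    by (rule order_trans[OF n vec_le_add[OF vscale_nonneg]]) (simp add: wmix_def less_eq_vec_def axis_def)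
  ultimately show "cech_vanish ((qmix (insert i S))(i := u i * qmix (insert i S) i)) ((wmix (insert i S))(i := wmix (insert i S) i + (vec 1 - axis i 1))) UNIV F (\<lambda>_. {0}) (Suc j) (n + int k *s wmix (insert i S) i)"
    unfolding mix_insert[OF i, symmetric] by (intro van) auto
next
  show "loc ((qmix (insert i S))(i := u i * qmix (insert i S) i)) ((wmix (insert i S))(i := wmix (insert i S) i + (vec 1 - axis i 1))) (\<lambda>_. {0}) T m = {0}" for T m
    unfolding mix_insert[OF i, symmetric] by (rule loc_zero[OF qmix_unit])
  show "b T \<in> loc ((qmix (insert i S))(i := u i * qmix (insert i S) i)) ((wmix (insert i S))(i := wmix (insert i S) i + (vec 1 - axis i 1))) F T n" if "Suc (card T) = p" for T
    unfolding mix_insert[OF i, symmetric] by (rule b[OF that])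
qed (use c in auto)

text \<open>A cocycle for \<open>insert i S\<close> is also one for \<open>S\<close>, hence a
  coboundary there; \<open>coboundary_mix_insert\<close> moves the primitive into the smaller
  localizations, using the vanishing for \<open>S\<close> in degrees below \<open>p\<close>.\<close>

lemma vanishing_mix:
  "0 \<le> n \<Longrightarrow> p < CARD('d) \<Longrightarrow> cech_vanish (qmix S) (wmix S) UNIV F (\<lambda>_. {0}) p n"
  using finite[of S]
proof (induction S arbitrary: n p)
  case empty
  have "qmix {} = y" "wmix {} = wy" by (auto simp: qmix_def wmix_def)
  moreover have "(vec (int 0) :: (int, 'd) vec) = 0" by (simp add: vec_eq_iff)
  ultimately show ?case using vanishing_nonneg[of p 0 n] empty by simp
next
  case (insert i S)
  show ?case unfolding cech_vanish_def
  proof (rule vanishI)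
    fix c assume c: "\<And>T. T \<subseteq> UNIV \<Longrightarrow> card T = p \<Longrightarrow> c T \<in> loc (qmix (insert i S)) (wmix (insert i S)) F T n"
      "\<And>T. T \<subseteq> UNIV \<Longrightarrow> card T = Suc p \<Longrightarrow> koszul_diff (\<lambda>_. 1) c T \<in> loc (qmix (insert i S)) (wmix (insert i S)) (\<lambda>_. {0}) T n"
    have z: "loc (qmix S) (wmix S) (\<lambda>_. {0}) T n = {0}" for S T n by (rule loc_zero[OF qmix_unit])
    have "\<exists>b. (\<forall>T. T \<subseteq> UNIV \<longrightarrow> Suc (card T) = p \<longrightarrow> b T \<in> loc (qmix S) (wmix S) F T n) \<and>
       (\<forall>T. T \<subseteq> UNIV \<longrightarrow> card T = p \<longrightarrow> c T - koszul_diff (\<lambda>_. 1) b T \<in> loc (qmix S) (wmix S) (\<lambda>_. {0}) T n)"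
    proof (rule vanishD[OF insert.IH[OF insert.prems, unfolded cech_vanish_def]])
      show "c T \<in> loc (qmix S) (wmix S) F T n" if "T \<subseteq> UNIV" "card T = p" for T
        using c(1)[OF that] loc_mix_insert[OF insert(2)] by blast
    qed (use c(2) in \<open>simp add: z\<close>)
    then obtain b where b: "\<And>T. Suc (card T) = p \<Longrightarrow> b T \<in> loc (qmix S) (wmix S) F T n" "\<And>T. card T = p \<Longrightarrow> c T = koszul_diff (\<lambda>_. 1) b T"
      by (auto simp: z)
    have "\<exists>b'. (\<forall>T. Suc (card T) = p \<longrightarrow> b' T \<in> loc (qmix (insert i S)) (wmix (insert i S)) F T n) \<and> (\<forall>T. card T = p \<longrightarrow> c T = koszul_diff (\<lambda>_. 1) b' T)"
      using insert.prems c(1) b by (intro coboundary_mix_insert[OF insert(2) insert.prems(1) insert.IH]) auto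
    then show "\<exists>b. (\<forall>T. T \<subseteq> UNIV \<longrightarrow> Suc (card T) = p \<longrightarrow> b T \<in> loc (qmix (insert i S)) (wmix (insert i S)) F T n) \<and>
       (\<forall>T. T \<subseteq> UNIV \<longrightarrow> card T = p \<longrightarrow> c T - koszul_diff (\<lambda>_. 1) b T \<in> loc (qmix (insert i S)) (wmix (insert i S)) (\<lambda>_. {0}) T n)"
      by (auto simp: z)
  qed
qed

text \<open>Injectivity on top cohomology of the map that enlarges the localizations: at each change
  of an element, the vanishing just below the top degree corrects the primitive.\<close>

lemma cech_image_mix:
  assumes "0 \<le> n" "x \<in> loc (qmix S) (wmix S) F UNIV n" "x \<in> cech_image y wy F n"
  shows "x \<in> cech_image (qmix S) (wmix S) F n"
  using finite[of S] assms
proof (induction S)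
  case empty
  have "qmix {} = y" "wmix {} = wy" by (auto simp: qmix_def wmix_def)
  then show ?case using empty by simp
next
  case (insert i S)
  then have "x \<in> cech_image (qmix S) (wmix S) F n" using loc_mix_insert[OF insert(2)] by blast
  then obtain b where b: "x = koszul_diff (\<lambda>_. 1) b UNIV" "\<And>T. Suc (card T) = CARD('d) \<Longrightarrow> b T \<in> loc (qmix S) (wmix S) F T n"
    unfolding cech_image_def by blast
  have U: "card T = CARD('d) \<Longrightarrow> T = UNIV" for T :: "'d set" by (rule card_subset_eq) auto
  have "\<exists>b'. (\<forall>T. Suc (card T) = CARD('d) \<longrightarrow> b' T \<in> loc (qmix (insert i S)) (wmix (insert i S)) F T n) \<and> (\<forall>T. card T = CARD('d) \<longrightarrow> (\<lambda>_. x) T = koszul_diff (\<lambda>_. 1) b' T)"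
    using insert.prems b by (intro coboundary_mix_insert[OF insert(2) insert.prems(1) vanishing_mix]) (auto dest: U)
  then show ?case unfolding cech_image_def by blast
qed

lemma cech_image_change:
  assumes "0 \<le> n" "x \<in> loc a wa F UNIV n" "x \<in> cech_image y wy F n"
  shows "x \<in> cech_image a wa F n"
proof -
  have "qmix UNIV = a" "wmix UNIV = wa" by (auto simp: qmix_def wmix_def)
  then show ?thesis using cech_image_mix[of n x UNIV] assms by simp
qed

lemma loc_change: "loc a wa F UNIV n \<subseteq> loc y wy F UNIV n"
proof -
  have "loc (qmix S) (wmix S) F UNIV n \<subseteq> loc (qmix {}) (wmix {}) F UNIV n" for S
    using finite[of S] by induction (use loc_mix_insert in blast)+
  moreover have "qmix UNIV = a" "wmix UNIV = wa" "qmix {} = y" "wmix {} = wy" by (auto simp: qmix_def wmix_def)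
  ultimately show ?thesis by metis
qed

end

section \<open>Top cohomology of the column products in a fixed degree\<close>

lemma dvd_one_inverse:
  assumes "(r :: 'r::comm_ring_1) dvd 1"
  obtains z where "\<And>x. r * (z * x) = x" "\<And>x. z * (r * x) = x"
proof -
  obtain z where z: "1 = r * z" using assms by (auto simp: dvd_def)
  have "r * (z * x) = (r * z) * x" "z * (r * x) = (r * z) * x" for x by (simp_all only: mult_ac)
  then have "r * (z * x) = x" "z * (r * x) = x" for x unfolding z[symmetric] by simp_all
  then show ?thesis by (rule that)
qed

context strict_reduction
begin

abbreviation "ymon v \<equiv> (\<Prod>i\<in>UNIV. y i ^ v i)"

text \<open>The fractions of degree \<open>n\<close> whose denominator is the monomial in the
  \<open>y i\<close> with exponents \<open>v\<close>. The exponents are separate because the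
  reduction lowers one of them at a time.\<close>

definition ylevel :: "(int, 'd) vec \<Rightarrow> ('d \<Rightarrow> nat) \<Rightarrow> 'q set" where
  "ylevel n v = {t. ymon v * t \<in> F (n + int (sum v UNIV) *s vec 1)}"

lemma prod_power_mem: "(\<Prod>j\<in>T. y j ^ v j) \<in> F (int (sum v T) *s vec 1)"
proof (induction T rule: infinite_finite_induct)
  case (insert j T)
  have "y j ^ v j * (\<Prod>j\<in>T. y j ^ v j) \<in> F (int (v j) *s vec 1 + int (sum v T) *s vec 1)"
    by (rule F_mult[OF F_power[OF y_mem] insert.IH])
  then show ?case unfolding prod.insert[OF insert(1,2)] sum.insert[OF insert(1,2)] vscale_add .
qed (simp_all add: F_one)

lemma ymon_unit: "ymon v dvd 1"
proof -
  have "(\<Prod>i\<in>S. y i ^ v i) dvd 1" for S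
  proof (induction S rule: infinite_finite_induct)
    case (insert i S)
    then show ?case using mult_dvd_mono[OF dvd_one_power[OF y_unit] insert.IH] by simp
  qed auto
  then show ?thesis .
qed

text \<open>Stated as a product on both sides to avoid division by \<open>y i ^ v i\<close>.\<close>

lemma ymon_upd: "ymon (v(i := k)) * y i ^ v i = ymon v * y i ^ k"
proof -
  have "(\<Prod>j\<in>UNIV-{i}. y j ^ (v(i := k)) j) = (\<Prod>j\<in>UNIV-{i}. y j ^ v j)" by (intro prod.cong) auto
  then show ?thesis
    using prod.remove[of UNIV i "\<lambda>j. y j ^ (v(i := k)) j"] prod.remove[of UNIV i "\<lambda>j. y j ^ v j"]
    by (simp add: mult_ac)
qed

lemma sum_upd: "sum (v(i := k)) UNIV + v i = sum v UNIV + (k::nat)" for v :: "'d \<Rightarrow> nat"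
proof -
  have "sum (v(i := k)) (UNIV - {i}) = sum v (UNIV - {i})" by (intro sum.cong) auto
  then show ?thesis using sum.remove[of UNIV i "v(i := k)"] sum.remove[of UNIV i v] by simp
qed

lemma sum_wy: "vec_nth (sum wy T) j = int (card T)"
  unfolding sum_component by simp

text \<open>If \<open>y i\<close> does not occur in the denominator, all other exponents are raised
  to the common value \<open>sum v UNIV\<close>, which gives a power of the product of the other
  elements.\<close>

lemma ylevel_loc:
  assumes "v i = 0" "t \<in> ylevel n v"
  shows "t \<in> loc y wy F (UNIV - {i}) n"
proof (rule locI)
  let ?k = "sum v UNIV" and ?T = "UNIV - {i}"
  have le: "v j \<le> ?k" for j by (rule member_le_sum) auto
  have "(\<Prod>j\<in>?T. y j ^ (?k - v j)) * (ymon v * t) \<in> F (int (\<Sum>j\<in>?T. ?k - v j) *s vec 1 + (n + int ?k *s vec 1))"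
    by (rule F_mult[OF prod_power_mem assms(2)[unfolded ylevel_def mem_Collect_eq]])
  moreover have ev: "ymon v = (\<Prod>j\<in>?T. y j ^ v j)" using prod.remove[of UNIV i "\<lambda>j. y j ^ v j"] assms(1) by simp
  moreover have "(\<Prod>j\<in>?T. y j ^ (?k - v j)) * (\<Prod>j\<in>?T. y j ^ v j) = prod y ?T ^ ?k"
    unfolding prod.distrib[symmetric] power_add[symmetric] prod_power_distrib by (intro prod.cong) (simp_all add: le)
  ultimately have pt: "prod y ?T ^ ?k * t \<in> F (int (\<Sum>j\<in>?T. ?k - v j) *s vec 1 + (n + int ?k *s vec 1))"
    unfolding ev by (simp only: mult.assoc[symmetric])
  have deg: "int (\<Sum>j\<in>?T. ?k - v j) *s vec 1 + (n + int ?k *s vec 1) = n + int ?k *s sum wy ?T"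
  proof -
    have "?k = sum v ?T" using sum.remove[of UNIV i v] assms(1) by simp
    then have "(\<Sum>j\<in>?T. ?k - v j) + ?k = (\<Sum>j\<in>?T. (?k - v j) + v j)" by (simp only: sum.distrib)
    also have "\<dots> = ?k * card ?T" by (simp add: le)
    finally have "int (\<Sum>j\<in>?T. ?k - v j) + int ?k = int ?k * int (card ?T)"
      by (metis of_nat_add of_nat_mult)
    then show ?thesis
      unfolding vec_eq_iff vector_add_component vector_smult_component sum_wy vec_component by (simp only: mult_1_right) linarith
  qed
  show "prod y ?T ^ ?k * t \<in> F (n + int ?k *s sum wy ?T)"
    using pt unfolding deg .
qed

text \<open>\<open>y i ^ v i\<close> removes \<open>y i\<close> from the denominator, and the power
  of \<open>s\<close>, of negative degree, restores the degree \<open>n\<close>.\<close>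

lemma ylevel_torsion:
  assumes t: "t \<in> ylevel n v" and s: "s \<in> F (- vec 1)"
  shows "(y i * s) ^ v i * t \<in> loc y wy F (UNIV - {i}) n"
proof (rule ylevel_loc[of "v(i := 0)"])
  have "ymon (v(i := 0)) * ((y i * s) ^ v i * t) = s ^ v i * (ymon (v(i := 0)) * y i ^ v i * t)"
    by (simp only: power_mult_distrib mult_ac)
  also have "\<dots> = s ^ v i * (ymon v * t)" using ymon_upd[of v i 0] by (simp only: power_0 mult_1_right)
  finally have eq: "ymon (v(i := 0)) * ((y i * s) ^ v i * t) = s ^ v i * (ymon v * t)" .
  have "s ^ v i * (ymon v * t) \<in> F (int (v i) *s - vec 1 + (n + int (sum v UNIV) *s vec 1))"
    by (rule F_mult[OF F_power[OF s] t[unfolded ylevel_def mem_Collect_eq]])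
  moreover have "int (sum v UNIV) = int (sum (v(i := 0)) UNIV) + int (v i)"
    using sum_upd[of v i 0] by (metis add.right_neutral of_nat_add)
  then have "int (v i) *s - vec 1 + (n + int (sum v UNIV) *s vec 1) = n + int (sum (v(i := 0)) UNIV) *s (vec 1 :: (int, 'd) vec)"
    by (simp add: vec_eq_iff algebra_simps del: of_nat_sum)
  ultimately show "(y i * s) ^ v i * t \<in> ylevel n (v(i := 0))"
    unfolding ylevel_def mem_Collect_eq eq by metis
qed simp

text \<open>Division by the unit \<open>ymon v\<close> makes the level a copy of a component of
  \<open>F\<close>.\<close>

lemma ylevel_fg: "\<exists>G. finite G \<and> G \<subseteq> ylevel n v \<and> (\<forall>W. submod (F 0) (*) W \<longrightarrow> G \<subseteq> W \<longrightarrow> ylevel n v \<subseteq> W)"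
proof -
  obtain z where zz: "\<And>x. ymon v * (z * x) = x" "\<And>x. z * (ymon v * x) = x"
    using dvd_one_inverse[OF ymon_unit[of v]] by blast
  obtain G where G: "finite G \<and> G \<subseteq> F (n + int (sum v UNIV) *s vec 1) \<and>
      (\<forall>W. submod (F 0) (*) W \<longrightarrow> G \<subseteq> W \<longrightarrow> F (n + int (sum v UNIV) *s vec 1) \<subseteq> W)"
    using F_fg[of "n + int (sum v UNIV) *s vec 1"] by (rule exE)
  show ?thesis
  proof (intro exI conjI allI impI)
    show "finite ((*) z ` G)" using G by simp
    show "(*) z ` G \<subseteq> ylevel n v" using G by (auto simp only: ylevel_def zz)
    fix W assume W: "submod (F 0) (*) W" "(*) z ` G \<subseteq> W"
    have "submod (F 0) (*) {x. z * x \<in> W}" using W(1) by (auto simp: submod_def distrib_left mult.left_commute)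
    then have "F (n + int (sum v UNIV) *s vec 1) \<subseteq> {x. z * x \<in> W}"
      using G W(2) by blast
    then have "z * (ymon v * t) \<in> W" if "t \<in> ylevel n v" for t using that unfolding ylevel_def by blast
    then show "ylevel n v \<subseteq> W" unfolding zz by blast
  qed
qed

lemma bounded_rank_y:
  "\<exists>W. submod (F 0) (*) W \<and> cech_image y wy F n \<subseteq> W \<and> loc y wy F UNIV n \<subseteq> W \<and> bounded_rank (F 0) (cech_image y wy F n) W"
proof -
  let ?V = "cech_image y wy F n"
  have V: "submod (F 0) (*) ?V" by (rule submod_cech_image) (rule y_mem)
  have lV: "t \<in> ?V" if "t \<in> loc y wy F (UNIV - {i}) n" for t i
    by (rule loc_in_cech_image[OF _ that]) (rule y_mem)
  obtain m where m: "\<And>n r. m \<le> n \<Longrightarrow> r \<in> F (n + vec 1) \<Longrightarrow> \<exists>f. (\<forall>i. f i \<in> F n) \<and> r = (\<Sum>i\<in>UNIV. y i * f i)"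
    using reduction by blast
  \<comment> \<open>Chosen such that \<open>n + int N *s vec 1 \<ge> m\<close> for all
    \<open>N \<ge> K\<close>. So the reduction applies to the numerators as soon as the total
    exponent of the denominator exceeds \<open>K\<close>.\<close>
  define K where "K = nat (\<Sum>i\<in>UNIV. \<bar>vec_nth m i - vec_nth n i\<bar>)"
  have K: "m \<le> n + int N *s vec 1" if "K \<le> N" for N
  proof -
    have "vec_nth m i \<le> vec_nth n i + int N" for i
    proof -
      have "\<bar>vec_nth m i - vec_nth n i\<bar> \<le> (\<Sum>i\<in>UNIV. \<bar>vec_nth m i - vec_nth n i\<bar>)" by (rule member_le_sum) auto
      then have "vec_nth m i - vec_nth n i \<le> int K" unfolding K_def by linarith
      then show ?thesis using that by linarith
    qed
    then show ?thesis by (simp add: less_eq_vec_def)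
  qed
  let ?box = "{v :: 'd \<Rightarrow> nat. \<forall>i. v i \<le> K}"
  have "finite (UNIV \<rightarrow>\<^sub>E {..K} :: ('d \<Rightarrow> nat) set)" by (intro finite_PiE) auto
  then have box: "finite ?box" by (rule finite_subset[rotated]) (auto simp: PiE_def)
  obtain G where G: "\<And>v. finite (G v)" "\<And>v. G v \<subseteq> ylevel n v" "\<And>v W. submod (F 0) (*) W \<Longrightarrow> G v \<subseteq> W \<Longrightarrow> ylevel n v \<subseteq> W"
    using ylevel_fg[of n] by metis
  have "\<exists>W. submod (F 0) (*) W \<and> ?V \<subseteq> W \<and> (\<Union>v\<in>?box. G v) \<subseteq> W \<and> bounded_rank (F 0) ?V W"
  proof (rule bounded_rank_finite[OF subring_F0 M_finite M_local V])
    show "finite (\<Union>v\<in>?box. G v)" using box G by blast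
    fix g \<mu> assume g: "g \<in> (\<Union>v\<in>?box. G v)" and \<mu>: "\<mu> \<in> M"
    obtain v where v: "g \<in> ylevel n v" using g G by blast
    obtain N s where s: "\<And>i. s i \<in> F (- vec 1)" "\<mu> ^ N = (\<Sum>i\<in>UNIV. y i * s i)" using M_radical[OF \<mu>] by blast
    \<comment> \<open>The elements \<open>(y i * s i) ^ v i\<close> carry \<open>g\<close> into the
      coboundaries, hence so does a power of their sum \<open>\<mu> ^ N\<close>. The factor
      \<open>1\<close> fits the shape of \<open>torsion_combination\<close>.\<close>
    have "(\<Sum>i\<in>UNIV. (y i * s i) * 1) ^ (sum v UNIV) * g \<in> ?V"
    proof (rule torsion_combination[OF subring_F0 V F_one])
      show "y i * s i \<in> F 0" for i using F_mult[OF y_mem s(1)[of i], of i] by simp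
      show "(y i * s i) ^ v i * g \<in> ?V" for i using lV[OF ylevel_torsion[OF v s(1)]] .
    qed auto
    then have "(\<mu> ^ N) ^ (sum v UNIV) * g \<in> ?V" unfolding s(2) by simp
    then show "\<exists>k. \<mu> ^ k * g \<in> ?V" unfolding power_mult[symmetric] by blast
  qed
  then obtain W where W: "submod (F 0) (*) W" "?V \<subseteq> W" "\<And>v. v \<in> ?box \<Longrightarrow> G v \<subseteq> W" "bounded_rank (F 0) ?V W"
    by blast
  have W_add: "addsub W" unfolding addsub_def using submodD(1)[OF W(1)] submod_diff[OF subring_F0 module_mult W(1)] by blast
  have "ylevel n v \<subseteq> W" for v
  proof (induction "sum v UNIV" arbitrary: v rule: less_induct)
    case (less v)
    show ?case
    proof (cases "sum v UNIV \<le> K")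
      case True
      have "v i \<le> sum v UNIV" for i by (rule member_le_sum) auto
      then have "v \<in> ?box" using True order_trans by blast
      then show ?thesis using G(3)[OF W(1)] W(3) by blast
    next
      case False
      then obtain N where N: "sum v UNIV = Suc N" "K \<le> N" by (cases "sum v UNIV") auto
      show ?thesis
      proof
        fix t assume t: "t \<in> ylevel n v"
        have deg: "n + int (sum v UNIV) *s vec 1 = (n + int N *s vec 1) + vec 1"
          unfolding N(1) vscale_Suc by (simp add: ac_simps)
        have "ymon v * t \<in> F ((n + int N *s vec 1) + vec 1)" using t[unfolded ylevel_def mem_Collect_eq deg] .
        from m[OF K[OF N(2)] this] obtain f where f: "\<And>i. f i \<in> F (n + int N *s vec 1)" "ymon v * t = (\<Sum>i\<in>UNIV. y i * f i)" by blast
        obtain z where zz: "\<And>x. ymon v * (z * x) = x" "\<And>x. z * (ymon v * x) = x"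
          using dvd_one_inverse[OF ymon_unit[of v]] by blast
        \<comment> \<open>\<open>z\<close> inverts \<open>ymon v\<close>. If \<open>v i = 0\<close>,
          the summand lies in the localization away from \<open>i\<close> and is a coboundary;
          otherwise \<open>y i\<close> cancels against the denominator and the total exponent
          drops.\<close>
        have "z * (y i * f i) \<in> W" for i
        proof (cases "v i = 0")
          case True
          have "y i * f i \<in> F (vec 1 + (n + int N *s vec 1))" by (rule F_mult[OF y_mem f(1)])
          then have "z * (y i * f i) \<in> ylevel n v"
            unfolding ylevel_def mem_Collect_eq zz N(1) vscale_Suc by (simp add: ac_simps)
          then show ?thesis using lV[OF ylevel_loc[where v = v and i = i, OF True]] W(2) by blast
        next
          case False
          let ?v = "v(i := v i - 1)"
          have "Suc (sum ?v UNIV) = sum v UNIV" using sum_upd[of v i "v i - 1"] False by simp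
          then have sv: "sum ?v UNIV = N" using N by simp
          have "y i ^ v i * (ymon ?v * (z * (y i * f i))) = (ymon ?v * y i ^ v i) * (z * (y i * f i))"
            by (simp only: mult_ac)
          also have "\<dots> = y i ^ (v i - 1) * (ymon v * (z * (y i * f i)))"
            unfolding ymon_upd by (simp only: mult_ac)
          also have "\<dots> = (y i ^ (v i - 1) * y i) * f i" unfolding zz by (simp add: mult.assoc)
          also have "y i ^ (v i - 1) * y i = y i ^ v i" using False by (simp flip: power_Suc2)
          finally have "ymon ?v * (z * (y i * f i)) = f i" using dvd_one_cancel[OF dvd_one_power[OF y_unit]] by blast
          then have "z * (y i * f i) \<in> ylevel n ?v" unfolding ylevel_def mem_Collect_eq sv using f(1) by simp
          moreover have "sum ?v UNIV < sum v UNIV" using sv N(1) by simp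
          ultimately show ?thesis using less.hyps[of ?v] by blast
        qed
        then have "(\<Sum>i\<in>UNIV. z * (y i * f i)) \<in> W" using W_add by (intro addsub_sum)
        then have "z * (ymon v * t) \<in> W" by (simp add: f(2) sum_distrib_left)
        then show "t \<in> W" by (simp only: zz)
      qed
    qed
  qed
  moreover have "loc y wy F UNIV n \<subseteq> (\<Union>k. ylevel n (\<lambda>_. k))"
  proof
    fix t assume "t \<in> loc y wy F UNIV n"
    then obtain k where k: "prod y UNIV ^ k * t \<in> F (n + int k *s sum wy UNIV)" by (auto simp: loc_def)
    have "ymon (\<lambda>_. k) = prod y UNIV ^ k" by (simp add: prod_power_distrib)
    moreover have "int k *s sum wy UNIV = int (sum (\<lambda>_::'d. k) UNIV) *s vec 1"
      unfolding vec_eq_iff vector_smult_component sum_wy vec_component by simp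
    ultimately have "t \<in> ylevel n (\<lambda>_. k)" using k unfolding ylevel_def by (simp only: mem_Collect_eq)
    then show "t \<in> (\<Union>k. ylevel n (\<lambda>_. k))" by blast
  qed
  ultimately show ?thesis using W by blast
qed

text \<open>The rank of \<open>N\<close> is that of \<open>N + V\<close>, with \<open>V\<close> the
  coboundaries for \<open>y\<close>. It still grows strictly, because \<open>V\<close> meets the
  localization for \<open>a\<close> only in coboundaries for \<open>a\<close>, and these lie in
  \<open>N\<close>.\<close>

lemma bounded_rank_a:
  assumes n: "0 \<le> n"
  shows "bounded_rank (F 0) (cech_image a wa F n) (loc a wa F UNIV n)"
proof -
  let ?V = "cech_image y wy F n" and ?U = "loc a wa F UNIV n"
  obtain W where W: "submod (F 0) (*) W" "?V \<subseteq> W" "loc y wy F UNIV n \<subseteq> W" "bounded_rank (F 0) ?V W"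
    using bounded_rank_y by blast
  have V: "submod (F 0) (*) ?V" by (rule submod_cech_image) (rule y_mem)
  obtain \<phi> b where \<phi>: "\<And>N. \<phi> N \<le> (b::nat)"
    "\<And>N N'. submod (F 0) (*) N \<Longrightarrow> submod (F 0) (*) N' \<Longrightarrow> ?V \<subseteq> N \<Longrightarrow> N \<subset> N' \<Longrightarrow> N' \<subseteq> W \<Longrightarrow> \<phi> N < (\<phi> N' :: nat)"
    using W(4) unfolding bounded_rank_def by blast
  show ?thesis
  proof (rule bounded_rankI[of "\<lambda>N. \<phi> (set_sum N ?V)" b])
    show "\<phi> (set_sum N ?V) \<le> b" for N by (rule \<phi>(1))
    fix N N' assume N: "submod (F 0) (*) N" "submod (F 0) (*) N'" "cech_image a wa F n \<subseteq> N" "N \<subset> N'" "N' \<subseteq> ?U"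
    show "\<phi> (set_sum N ?V) < \<phi> (set_sum N' ?V)"
    proof (rule \<phi>(2))
      show "submod (F 0) (*) (set_sum N ?V)" "submod (F 0) (*) (set_sum N' ?V)" by (intro submod_set_sum N(1,2) V)+
      show "?V \<subseteq> set_sum N ?V" by (rule set_sum_superset(1)[OF N(1)])
      have "N' \<subseteq> W" using N(5) loc_change W(3) by blast
      then show "set_sum N' ?V \<subseteq> W" using W by (intro set_sum_least) auto
      have "set_sum N ?V \<subseteq> set_sum N' ?V" using N(4) unfolding set_sum_def by blast
      moreover have "\<not> N' \<subseteq> set_sum N ?V"
      proof
        assume sub: "N' \<subseteq> set_sum N ?V"
        have "N' \<subseteq> N"
        proof
          fix x assume x: "x \<in> N'"
          then obtain p v where pv: "x = p + v" "p \<in> N" "v \<in> ?V" using sub by (auto simp: set_sum_def)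
          have "x - p \<in> N'" using submod_diff[OF subring_F0 module_mult N(2) x] pv(2) N(4) by blast
          then have "v \<in> ?U" using pv(1) N(5) by auto
          then have "v \<in> N" using cech_image_change[OF n _ pv(3)] N(3) by blast
          then show "x \<in> N" using pv submodD(2)[OF N(1)] by blast
        qed
        then show False using N(4) by blast
      qed
      moreover have "N' \<subseteq> set_sum N' ?V" by (rule set_sum_superset(2)[OF V])
      ultimately show "set_sum N ?V \<subset> set_sum N' ?V" by blast
    qed
  qed
qed

end

section \<open>The total ring of fractions\<close>

definition nonzerodivisor :: "'a::comm_ring_1 \<Rightarrow> bool" where
  "nonzerodivisor s \<longleftrightarrow> (\<forall>x. s * x = 0 \<longrightarrow> x = 0)"

lemma nonzerodivisor_cancel: "nonzerodivisor s \<Longrightarrow> s * x = s * y \<Longrightarrow> x = y"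
proof -
  assume "nonzerodivisor s" "s * x = s * y"
  then have "s * (x - y) = 0" by (simp add: right_diff_distrib)
  then have "x - y = 0" using \<open>nonzerodivisor s\<close> unfolding nonzerodivisor_def by blast
  then show "x = y" by simp
qed

lemma nonzerodivisor_one: "nonzerodivisor 1"
  by (simp add: nonzerodivisor_def)

lemma nonzerodivisor_mult: "nonzerodivisor (s * t) \<longleftrightarrow> nonzerodivisor s \<and> nonzerodivisor t"
proof -
  have 1: "s * t * x = t * (s * x)" "s * t * x = s * (t * x)" for x by (simp_all only: mult_ac)
  show ?thesis unfolding nonzerodivisor_def
  proof (intro iffI conjI allI impI)
    fix x assume *: "\<forall>x. s * t * x = 0 \<longrightarrow> x = 0"
    show "x = 0" if "s * x = 0" using * 1(1)[of x] that by (metis mult_zero_right)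
    show "x = 0" if "t * x = 0" using * 1(2)[of x] that by (metis mult_zero_right)
  next
    fix x assume "(\<forall>x. s * x = 0 \<longrightarrow> x = 0) \<and> (\<forall>x. t * x = 0 \<longrightarrow> x = 0)" "s * t * x = 0"
    then show "x = 0" unfolding 1(2) by blast
  qed
qed

text \<open>A partial equivalence: exactly the pairs with a nonzerodivisor as denominator are
  related to themselves.\<close>

definition total_frac_rel :: "'a::comm_ring_1 \<times> 'a \<Rightarrow> 'a \<times> 'a \<Rightarrow> bool" where
  "total_frac_rel = (\<lambda>p q. nonzerodivisor (snd p) \<and> nonzerodivisor (snd q) \<and> fst p * snd q = fst q * snd p)"

lemma part_equivp_total_frac_rel: "part_equivp (total_frac_rel :: 'a::comm_ring_1 \<times> 'a \<Rightarrow> _)"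
proof (rule part_equivpI)
  show "\<exists>p :: 'a \<times> 'a. total_frac_rel p p" by (rule exI[of _ "(0, 1)"]) (simp add: total_frac_rel_def nonzerodivisor_one)
  show "symp (total_frac_rel :: 'a \<times> 'a \<Rightarrow> _)" by (auto simp: symp_def total_frac_rel_def)
  show "transp (total_frac_rel :: 'a \<times> 'a \<Rightarrow> _)"
  proof (rule transpI)
    fix p q r :: "'a \<times> 'a" assume "total_frac_rel p q" "total_frac_rel q r"
    then have *: "nonzerodivisor (snd p)" "nonzerodivisor (snd q)" "nonzerodivisor (snd r)"
      "fst p * snd q = fst q * snd p" "fst q * snd r = fst r * snd q" by (auto simp: total_frac_rel_def)
    have "snd q * (fst p * snd r) = (fst p * snd q) * snd r" by (simp only: mult_ac)
    also have "\<dots> = (fst q * snd r) * snd p" unfolding *(4) by (simp only: mult_ac)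
    also have "\<dots> = snd q * (fst r * snd p)" unfolding *(5) by (simp only: mult_ac)
    finally show "total_frac_rel p r" using * nonzerodivisor_cancel by (auto simp: total_frac_rel_def)
  qed
qed

quotient_type (overloaded) 'a total_frac = "'a::comm_ring_1 \<times> 'a" / partial: total_frac_rel
  by (rule part_equivp_total_frac_rel)

instantiation total_frac :: (comm_ring_1) comm_ring_1
begin

lift_definition zero_total_frac :: "'a total_frac" is "(0, 1)"
  by (simp add: total_frac_rel_def nonzerodivisor_one)

lift_definition one_total_frac :: "'a total_frac" is "(1, 1)"
  by (simp add: total_frac_rel_def nonzerodivisor_one)

lift_definition plus_total_frac :: "'a total_frac \<Rightarrow> 'a total_frac \<Rightarrow> 'a total_frac"
  is "\<lambda>p q. (fst p * snd q + fst q * snd p, snd p * snd q)"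
proof -
  fix p p' q q' :: "'a \<times> 'a" assume "total_frac_rel p p'" "total_frac_rel q q'"
  then have *: "nonzerodivisor (snd p)" "nonzerodivisor (snd p')" "nonzerodivisor (snd q)" "nonzerodivisor (snd q')"
    "fst p * snd p' = fst p' * snd p" "fst q * snd q' = fst q' * snd q" by (auto simp: total_frac_rel_def)
  have "(fst p * snd q + fst q * snd p) * (snd p' * snd q') = (fst p * snd p') * (snd q * snd q') + (fst q * snd q') * (snd p * snd p')"
    by (simp add: algebra_simps)
  also have "\<dots> = (fst p' * snd q' + fst q' * snd p') * (snd p * snd q)"
    unfolding *(5,6) by (simp add: algebra_simps)
  finally show "total_frac_rel (fst p * snd q + fst q * snd p, snd p * snd q) (fst p' * snd q' + fst q' * snd p', snd p' * snd q')"
    using * by (simp add: total_frac_rel_def nonzerodivisor_mult)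
qed

lift_definition times_total_frac :: "'a total_frac \<Rightarrow> 'a total_frac \<Rightarrow> 'a total_frac"
  is "\<lambda>p q. (fst p * fst q, snd p * snd q)"
proof -
  fix p p' q q' :: "'a \<times> 'a" assume "total_frac_rel p p'" "total_frac_rel q q'"
  then have *: "nonzerodivisor (snd p)" "nonzerodivisor (snd p')" "nonzerodivisor (snd q)" "nonzerodivisor (snd q')"
    "fst p * snd p' = fst p' * snd p" "fst q * snd q' = fst q' * snd q" by (auto simp: total_frac_rel_def)
  have "(fst p * fst q) * (snd p' * snd q') = (fst p * snd p') * (fst q * snd q')" by (simp only: mult_ac)
  also have "\<dots> = (fst p' * fst q') * (snd p * snd q)" unfolding *(5,6) by (simp only: mult_ac)
  finally show "total_frac_rel (fst p * fst q, snd p * snd q) (fst p' * fst q', snd p' * snd q')"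
    using * by (simp add: total_frac_rel_def nonzerodivisor_mult)
qed

lift_definition uminus_total_frac :: "'a total_frac \<Rightarrow> 'a total_frac" is "\<lambda>p. (- fst p, snd p)"
  by (auto simp: total_frac_rel_def)

definition minus_total_frac :: "'a total_frac \<Rightarrow> 'a total_frac \<Rightarrow> 'a total_frac" where
  "minus_total_frac p q = p + - q"

instance
proof
  fix p q r :: "'a total_frac"
  show "p * q * r = p * (q * r)"
    by transfer (auto simp: total_frac_rel_def nonzerodivisor_mult mult_ac)
  show "p * q = q * p"
    by transfer (auto simp: total_frac_rel_def nonzerodivisor_mult mult_ac)
  show "1 * p = p"
    by transfer (auto simp: total_frac_rel_def nonzerodivisor_mult)
  show "p + q + r = p + (q + r)"
    by transfer (auto simp: total_frac_rel_def nonzerodivisor_mult algebra_simps)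
  show "p + q = q + p"
    by transfer (auto simp: total_frac_rel_def nonzerodivisor_mult algebra_simps)
  show "0 + p = p"
    by transfer (auto simp: total_frac_rel_def nonzerodivisor_mult)
  show "- p + p = 0"
    by transfer (auto simp: total_frac_rel_def nonzerodivisor_mult nonzerodivisor_one)
  show "p - q = p + - q" by (rule minus_total_frac_def)
  show "(p + q) * r = p * r + q * r"
    by transfer (auto simp: total_frac_rel_def nonzerodivisor_mult algebra_simps)
  show "(0::'a total_frac) \<noteq> 1"
    by transfer (simp add: total_frac_rel_def nonzerodivisor_one)
qed

end

lift_definition to_frac :: "'a::comm_ring_1 \<Rightarrow> 'a total_frac" is "\<lambda>r. (r, 1)"
  by (simp add: total_frac_rel_def nonzerodivisor_one)

text \<open>For zero divisors the value \<open>0\<close> is a default.\<close>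

lift_definition frac_inverse :: "'a::comm_ring_1 \<Rightarrow> 'a total_frac" is "\<lambda>s. if nonzerodivisor s then (1, s) else (0, 1)"
  by (simp add: total_frac_rel_def nonzerodivisor_one)

lemma to_frac_add: "to_frac (r + s) = to_frac r + to_frac s"
  by transfer (simp add: total_frac_rel_def nonzerodivisor_one)

lemma to_frac_mult: "to_frac (r * s) = to_frac r * to_frac s"
  by transfer (simp add: total_frac_rel_def nonzerodivisor_one)

lemma to_frac_0 [simp]: "to_frac 0 = 0"
  by transfer (simp add: total_frac_rel_def nonzerodivisor_one)

lemma to_frac_1 [simp]: "to_frac 1 = 1"
  by transfer (simp add: total_frac_rel_def nonzerodivisor_one)

lemma to_frac_minus: "to_frac (- r) = - to_frac r"
  by transfer (simp add: total_frac_rel_def nonzerodivisor_one)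

lemma to_frac_diff: "to_frac (r - s) = to_frac r - to_frac s"
  using to_frac_add[of r "- s"] by (simp add: to_frac_minus)

lemma to_frac_eq_iff [simp]: "to_frac r = to_frac s \<longleftrightarrow> r = s"
  by transfer (simp add: total_frac_rel_def nonzerodivisor_one)

lemma to_frac_prod: "to_frac (prod f S) = (\<Prod>i\<in>S. to_frac (f i))"
  by (induction S rule: infinite_finite_induct) (auto simp: to_frac_mult)

lemma to_frac_power: "to_frac (r ^ k) = to_frac r ^ k"
  by (induction k) (auto simp: to_frac_mult)

lemma to_frac_unit: "nonzerodivisor s \<Longrightarrow> to_frac s dvd 1"
proof -
  assume "nonzerodivisor s"
  then have "1 = to_frac s * frac_inverse s"
    by transfer (simp add: total_frac_rel_def nonzerodivisor_one)
  then show ?thesis by (rule dvdI)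
qed

section \<open>Ideals of the ring of a type\<close>

lemma type_ring_simps [simp]:
  "carrier (ring_of_type_algebra :: 'a::comm_ring_1 ring) = UNIV"
  "x \<otimes>\<^bsub>ring_of_type_algebra\<^esub> y = x * (y :: 'a)"
  "x \<oplus>\<^bsub>ring_of_type_algebra\<^esub> y = x + (y :: 'a)"
  "\<one>\<^bsub>ring_of_type_algebra\<^esub> = (1 :: 'a)"
  "\<zero>\<^bsub>ring_of_type_algebra\<^esub> = (0 :: 'a)"
  by (simp_all add: ring_of_type_algebra_def)

lemma type_ring_a_inv [simp]: "\<ominus>\<^bsub>ring_of_type_algebra\<^esub> x = - (x :: 'a::comm_ring_1)"
proof -
  interpret R: ring "ring_of_type_algebra :: 'a ring" by (rule ring_from_type_algebra)
  show ?thesis using R.minus_equality[of "- x" x] by simp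
qed

lemma type_ring_pow [simp]: "x [^]\<^bsub>ring_of_type_algebra\<^esub> (k::nat) = (x :: 'a::comm_ring_1) ^ k"
proof -
  interpret R: ring "ring_of_type_algebra :: 'a ring" by (rule ring_from_type_algebra)
  show ?thesis by (induction k) (simp_all add: mult.commute)
qed

lemma type_ring_finprod [simp]:
  "finite S \<Longrightarrow> (\<Otimes>\<^bsub>ring_of_type_algebra\<^esub>i\<in>S. f i) = (\<Prod>i\<in>S. f i :: 'a::comm_ring_1)"
proof (induction S rule: finite_induct)
  interpret R: cring "ring_of_type_algebra :: 'a ring" by (rule cring_from_type_algebra)
  { case empty then show ?case by simp }
  { case (insert i S) then show ?case by (simp add: Pi_def) }
qed

lemma ideal_type_ring: "ideal J (ring_of_type_algebra :: 'a::comm_ring_1 ring) \<longleftrightarrow> submod UNIV (*) J"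
proof
  interpret R: cring "ring_of_type_algebra :: 'a ring" by (rule cring_from_type_algebra)
  {
    assume "ideal J (ring_of_type_algebra :: 'a ring)"
    then interpret ideal J "ring_of_type_algebra :: 'a ring" .
    show "submod UNIV (*) J" using zero_closed a_closed I_l_closed by (auto simp: submod_def)
  next
    assume J: "submod UNIV (*) J"
    show "ideal J (ring_of_type_algebra :: 'a ring)"
    proof (rule idealI)
      show "ring (ring_of_type_algebra :: 'a ring)" by (rule ring_from_type_algebra)
      show "subgroup J (add_monoid (ring_of_type_algebra :: 'a ring))"
      proof (rule group.subgroupI)
        show "group (add_monoid (ring_of_type_algebra :: 'a ring))" by (rule R.a_group)
        fix x y assume "x \<in> J" "y \<in> J"
        then show "x \<otimes>\<^bsub>add_monoid ring_of_type_algebra\<^esub> y \<in> J" using submodD(2)[OF J] by simp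
      next
        fix x assume "x \<in> J"
        then have "- 1 * x \<in> J" using submodD(3)[OF J] by blast
        then have "\<ominus>\<^bsub>ring_of_type_algebra\<^esub> x \<in> J" by simp
        then show "inv\<^bsub>add_monoid ring_of_type_algebra\<^esub> x \<in> J" by (simp only: a_inv_def)
      qed (use submodD(1)[OF J] in auto)
      fix x r assume "x \<in> J"
      then show "r \<otimes>\<^bsub>ring_of_type_algebra\<^esub> x \<in> J" "x \<otimes>\<^bsub>ring_of_type_algebra\<^esub> r \<in> J"
        using submodD(3)[OF J, of r x] by (simp_all add: mult.commute)
    qed
  }
qed

lemma genideal_type_ring:
  "Idl\<^bsub>ring_of_type_algebra\<^esub> S = \<Inter>{J. submod UNIV (*) J \<and> S \<subseteq> (J :: 'a::comm_ring_1 set)}"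
  by (simp add: genideal_def ideal_type_ring)

lemma submod_genideal: "submod UNIV (*) (Idl\<^bsub>ring_of_type_algebra\<^esub> (S :: 'a::comm_ring_1 set))"
  unfolding genideal_type_ring by (auto simp: submod_def)

lemma subring_UNIV: "subring_of UNIV"
  by (simp add: subring_of_def)

lemma addsub_submod: "submod UNIV (*) N \<Longrightarrow> addsub N"
  unfolding addsub_def using submodD(1) submod_diff[OF subring_UNIV module_mult] by blast

lemma genideal_insert:
  "Idl\<^bsub>ring_of_type_algebra\<^esub> (insert g S) = {g * r + x | r x. x \<in> Idl\<^bsub>ring_of_type_algebra\<^esub> (S :: 'a::comm_ring_1 set)}"
proof (intro equalityI)
  let ?I = "Idl\<^bsub>ring_of_type_algebra\<^esub> S" and ?R = "{g * r + x | r x. x \<in> Idl\<^bsub>ring_of_type_algebra\<^esub> S}"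
  have eq: "?R = addgen UNIV ?I g" by (auto simp: addgen_def mult.commute)
  have "submod UNIV (*) ?R" unfolding eq by (rule submod_addgen[OF subring_UNIV submod_genideal])
  moreover have "S \<subseteq> ?I" unfolding genideal_type_ring by blast
  then have "insert g S \<subseteq> ?R"
    unfolding eq using addgen_mem[OF subring_UNIV submod_genideal[of S], of g] addgen_superset[OF subring_UNIV, of ?I g] by blast
  ultimately show "Idl\<^bsub>ring_of_type_algebra\<^esub> (insert g S) \<subseteq> ?R" unfolding genideal_type_ring by blast
  have "?I \<subseteq> Idl\<^bsub>ring_of_type_algebra\<^esub> (insert g S)" unfolding genideal_type_ring by blast
  moreover have "g \<in> Idl\<^bsub>ring_of_type_algebra\<^esub> (insert g S)" unfolding genideal_type_ring by blast
  ultimately show "?R \<subseteq> Idl\<^bsub>ring_of_type_algebra\<^esub> (insert g S)"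
    unfolding eq by (intro addgen_least submod_genideal)
qed

lemma genideal_empty: "Idl\<^bsub>ring_of_type_algebra\<^esub> {} = {0 :: 'a::comm_ring_1}"
proof -
  have "submod UNIV (*) {0 :: 'a}" by (simp add: submod_def)
  then show ?thesis using submodD(1)[OF submod_genideal[of "{} :: 'a set"]] unfolding genideal_type_ring by blast
qed

text \<open>The coefficients are indexed by \<open>i\<close> and not by the value
  \<open>y i\<close>, so repeated generators do no harm.\<close>

lemma genideal_image:
  "finite S \<Longrightarrow> Idl\<^bsub>ring_of_type_algebra\<^esub> (y ` S) = {\<Sum>i\<in>S. y i * s i | s. True}"
  for y :: "'i \<Rightarrow> 'a::comm_ring_1"
proof (induction S rule: finite_induct)
  case empty
  then show ?case by (simp add: genideal_empty)
next
  case (insert i S)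
  have "{y i * r + x | r x. x \<in> {\<Sum>i\<in>S. y i * s i | s. True}} = {\<Sum>i\<in>insert i S. y i * s i | s. True}"
  proof safe
    fix r s show "\<exists>s'. y i * r + (\<Sum>i\<in>S. y i * s i) = (\<Sum>i\<in>insert i S. y i * s' i) \<and> True"
      using insert(1,2) by (intro exI[of _ "s(i := r)"]) (auto intro!: sum.cong)
  next
    fix s show "\<exists>r x. (\<Sum>i\<in>insert i S. y i * s i) = y i * r + x \<and> x \<in> {\<Sum>i\<in>S. y i * s i | s. True}"
      using insert(1,2) by auto
  qed
  then show ?case using insert.IH by (simp only: image_insert genideal_insert)
qed

text \<open>The union of a nonempty chain of ideals of a noetherian ring belongs to the chain; the
  index of that member is the \<open>K\<close> sought.\<close>

lemma noeth_type_ring: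
  assumes "noetherian_ring (ring_of_type_algebra :: 'a::comm_ring_1 ring)"
  shows "noeth UNIV (*) (UNIV :: 'a set)"
  unfolding noeth_def
proof (intro allI impI)
  interpret R: noetherian_ring "ring_of_type_algebra :: 'a ring" by fact
  fix A :: "nat \<Rightarrow> 'a set"
  assume A: "\<forall>k. submod UNIV (*) (A k) \<and> A k \<subseteq> A (Suc k) \<and> A k \<subseteq> UNIV"
  have mono: "A k \<subseteq> A l" if "k \<le> l" for k l
    using A by (intro lift_Suc_mono_le[OF _ that]) auto
  have "\<Union>(range A) \<in> range A"
  proof (rule R.ideal_chain_is_trivial)
    show "subset.chain {I. ideal I ring_of_type_algebra} (range A)"
      unfolding subset_chain_def
    proof (intro conjI ballI)
      show "range A \<subseteq> {I. ideal I ring_of_type_algebra}" using A by (auto simp: ideal_type_ring)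
      fix M N assume "M \<in> range A" "N \<in> range A"
      then obtain k l where "M = A k" "N = A l" by blast
      then show "M \<subseteq> N \<or> N \<subseteq> M" using mono[of k l] mono[of l k] by (cases "k \<le> l") auto
    qed
  qed simp
  then obtain K where "\<Union>(range A) = A K" by blast
  then have "A k = A K" if "k \<ge> K" for k using mono[OF that] by blast
  then show "\<exists>K. \<forall>k\<ge>K. A k = A K" by blast
qed

text \<open>A nonunit lies in an ideal maximal among those that contain it and avoid
  \<open>1\<close>. Such an ideal exists by the noetherian property; it is a maximal ideal and so
  equals \<open>\<mm>\<close>.\<close>

lemma local_ring_unit:
  assumes loc: "noetherian_local_ring (ring_of_type_algebra :: 'a::comm_ring_1 ring) \<mm>" and s: "s \<notin> \<mm>"
  shows "s dvd 1"
proof (rule ccontr)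
  assume ns: "\<not> s dvd 1"
  have N: "noeth UNIV (*) (UNIV :: 'a set)"
    using loc by (intro noeth_type_ring) (simp add: noetherian_local_ring_def)
  define P where "P = {J :: 'a set. submod UNIV (*) J \<and> s \<in> J \<and> 1 \<notin> J}"
  have memP: "{r * s | r. True} \<in> P"
  proof -
    have "1 \<notin> {r * s | r. True}" using ns by (auto simp: dvd_def mult.commute)
    moreover have "s = 1 * s" by simp
    then have "s \<in> {r * s | r. True}" by blast
    moreover have "submod UNIV (*) {r * s | r. True}"
      unfolding submod_def
    proof (intro conjI ballI)
      show "0 \<in> {r * s | r. True}" by (auto intro: exI[of _ 0])
      show "x + y \<in> {r * s | r. True}" if "x \<in> {r * s | r. True}" "y \<in> {r * s | r. True}" for x y
        using that by (auto simp flip: distrib_right)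
      show "r * x \<in> {r * s | r. True}" if "x \<in> {r * s | r. True}" for r x
        using that by (auto simp flip: mult.assoc)
    qed
    ultimately show ?thesis by (simp add: P_def)
  qed
  have subP: "submod UNIV (*) J \<and> J \<subseteq> UNIV" if "J \<in> P" for J using that by (simp add: P_def)
  have "\<exists>J\<in>P. \<forall>J'\<in>P. J \<subseteq> J' \<longrightarrow> J' = J"
  proof (rule noeth_maximal[OF N memP subP])
    fix M assume "M \<in> P" and M: "\<And>N'. N' \<in> P \<Longrightarrow> M \<subseteq> N' \<Longrightarrow> N' = M"
    then show ?thesis by (intro bexI[of _ M] ballI impI M)
  qed
  then obtain J where J: "J \<in> P" "\<And>J'. J' \<in> P \<Longrightarrow> J \<subseteq> J' \<Longrightarrow> J' = J" by blast
  have top: "J' = UNIV" if "submod UNIV (*) J'" "1 \<in> J'" for J' :: "'a set"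
    using submodD(3)[OF that(1), of _ 1] that(2) by auto
  have "maximalideal J (ring_of_type_algebra :: 'a ring)"
  proof (rule maximalidealI)
    show "ideal J (ring_of_type_algebra :: 'a ring)" using J by (simp add: P_def ideal_type_ring)
    show "carrier ring_of_type_algebra \<noteq> J" using J by (auto simp: P_def)
    fix J' :: "'a set" assume "ideal J' (ring_of_type_algebra :: 'a ring)" "J \<subseteq> J'"
    then show "J' = J \<or> J' = carrier ring_of_type_algebra"
      using J(2)[of J'] J(1) top[of J'] by (auto simp: P_def ideal_type_ring)
  qed
  then have "J = \<mm>" using loc by (simp add: noetherian_local_ring_def)
  then show False using J s by (simp add: P_def)
qed

text \<open>A finite positive supremum of extended naturals is attained, as otherwise
  \<open>d - 1\<close> would be an upper bound.\<close>

lemma regular_sequence_of_depth: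
  assumes "ring_depth R \<mm> = enat d" "0 < d"
  obtains us where "set us \<subseteq> \<mm>" "regular_sequence R us" "length us = d"
proof -
  define S where "S = {enat (length us) | us. set us \<subseteq> \<mm> \<and> regular_sequence R us}"
  have sup: "Sup S = enat d" using assms by (simp add: ring_depth_def S_def)
  have "enat d \<in> S"
  proof (rule ccontr)
    assume nS: "enat d \<notin> S"
    have "t \<le> enat (d - 1)" if t: "t \<in> S" for t
    proof -
      have "t \<le> enat d" using Sup_upper[OF t] sup by simp
      moreover have "t \<noteq> enat d" using t nS by blast
      ultimately have "t < enat d" by simp
      then show ?thesis by (cases t) auto
    qed
    then have "Sup S \<le> enat (d - 1)" by (rule Sup_least)
    then show False using sup assms(2) by simp
  qed
  then show ?thesis using that by (auto simp: S_def)
qed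

text \<open>The regular sequence \<open>us\<close> makes the Koszul cohomology of \<open>y\<close>
  vanish below \<open>CARD('d)\<close>, because powers of its members lie in the ideal of the
  \<open>y i\<close>. Exactness then passes to the subfamily \<open>insert i J\<close>.\<close>

lemma local_ring_regular:
  fixes y :: "'d::{finite,linorder} \<Rightarrow> 'a::comm_ring_1"
  assumes loc: "noetherian_local_ring (ring_of_type_algebra :: 'a ring) \<mm>"
    and us: "set us \<subseteq> \<mm>" "regular_sequence ring_of_type_algebra us" "length us = CARD('d)"
    and y: "\<And>i. y i \<in> \<mm>" and rad: "\<And>\<mu>. \<mu> \<in> \<mm> \<Longrightarrow> \<exists>N s. \<mu> ^ N = (\<Sum>i\<in>UNIV. y i * s i)"
    and i: "i \<notin> J" and r: "y i * r = (\<Sum>j\<in>J. y j * s j)"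
  shows "\<exists>s'. r = (\<Sum>j\<in>J. y j * s' j)"
proof -
  have N: "noeth UNIV (*) (UNIV :: 'a set)"
    using loc by (intro noeth_type_ring) (simp add: noetherian_local_ring_def)
  have m: "submod UNIV (*) \<mm>" "\<mm> \<noteq> UNIV"
    using loc by (auto simp: noetherian_local_ring_def maximalideal_def maximalideal_axioms_def ideal_type_ring)
  have one: "1 \<notin> \<mm>" using m submodD(3)[OF m(1), of _ 1] by auto
  have unit: "(1 - y i * r) dvd 1" for i r
  proof (rule local_ring_unit[OF loc])
    show "1 - y i * r \<notin> \<mm>"
    proof
      assume "1 - y i * r \<in> \<mm>"
      moreover have "y i * r \<in> \<mm>" using submodD(3)[OF m(1) _ y[of i], of r] by (simp add: mult.commute)
      ultimately have "1 - y i * r + y i * r \<in> \<mm>" using submodD(2)[OF m(1)] by blast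
      then show False using one by simp
    qed
  qed
  define b where "b l = Idl\<^bsub>ring_of_type_algebra\<^esub> (set (take l us))" for l
  have bsub: "submod UNIV (*) (b l)" for l unfolding b_def by (rule submod_genideal)
  have b0: "b 0 = {0}" by (simp add: b_def genideal_empty)
  have "koszul_exact y UNIV p" if p: "p < CARD('d)" for p
  proof -
    have "vanish y UNIV (\<lambda>_. UNIV) (\<lambda>_. b 0) p"
    proof (rule koszul_vanish[where d = "CARD('d)" and u = "\<lambda>l. us ! l"])
      show "addsub (b l)" for l by (rule addsub_submod[OF bsub])
      show "r * x \<in> b l" if "x \<in> b l" for l r x using submodD(3)[OF bsub _ that] by simp
      fix l assume l: "l < CARD('d)"
      then have ls: "l < length us" using us by simp
      have "set (take (Suc l) us) = insert (us ! l) (set (take l us))"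
        by (simp add: take_Suc_conv_app_nth[OF ls])
      then show "b (Suc l) = {us ! l * x + g | x g. g \<in> b l}" by (simp add: b_def genideal_insert)
      show "x \<in> b l" if "us ! l * x \<in> b l" for x
        using us(2) that ls by (simp add: regular_sequence_def b_def)
      have "us ! l \<in> \<mm>" using us(1) ls by auto
      then show "\<exists>N s. (us ! l) ^ N = (\<Sum>i\<in>UNIV. y i * s i)" by (rule rad)
    qed (use p in simp)
    then show ?thesis by (simp add: b0)
  qed
  then have "koszul_exact y (insert i J) (card J)"
    by (rule koszul_exact_subset[OF N unit]) (use i in auto)
  then show ?thesis by (rule koszul_exact_regular[OF _ i r])
qed

section \<open>Powers of the ideals\<close>

lemma ideals_set_simps [simp]:
  "carrier (ideals_set R) = {I. ideal I R}"
  "J \<otimes>\<^bsub>ideals_set R\<^esub> K = J \<cdot>\<^bsub>R\<^esub> K"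
  "\<one>\<^bsub>ideals_set R\<^esub> = carrier R"
  by (simp_all add: ideals_set_def)

lemma ideal_prod_subset:
  assumes "submod UNIV (*) N" "\<And>r s. r \<in> J \<Longrightarrow> s \<in> K \<Longrightarrow> r * s \<in> N"
  shows "J \<cdot>\<^bsub>ring_of_type_algebra\<^esub> K \<subseteq> (N :: 'a::comm_ring_1 set)"
proof
  fix t assume "t \<in> J \<cdot>\<^bsub>ring_of_type_algebra\<^esub> K"
  then show "t \<in> N" by induction (use assms submodD(2)[OF assms(1)] in auto)
qed

text \<open>Applied to the sets \<open>{r. r t^n \<in> S}\<close> for a subring \<open>S\<close>,
  this says that the extended Rees algebra of \<open>I\<close> is generated over the constants by
  the \<open>I i t i\<close> and the inverses of the variables.\<close>

lemma ideal_powers_subset: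
  fixes I :: "'d::finite \<Rightarrow> 'a::comm_ring_1 set"
  assumes I: "\<And>i. ideal (I i) ring_of_type_algebra"
    and N: "\<And>n. submod UNIV (*) (N n)" "\<And>m n r s. r \<in> N m \<Longrightarrow> s \<in> N n \<Longrightarrow> r * s \<in> N (m + n)"
    and one: "1 \<in> N 0" "\<And>i. 1 \<in> N (- axis i 1)" and IN: "\<And>i. I i \<subseteq> N (axis i 1)"
  shows "ideal_powers ring_of_type_algebra I n \<subseteq> N n"
proof -
  let ?R = "ring_of_type_algebra :: 'a ring"
  interpret R: cring ?R by (rule cring_from_type_algebra)
  interpret P: comm_monoid "ideals_set ?R" by (rule R.ideals_set_is_comm_monoid)
  have N1: "N m = UNIV" if "1 \<in> N m" for m using submodD(3)[OF N(1) _ that, of _] by auto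
  have pw: "I i [^]\<^bsub>ideals_set ?R\<^esub> k \<subseteq> N (axis i (int k))" for i and k :: nat
  proof (induction k)
    case 0
    have ax: "axis i (int 0) = (0 :: int ^ 'd)" by (simp add: axis_def vec_eq_iff)
    show ?case unfolding ax N1[OF one(1)] by simp
  next
    case (Suc k)
    have ax: "axis i (int (Suc k)) = axis i (int k) + (axis i 1 :: int ^ 'd)" by (simp add: axis_def vec_eq_iff)
    show ?case unfolding P.nat_pow_Suc ax ideals_set_simps
      by (rule ideal_prod_subset[OF N(1)]) (use Suc IN N(2) in blast)
  qed
  \<comment> \<open>Negative exponents are truncated and give the unit ideal, so \<open>N\<close>
    has to contain \<open>1\<close> in these degrees.\<close>
  have neg: "1 \<in> N (axis i (- int k))" for i and k :: nat
  proof (induction k)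
    case 0
    have ax: "axis i (- int 0) = (0 :: int ^ 'd)" by (simp add: axis_def vec_eq_iff)
    show ?case unfolding ax by (rule one(1))
  next
    case (Suc k)
    have "axis i (- int (Suc k)) = axis i (- int k) + (- axis i 1 :: int ^ 'd)" by (simp add: axis_def vec_eq_iff)
    then show ?case using N(2)[OF Suc one(2)[of i]] by simp
  qed
  have pw': "I i [^]\<^bsub>ideals_set ?R\<^esub> nat c \<subseteq> N (axis i c)" for i c
  proof (cases "0 \<le> c")
    case True
    then show ?thesis using pw[of i "nat c"] by simp
  next
    case False
    then have "1 \<in> N (axis i c)" using neg[of i "nat (- c)"] by simp
    then show ?thesis using N1 by blast
  qed
  have car: "I i [^]\<^bsub>ideals_set ?R\<^esub> k \<in> carrier (ideals_set ?R)" for i and k :: nat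
    by (rule P.nat_pow_closed) (use I in simp)
  have "(\<Otimes>\<^bsub>ideals_set ?R\<^esub>i\<in>S. I i [^]\<^bsub>ideals_set ?R\<^esub> nat (vec_nth n i)) \<subseteq> N (\<Sum>i\<in>S. axis i (vec_nth n i))" for S
    using finite[of S]
  proof (induction S rule: finite_induct)
    case empty
    then show ?case using N1[OF one(1)] by simp
  next
    case (insert i S)
    have "(\<Otimes>\<^bsub>ideals_set ?R\<^esub>i\<in>insert i S. I i [^]\<^bsub>ideals_set ?R\<^esub> nat (vec_nth n i)) =
        (I i [^]\<^bsub>ideals_set ?R\<^esub> nat (vec_nth n i)) \<cdot>\<^bsub>?R\<^esub> (\<Otimes>\<^bsub>ideals_set ?R\<^esub>i\<in>S. I i [^]\<^bsub>ideals_set ?R\<^esub> nat (vec_nth n i))"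
      using insert(1,2) car P.finprod_insert by (subst P.finprod_insert) (auto simp del: ideals_set_simps(1))
    moreover have "\<dots> \<subseteq> N (axis i (vec_nth n i) + (\<Sum>i\<in>S. axis i (vec_nth n i)))"
      by (rule ideal_prod_subset[OF N(1)]) (use pw'[of i "vec_nth n i"] insert.IH N(2) in blast)
    ultimately show ?case using insert(1,2) by simp
  qed
  moreover have "(\<Sum>i\<in>UNIV. axis i (vec_nth n i)) = n"
    by (simp add: vec_eq_iff axis_def sum_component)
  ultimately show ?thesis unfolding ideal_powers_def by metis
qed

lemma ideal_powers_axis:
  fixes I :: "'d::finite \<Rightarrow> 'a::comm_ring_1 set"
  assumes I: "\<And>i. ideal (I i) ring_of_type_algebra"
  shows "ideal_powers ring_of_type_algebra I (axis k 1) = I k"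
proof -
  let ?R = "ring_of_type_algebra :: 'a ring"
  interpret R: cring ?R by (rule cring_from_type_algebra)
  interpret P: comm_monoid "ideals_set ?R" by (rule R.ideals_set_is_comm_monoid)
  have "ideal_powers ?R I (axis k 1) = (\<Otimes>\<^bsub>ideals_set ?R\<^esub>i\<in>UNIV. if k = i then I i else \<one>\<^bsub>ideals_set ?R\<^esub>)"
    unfolding ideal_powers_def
  proof (rule P.finprod_cong')
    show "(\<lambda>i. if k = i then I i else \<one>\<^bsub>ideals_set ?R\<^esub>) \<in> UNIV \<rightarrow> carrier (ideals_set ?R)"
      using I P.one_closed by auto
    fix i
    have pow: "I i [^]\<^bsub>ideals_set ?R\<^esub> (1::nat) = I i" by (rule P.nat_pow_eone) (use I in simp)
    have nat: "nat (vec_nth (axis k 1) i) = (if k = i then 1 else 0)" by (simp add: axis_def)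
    show "I i [^]\<^bsub>ideals_set ?R\<^esub> nat (vec_nth (axis k 1) i) = (if k = i then I i else \<one>\<^bsub>ideals_set ?R\<^esub>)"
      unfolding nat by (cases "k = i") (simp_all only: if_True if_False pow P.nat_pow_0 simp_thms)
  qed simp
  also have "\<dots> = I k" using I by (intro P.finprod_singleton) auto
  finally show ?thesis .
qed

lemma ideal_powers_zero:
  fixes I :: "'d::finite \<Rightarrow> 'a::comm_ring_1 set"
  shows "ideal_powers ring_of_type_algebra I 0 = UNIV"
proof -
  let ?R = "ring_of_type_algebra :: 'a ring"
  interpret R: cring ?R by (rule cring_from_type_algebra)
  interpret P: comm_monoid "ideals_set ?R" by (rule R.ideals_set_is_comm_monoid)
  show ?thesis unfolding ideal_powers_def by (simp add: P.finprod_one_eqI)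
qed

section \<open>The extended Rees algebra\<close>

lemma poly_mapping_sum_single: "p = (\<Sum>k\<in>Poly_Mapping.keys p. Poly_Mapping.single k (Poly_Mapping.lookup p k))"
proof (rule poly_mapping_eqI)
  fix k
  have "Poly_Mapping.lookup (\<Sum>k\<in>Poly_Mapping.keys p. Poly_Mapping.single k (Poly_Mapping.lookup p k)) k = (\<Sum>l\<in>Poly_Mapping.keys p. if l = k then Poly_Mapping.lookup p l else 0)"
    by (simp add: lookup_sum lookup_single when_def)
  then show "Poly_Mapping.lookup p k = Poly_Mapping.lookup (\<Sum>k\<in>Poly_Mapping.keys p. Poly_Mapping.single k (Poly_Mapping.lookup p k)) k"
    by (auto simp: sum.delta in_keys_iff)
qed

lemma addsub_extended_rees: "(\<And>n. addsub (N n)) \<Longrightarrow> addsub (extended_rees N)"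
  by (simp add: extended_rees_def addsub_def lookup_minus)

lemma single_in_extended_rees:
  assumes "\<And>n. addsub (N n)"
  shows "Poly_Mapping.single n r \<in> extended_rees N \<longleftrightarrow> r \<in> N n"
  using addsubD(1)[OF assms] by (auto simp: extended_rees_def lookup_single when_def)

lemma extended_rees_mult:
  fixes N1 N2 N3 :: "int ^ 'd::finite \<Rightarrow> 'a::comm_ring_1 set"
  assumes N3: "\<And>n. addsub (N3 n)" and N: "\<And>m n r s. r \<in> N1 m \<Longrightarrow> s \<in> N2 n \<Longrightarrow> r * s \<in> N3 (m + n)"
    and p: "p \<in> extended_rees N1" and q: "q \<in> extended_rees N2"
  shows "p * q \<in> extended_rees N3"
proof -
  have "p * q = (\<Sum>k\<in>Poly_Mapping.keys p. \<Sum>l\<in>Poly_Mapping.keys q. Poly_Mapping.single (k + l) (Poly_Mapping.lookup p k * Poly_Mapping.lookup q l))"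
    by (subst (1) poly_mapping_sum_single[of p], subst (1) poly_mapping_sum_single[of q])
      (simp add: sum_product mult_single)
  moreover have "Poly_Mapping.single (k + l) (Poly_Mapping.lookup p k * Poly_Mapping.lookup q l) \<in> extended_rees N3" for k l
    unfolding single_in_extended_rees[OF N3] using p q by (intro N) (auto simp: extended_rees_def)
  ultimately show ?thesis by (auto intro!: addsub_sum addsub_extended_rees N3)
qed

lemma lookup_single_mult:
  fixes p :: "'k::cancel_comm_monoid_add \<Rightarrow>\<^sub>0 'a::comm_ring_1"
  shows "Poly_Mapping.lookup (Poly_Mapping.single n r * p) (n + k) = r * Poly_Mapping.lookup p k"
proof -
  have "Poly_Mapping.single n r * p = (\<Sum>l\<in>Poly_Mapping.keys p. Poly_Mapping.single (n + l) (r * Poly_Mapping.lookup p l))"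
    by (subst (1) poly_mapping_sum_single[of p]) (simp add: sum_distrib_left mult_single)
  then have "Poly_Mapping.lookup (Poly_Mapping.single n r * p) (n + k) =
      (\<Sum>l\<in>Poly_Mapping.keys p. if l = k then r * Poly_Mapping.lookup p k else 0)"
    by (auto simp: lookup_sum lookup_single when_def intro!: sum.cong)
  then show ?thesis by (auto simp: sum.delta in_keys_iff)
qed

text \<open>The coefficients of the product are those of the other factor, shifted by
  \<open>n\<close> and multiplied by \<open>r\<close>.\<close>

lemma nonzerodivisor_single:
  assumes "nonzerodivisor r"
  shows "nonzerodivisor (Poly_Mapping.single n r :: 'k::ab_group_add \<Rightarrow>\<^sub>0 'a::comm_ring_1)"
  unfolding nonzerodivisor_def
proof (intro allI impI poly_mapping_eqI)
  fix p :: "'k \<Rightarrow>\<^sub>0 'a" and k assume "Poly_Mapping.single n r * p = 0"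
  then have "r * Poly_Mapping.lookup p k = 0" using lookup_single_mult[of n r p k] by simp
  then show "Poly_Mapping.lookup p k = Poly_Mapping.lookup 0 k" using assms by (simp add: nonzerodivisor_def)
qed

text \<open>The monomial \<open>r t^n\<close> in the total ring of fractions of the Laurent
  polynomial ring, which is the ambient ring for the graded locales.\<close>

definition frac_monom :: "'k::ab_group_add \<Rightarrow> 'a::comm_ring_1 \<Rightarrow> ('k \<Rightarrow>\<^sub>0 'a) total_frac" where
  "frac_monom n r = to_frac (Poly_Mapping.single n r)"

lemma frac_monom_mult: "frac_monom m r * frac_monom n s = frac_monom (m + n) (r * s)"
  by (simp add: frac_monom_def mult_single flip: to_frac_mult)

lemma frac_monom_add: "frac_monom n (r + s) = frac_monom n r + frac_monom n s"
  by (simp add: frac_monom_def single_add to_frac_add)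

lemma frac_monom_diff: "frac_monom n (r - s) = frac_monom n r - frac_monom n s"
  by (simp add: frac_monom_def single_diff to_frac_diff)

lemma frac_monom_zero [simp]: "frac_monom n 0 = 0"
  by (simp add: frac_monom_def)

lemma frac_monom_one [simp]: "frac_monom 0 1 = 1"
  by (simp add: frac_monom_def)

lemma frac_monom_eq_iff [simp]: "frac_monom n r = frac_monom n s \<longleftrightarrow> r = s"
  unfolding frac_monom_def to_frac_eq_iff by (metis lookup_single_eq)

lemma frac_monom_sum: "frac_monom n (sum f S) = (\<Sum>i\<in>S. frac_monom n (f i))"
  by (induction S rule: infinite_finite_induct) (auto simp: frac_monom_add)

lemma frac_monom_power: "frac_monom 0 (r ^ k) = frac_monom 0 r ^ k"
  by (induction k) (auto simp flip: frac_monom_mult[of 0 _ 0, simplified])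

lemma frac_monom_unit: "nonzerodivisor r \<Longrightarrow> frac_monom n r dvd 1"
  unfolding frac_monom_def by (intro to_frac_unit nonzerodivisor_single)

lemma extended_rees_module_simps:
  "carrier (extended_rees_module F) = extended_rees F"
  "p \<odot>\<^bsub>extended_rees_module F\<^esub> q = p * q"
  "p \<oplus>\<^bsub>extended_rees_module F\<^esub> q = p + q"
  "\<zero>\<^bsub>extended_rees_module F\<^esub> = 0"
  by (simp_all add: extended_rees_module_def)

lemma extended_rees_ring_simps:
  "carrier (extended_rees_ring F) = extended_rees F"
  "p \<otimes>\<^bsub>extended_rees_ring F\<^esub> q = p * q"
  "p \<oplus>\<^bsub>extended_rees_ring F\<^esub> q = p + q"
  "\<one>\<^bsub>extended_rees_ring F\<^esub> = 1"
  "\<zero>\<^bsub>extended_rees_ring F\<^esub> = 0"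
  by (simp_all add: extended_rees_ring_def ring_of_type_algebra_def)

lemma abelian_monoid_extended_rees_module:
  assumes "\<And>n. addsub (F n :: 'a::comm_ring_1 set)"
  shows "abelian_monoid (extended_rees_module F)"
  by (rule abelian_monoidI)
    (use addsubD(1,4)[OF addsub_extended_rees[OF assms]] in \<open>auto simp: extended_rees_module_def add.assoc add.commute\<close>)

lemma finsum_extended_rees_module:
  assumes F: "\<And>n. addsub (F n :: 'a::comm_ring_1 set)" and "finite S" "\<And>g. g \<in> S \<Longrightarrow> f g \<in> extended_rees F"
  shows "(\<Oplus>\<^bsub>extended_rees_module F\<^esub>g\<in>S. f g) = sum f S"
  using assms(2,3)
proof (induction S rule: finite_induct)
  interpret A: abelian_monoid "extended_rees_module F" by (rule abelian_monoid_extended_rees_module[OF F])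
  { case empty show ?case unfolding A.finsum_empty by (simp add: extended_rees_module_def) }
  { case (insert g S)
    have "f \<in> S \<rightarrow> carrier (extended_rees_module F)" "f g \<in> carrier (extended_rees_module F)"
      using insert.prems by (auto simp: extended_rees_module_def)
    then have "(\<Oplus>\<^bsub>extended_rees_module F\<^esub>g\<in>insert g S. f g) = f g \<oplus>\<^bsub>extended_rees_module F\<^esub> (\<Oplus>\<^bsub>extended_rees_module F\<^esub>g\<in>S. f g)"
      by (rule A.finsum_insert[OF insert(1,2)])
    also have "(\<Oplus>\<^bsub>extended_rees_module F\<^esub>g\<in>S. f g) = sum f S" using insert by auto
    finally show ?case using insert(1,2) by (simp add: extended_rees_module_def) }
qed

lemma sum_axis: "(\<Sum>i\<in>UNIV. axis i (c i)) = (\<chi> i. (c i :: 'b::comm_monoid_add))"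
  by (simp add: vec_eq_iff axis_def sum_component)

section \<open>Cohen-Macaulay rings with a complete reduction\<close>

locale cm_reduction =
  fixes \<mm> :: "'a::comm_ring_1 set"
    and I :: "'d::{finite,linorder} \<Rightarrow> 'a set"
    and F :: "int ^ 'd::{finite,linorder} \<Rightarrow> 'a set"
    and x :: "'d \<Rightarrow> 'd \<Rightarrow> 'a"
  assumes CM: "cohen_macaulay_local_ring (ring_of_type_algebra :: 'a ring) \<mm>"
    and dim: "krull_dim (ring_of_type_algebra :: 'a ring) = enat CARD('d)"
    and primary: "\<And>i. primary_to ring_of_type_algebra \<mm> (I i)"
    and adm: "admissible_filtration I F"
    and cr: "complete_reduction ring_of_type_algebra I F x"
begin

lemma local_ring: "noetherian_local_ring (ring_of_type_algebra :: 'a ring) \<mm>"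
  using CM by (simp add: cohen_macaulay_local_ring_def)

lemma noetherian: "noetherian_ring (ring_of_type_algebra :: 'a ring)"
  using local_ring by (simp add: noetherian_local_ring_def)

lemma max_submod: "submod UNIV (*) \<mm>"
  using local_ring by (auto simp: noetherian_local_ring_def maximalideal_def ideal_type_ring)

lemma I_ideal: "ideal (I i) ring_of_type_algebra"
  using primary[of i] by (simp add: primary_to_def)

lemma I_radical: "\<mm> = {b. \<exists>k::nat. b ^ k \<in> I i}"
  using primary[of i] by (simp add: primary_to_def)

lemma I_max: "I i \<subseteq> \<mm>"
  unfolding I_radical[of i] by (auto intro: exI[of _ 1])

lemma filtration: "multi_filtration ring_of_type_algebra I F"
  using adm by (simp add: admissible_filtration_def)

lemma F_submod: "submod UNIV (*) (F n)"
  using filtration by (simp add: multi_filtration_def ideal_type_ring)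

lemma F_addsub: "addsub (F n)"
  by (rule addsub_submod[OF F_submod])

lemma F_antimono: "m \<le> n \<Longrightarrow> F n \<subseteq> F m"
  using filtration by (simp add: multi_filtration_def)

lemma F_powers: "ideal_powers ring_of_type_algebra I n \<subseteq> F n"
  using filtration by (simp add: multi_filtration_def)

lemma F_mult: "r \<in> F m \<Longrightarrow> s \<in> F n \<Longrightarrow> r * s \<in> F (m + n)"
proof -
  assume "r \<in> F m" "s \<in> F n"
  then have "r \<otimes>\<^bsub>ring_of_type_algebra\<^esub> s \<in> F m \<cdot>\<^bsub>ring_of_type_algebra\<^esub> F n" by (rule ideal_prod.prod)
  moreover have "F m \<cdot>\<^bsub>ring_of_type_algebra\<^esub> F n \<subseteq> F (m + n)" using filtration by (simp add: multi_filtration_def)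
  ultimately show ?thesis by auto
qed

lemma F_zero: "F 0 = UNIV"
  using F_powers[of 0] by (simp add: ideal_powers_zero top.extremum_unique)

lemma I_F: "I i \<subseteq> F (axis i 1)"
  using F_powers[of "axis i 1"] by (simp add: ideal_powers_axis[OF I_ideal])

lemma x_mem: "x i j \<in> I i"
  using cr by (simp add: complete_reduction_def)

lemma prod_F: "(\<And>i. i \<in> T \<Longrightarrow> f i \<in> F (axis i 1)) \<Longrightarrow> (\<Prod>i\<in>T. f i) \<in> F (\<Sum>i\<in>T. axis i 1)"
  by (induction T rule: infinite_finite_induct) (auto simp: F_zero intro!: F_mult)

lemma sum_axis_one: "(\<Sum>i\<in>UNIV. axis i 1) = (vec 1 :: (int, 'd) vec)"
  unfolding sum_axis by (simp add: vec_eq_iff)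

definition "y j = (\<Prod>i\<in>UNIV. x i j)"
definition "u j = (\<Prod>i\<in>UNIV-{j}. x i j)"

lemma y_eq: "y j = u j * x j j"
  unfolding y_def u_def by (subst prod.remove[of UNIV j]) (auto simp: mult.commute)

lemma u_mem: "u j \<in> F (vec 1 - axis j 1)"
proof -
  have "(\<Sum>i\<in>UNIV-{j}. axis i 1) = (vec 1 - axis j 1 :: (int, 'd) vec)"
    using sum.remove[of UNIV j "\<lambda>i. axis i 1 :: (int, 'd) vec"] unfolding sum_axis_one by (simp add: algebra_simps)
  moreover have "u j \<in> F (\<Sum>i\<in>UNIV-{j}. axis i 1)"
    unfolding u_def using x_mem I_F by (intro prod_F) blast
  ultimately show ?thesis by metis
qed

lemma column_product_eq: "column_product ring_of_type_algebra x = y"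
  by (simp add: column_product_def y_def fun_eq_iff)

lemma column_ideal_eq: "column_ideal ring_of_type_algebra x l = {\<Sum>k\<in>{k. card {i. i \<le> k} \<le> l}. y k * s k | s. True}"
  unfolding column_ideal_def column_product_eq by (rule genideal_image) simp

text \<open>The coefficients can be taken in \<open>F n\<close> because the second factor absorbs
  those of the first.\<close>

lemma span_prod:
  assumes "finite K" "r \<in> {\<Sum>k\<in>K. y k * s k | s. True} \<cdot>\<^bsub>ring_of_type_algebra\<^esub> F n"
  shows "\<exists>f. (\<forall>k. f k \<in> F n) \<and> r = (\<Sum>k\<in>K. y k * f k)"
  using assms(2)
proof induction
  case (prod i j)
  then obtain s where s: "i = (\<Sum>k\<in>K. y k * s k)" by blast
  have "i \<otimes>\<^bsub>ring_of_type_algebra\<^esub> j = (\<Sum>k\<in>K. y k * (s k * j))"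
    by (simp add: s sum_distrib_right mult.assoc)
  moreover have "s k * j \<in> F n" for k using submodD(3)[OF F_submod _ prod(2)] by blast
  ultimately show ?case by (intro exI[of _ "\<lambda>k. s k * j"]) blast
next
  case (sum r1 r2)
  then obtain f g where "\<forall>k. f k \<in> F n" "r1 = (\<Sum>k\<in>K. y k * f k)" "\<forall>k. g k \<in> F n" "r2 = (\<Sum>k\<in>K. y k * g k)" by blast
  then have "\<forall>k. f k + g k \<in> F n" "r1 \<oplus>\<^bsub>ring_of_type_algebra\<^esub> r2 = (\<Sum>k\<in>K. y k * (f k + g k))"
    using submodD(2)[OF F_submod] by (auto simp: distrib_left sum.distrib)
  then show ?case by (intro exI[of _ "\<lambda>k. f k + g k"]) auto
qed

lemma reduction: "\<exists>m. \<forall>n\<ge>m. \<forall>r\<in>F (n + vec 1). \<exists>f. (\<forall>i. f i \<in> F n) \<and> r = (\<Sum>i\<in>UNIV. y i * f i)"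
proof -
  have "{k :: 'd. card {i. i \<le> k} \<le> CARD('d)} = UNIV" by (auto intro: card_mono)
  then have full: "column_ideal ring_of_type_algebra x CARD('d) = {\<Sum>k\<in>UNIV. y k * s k | s. True}"
    unfolding column_ideal_eq by simp
  obtain m where m: "\<And>n. m \<le> n \<Longrightarrow> F (n + vec 1) = column_ideal ring_of_type_algebra x CARD('d) \<cdot>\<^bsub>ring_of_type_algebra\<^esub> F n"
    using cr unfolding complete_reduction_def for_all_large_def by blast
  have "\<exists>f. (\<forall>i. f i \<in> F n) \<and> r = (\<Sum>i\<in>UNIV. y i * f i)" if n: "m \<le> n" and r: "r \<in> F (n + vec 1)" for n r
    by (rule span_prod[OF finite]) (use r[unfolded m[OF n] full] in simp)
  then show ?thesis by blast
qed

text \<open>Each \<open>I i\<close> contains a power of \<open>\<mu>\<close>, so the product of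
  these powers lies in \<open>F (vec 1)\<close>. Its own powers reach arbitrarily large degrees,
  where the reduction expresses them by the \<open>y i\<close>.\<close>

lemma max_radical:
  assumes "\<mu> \<in> \<mm>"
  shows "\<exists>N s. \<mu> ^ N = (\<Sum>i\<in>UNIV. y i * s i)"
proof -
  have "\<exists>k::nat. \<mu> ^ k \<in> I i" for i using assms I_radical[of i] by blast
  then obtain k :: "'d \<Rightarrow> nat" where k: "\<And>i. \<mu> ^ k i \<in> I i" by metis
  have "(\<Prod>i\<in>UNIV. \<mu> ^ k i) \<in> F (\<Sum>i\<in>UNIV. axis i 1)" using k I_F by (intro prod_F) blast
  then have K: "\<mu> ^ sum k UNIV \<in> F (vec 1)" unfolding sum_axis_one by (simp add: power_sum)
  have KN: "(\<mu> ^ sum k UNIV) ^ N \<in> F (int N *s vec 1)" for N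
  proof (induction N)
    case 0
    have "int 0 *s vec 1 = (0 :: (int, 'd) vec)" by (simp add: vec_eq_iff)
    then show ?case by (simp add: F_zero)
  next
    case (Suc N)
    show ?case using F_mult[OF K Suc] by (simp add: vscale_Suc del: of_nat_Suc)
  qed
  obtain m where m: "\<And>n r. m \<le> n \<Longrightarrow> r \<in> F (n + vec 1) \<Longrightarrow> \<exists>f. (\<forall>i. f i \<in> F n) \<and> r = (\<Sum>i\<in>UNIV. y i * f i)"
    using reduction by blast
  \<comment> \<open>One more than a bound for the entries of \<open>m\<close>, since the reduction
    at \<open>m\<close> speaks of \<open>F (m + vec 1)\<close>.\<close>
  define N where "N = Suc (nat (\<Sum>i\<in>UNIV. \<bar>vec_nth m i\<bar>))"
  have "m + vec 1 \<le> int N *s vec 1"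
    unfolding less_eq_vec_def
  proof
    fix i
    have "\<bar>vec_nth m i\<bar> \<le> (\<Sum>i\<in>UNIV. \<bar>vec_nth m i\<bar>)" by (rule member_le_sum) auto
    then show "vec_nth (m + vec 1) i \<le> vec_nth (int N *s vec 1) i"
      unfolding vector_add_component vector_smult_component vec_component N_def by simp
  qed
  then have "(\<mu> ^ sum k UNIV) ^ N \<in> F (m + vec 1)" using KN[of N] F_antimono by blast
  from m[OF order_refl this] show ?thesis unfolding power_mult[symmetric] by blast
qed

lemma y_max: "y j \<in> \<mm>"
proof -
  have "x j j \<in> \<mm>" using x_mem I_max by blast
  then show ?thesis unfolding y_eq using submodD(3)[OF max_submod] by blast
qed

text \<open>With \<open>J\<close> empty this makes the \<open>y i\<close> nonzerodivisors; with
  \<open>J\<close> an initial segment of the indices it is combined with strictness.\<close>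

lemma y_regular:
  assumes "i \<notin> J" "y i * r = (\<Sum>j\<in>J. y j * s j)"
  shows "\<exists>s'. r = (\<Sum>j\<in>J. y j * s' j)"
proof -
  have "ring_depth (ring_of_type_algebra :: 'a ring) \<mm> = enat CARD('d)"
    using CM dim by (simp add: cohen_macaulay_local_ring_def)
  moreover have "0 < CARD('d)" by simp
  ultimately obtain us where "set us \<subseteq> \<mm>" "regular_sequence (ring_of_type_algebra :: 'a ring) us" "length us = CARD('d)"
    by (rule regular_sequence_of_depth)
  from local_ring_regular[OF local_ring this y_max max_radical assms] show ?thesis .
qed

lemma y_nonzerodivisor: "nonzerodivisor (y i)"
  unfolding nonzerodivisor_def using y_regular[of i "{}"] by simp

lemma x_nonzerodivisor: "nonzerodivisor (x i i)"
  using y_nonzerodivisor[of i] unfolding y_eq nonzerodivisor_mult by blast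

abbreviation "FQ n \<equiv> frac_monom n ` F n"

sublocale Q: graded_family FQ
proof
  show "addsub (FQ n)" for n
    unfolding addsub_def
  proof (intro conjI ballI)
    show "0 \<in> FQ n" using addsubD(1)[OF F_addsub[of n]] frac_monom_zero by (metis imageI)
    show "r - s \<in> FQ n" if "r \<in> FQ n" "s \<in> FQ n" for r s
      using that addsubD(2)[OF F_addsub[of n]] by (auto simp flip: frac_monom_diff)
  qed
  show "1 \<in> FQ 0" using F_zero frac_monom_one by (metis UNIV_I imageI)
  show "r * s \<in> FQ (m + n)" if "r \<in> FQ m" "s \<in> FQ n" for r s m n
    using that F_mult by (auto simp: frac_monom_mult)
qed

lemma FQ_zero: "FQ 0 = range (frac_monom 0)"
  by (simp add: F_zero)

lemma addsub_rees: "addsub (extended_rees F)"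
  by (rule addsub_extended_rees[OF F_addsub])

lemma rees_mult: "p \<in> extended_rees F \<Longrightarrow> q \<in> extended_rees F \<Longrightarrow> p * q \<in> extended_rees F"
  by (rule extended_rees_mult[where ?N1.0 = F and ?N2.0 = F]) (auto intro: F_addsub F_mult)

lemma single_in_rees: "Poly_Mapping.single n r \<in> extended_rees F \<longleftrightarrow> r \<in> F n"
  by (rule single_in_extended_rees[OF F_addsub])

lemma rees_subring: "subring_of (extended_rees F)"
proof -
  have "(1 :: ((int, 'd) vec \<Rightarrow>\<^sub>0 'a)) = Poly_Mapping.single 0 1" by simp
  then have "(1 :: ((int, 'd) vec \<Rightarrow>\<^sub>0 'a)) \<in> extended_rees F" using single_in_rees[of 0 1] F_zero by simp
  then show ?thesis using addsubD(2)[OF addsub_rees] rees_mult by (simp add: subring_of_def)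
qed

text \<open>\<open>S\<close> is generated over the constants by generators of the
  \<open>I i t i\<close> and by the inverses of the variables, hence noetherian. It contains the
  extended Rees algebra of \<open>I\<close>, over which that of \<open>F\<close> is finite by
  admissibility.\<close>

lemma noeth_rees:
  obtains S where "S \<subseteq> extended_rees F" "noeth S (*) (extended_rees F)"
proof -
  let ?single = "Poly_Mapping.single :: (int, 'd) vec \<Rightarrow> 'a \<Rightarrow> _"
  have sm: "?single m r * ?single n s = ?single (m + n) (r * s)" for m n r s by (rule mult_single)
  have N: "noeth (range (?single 0)) (*) (range (?single 0))"
    by (rule noeth_image) (simp_all add: single_add mult_single noeth_type_ring[OF noetherian])
  have base: "subring_of (range (?single 0))"
    unfolding subring_of_def
  proof (intro conjI ballI)
    show "1 \<in> range (?single 0)" by (metis rangeI single_one)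
    fix p q assume "p \<in> range (?single 0)" "q \<in> range (?single 0)"
    then show "p - q \<in> range (?single 0)" "p * q \<in> range (?single 0)"
      by (auto simp: mult_single simp flip: single_diff)
  qed
  have "\<exists>A. finite A \<and> I i = Idl\<^bsub>ring_of_type_algebra\<^esub> A" for i
    using noetherian_ring.finetely_gen[OF noetherian I_ideal[of i]] by blast
  then obtain A where A: "\<And>i. finite (A i)" "\<And>i. I i = Idl\<^bsub>ring_of_type_algebra\<^esub> (A i)" by metis
  let ?P = "(\<Union>i. ?single (axis i 1) ` A i) \<union> range (\<lambda>i. ?single (- axis i 1) 1)"
  have fP: "finite ?P" using A(1) by auto
  have "\<exists>S. subring_of S \<and> noeth S (*) S \<and> range (?single 0) \<subseteq> S \<and> ?P \<subseteq> S \<and>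
    (\<forall>T. subring_of T \<longrightarrow> range (?single 0) \<subseteq> T \<longrightarrow> ?P \<subseteq> T \<longrightarrow> S \<subseteq> T)"
  proof (rule noeth_adjoin_finite[OF base N fP])
    fix S assume "subring_of S" "noeth S (*) S" "range (?single 0) \<subseteq> S" "?P \<subseteq> S"
      "\<And>T. subring_of T \<Longrightarrow> range (?single 0) \<subseteq> T \<Longrightarrow> ?P \<subseteq> T \<Longrightarrow> S \<subseteq> T"
    then show ?thesis by (intro exI[of _ S] conjI allI impI)
  qed
  then obtain S where S: "subring_of S" "noeth S (*) S" "range (?single 0) \<subseteq> S" "?P \<subseteq> S"
    "\<And>T. subring_of T \<Longrightarrow> range (?single 0) \<subseteq> T \<Longrightarrow> ?P \<subseteq> T \<Longrightarrow> S \<subseteq> T"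
    by blast
  have AI: "A i \<subseteq> I i" for i unfolding A(2) genideal_type_ring by blast
  have "S \<subseteq> extended_rees F"
  proof (rule S(5)[OF rees_subring])
    show "range (?single 0) \<subseteq> extended_rees F" using F_zero by (auto simp: single_in_rees)
    have "(1::'a) \<in> F (- axis i 1)" for i
    proof -
      have "- axis i 1 \<le> (0 :: (int, 'd) vec)" by (simp add: less_eq_vec_def axis_def)
      then show ?thesis using F_antimono F_zero by blast
    qed
    then show "?P \<subseteq> extended_rees F" using AI I_F by (auto simp: single_in_rees) blast
  qed
  have powers: "ideal_powers ring_of_type_algebra I n \<subseteq> {r. ?single n r \<in> S}" for n
  proof (rule ideal_powers_subset[OF I_ideal])
    show "submod UNIV (*) {r. ?single n r \<in> S}" for n
      unfolding submod_def
    proof (intro conjI ballI)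
      show "0 \<in> {r. ?single n r \<in> S}" using subring_of_closed(2)[OF S(1)] by simp
      show "r + s \<in> {r. ?single n r \<in> S}" if "r \<in> {r. ?single n r \<in> S}" "s \<in> {r. ?single n r \<in> S}" for r s
        using that subring_of_closed(6)[OF S(1)] by (simp add: single_add)
      show "r * s \<in> {r. ?single n r \<in> S}" if "s \<in> {r. ?single n r \<in> S}" for r s
      proof -
        have "?single 0 r * ?single n s \<in> S" using that S(3) by (intro subring_of_closed(4)[OF S(1)]) auto
        then show ?thesis by (simp add: mult_single)
      qed
    qed
    show "r * s \<in> {r. ?single (m + n) r \<in> S}" if "r \<in> {r. ?single m r \<in> S}" "s \<in> {r. ?single n r \<in> S}" for m n r s
      using that subring_of_closed(4)[OF S(1)] by (simp flip: sm)
    show "1 \<in> {r. ?single 0 r \<in> S}" using subring_of_closed(1)[OF S(1)] by simp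
    show "1 \<in> {r. ?single (- axis i 1) r \<in> S}" for i using S(4) by auto
    show "I i \<subseteq> {r. ?single (axis i 1) r \<in> S}" for i
    proof -
      have sub: "submod UNIV (*) {r. ?single (axis i 1) r \<in> S}" by fact
      have "A i \<subseteq> {r. ?single (axis i 1) r \<in> S}" using S(4) by auto
      then show ?thesis unfolding A(2) genideal_type_ring using sub by blast
    qed
  qed
  have "extended_rees (ideal_powers ring_of_type_algebra I) \<subseteq> S"
  proof
    fix p assume p: "p \<in> extended_rees (ideal_powers ring_of_type_algebra I)"
    have "addsub S" using subring_of_closed[OF S(1)] by (simp add: addsub_def)
    moreover have "Poly_Mapping.single k (Poly_Mapping.lookup p k) \<in> S" for k
      using p powers[of k] by (auto simp: extended_rees_def)
    ultimately have "(\<Sum>k\<in>Poly_Mapping.keys p. Poly_Mapping.single k (Poly_Mapping.lookup p k)) \<in> S"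
      by (intro addsub_sum)
    then show "p \<in> S" using poly_mapping_sum_single[of p] by simp
  qed
  moreover have "\<exists>G\<subseteq>extended_rees F. finite G \<and>
    extended_rees F = {(\<Oplus>\<^bsub>extended_rees_module F\<^esub>g\<in>G. c g * g) | c. c \<in> G \<rightarrow> extended_rees (ideal_powers ring_of_type_algebra I)}"
    using adm unfolding admissible_filtration_def finitely_generated_module_def extended_rees_module_simps extended_rees_ring_simps
    by (rule conjunct2)
  then obtain G where G: "G \<subseteq> extended_rees F" "finite G"
    "extended_rees F = {(\<Oplus>\<^bsub>extended_rees_module F\<^esub>g\<in>G. c g * g) | c. c \<in> G \<rightarrow> extended_rees (ideal_powers ring_of_type_algebra I)}"
    by (elim exE conjE)
  ultimately have sub: "extended_rees F \<subseteq> {\<Sum>g\<in>G. c g * g | c. c \<in> G \<rightarrow> S}"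
  proof -
    assume IS: "extended_rees (ideal_powers ring_of_type_algebra I) \<subseteq> S"
    show ?thesis
    proof
      fix p assume "p \<in> extended_rees F"
      then obtain c where c: "p = (\<Oplus>\<^bsub>extended_rees_module F\<^esub>g\<in>G. c g * g)" "c \<in> G \<rightarrow> extended_rees (ideal_powers ring_of_type_algebra I)"
        using G(3) by blast
      have cS: "c \<in> G \<rightarrow> S" using c(2) IS by blast
      have "c g * g \<in> extended_rees F" if "g \<in> G" for g
        using cS \<open>S \<subseteq> extended_rees F\<close> G(1) that by (intro rees_mult) auto
      then have "p = (\<Sum>g\<in>G. c g * g)" unfolding c(1) by (rule finsum_extended_rees_module[OF F_addsub G(2)])
      then show "p \<in> {\<Sum>g\<in>G. c g * g | c. c \<in> G \<rightarrow> S}" using cS by blast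
    qed
  qed
  have "noeth S (*) {\<Sum>g\<in>G. c g * g | c. c \<in> G \<rightarrow> S}"
    using noeth_finite_span[OF S(1,2) module_mult G(2)] by blast
  then have "noeth S (*) (extended_rees F)" using sub by (rule noeth_subset)
  then show ?thesis using that \<open>S \<subseteq> extended_rees F\<close> by blast
qed

end

lemma iterated_multiples_eq:
  "iterated_multiples z v F l n = {\<Sum>j<l. z j * f j | f. \<forall>j<l. f j \<in> F (n - v)}"
proof (induction l)
  case (Suc l)
  show ?case unfolding iterated_multiples.simps add_multiples_def Suc
  proof safe
    fix r f assume "r \<in> F (n - v)" "\<forall>j<l. f j \<in> F (n - v)"
    then show "\<exists>f'. z l * r + (\<Sum>j<l. z j * f j) = (\<Sum>j<Suc l. z j * f' j) \<and> (\<forall>j<Suc l. f' j \<in> F (n - v))"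
      by (intro exI[of _ "f(l := r)"]) (auto simp: less_Suc_eq add.commute)
  next
    fix f assume "\<forall>j<Suc l. f j \<in> F (n - v)"
    then show "\<exists>r g. (\<Sum>j<Suc l. z j * f j) = z l * r + g \<and> r \<in> F (n - v) \<and> g \<in> {\<Sum>j<l. z j * f j |f. \<forall>j<l. f j \<in> F (n - v)}"
      by (intro exI[of _ "f l"] exI[of _ "\<Sum>j<l. z j * f j"]) (auto simp: add.commute)
  qed
qed auto

text \<open>\<open>e l\<close> is the \<open>l\<close>-th smallest element, counted from
  \<open>0\<close>; the second clause matches the way in which \<open>column_ideal\<close> selects
  the first \<open>l\<close> columns.\<close>

lemma linorder_enumeration:
  obtains e :: "nat \<Rightarrow> 'd::{finite,linorder}" where "inj_on e {..<CARD('d)}"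
    "\<And>l. l \<le> CARD('d) \<Longrightarrow> {k. card {i. i \<le> k} \<le> l} = e ` {..<l}"
proof -
  let ?s = "sorted_list_of_set (UNIV :: 'd set)"
  define e where "e l = ?s ! l" for l
  have len: "length ?s = CARD('d)" by simp
  have dist: "distinct ?s" and srt: "sorted ?s" by simp_all
  have mono: "e k \<le> e l \<longleftrightarrow> k \<le> l" if "k < CARD('d)" "l < CARD('d)" for k l
  proof
    assume "k \<le> l" then show "e k \<le> e l" unfolding e_def using srt len that by (intro sorted_nth_mono) auto
  next
    assume le: "e k \<le> e l"
    show "k \<le> l"
    proof (rule ccontr)
      assume "\<not> k \<le> l"
      then have "e l \<le> e k" unfolding e_def using srt len that by (intro sorted_nth_mono) auto
      then have "?s ! k = ?s ! l" using le by (simp add: e_def)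
      then show False using nth_eq_iff_index_eq[OF dist, of k l] len that \<open>\<not> k \<le> l\<close> by simp
    qed
  qed
  have inj: "inj_on e {..<CARD('d)}"
    unfolding inj_on_def using mono by (metis dual_order.antisym lessThan_iff order_refl)
  have surj: "\<exists>l<CARD('d). k = e l" for k
  proof -
    have "k \<in> set ?s" by simp
    then have "\<exists>l<length ?s. ?s ! l = k" unfolding in_set_conv_nth .
    then show ?thesis using len by (auto simp: e_def)
  qed
  have cd: "card {i. i \<le> e l} = Suc l" if l: "l < CARD('d)" for l
  proof -
    have "{i. i \<le> e l} = e ` {..l}"
    proof (intro equalityI subsetI)
      fix i assume i: "i \<in> {i. i \<le> e l}"
      obtain k where "k < CARD('d)" "i = e k" using surj by blast
      then show "i \<in> e ` {..l}" using i mono l by auto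
    qed (use mono l in auto)
    moreover have "inj_on e {..l}" using inj by (rule inj_on_subset) (use l in auto)
    ultimately show ?thesis by (simp add: card_image)
  qed
  have "{k. card {i. i \<le> k} \<le> l} = e ` {..<l}" if "l \<le> CARD('d)" for l
  proof (intro equalityI subsetI)
    fix k :: 'd assume k: "k \<in> {k. card {i. i \<le> k} \<le> l}"
    obtain j where "j < CARD('d)" "k = e j" using surj by blast
    then show "k \<in> e ` {..<l}" using k cd by auto
  next
    fix k :: 'd assume "k \<in> e ` {..<l}"
    then show "k \<in> {k. card {i. i \<le> k} \<le> l}" using cd that by auto
  qed
  with inj show ?thesis by (rule that)
qed

section \<open>Interpretation of the abstract reductions\<close>

context cm_reduction
begin

text \<open>A graded ideal is recovered from the Laurent polynomials with coefficients in its
  components, so the chain becomes one of submodules of the extended Rees algebra.\<close>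

lemma acc:
  fixes A :: "nat \<Rightarrow> (int, 'd) vec \<Rightarrow> ((int, 'd) vec \<Rightarrow>\<^sub>0 'a) total_frac set"
  assumes A: "\<And>k. Q.graded_ideal (A k)" and mono: "\<And>k n. A k n \<subseteq> A (Suc k) n"
  shows "\<exists>K. \<forall>k\<ge>K. A k = A K"
proof -
  obtain S where S: "S \<subseteq> extended_rees F" "noeth S (*) (extended_rees F)" by (rule noeth_rees)
  let ?N = "\<lambda>k n. frac_monom n -` A k n"
  have addN: "addsub (?N k n)" for k n
    using Q.graded_idealD(1)[OF A[of k], of n] by (simp add: addsub_def frac_monom_diff)
  have NF: "?N k n \<subseteq> F n" for k n using Q.graded_idealD(2)[OF A[of k], of n] by auto
  have "\<exists>K. \<forall>k\<ge>K. extended_rees (?N k) = extended_rees (?N K)"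
  proof (rule noethD[OF S(2)])
    fix k
    show "submod S (*) (extended_rees (?N k))"
      unfolding submod_def
    proof (intro conjI ballI)
      show "0 \<in> extended_rees (?N k)" using addsubD(1)[OF addsub_extended_rees[OF addN]] .
      show "p + q \<in> extended_rees (?N k)" if "p \<in> extended_rees (?N k)" "q \<in> extended_rees (?N k)" for p q
        using addsubD(4)[OF addsub_extended_rees[OF addN] that] .
      show "p * q \<in> extended_rees (?N k)" if "p \<in> S" "q \<in> extended_rees (?N k)" for p q
      proof (rule extended_rees_mult[where ?N1.0 = F and ?N2.0 = "?N k"])
        show "p \<in> extended_rees F" using that S(1) by blast
        show "r * s \<in> ?N k (m + n)" if "r \<in> F m" "s \<in> ?N k n" for m n r s
          using Q.graded_idealD(3)[OF A[of k], of "frac_monom m r" m "frac_monom n s" n] that by (simp add: frac_monom_mult)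
      qed (use addN that in auto)
    qed
    show "extended_rees (?N k) \<subseteq> extended_rees (?N (Suc k))" using mono[of k] by (auto simp: extended_rees_def)
    show "extended_rees (?N k) \<subseteq> extended_rees F" using NF[where k = k] by (auto simp: extended_rees_def)
  qed
  then obtain K where K: "\<And>k. k \<ge> K \<Longrightarrow> extended_rees (?N k) = extended_rees (?N K)" by blast
  have "A k = A K" if "k \<ge> K" for k
  proof
    fix n
    have "?N k n = ?N K n"
      using K[OF that] single_in_extended_rees[where N = "?N k" and n = n, OF addN] single_in_extended_rees[where N = "?N K" and n = n, OF addN] by auto
    moreover have "A j n = frac_monom n ` ?N j n" for j using Q.graded_idealD(2)[OF A[of j], of n] by auto
    ultimately show "A k n = A K n" by metis
  qed
  then show ?thesis by blast
qed

abbreviation "aQ i \<equiv> frac_monom (axis i 1) (x i i)"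
abbreviation "uQ i \<equiv> frac_monom (vec 1 - axis i 1) (u i)"

lemma yQ_eq: "uQ i * aQ i = frac_monom (vec 1) (y i)"
  by (simp add: y_eq frac_monom_mult)

text \<open>As \<open>y i = u i * x i i\<close>, each summand \<open>y i * f i\<close> of the
  reduction is \<open>aQ i\<close> times an element of degree \<open>n - axis i 1\<close>. The
  threshold moves by \<open>vec 1\<close>.\<close>

sublocale J: joint_reduction FQ aQ
proof
  show "aQ i \<in> FQ (axis i 1)" for i using x_mem[of i i] I_F[of i] by blast
  show "aQ i dvd 1" for i by (rule frac_monom_unit[OF x_nonzerodivisor])
  show "\<exists>K. \<forall>k\<ge>K. A k = A K" if "\<And>k::nat. Q.graded_ideal (A k)" "\<And>k n. A k n \<subseteq> A (Suc k) n" for A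
    by (rule acc) (fact that)+
  obtain m where m: "\<And>n r. m \<le> n \<Longrightarrow> r \<in> F (n + vec 1) \<Longrightarrow> \<exists>f. (\<forall>i. f i \<in> F n) \<and> r = (\<Sum>i\<in>UNIV. y i * f i)"
    using reduction by blast
  have "\<exists>f. (\<forall>i. f i \<in> FQ (n - axis i 1)) \<and> r = (\<Sum>i\<in>UNIV. aQ i * f i)" if n: "m + vec 1 \<le> n" and r: "r \<in> FQ n" for n r
  proof -
    obtain r' where r': "r = frac_monom n r'" "r' \<in> F ((n - vec 1) + vec 1)" using r by auto
    have "m \<le> n - vec 1" using n by (simp add: less_eq_vec_def le_diff_eq)
    from m[OF this r'(2)] obtain f where f: "\<And>i. f i \<in> F (n - vec 1)" "r' = (\<Sum>i\<in>UNIV. y i * f i)" by blast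
    show ?thesis
    proof (intro exI conjI allI)
      show "frac_monom (n - axis i 1) (u i * f i) \<in> FQ (n - axis i 1)" for i
        using F_mult[OF u_mem[of i] f(1)[of i]] by simp
      show "r = (\<Sum>i\<in>UNIV. aQ i * frac_monom (n - axis i 1) (u i * f i))"
        by (simp add: r'(1) f(2) frac_monom_sum y_eq mult_ac frac_monom_mult)
    qed
  qed
  then show "\<exists>m. \<forall>n\<ge>m. \<forall>r\<in>FQ n. \<exists>f. (\<forall>i. f i \<in> FQ (n - axis i 1)) \<and> r = (\<Sum>i\<in>UNIV. aQ i * f i)" by blast
qed

lemma FQ_finitely_generated:
  "\<exists>G. finite G \<and> G \<subseteq> FQ n \<and> (\<forall>W. submod (FQ 0) (*) W \<longrightarrow> G \<subseteq> W \<longrightarrow> FQ n \<subseteq> W)"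
proof -
  have "ideal (F n) ring_of_type_algebra" by (simp add: ideal_type_ring F_submod)
  from noetherian_ring.finetely_gen[OF noetherian this] obtain G where G: "finite G" "F n = Idl\<^bsub>ring_of_type_algebra\<^esub> G" by blast
  show ?thesis
  proof (intro exI[of _ "frac_monom n ` G"] conjI allI impI)
    show "frac_monom n ` G \<subseteq> FQ n" unfolding G(2) genideal_type_ring by blast
    fix W assume W: "submod (FQ 0) (*) W" "frac_monom n ` G \<subseteq> W"
    have "submod UNIV (*) (frac_monom n -` W)"
      unfolding submod_def
    proof (intro conjI ballI)
      show "0 \<in> frac_monom n -` W" using submodD(1)[OF W(1)] by simp
      show "r + s \<in> frac_monom n -` W" if "r \<in> frac_monom n -` W" "s \<in> frac_monom n -` W" for r s
        using submodD(2)[OF W(1)] that by (simp add: frac_monom_add)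
      show "r * s \<in> frac_monom n -` W" if "s \<in> frac_monom n -` W" for r s
      proof -
        have "frac_monom 0 r * frac_monom n s \<in> W" using that by (intro submodD(3)[OF W(1)]) (auto simp: FQ_zero)
        then show ?thesis by (simp add: frac_monom_mult)
      qed
    qed
    moreover have "G \<subseteq> frac_monom n -` W" using W(2) by blast
    ultimately have "F n \<subseteq> frac_monom n -` W" unfolding G(2) genideal_type_ring by blast
    then show "FQ n \<subseteq> W" by blast
  qed (use G in simp)
qed

lemma strict_reduction_exists:
  assumes strict: "strict_complete_reduction ring_of_type_algebra I F x"
  shows "\<exists>e M. strict_reduction FQ aQ uQ e M"
proof -
  obtain e :: "nat \<Rightarrow> 'd" where e: "inj_on e {..<CARD('d)}"
    "\<And>l. l \<le> CARD('d) \<Longrightarrow> {k. card {i. i \<le> k} \<le> l} = e ` {..<l}" by (rule linorder_enumeration) blast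
  have "ideal \<mm> ring_of_type_algebra" by (simp add: ideal_type_ring max_submod)
  from noetherian_ring.finetely_gen[OF noetherian this] obtain G where G: "finite G" "\<mm> = Idl\<^bsub>ring_of_type_algebra\<^esub> G" by blast
  have G_max: "G \<subseteq> \<mm>" unfolding G(2) genideal_type_ring by blast
  have "strict_reduction FQ aQ uQ e (frac_monom (0 :: (int, 'd) vec) ` G)"
  proof
    show "aQ i \<in> FQ (axis i 1)" for i by (rule J.a_mem)
    show "uQ i \<in> FQ (vec 1 - axis i 1)" for i using u_mem by blast
    show "uQ i * aQ i dvd 1" for i unfolding yQ_eq by (rule frac_monom_unit[OF y_nonzerodivisor])
    show "\<exists>G. finite G \<and> G \<subseteq> FQ n \<and> (\<forall>W. submod (FQ 0) (*) W \<longrightarrow> G \<subseteq> W \<longrightarrow> FQ n \<subseteq> W)" for n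
      by (rule FQ_finitely_generated)
    show "finite (frac_monom 0 ` G)" using G by simp
    show "frac_monom 0 ` G \<subseteq> FQ 0" unfolding FQ_zero by blast
    show "\<exists>m. \<forall>n\<ge>m. \<forall>r\<in>FQ (n + vec 1). \<exists>f. (\<forall>i. f i \<in> FQ n) \<and> r = (\<Sum>i\<in>UNIV. uQ i * aQ i * f i)"
    proof -
      obtain m where m: "\<And>n r. m \<le> n \<Longrightarrow> r \<in> F (n + vec 1) \<Longrightarrow> \<exists>f. (\<forall>i. f i \<in> F n) \<and> r = (\<Sum>i\<in>UNIV. y i * f i)"
        using reduction by blast
      have "\<exists>f. (\<forall>i. f i \<in> FQ n) \<and> r = (\<Sum>i\<in>UNIV. uQ i * aQ i * f i)" if n: "m \<le> n" and r: "r \<in> FQ (n + vec 1)" for n r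
      proof -
        obtain r' where r': "r = frac_monom (n + vec 1) r'" "r' \<in> F (n + vec 1)" using r by blast
        from m[OF n r'(2)] obtain f where "\<forall>i. f i \<in> F n" "r' = (\<Sum>i\<in>UNIV. y i * f i)" by blast
        then show ?thesis unfolding yQ_eq r'(1)
          by (intro exI[of _ "\<lambda>i. frac_monom n (f i)"]) (auto simp: frac_monom_sum frac_monom_mult add.commute)
      qed
      then show ?thesis by blast
    qed
    show "(\<exists>r. (\<forall>\<mu>. r \<mu> \<in> FQ 0) \<and> s = (\<Sum>\<mu>\<in>frac_monom (0 :: (int, 'd) vec) ` G. r \<mu> * \<mu>)) \<or> (\<exists>v\<in>FQ 0. v * s = 1)" if "s \<in> FQ 0" for s
    proof -
      obtain t where t: "s = frac_monom 0 t" using \<open>s \<in> FQ 0\<close> unfolding FQ_zero by blast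
      show ?thesis
      proof (cases "t \<in> \<mm>")
        case True
        then have "t \<in> Idl\<^bsub>ring_of_type_algebra\<^esub> ((\<lambda>g. g) ` G)" using G(2) by simp
        then obtain c where c: "t = (\<Sum>g\<in>G. g * c g)" unfolding genideal_image[OF G(1)] by blast
        have inj: "inj_on (frac_monom 0 :: 'a \<Rightarrow> ((int, 'd) vec \<Rightarrow>\<^sub>0 'a) total_frac) G" by (auto simp: inj_on_def)
        \<comment> \<open>The coefficients have to be functions of the elements
          \<open>\<mu>\<close>, hence the inverse of \<open>frac_monom 0\<close> on
          \<open>G\<close>.\<close>
        define r where "r \<mu> = frac_monom (0 :: (int, 'd) vec) (c (the_inv_into G (frac_monom 0) \<mu>))" for \<mu> :: "((int, 'd) vec \<Rightarrow>\<^sub>0 'a) total_frac"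
        have "s = (\<Sum>\<mu>\<in>frac_monom (0 :: (int, 'd) vec) ` G. r \<mu> * \<mu>)"
          unfolding sum.reindex[OF inj] t c by (simp add: frac_monom_sum frac_monom_mult r_def the_inv_into_f_f[OF inj] mult.commute)
        moreover have "\<forall>\<mu>. r \<mu> \<in> FQ 0" unfolding FQ_zero r_def by blast
        ultimately show ?thesis by blast
      next
        case False
        then obtain v where "1 = t * v" using local_ring_unit[OF local_ring] by (auto simp: dvd_def)
        then have "frac_monom 0 v * s = 1" unfolding t frac_monom_mult by (simp add: mult.commute)
        then show ?thesis unfolding FQ_zero by blast
      qed
    qed
    show "\<exists>N s. (\<forall>i. s i \<in> FQ (- vec 1)) \<and> \<mu> ^ N = (\<Sum>i\<in>UNIV. uQ i * aQ i * s i)" if \<mu>: "\<mu> \<in> frac_monom (0 :: (int, 'd) vec) ` G" for \<mu>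
    proof -
      obtain g where g: "\<mu> = frac_monom 0 g" "g \<in> \<mm>" using \<mu> G_max by blast
      obtain N s where s: "g ^ N = (\<Sum>i\<in>UNIV. y i * s i)" using max_radical[OF g(2)] by blast
      have "\<mu> ^ N = (\<Sum>i\<in>UNIV. uQ i * aQ i * frac_monom (- vec 1) (s i))"
        unfolding yQ_eq g(1) frac_monom_power[symmetric] s by (simp add: frac_monom_sum frac_monom_mult)
      moreover have "- vec 1 \<le> (0 :: (int, 'd) vec)" by (simp add: less_eq_vec_def)
      then have "F (- vec 1) = UNIV" using F_antimono F_zero by blast
      ultimately show ?thesis by (intro exI[of _ N] exI[of _ "\<lambda>i. frac_monom (- vec 1) (s i)"]) auto
    qed
    fix l n r
    assume l: "l < CARD('d)" and n: "vec (int l) \<le> n" and r: "r \<in> FQ n"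
      and mem: "uQ (e l) * aQ (e l) * r \<in> iterated_multiples (\<lambda>l. uQ (e l) * aQ (e l)) (vec 1) FQ l (n + vec 1)"
    let ?Y = "e ` {..<l}"
    have inj: "inj_on e {..<l}" by (rule inj_on_subset[OF e(1)]) (use l in auto)
    have el: "e l \<notin> ?Y" using e(1) l by (auto dest: inj_onD)
    obtain r' where r': "r = frac_monom n r'" "r' \<in> F n" using r by blast
    obtain f where f: "frac_monom (vec 1) (y (e l)) * r = (\<Sum>j<l. frac_monom (vec 1) (y (e j)) * f j)" "\<forall>j<l. f j \<in> FQ n"
      using mem unfolding iterated_multiples_eq yQ_eq by auto
    have "\<forall>j. \<exists>g. j < l \<longrightarrow> f j = frac_monom n g" using f(2) by blast
    then obtain g where g: "\<And>j. j < l \<Longrightarrow> f j = frac_monom n (g j)" by metis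
    have "frac_monom (vec 1 + n) (y (e l) * r') = frac_monom (vec 1 + n) (\<Sum>j<l. y (e j) * g j)"
      using f(1) g by (simp add: frac_monom_mult frac_monom_sum r'(1))
    then have "y (e l) * r' = (\<Sum>j<l. y (e j) * g j)" by simp
    also have "\<dots> = (\<Sum>k\<in>?Y. y k * g (the_inv_into {..<l} e k))"
      unfolding sum.reindex[OF inj] by (simp add: the_inv_into_f_f[OF inj])
    \<comment> \<open>Regularity puts \<open>r'\<close> into the ideal of the first \<open>l\<close>
      column products; strictness then moves the coefficients into \<open>F (n - vec 1)\<close>. For
      \<open>l = 0\<close> regularity alone gives \<open>r' = 0\<close>.\<close>
    finally have "\<exists>s. r' = (\<Sum>k\<in>?Y. y k * s k)" by (rule y_regular[OF el])
    then obtain s where s: "r' = (\<Sum>k\<in>?Y. y k * s k)" by blast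
    have "\<exists>h. (\<forall>k. h k \<in> F (n - vec 1)) \<and> r' = (\<Sum>k\<in>?Y. y k * h k)"
    proof (cases "l = 0")
      case True
      then show ?thesis using s addsubD(1)[OF F_addsub] by (intro exI[of _ "\<lambda>_. 0"]) auto
    next
      case False
      have Y: "{k. card {i. i \<le> k} \<le> l} = ?Y" using e(2) l by simp
      have "column_ideal ring_of_type_algebra x l \<inter> F n = column_ideal ring_of_type_algebra x l \<cdot>\<^bsub>ring_of_type_algebra\<^esub> F (n - vec 1)"
        using strict False l n unfolding strict_complete_reduction_def by simp
      moreover have "r' \<in> column_ideal ring_of_type_algebra x l" unfolding column_ideal_eq Y using s by blast
      ultimately have "r' \<in> {\<Sum>k\<in>?Y. y k * s k | s. True} \<cdot>\<^bsub>ring_of_type_algebra\<^esub> F (n - vec 1)"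
        using r'(2) unfolding column_ideal_eq Y by blast
      then show ?thesis by (intro span_prod) auto
    qed
    then obtain h where h: "\<And>k. h k \<in> F (n - vec 1)" "r' = (\<Sum>k\<in>?Y. y k * h k)" by blast
    have "r = (\<Sum>j<l. frac_monom (vec 1) (y (e j)) * frac_monom (n - vec 1) (h (e j)))"
      unfolding r'(1) h(2) sum.reindex[OF inj] by (simp add: frac_monom_sum frac_monom_mult)
    then show "r \<in> iterated_multiples (\<lambda>l. uQ (e l) * aQ (e l)) (vec 1) FQ l n"
      unfolding iterated_multiples_eq yQ_eq mem_Collect_eq
      by (intro exI[of _ "\<lambda>j. frac_monom (n - vec 1) (h (e j))"]) (use h(1) in blast)
  qed
  then show ?thesis by blast
qed

end

section \<open>Localization of modules and fractions\<close>

text \<open>Operations on classes are defined as unions over representatives. If all representatives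
  give the same set, the union is that set.\<close>

lemma UN_pair_constant:
  assumes "A \<noteq> {}" "\<And>m k. (m, k) \<in> A \<Longrightarrow> f m k = c"
  shows "(\<Union>(m, k)\<in>A. f m k) = c"
  using assms by fastforce

locale fraction_module =
  fixes S :: "'p::comm_ring_1 ring" and M :: "('p, 'p) module" and C :: "'p set"
  assumes S_ops: "p \<otimes>\<^bsub>S\<^esub> q = p * q" "\<one>\<^bsub>S\<^esub> = 1"
    and M_ops: "carrier M = C" "p \<oplus>\<^bsub>M\<^esub> q = p + q" "\<zero>\<^bsub>M\<^esub> = 0" "p \<odot>\<^bsub>M\<^esub> q = p * q"
    and C_addsub: "addsub C"
begin

lemma S_pow: "s [^]\<^bsub>S\<^esub> (k::nat) = s ^ k"
  by (induction k) (simp_all add: nat_pow_def S_ops mult.commute)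

text \<open>The fraction \<open>m / s^k\<close> is identified with the element \<open>q\<close> of the total ring of fractions such that
  \<open>m = s^k q\<close>.\<close>

definition frac_dom :: "'p \<Rightarrow> 'p total_frac set" where
  "frac_dom s = {q. \<exists>k. \<exists>m\<in>C. to_frac m = to_frac s ^ k * q}"

definition frac_class :: "'p \<Rightarrow> 'p total_frac \<Rightarrow> ('p \<times> nat) set" where
  "frac_class s q = {(m, k). m \<in> C \<and> to_frac m = to_frac s ^ k * q}"

lemma frac_pow_cancel:
  assumes "nonzerodivisor s" "to_frac s ^ k * q = to_frac s ^ k * q'"
  shows "q = q'"
  using dvd_one_cancel[OF dvd_one_power[OF to_frac_unit[OF assms(1)]] assms(2)] .

text \<open>As \<open>s\<close> is a nonzerodivisor, pairs are related exactly if they have the same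
  quotient in the total ring of fractions. One direction cancels a power of \<open>s\<close>, the
  other holds with \<open>l = 0\<close>.\<close>

lemma fraction_eq:
  assumes s: "nonzerodivisor s" and m: "m \<in> C" "to_frac m = to_frac s ^ k * q"
  shows "fraction S M s m k = frac_class s q"
proof -
  have "(\<exists>l. s ^ (l + k') * m = s ^ (l + k) * m') \<longleftrightarrow> to_frac m' = to_frac s ^ k' * q" for m' k'
  proof
    assume "\<exists>l. s ^ (l + k') * m = s ^ (l + k) * m'"
    then obtain l where "to_frac (s ^ (l + k') * m) = to_frac (s ^ (l + k) * m')" by auto
    then have "to_frac s ^ (l + k) * to_frac m' = to_frac s ^ (l + k') * (to_frac s ^ k * q)"
      by (simp only: to_frac_mult to_frac_power m(2))
    also have "\<dots> = to_frac s ^ (l + k) * (to_frac s ^ k' * q)" by (simp only: power_add mult_ac)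
    finally show "to_frac m' = to_frac s ^ k' * q" by (rule frac_pow_cancel[OF s])
  next
    assume *: "to_frac m' = to_frac s ^ k' * q"
    have "to_frac (s ^ (0 + k') * m) = to_frac (s ^ (0 + k) * m')"
      unfolding to_frac_mult to_frac_power m(2) * by (simp add: mult_ac)
    then show "\<exists>l. s ^ (l + k') * m = s ^ (l + k) * m'" unfolding to_frac_eq_iff by blast
  qed
  then show ?thesis
    using m(1) unfolding fraction_def fraction_rel_def frac_class_def Image_def S_pow M_ops by auto
qed

lemma frac_exists:
  assumes "nonzerodivisor s"
  obtains q where "to_frac m = to_frac s ^ k * q"
proof -
  obtain z where "\<And>x. to_frac s ^ k * (z * x) = x"
    using dvd_one_inverse[OF dvd_one_power[OF to_frac_unit[OF assms]]] by blast
  from this[symmetric] show ?thesis by (rule that)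
qed

lemma frac_class_inj:
  assumes "nonzerodivisor s" "q \<in> frac_dom s" "frac_class s q = frac_class s q'"
  shows "q = q'"
proof -
  obtain m k where "m \<in> C" "to_frac m = to_frac s ^ k * q" using assms(2) by (auto simp: frac_dom_def)
  then have "(m, k) \<in> frac_class s q" by (simp add: frac_class_def)
  then have "(m, k) \<in> frac_class s q'" unfolding assms(3) .
  then have "to_frac s ^ k * q = to_frac s ^ k * q'" using \<open>to_frac m = to_frac s ^ k * q\<close> by (simp add: frac_class_def)
  then show ?thesis by (rule frac_pow_cancel[OF assms(1)])
qed

lemma frac_class_nonempty: "q \<in> frac_dom s \<Longrightarrow> frac_class s q \<noteq> {}"
  by (auto simp: frac_dom_def frac_class_def)

lemma frac_domI: "m \<in> C \<Longrightarrow> to_frac m = to_frac s ^ k * q \<Longrightarrow> q \<in> frac_dom s"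
  by (auto simp: frac_dom_def)

lemma localization_carrier:
  assumes s: "nonzerodivisor s"
  shows "carrier (localization S M s) = frac_class s ` frac_dom s"
proof -
  have "carrier (localization S M s) = {fraction S M s m k | m k. m \<in> C}"
    by (auto simp: localization_def quotient_def M_ops fraction_def)
  also have "\<dots> = frac_class s ` frac_dom s"
  proof (intro equalityI subsetI)
    fix A assume "A \<in> {fraction S M s m k | m k. m \<in> C}"
    then obtain m k where A: "A = fraction S M s m k" "m \<in> C" by blast
    obtain q where "to_frac m = to_frac s ^ k * q" by (rule frac_exists[OF s])
    then show "A \<in> frac_class s ` frac_dom s" using A fraction_eq[OF s A(2)] frac_domI by blast
  next
    fix A assume "A \<in> frac_class s ` frac_dom s"
    then obtain q m k where "A = frac_class s q" "m \<in> C" "to_frac m = to_frac s ^ k * q" by (auto simp: frac_dom_def)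
    then show "A \<in> {fraction S M s m k | m k. m \<in> C}" using fraction_eq[OF s] by blast
  qed
  finally show ?thesis .
qed

context
  fixes s assumes s: "nonzerodivisor s" and sC: "\<And>m. m \<in> C \<Longrightarrow> s * m \<in> C"
begin

lemma s_power: "m \<in> C \<Longrightarrow> s ^ k * m \<in> C"
  by (induction k) (auto simp: mult.assoc sC)

lemma frac_dom_add:
  assumes "q \<in> frac_dom s" "q' \<in> frac_dom s" shows "q + q' \<in> frac_dom s"
proof -
  obtain m k m' k' where *: "m \<in> C" "to_frac m = to_frac s ^ k * q" "m' \<in> C" "to_frac m' = to_frac s ^ k' * q'"
    using assms by (auto simp: frac_dom_def)
  have "to_frac (s ^ k' * m + s ^ k * m') = to_frac s ^ (k + k') * (q + q')"
    unfolding to_frac_add to_frac_mult to_frac_power *(2,4) by (simp add: power_add algebra_simps)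
  then show ?thesis using * s_power addsubD(4)[OF C_addsub] by (intro frac_domI) auto
qed

lemma frac_dom_scale:
  assumes "\<And>m. m \<in> C \<Longrightarrow> r * m \<in> C" "q \<in> frac_dom s" shows "to_frac r * q \<in> frac_dom s"
proof -
  obtain m k where *: "m \<in> C" "to_frac m = to_frac s ^ k * q" using assms by (auto simp: frac_dom_def)
  have "to_frac (r * m) = to_frac s ^ k * (to_frac r * q)" unfolding to_frac_mult *(2) by (simp only: mult_ac)
  then show ?thesis using assms(1)[OF *(1)] by (intro frac_domI)
qed

lemma frac_dom_zero: "0 \<in> frac_dom s"
  using addsubD(1)[OF C_addsub] by (intro frac_domI[of 0 _ 0]) auto

lemma frac_dom_uminus: "q \<in> frac_dom s \<Longrightarrow> - q \<in> frac_dom s"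
  using frac_dom_scale[of "- 1" q] addsubD(3)[OF C_addsub] by (simp add: to_frac_minus)

lemma localization_zero: "\<zero>\<^bsub>localization S M s\<^esub> = frac_class s 0"
  using addsubD(1)[OF C_addsub] by (auto simp: localization_def M_ops intro!: fraction_eq[OF s])

lemma localization_add:
  assumes "q \<in> frac_dom s" "q' \<in> frac_dom s"
  shows "frac_class s q \<oplus>\<^bsub>localization S M s\<^esub> frac_class s q' = frac_class s (q + q')"
proof -
  have "fraction S M s (s ^ k' * m + s ^ k * m') (k + k') = frac_class s (q + q')"
    if "(m, k) \<in> frac_class s q" "(m', k') \<in> frac_class s q'" for m k m' k'
  proof (rule fraction_eq[OF s])
    have *: "m \<in> C" "to_frac m = to_frac s ^ k * q" "m' \<in> C" "to_frac m' = to_frac s ^ k' * q'"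
      using that by (auto simp: frac_class_def)
    then show "s ^ k' * m + s ^ k * m' \<in> C" using s_power addsubD(4)[OF C_addsub] by auto
    show "to_frac (s ^ k' * m + s ^ k * m') = to_frac s ^ (k + k') * (q + q')"
      unfolding to_frac_add to_frac_mult to_frac_power *(2,4) by (simp add: power_add algebra_simps)
  qed
  then have "(\<Union>(m, k)\<in>frac_class s q. \<Union>(m', k')\<in>frac_class s q'. fraction S M s (s ^ k' * m + s ^ k * m') (k + k')) = frac_class s (q + q')"
    using frac_class_nonempty[OF assms(1)] frac_class_nonempty[OF assms(2)]
    by (intro UN_pair_constant)
  then show ?thesis by (simp add: localization_def M_ops S_pow)
qed

lemma localization_smult:
  assumes "\<And>m. m \<in> C \<Longrightarrow> r * m \<in> C" "q \<in> frac_dom s"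
  shows "r \<odot>\<^bsub>localization S M s\<^esub> frac_class s q = frac_class s (to_frac r * q)"
proof -
  have "fraction S M s (r * m) k = frac_class s (to_frac r * q)" if "(m, k) \<in> frac_class s q" for m k
  proof (rule fraction_eq[OF s])
    have *: "m \<in> C" "to_frac m = to_frac s ^ k * q" using that by (auto simp: frac_class_def)
    show "r * m \<in> C" by (rule assms(1)[OF *(1)])
    show "to_frac (r * m) = to_frac s ^ k * (to_frac r * q)" unfolding to_frac_mult *(2) by (simp only: mult_ac)
  qed
  then have "(\<Union>(m, k)\<in>frac_class s q. fraction S M s (r * m) k) = frac_class s (to_frac r * q)"
    using frac_class_nonempty[OF assms(2)] by (intro UN_pair_constant)
  then show ?thesis by (simp add: localization_def M_ops)
qed

lemma abelian_group_localization: "abelian_group (localization S M s)"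
proof (rule abelian_groupI)
  note car = localization_carrier[OF s]
  fix A B D assume "A \<in> carrier (localization S M s)" "B \<in> carrier (localization S M s)" "D \<in> carrier (localization S M s)"
  then obtain p q r where *: "A = frac_class s p" "p \<in> frac_dom s" "B = frac_class s q" "q \<in> frac_dom s" "D = frac_class s r" "r \<in> frac_dom s"
    unfolding car by blast
  show "A \<oplus>\<^bsub>localization S M s\<^esub> B \<oplus>\<^bsub>localization S M s\<^esub> D = A \<oplus>\<^bsub>localization S M s\<^esub> (B \<oplus>\<^bsub>localization S M s\<^esub> D)"
    using * by (simp add: localization_add frac_dom_add add.assoc)
next
  note car = localization_carrier[OF s]
  fix A B assume "A \<in> carrier (localization S M s)" "B \<in> carrier (localization S M s)"
  then obtain p q where *: "A = frac_class s p" "p \<in> frac_dom s" "B = frac_class s q" "q \<in> frac_dom s"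
    unfolding car by blast
  show "A \<oplus>\<^bsub>localization S M s\<^esub> B = B \<oplus>\<^bsub>localization S M s\<^esub> A"
    using * by (simp add: localization_add add.commute)
  show "A \<oplus>\<^bsub>localization S M s\<^esub> B \<in> carrier (localization S M s)"
    unfolding car using * by (simp add: localization_add frac_dom_add)
next
  note car = localization_carrier[OF s]
  show "\<zero>\<^bsub>localization S M s\<^esub> \<in> carrier (localization S M s)"
    unfolding car localization_zero using frac_dom_zero by blast
  fix A assume "A \<in> carrier (localization S M s)"
  then obtain p where *: "A = frac_class s p" "p \<in> frac_dom s" unfolding car by blast
  show "\<zero>\<^bsub>localization S M s\<^esub> \<oplus>\<^bsub>localization S M s\<^esub> A = A"
    unfolding localization_zero * using * frac_dom_zero by (simp add: localization_add)
  show "\<exists>B\<in>carrier (localization S M s). B \<oplus>\<^bsub>localization S M s\<^esub> A = \<zero>\<^bsub>localization S M s\<^esub>"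
    unfolding car localization_zero * using * frac_dom_uminus[of p]
    by (intro bexI[of _ "frac_class s (- p)"]) (auto simp: localization_add)
qed

lemma localization_uminus:
  assumes "q \<in> frac_dom s"
  shows "\<ominus>\<^bsub>localization S M s\<^esub> frac_class s q = frac_class s (- q)"
proof (rule abelian_group.minus_equality[OF abelian_group_localization])
  show "frac_class s (- q) \<oplus>\<^bsub>localization S M s\<^esub> frac_class s q = \<zero>\<^bsub>localization S M s\<^esub>"
    unfolding localization_zero using assms frac_dom_uminus by (simp add: localization_add)
  show "frac_class s q \<in> carrier (localization S M s)" "frac_class s (- q) \<in> carrier (localization S M s)"
    unfolding localization_carrier[OF s] using assms frac_dom_uminus by auto
qed

text \<open>Membership of the partial sums in \<open>frac_dom s\<close> is carried along, since
  \<open>localization_add\<close> asks for it.\<close>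

lemma localization_finsum:
  assumes "finite T" "\<And>i. i \<in> T \<Longrightarrow> f i \<in> frac_dom s"
  shows "(\<Oplus>\<^bsub>localization S M s\<^esub>i\<in>T. frac_class s (f i)) = frac_class s (\<Sum>i\<in>T. f i) \<and> (\<Sum>i\<in>T. f i) \<in> frac_dom s"
  using assms
proof (induction T rule: finite_induct)
  interpret L: abelian_group "localization S M s" by (rule abelian_group_localization)
  { case empty show ?case by (simp add: localization_zero frac_dom_zero) }
  { case (insert i T)
    have "(\<lambda>i. frac_class s (f i)) \<in> T \<rightarrow> carrier (localization S M s)" "frac_class s (f i) \<in> carrier (localization S M s)"
      unfolding localization_carrier[OF s] using insert.prems by auto
    then have "(\<Oplus>\<^bsub>localization S M s\<^esub>i\<in>insert i T. frac_class s (f i)) =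
        frac_class s (f i) \<oplus>\<^bsub>localization S M s\<^esub> (\<Oplus>\<^bsub>localization S M s\<^esub>i\<in>T. frac_class s (f i))"
      by (rule L.finsum_insert[OF insert(1,2)])
    then show ?case using insert by (simp add: localization_add frac_dom_add) }
qed

text \<open>Expanding a fraction by \<open>u ^ k\<close> does not change its quotient
  \<open>q\<close>; this is why the maps of the Cech complex become inclusions.\<close>

lemma localization_map_class:
  assumes u: "nonzerodivisor u" "\<And>m. m \<in> C \<Longrightarrow> u * m \<in> C" and q: "q \<in> frac_dom s"
  shows "localization_map S M s u (frac_class s q) = frac_class (s * u) q" "q \<in> frac_dom (s * u)"
proof -
  have up: "u ^ k * m \<in> C" if "m \<in> C" for k m
    using that by (induction k) (auto simp: mult.assoc u(2))
  have eq: "to_frac (u ^ k * m) = to_frac (s * u) ^ k * q" if "to_frac m = to_frac s ^ k * q" for m k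
    unfolding to_frac_mult to_frac_power that power_mult_distrib by (simp only: mult_ac)
  have "fraction S M (s * u) (u ^ k * m) k = frac_class (s * u) q" if "(m, k) \<in> frac_class s q" for m k
    using that s u by (intro fraction_eq up eq) (auto simp: frac_class_def nonzerodivisor_mult)
  then have "(\<Union>(m, k)\<in>frac_class s q. fraction S M (s * u) (u ^ k * m) k) = frac_class (s * u) q"
    using frac_class_nonempty[OF q] by (intro UN_pair_constant)
  then show "localization_map S M s u (frac_class s q) = frac_class (s * u) q"
    by (simp add: localization_map_def M_ops S_ops S_pow)
  obtain m k where "m \<in> C" "to_frac m = to_frac s ^ k * q" using q by (auto simp: frac_dom_def)
  then show "q \<in> frac_dom (s * u)" using up eq by (intro frac_domI)
qed

end

end

section \<open>The Cech complex and fractions\<close>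

locale fraction_cech = fraction_module S M C for S :: "'p::comm_ring_1 ring" and M C +
  fixes x :: "'i::{finite,linorder} \<Rightarrow> 'p"
  assumes S_monoid: "comm_monoid S" and x_S: "x i \<in> carrier S"
    and x_nonzerodivisor: "nonzerodivisor (x i)" and x_C: "m \<in> C \<Longrightarrow> x i * m \<in> C"
begin

lemma finprod_x: "(\<Otimes>\<^bsub>S\<^esub>i\<in>T. x i) = prod x T"
  using finite[of T]
proof (induction T rule: finite_induct)
  interpret comm_monoid S by (rule S_monoid)
  { case empty show ?case by (simp add: S_ops) }
  { case (insert i T) then show ?case using x_S by (simp add: S_ops) }
qed

lemma prod_nonzerodivisor: "nonzerodivisor (prod x T)"
  by (induction T rule: infinite_finite_induct) (auto simp: nonzerodivisor_one nonzerodivisor_mult x_nonzerodivisor)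

lemma prod_C: "m \<in> C \<Longrightarrow> prod x T * m \<in> C"
  by (induction T rule: infinite_finite_induct) (auto simp: mult.assoc x_C)

abbreviation "D T \<equiv> frac_dom (prod x T)"
abbreviation "Cl T \<equiv> frac_class (prod x T)"

text \<open>Turns a function with values in the total ring of fractions into a cochain of degree
  \<open>p\<close> of the Cech complex; only its values at sets of size \<open>p\<close>
  count.\<close>

definition enc :: "nat \<Rightarrow> ('i set \<Rightarrow> 'p total_frac) \<Rightarrow> 'i set \<Rightarrow> ('p \<times> nat) set" where
  "enc p c = (\<lambda>T\<in>{T. card T = p}. Cl T (c T))"

definition cochain :: "nat \<Rightarrow> ('i set \<Rightarrow> 'p total_frac) \<Rightarrow> bool" where
  "cochain p c \<longleftrightarrow> (\<forall>T. card T = p \<longrightarrow> c T \<in> D T)"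

lemma D_mono: "i \<in> T \<Longrightarrow> q \<in> D (T - {i}) \<Longrightarrow> q \<in> D T"
proof -
  assume i: "i \<in> T" and q: "q \<in> D (T - {i})"
  have "q \<in> frac_dom (prod x (T - {i}) * x i)"
    by (rule localization_map_class(2)[OF prod_nonzerodivisor prod_C x_nonzerodivisor x_C q])
  then show ?thesis using prod.remove[of T i x] i by (simp add: mult.commute)
qed

lemma enc_cong: "(\<And>T. card T = p \<Longrightarrow> c T = c' T) \<Longrightarrow> enc p c = enc p c'"
  by (auto simp: enc_def fun_eq_iff)

lemma enc_inj: "enc p c = enc p c' \<Longrightarrow> cochain p c \<Longrightarrow> card T = p \<Longrightarrow> c T = c' T"
  using frac_class_inj[OF prod_nonzerodivisor, of "c T" T "c' T"]
  by (auto simp: enc_def cochain_def dest: fun_cong[of _ _ T])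

lemma cech_carrier: "carrier (cech_module S M x p) = enc p ` {c. cochain p c}"
proof (intro equalityI subsetI)
  fix g assume "g \<in> carrier (cech_module S M x p)"
  then have g: "g \<in> (\<Pi>\<^sub>E T\<in>{T. card T = p}. Cl T ` D T)"
    by (simp add: cech_module_def cech_loc_def finprod_x localization_carrier[OF prod_nonzerodivisor])
  then have "\<forall>T. \<exists>q. card T = p \<longrightarrow> g T = Cl T q \<and> q \<in> D T" by (auto simp: PiE_def Pi_def)
  then obtain c where c: "\<And>T. card T = p \<Longrightarrow> g T = Cl T (c T) \<and> c T \<in> D T" by metis
  then have "g = enc p c" using g by (auto simp: enc_def fun_eq_iff PiE_def extensional_def)
  then show "g \<in> enc p ` {c. cochain p c}" using c by (auto simp: cochain_def)
next
  fix g assume "g \<in> enc p ` {c. cochain p c}"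
  then show "g \<in> carrier (cech_module S M x p)"
    by (auto simp: cech_module_def cech_loc_def finprod_x localization_carrier[OF prod_nonzerodivisor] enc_def cochain_def)
qed

lemma cech_zero: "\<zero>\<^bsub>cech_module S M x p\<^esub> = enc p (\<lambda>_. 0)"
  by (simp add: cech_module_def cech_loc_def finprod_x enc_def localization_zero[OF prod_nonzerodivisor prod_C])

lemma cochain_zero: "cochain p (\<lambda>_. 0)"
  by (simp add: cochain_def frac_dom_zero[OF prod_nonzerodivisor prod_C])

lemma cochain_add: "cochain p c \<Longrightarrow> cochain p c' \<Longrightarrow> cochain p (\<lambda>T. c T + c' T)"
  by (simp add: cochain_def frac_dom_add[OF prod_nonzerodivisor prod_C])

lemma cochain_scale: "(\<And>m. m \<in> C \<Longrightarrow> r * m \<in> C) \<Longrightarrow> cochain p c \<Longrightarrow> cochain p (\<lambda>T. to_frac r * c T)"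
  by (simp add: cochain_def frac_dom_scale[OF prod_nonzerodivisor prod_C])

lemma cech_add:
  "cochain p c \<Longrightarrow> cochain p c' \<Longrightarrow> enc p c \<oplus>\<^bsub>cech_module S M x p\<^esub> enc p c' = enc p (\<lambda>T. c T + c' T)"
  by (auto simp: cech_module_def cech_loc_def finprod_x enc_def cochain_def localization_add[OF prod_nonzerodivisor prod_C] intro!: restrict_ext)

lemma cech_smult:
  assumes "\<And>m. m \<in> C \<Longrightarrow> r * m \<in> C" "cochain p c"
  shows "r \<odot>\<^bsub>cech_module S M x p\<^esub> enc p c = enc p (\<lambda>T. to_frac r * c T)"
  using assms localization_smult[OF prod_nonzerodivisor prod_C assms(1)]
  by (auto simp: cech_module_def cech_loc_def finprod_x enc_def cochain_def intro!: restrict_ext)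

lemma D_sign: "q \<in> D T \<Longrightarrow> koszul_sign i U * q \<in> D T"
proof -
  assume q: "q \<in> D T"
  have "addsub (D T)"
    unfolding addsub_def
  proof (intro conjI ballI)
    show "0 \<in> D T" by (rule frac_dom_zero[OF prod_nonzerodivisor prod_C])
    show "p - q \<in> D T" if "p \<in> D T" "q \<in> D T" for p q
      using frac_dom_add[OF prod_nonzerodivisor prod_C that(1) frac_dom_uminus[OF prod_nonzerodivisor prod_C that(2)]] by simp
  qed
  then show ?thesis using q by (rule koszul_sign_mem)
qed

text \<open>The localization maps being inclusions, the alternating sum is the Koszul differential
  with all coefficients \<open>1\<close>.\<close>

lemma cech_diff_enc:
  assumes c: "cochain p c"
  shows "cech_diff S M x p (enc p c) = enc (Suc p) (koszul_diff (\<lambda>_. 1) c)" "cochain (Suc p) (koszul_diff (\<lambda>_. 1) c)"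
proof -
  have *: "(\<Oplus>\<^bsub>cech_loc S M x T\<^esub>i\<in>T.
        (let z = localization_map S M (\<Otimes>\<^bsub>S\<^esub>j\<in>T - {i}. x j) (x i) (enc p c (T - {i}))
         in if even (card {j \<in> T. j < i}) then z else \<ominus>\<^bsub>cech_loc S M x T\<^esub> z)) = Cl T (koszul_diff (\<lambda>_. 1) c T) \<and> koszul_diff (\<lambda>_. 1) c T \<in> D T"
    if T: "card T = Suc p" for T
  proof -
    interpret L: abelian_group "localization S M (prod x T)"
      by (rule abelian_group_localization[OF prod_nonzerodivisor prod_C])
    have cT: "c (T - {i}) \<in> D (T - {i})" "c (T - {i}) \<in> D T" if "i \<in> T" for i
    proof -
      have "card (T - {i}) = p" using T that by simp
      then show "c (T - {i}) \<in> D (T - {i})" using c by (simp add: cochain_def)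
      then show "c (T - {i}) \<in> D T" by (rule D_mono[OF that])
    qed
    have summand: "(let z = localization_map S M (\<Otimes>\<^bsub>S\<^esub>j\<in>T - {i}. x j) (x i) (enc p c (T - {i}))
         in if even (card {j \<in> T. j < i}) then z else \<ominus>\<^bsub>localization S M (prod x T)\<^esub> z) = Cl T (koszul_sign i T * c (T - {i}))"
      if i: "i \<in> T" for i
    proof -
      have lm: "localization_map S M (prod x (T - {i})) (x i) (Cl (T - {i}) (c (T - {i}))) = frac_class (prod x (T - {i}) * x i) (c (T - {i}))"
        by (rule localization_map_class(1)[OF prod_nonzerodivisor prod_C x_nonzerodivisor x_C cT(1)[OF i]])
      have "enc p c (T - {i}) = Cl (T - {i}) (c (T - {i}))" using T i by (simp add: enc_def)
      moreover have "prod x (T - {i}) * x i = prod x T" using prod.remove[of T i x] i by (simp add: mult.commute)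
      ultimately have "localization_map S M (\<Otimes>\<^bsub>S\<^esub>j\<in>T - {i}. x j) (x i) (enc p c (T - {i})) = Cl T (c (T - {i}))"
        using lm by (simp add: finprod_x)
      then show ?thesis
        using localization_uminus[OF prod_nonzerodivisor prod_C cT(2)[OF i]] by (simp add: koszul_sign_def Let_def)
    qed
    have "(\<Oplus>\<^bsub>cech_loc S M x T\<^esub>i\<in>T.
        (let z = localization_map S M (\<Otimes>\<^bsub>S\<^esub>j\<in>T - {i}. x j) (x i) (enc p c (T - {i}))
         in if even (card {j \<in> T. j < i}) then z else \<ominus>\<^bsub>cech_loc S M x T\<^esub> z)) =
      (\<Oplus>\<^bsub>localization S M (prod x T)\<^esub>i\<in>T. Cl T (koszul_sign i T * c (T - {i})))"
      unfolding cech_loc_def finprod_x[of T]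
    proof (rule L.finsum_cong')
      show "(\<lambda>i. Cl T (koszul_sign i T * c (T - {i}))) \<in> T \<rightarrow> carrier (localization S M (prod x T))"
        unfolding localization_carrier[OF prod_nonzerodivisor] using cT D_sign by blast
    qed (use summand in auto)
    moreover have "koszul_diff (\<lambda>_. 1) c T = (\<Sum>i\<in>T. koszul_sign i T * c (T - {i}))" by (simp add: koszul_diff_def)
    moreover have "(\<Oplus>\<^bsub>localization S M (prod x T)\<^esub>i\<in>T. Cl T (koszul_sign i T * c (T - {i}))) = Cl T (\<Sum>i\<in>T. koszul_sign i T * c (T - {i}))
        \<and> (\<Sum>i\<in>T. koszul_sign i T * c (T - {i})) \<in> D T"
      by (rule localization_finsum[OF prod_nonzerodivisor prod_C finite], assumption, rule D_sign[OF cT(2)])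
    ultimately show ?thesis by simp
  qed
  then show "cochain (Suc p) (koszul_diff (\<lambda>_. 1) c)" by (simp add: cochain_def)
  show "cech_diff S M x p (enc p c) = enc (Suc p) (koszul_diff (\<lambda>_. 1) c)"
    unfolding cech_diff_def enc_def[of "Suc p"] by (rule restrict_ext) (use * in simp)
qed

text \<open>Writing \<open>Suc (card T) = p\<close> covers degree zero as well, where the condition
  becomes \<open>c {} = 0\<close>.\<close>

definition boundary :: "nat \<Rightarrow> ('i set \<Rightarrow> 'p total_frac) \<Rightarrow> bool" where
  "boundary p c \<longleftrightarrow> (\<exists>b. (\<forall>T. Suc (card T) = p \<longrightarrow> b T \<in> D T) \<and> (\<forall>T. card T = p \<longrightarrow> c T = koszul_diff (\<lambda>_. 1) b T))"

lemma boundary_cochain: "boundary p c \<Longrightarrow> cochain p c"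
proof -
  assume "boundary p c"
  then obtain b where b: "\<And>T. Suc (card T) = p \<Longrightarrow> b T \<in> D T" "\<And>T. card T = p \<Longrightarrow> c T = koszul_diff (\<lambda>_. 1) b T"
    unfolding boundary_def by blast
  show "cochain p c"
  proof (cases p)
    case 0
    then show ?thesis using b(2) cochain_zero[of 0] by (simp add: cochain_def)
  next
    case (Suc p')
    then have "cochain p' b" using b(1) by (simp add: cochain_def)
    from cech_diff_enc(2)[OF this] show ?thesis using b(2) Suc by (simp add: cochain_def)
  qed
qed

lemma coboundaries_eq: "cech_coboundaries S M x p = enc p ` {c. boundary p c}"
proof (cases p)
  case 0
  have "boundary 0 c \<longleftrightarrow> c {} = 0" for c by (auto simp: boundary_def)
  moreover have "enc 0 c = enc 0 (\<lambda>_. 0)" if "c {} = 0" for c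
    by (rule enc_cong) (use that in simp)
  moreover have "(\<lambda>_. 0 :: 'p total_frac) \<in> {c. c {} = 0}" by simp
  ultimately have "enc p ` {c. boundary p c} = {enc 0 (\<lambda>_. 0)}"
    unfolding 0 \<open>\<And>c. boundary 0 c \<longleftrightarrow> c {} = 0\<close> by blast
  then show ?thesis using 0 by (simp add: cech_coboundaries_def cech_zero)
next
  case (Suc p')
  show ?thesis
  proof (intro equalityI subsetI)
    fix g assume "g \<in> cech_coboundaries S M x p"
    then obtain b where b: "cochain p' b" "g = cech_diff S M x p' (enc p' b)"
      using Suc by (auto simp: cech_coboundaries_def cech_carrier)
    have "boundary p (koszul_diff (\<lambda>_. 1) b)" using b(1) Suc by (auto simp: boundary_def cochain_def)
    then show "g \<in> enc p ` {c. boundary p c}" using b cech_diff_enc(1)[OF b(1)] Suc by blast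
  next
    fix g assume "g \<in> enc p ` {c. boundary p c}"
    then obtain c b where *: "g = enc p c" "\<forall>T. Suc (card T) = p \<longrightarrow> b T \<in> D T" "\<forall>T. card T = p \<longrightarrow> c T = koszul_diff (\<lambda>_. 1) b T"
      by (auto simp: boundary_def)
    have b: "cochain p' b" using * Suc by (simp add: cochain_def)
    have "g = enc p (koszul_diff (\<lambda>_. 1) b)" unfolding *(1) using * by (intro enc_cong) auto
    then have "g = cech_diff S M x p' (enc p' b)" using cech_diff_enc(1)[OF b] Suc by simp
    then show "g \<in> cech_coboundaries S M x p" using b Suc by (auto simp: cech_coboundaries_def cech_carrier)
  qed
qed

lemma cocycles_eq: "cech_cocycles S M x p = enc p ` {c. cochain p c \<and> (\<forall>T. card T = Suc p \<longrightarrow> koszul_diff (\<lambda>_. 1) c T = 0)}"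
proof -
  have "cech_diff S M x p (enc p c) = \<zero>\<^bsub>cech_module S M x (Suc p)\<^esub> \<longleftrightarrow> (\<forall>T. card T = Suc p \<longrightarrow> koszul_diff (\<lambda>_. 1) c T = 0)"
    if c: "cochain p c" for c
    unfolding cech_diff_enc(1)[OF c] cech_zero
    using enc_inj[OF _ cech_diff_enc(2)[OF c], of "\<lambda>_. 0"] enc_cong[of "Suc p" "koszul_diff (\<lambda>_. 1) c" "\<lambda>_. 0"] by blast
  then show ?thesis unfolding cech_cocycles_def cech_carrier by blast
qed

lemma boundary_zero: "boundary p (\<lambda>_. 0)"
  unfolding boundary_def by (intro exI[of _ "\<lambda>_. 0"]) (simp add: frac_dom_zero[OF prod_nonzerodivisor prod_C])

lemma boundary_add: "boundary p c \<Longrightarrow> boundary p c' \<Longrightarrow> boundary p (\<lambda>T. c T + c' T)"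
proof -
  assume "boundary p c" "boundary p c'"
  then obtain b b' where *: "\<forall>T. Suc (card T) = p \<longrightarrow> b T \<in> D T" "\<forall>T. card T = p \<longrightarrow> c T = koszul_diff (\<lambda>_. 1) b T"
    "\<forall>T. Suc (card T) = p \<longrightarrow> b' T \<in> D T" "\<forall>T. card T = p \<longrightarrow> c' T = koszul_diff (\<lambda>_. 1) b' T" unfolding boundary_def by blast
  then show ?thesis unfolding boundary_def
    by (intro exI[of _ "\<lambda>T. b T + b' T"]) (simp add: koszul_diff_add frac_dom_add[OF prod_nonzerodivisor prod_C])
qed

lemma boundary_scale:
  assumes "\<And>m. m \<in> C \<Longrightarrow> r * m \<in> C" "boundary p c"
  shows "boundary p (\<lambda>T. to_frac r * c T)"
proof -
  obtain b where *: "\<forall>T. Suc (card T) = p \<longrightarrow> b T \<in> D T" "\<forall>T. card T = p \<longrightarrow> c T = koszul_diff (\<lambda>_. 1) b T"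
    using assms(2) unfolding boundary_def by blast
  then show ?thesis unfolding boundary_def
    by (intro exI[of _ "\<lambda>T. to_frac r * b T"]) (simp add: koszul_diff_scale frac_dom_scale[OF prod_nonzerodivisor prod_C assms(1)])
qed

lemma boundary_uminus: "boundary p c \<Longrightarrow> boundary p (\<lambda>T. - c T)"
  using boundary_scale[of "- 1" p c] addsubD(3)[OF C_addsub] by (simp add: to_frac_minus)

definition cohom_class :: "nat \<Rightarrow> ('i set \<Rightarrow> 'p total_frac) \<Rightarrow> ('i set \<Rightarrow> ('p \<times> nat) set) set" where
  "cohom_class p c = {enc p (\<lambda>T. b T + c T) | b. boundary p b}"

lemma coset_eq:
  assumes "cochain p c"
  shows "cech_coboundaries S M x p +>\<^bsub>cech_module S M x p\<^esub> enc p c = cohom_class p c"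
  unfolding a_r_coset_def' coboundaries_eq cohom_class_def
  using cech_add[OF boundary_cochain assms] by auto

lemma cohom_class_boundary: "boundary p c \<Longrightarrow> cohom_class p c = cech_coboundaries S M x p"
  unfolding cohom_class_def coboundaries_eq
proof (intro equalityI subsetI)
  assume c: "boundary p c"
  fix g assume "g \<in> enc p ` {c. boundary p c}"
  then obtain b where b: "g = enc p b" "boundary p b" by blast
  have "boundary p (\<lambda>T. b T + - c T)" by (rule boundary_add[OF b(2) boundary_uminus[OF c]])
  moreover have "g = enc p (\<lambda>T. (b T + - c T) + c T)" by (simp add: b)
  ultimately show "g \<in> {enc p (\<lambda>T. b T + c T) | b. boundary p b}"
    by (intro CollectI exI[of _ "\<lambda>T. b T + - c T"] conjI)
qed (auto intro: boundary_add)

lemma cohom_class_add: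
  assumes "cochain p c" "cochain p c'"
  shows "cohom_class p c <+>\<^bsub>cech_module S M x p\<^esub> cohom_class p c' = cohom_class p (\<lambda>T. c T + c' T)"
proof (intro equalityI subsetI)
  fix g assume "g \<in> cohom_class p c <+>\<^bsub>cech_module S M x p\<^esub> cohom_class p c'"
  then obtain b b' where b: "boundary p b" "boundary p b'"
    and g: "g = enc p (\<lambda>T. b T + c T) \<oplus>\<^bsub>cech_module S M x p\<^esub> enc p (\<lambda>T. b' T + c' T)"
    unfolding set_add_def' cohom_class_def by blast
  have "g = enc p (\<lambda>T. (b T + c T) + (b' T + c' T))"
    unfolding g by (rule cech_add[OF cochain_add[OF boundary_cochain[OF b(1)] assms(1)] cochain_add[OF boundary_cochain[OF b(2)] assms(2)]])
  also have "\<dots> = enc p (\<lambda>T. (b T + b' T) + (c T + c' T))" by (simp add: algebra_simps)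
  finally show "g \<in> cohom_class p (\<lambda>T. c T + c' T)"
    unfolding cohom_class_def using boundary_add[OF b] by (intro CollectI exI[of _ "\<lambda>T. b T + b' T"] conjI)
next
  fix g assume "g \<in> cohom_class p (\<lambda>T. c T + c' T)"
  then obtain b where b: "boundary p b" "g = enc p (\<lambda>T. b T + (c T + c' T))" unfolding cohom_class_def by blast
  have "g = enc p (\<lambda>T. (b T + c T) + (0 + c' T))" using b by (simp add: algebra_simps)
  also have "\<dots> = enc p (\<lambda>T. b T + c T) \<oplus>\<^bsub>cech_module S M x p\<^esub> enc p (\<lambda>T. 0 + c' T)"
    by (rule cech_add[OF cochain_add[OF boundary_cochain[OF b(1)] assms(1)] cochain_add[OF cochain_zero assms(2)], symmetric])
  finally show "g \<in> cohom_class p c <+>\<^bsub>cech_module S M x p\<^esub> cohom_class p c'"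
    unfolding set_add_def' cohom_class_def using b(1) boundary_zero[of p] by blast
qed

text \<open>The product is a union over the representatives of the class; changing the
  representative changes the result by \<open>r\<close> times a boundary, which is a
  boundary.\<close>

lemma cohom_class_smult:
  assumes r: "\<And>m. m \<in> C \<Longrightarrow> r * m \<in> C" and c: "cochain p c"
  shows "r \<odot>\<^bsub>local_cohomology S M x p\<^esub> cohom_class p c = cohom_class p (\<lambda>T. to_frac r * c T)"
proof -
  have "cech_coboundaries S M x p +>\<^bsub>cech_module S M x p\<^esub> (r \<odot>\<^bsub>cech_module S M x p\<^esub> g) = cohom_class p (\<lambda>T. to_frac r * c T)"
    if "g \<in> cohom_class p c" for g
  proof -
    obtain b where b: "boundary p b" "g = enc p (\<lambda>T. b T + c T)" using \<open>g \<in> cohom_class p c\<close> unfolding cohom_class_def by blast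
    have rb: "boundary p (\<lambda>T. to_frac r * b T)" by (rule boundary_scale[OF _ b(1)]) (rule r)
    have bc: "cochain p (\<lambda>T. b T + c T)" by (rule cochain_add[OF boundary_cochain[OF b(1)] c])
    have "r \<odot>\<^bsub>cech_module S M x p\<^esub> g = enc p (\<lambda>T. to_frac r * (b T + c T))" unfolding b(2) by (rule cech_smult[OF r bc])
    then have "cech_coboundaries S M x p +>\<^bsub>cech_module S M x p\<^esub> (r \<odot>\<^bsub>cech_module S M x p\<^esub> g) = cohom_class p (\<lambda>T. to_frac r * (b T + c T))"
      using coset_eq[OF cochain_scale[OF r bc]] by simp
    also have "\<dots> = cohom_class p (\<lambda>T. to_frac r * c T)"
      unfolding cohom_class_def
    proof (intro equalityI subsetI)
      fix h assume "h \<in> {enc p (\<lambda>T. a T + to_frac r * (b T + c T)) | a. boundary p a}"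
      then obtain a where a: "boundary p a" "h = enc p (\<lambda>T. a T + to_frac r * (b T + c T))" by blast
      have "h = enc p (\<lambda>T. (a T + to_frac r * b T) + to_frac r * c T)" unfolding a(2) by (simp add: algebra_simps)
      then show "h \<in> {enc p (\<lambda>T. a T + to_frac r * c T) | a. boundary p a}"
        using boundary_add[OF a(1) rb] by (intro CollectI exI[of _ "\<lambda>T. a T + to_frac r * b T"] conjI)
    next
      fix h assume "h \<in> {enc p (\<lambda>T. a T + to_frac r * c T) | a. boundary p a}"
      then obtain a where a: "boundary p a" "h = enc p (\<lambda>T. a T + to_frac r * c T)" by blast
      have "h = enc p (\<lambda>T. (a T + - (to_frac r * b T)) + to_frac r * (b T + c T))" unfolding a(2) by (simp add: algebra_simps)
      then show "h \<in> {enc p (\<lambda>T. a T + to_frac r * (b T + c T)) | a. boundary p a}"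
        using boundary_add[OF a(1) boundary_uminus[OF rb]] by (intro CollectI exI[of _ "\<lambda>T. a T + - (to_frac r * b T)"] conjI)
    qed
    finally show ?thesis .
  qed
  moreover have "cohom_class p c \<noteq> {}" unfolding cohom_class_def using boundary_zero by blast
  ultimately show ?thesis unfolding local_cohomology_def by (simp add: UN_constant_eq)
qed

end

section \<open>The local cohomology of the extended Rees algebra\<close>

lemma ideal_ideal_powers:
  fixes I :: "'d::finite \<Rightarrow> 'a::comm_ring_1 set"
  assumes "\<And>i. ideal (I i) ring_of_type_algebra"
  shows "ideal (ideal_powers ring_of_type_algebra I n) ring_of_type_algebra"
proof -
  let ?R = "ring_of_type_algebra :: 'a ring"
  interpret R: cring ?R by (rule cring_from_type_algebra)
  interpret P: comm_monoid "ideals_set ?R" by (rule R.ideals_set_is_comm_monoid)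
  have "(\<lambda>i. I i [^]\<^bsub>ideals_set ?R\<^esub> nat (vec_nth n i)) \<in> UNIV \<rightarrow> carrier (ideals_set ?R)"
    using P.nat_pow_closed assms by auto
  from P.finprod_closed[OF this] show ?thesis by (simp add: ideal_powers_def)
qed

text \<open>The truncated exponents satisfy
  \<open>nat (m i) + nat (n i) \<ge> nat (m i + n i)\<close>, and higher powers of an ideal are
  smaller.\<close>

lemma ideal_powers_mult:
  fixes I :: "'d::finite \<Rightarrow> 'a::comm_ring_1 set"
  assumes I: "\<And>i. ideal (I i) ring_of_type_algebra"
    and r: "r \<in> ideal_powers ring_of_type_algebra I m" and s: "s \<in> ideal_powers ring_of_type_algebra I n"
  shows "r * s \<in> ideal_powers ring_of_type_algebra I (m + n)"
proof -
  let ?R = "ring_of_type_algebra :: 'a ring"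
  let ?pow = "\<lambda>i (k::nat). I i [^]\<^bsub>ideals_set ?R\<^esub> k"
  interpret R: cring ?R by (rule cring_from_type_algebra)
  interpret P: comm_monoid "ideals_set ?R" by (rule R.ideals_set_is_comm_monoid)
  have car: "I i \<in> carrier (ideals_set ?R)" for i using I by simp
  have pw: "?pow i k \<in> carrier (ideals_set ?R)" for i k by (rule P.nat_pow_closed[OF car])
  have le: "?pow i (nat (vec_nth m i) + nat (vec_nth n i)) \<subseteq> ?pow i (nat (vec_nth (m + n) i))" for i
  proof -
    define k where "k = nat (vec_nth (m + n) i)"
    obtain l where l: "nat (vec_nth m i) + nat (vec_nth n i) = k + l"
      using that[of "nat (vec_nth m i) + nat (vec_nth n i) - k"] by (simp add: k_def)
    have sub: "submod UNIV (*) (?pow i k)" using pw[of i k] by (simp add: ideal_type_ring)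
    have "?pow i (k + l) = ?pow i k \<cdot>\<^bsub>?R\<^esub> ?pow i l" using P.nat_pow_mult[OF car, of i k l] by simp
    also have "\<dots> \<subseteq> ?pow i k"
    proof (rule ideal_prod_subset[OF sub])
      show "p * q \<in> ?pow i k" if "p \<in> ?pow i k" for p q
        using submodD(3)[OF sub _ that, of q] by (simp add: mult.commute)
    qed
    finally show ?thesis unfolding l k_def .
  qed
  have mono: "(\<Otimes>\<^bsub>ideals_set ?R\<^esub>i\<in>S. ?pow i (nat (vec_nth m i) + nat (vec_nth n i))) \<subseteq> (\<Otimes>\<^bsub>ideals_set ?R\<^esub>i\<in>S. ?pow i (nat (vec_nth (m + n) i)))" for S
    using finite[of S]
  proof (induction S rule: finite_induct)
    case (insert i S)
    have prod: "(\<Otimes>\<^bsub>ideals_set ?R\<^esub>j\<in>insert i S. ?pow j (f j)) = ?pow i (f i) \<cdot>\<^bsub>?R\<^esub> (\<Otimes>\<^bsub>ideals_set ?R\<^esub>j\<in>S. ?pow j (f j))" for f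
      using P.finprod_insert[OF insert(1,2), of "\<lambda>j. ?pow j (f j)"] pw by (simp del: ideals_set_simps(1))
    have "(\<Otimes>\<^bsub>ideals_set ?R\<^esub>i\<in>insert i S. ?pow i (nat (vec_nth (m + n) i))) \<in> carrier (ideals_set ?R)"
      by (rule P.finprod_closed) (use pw in simp)
    then have sub: "submod UNIV (*) (\<Otimes>\<^bsub>ideals_set ?R\<^esub>i\<in>insert i S. ?pow i (nat (vec_nth (m + n) i)))"
      by (simp add: ideal_type_ring)
    show ?case unfolding prod[of "\<lambda>i. nat (vec_nth m i) + nat (vec_nth n i)"]
    proof (rule ideal_prod_subset[OF sub])
      fix p q assume pq: "p \<in> ?pow i (nat (vec_nth m i) + nat (vec_nth n i))"
        "q \<in> (\<Otimes>\<^bsub>ideals_set ?R\<^esub>i\<in>S. ?pow i (nat (vec_nth m i) + nat (vec_nth n i)))"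
      have "p \<otimes>\<^bsub>?R\<^esub> q \<in> ?pow i (nat (vec_nth (m + n) i)) \<cdot>\<^bsub>?R\<^esub> (\<Otimes>\<^bsub>ideals_set ?R\<^esub>i\<in>S. ?pow i (nat (vec_nth (m + n) i)))"
        by (rule ideal_prod.prod) (use pq le insert.IH in blast)+
      then show "p * q \<in> (\<Otimes>\<^bsub>ideals_set ?R\<^esub>i\<in>insert i S. ?pow i (nat (vec_nth (m + n) i)))"
        unfolding prod[of "\<lambda>i. nat (vec_nth (m + n) i)"] by simp
    qed
  qed simp
  have "r \<otimes>\<^bsub>?R\<^esub> s \<in> ideal_powers ?R I m \<otimes>\<^bsub>ideals_set ?R\<^esub> ideal_powers ?R I n"
    unfolding ideals_set_simps by (rule ideal_prod.prod[OF r s])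
  also have "\<dots> = (\<Otimes>\<^bsub>ideals_set ?R\<^esub>i\<in>UNIV. ?pow i (nat (vec_nth m i)) \<otimes>\<^bsub>ideals_set ?R\<^esub> ?pow i (nat (vec_nth n i)))"
    unfolding ideal_powers_def by (rule P.finprod_multf[symmetric]) (use pw in auto)
  also have "\<dots> = (\<Otimes>\<^bsub>ideals_set ?R\<^esub>i\<in>UNIV. ?pow i (nat (vec_nth m i) + nat (vec_nth n i)))"
    unfolding P.nat_pow_mult[OF car] ..
  also have "\<dots> \<subseteq> ideal_powers ?R I (m + n)" unfolding ideal_powers_def by (rule mono)
  finally show ?thesis by simp
qed

lemma (in fraction_cech) cohom_class_cong:
  "(\<And>T. card T = p \<Longrightarrow> c T = c' T) \<Longrightarrow> cohom_class p c = cohom_class p c'"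
proof -
  assume "\<And>T. card T = p \<Longrightarrow> c T = c' T"
  then have "enc p (\<lambda>T. b T + c T) = enc p (\<lambda>T. b T + c' T)" for b by (intro enc_cong) simp
  then show ?thesis by (simp add: cohom_class_def)
qed

section \<open>Graded local cohomology in terms of fractions\<close>

context cm_reduction
begin

abbreviation "S \<equiv> extended_rees_ring (ideal_powers ring_of_type_algebra I)"
abbreviation "M \<equiv> extended_rees_module F"
abbreviation "wt \<equiv> (\<lambda>i::'d. axis i 1 :: (int, 'd) vec)"
abbreviation "xs i \<equiv> Poly_Mapping.single (wt i) (x i i)"

lemma powers_addsub: "addsub (ideal_powers ring_of_type_algebra I n)"
  using ideal_ideal_powers[OF I_ideal] by (intro addsub_submod) (simp add: ideal_type_ring)

lemma comm_monoid_S: "comm_monoid S"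
proof (rule comm_monoidI)
  show "\<one>\<^bsub>S\<^esub> \<in> carrier S"
    using single_in_extended_rees[where N = "ideal_powers ring_of_type_algebra I", OF powers_addsub, of 0 1] by (simp add: extended_rees_ring_simps ideal_powers_zero)
  show "p \<otimes>\<^bsub>S\<^esub> q \<in> carrier S" if "p \<in> carrier S" "q \<in> carrier S" for p q
    unfolding extended_rees_ring_simps
  proof (rule extended_rees_mult)
    show "p \<in> extended_rees (ideal_powers ring_of_type_algebra I)" "q \<in> extended_rees (ideal_powers ring_of_type_algebra I)"
      using that by (simp_all add: extended_rees_ring_simps)
  qed (rule powers_addsub, rule ideal_powers_mult[OF I_ideal])
qed (simp_all add: extended_rees_ring_simps mult_ac)

sublocale K: fraction_cech S M "extended_rees F" xs
proof (intro fraction_cech.intro fraction_module.intro fraction_cech_axioms.intro)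
  show "p \<otimes>\<^bsub>S\<^esub> q = p * q" "\<one>\<^bsub>S\<^esub> = 1" for p q by (simp_all add: extended_rees_ring_simps)
  show "carrier M = extended_rees F" "p \<oplus>\<^bsub>M\<^esub> q = p + q" "\<zero>\<^bsub>M\<^esub> = 0" "p \<odot>\<^bsub>M\<^esub> q = p * q" for p q
    by (simp_all add: extended_rees_module_simps)
  show "addsub (extended_rees F)" by (rule addsub_rees)
  show "comm_monoid S" by (rule comm_monoid_S)
  show "xs i \<in> carrier S" for i
    unfolding extended_rees_ring_simps single_in_extended_rees[where N = "ideal_powers ring_of_type_algebra I", OF powers_addsub] ideal_powers_axis[OF I_ideal] by (rule x_mem)
  show "nonzerodivisor (xs i)" for i by (rule nonzerodivisor_single[OF x_nonzerodivisor])
  show "xs i * m \<in> extended_rees F" if "m \<in> extended_rees F" for i m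
    by (rule rees_mult[OF _ that]) (use x_mem I_F single_in_rees in blast)
qed

abbreviation "Loc T n \<equiv> loc aQ wt FQ T n"

lemma to_frac_prod_xs: "to_frac (prod xs T) = prod aQ T"
  by (simp add: to_frac_prod frac_monom_def)

lemma loc_fraction:
  "q \<in> Loc T n \<longleftrightarrow> (\<exists>m k. m \<in> extended_rees_component F (n + int k *s sum wt T) \<and> to_frac m = to_frac (prod xs T) ^ k * q)"
proof -
  have "FQ k = to_frac ` extended_rees_component F k" for k
    by (simp add: extended_rees_component_def frac_monom_def image_image)
  then have "q \<in> Loc T n \<longleftrightarrow> (\<exists>k. prod aQ T ^ k * q \<in> to_frac ` extended_rees_component F (n + int k *s sum wt T))"
    by (simp add: loc_def)
  also have "\<dots> \<longleftrightarrow> (\<exists>m k. m \<in> extended_rees_component F (n + int k *s sum wt T) \<and> to_frac m = to_frac (prod xs T) ^ k * q)"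
    unfolding to_frac_prod_xs image_iff Bex_def eq_commute[of "prod aQ T ^ k * q" for k] by (rule ex_comm)
  finally show ?thesis .
qed

lemma component_subset: "extended_rees_component F n \<subseteq> extended_rees F"
  using single_in_rees by (auto simp: extended_rees_component_def)

lemma Loc_D: "q \<in> Loc T n \<Longrightarrow> q \<in> K.D T"
proof -
  assume "q \<in> Loc T n"
  then obtain m k where m: "m \<in> extended_rees_component F (n + int k *s sum wt T)" "to_frac m = to_frac (prod xs T) ^ k * q"
    unfolding loc_fraction by blast
  show ?thesis by (rule K.frac_domI[OF subsetD[OF component_subset m(1)] m(2)])
qed

text \<open>A class of fractions determines its quotient, so a homogeneous numerator of any
  representative is the numerator that \<open>loc\<close> asks for.\<close>

lemma enc_component:
  assumes "K.cochain p c"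
  shows "K.enc p c \<in> cech_component S M (extended_rees_component F) xs wt p n \<longleftrightarrow> (\<forall>T. card T = p \<longrightarrow> c T \<in> Loc T n)"
proof -
  have "K.Cl T (c T) \<in> {fraction S M (prod xs T) m k | m k. m \<in> extended_rees_component F (n + int k *s sum wt T)} \<longleftrightarrow> c T \<in> Loc T n"
    if T: "card T = p" for T
  proof
    assume "K.Cl T (c T) \<in> {fraction S M (prod xs T) m k | m k. m \<in> extended_rees_component F (n + int k *s sum wt T)}"
    then obtain m k where m: "K.Cl T (c T) = fraction S M (prod xs T) m k" "m \<in> extended_rees_component F (n + int k *s sum wt T)" by blast
    then have mC: "m \<in> extended_rees F" using component_subset by blast
    obtain q where q: "to_frac m = to_frac (prod xs T) ^ k * q" by (rule K.frac_exists[OF K.prod_nonzerodivisor])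
    have "K.Cl T (c T) = K.Cl T q" unfolding m(1) by (rule K.fraction_eq[OF K.prod_nonzerodivisor mC q])
    then have "c T = q" by (rule K.frac_class_inj[OF K.prod_nonzerodivisor, rotated]) (use assms T in \<open>simp add: K.cochain_def\<close>)
    then show "c T \<in> Loc T n" unfolding loc_fraction using m(2) q by blast
  next
    assume "c T \<in> Loc T n"
    then obtain m k where m: "m \<in> extended_rees_component F (n + int k *s sum wt T)" "to_frac m = to_frac (prod xs T) ^ k * c T"
      unfolding loc_fraction by blast
    then have mC: "m \<in> extended_rees F" using component_subset by blast
    from K.fraction_eq[OF K.prod_nonzerodivisor mC m(2)] m(1)
    show "K.Cl T (c T) \<in> {fraction S M (prod xs T) m k | m k. m \<in> extended_rees_component F (n + int k *s sum wt T)}" by blast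
  qed
  then show ?thesis unfolding cech_component_def K.finprod_x K.enc_def restrict_PiE_iff by blast
qed

abbreviation "H p n \<equiv> rees_local_cohomology_component I F (\<lambda>i. x i i) p n"

lemma H_zero: "\<zero>\<^bsub>H p n\<^esub> = cech_coboundaries S M xs p"
  by (simp add: rees_local_cohomology_component_def Let_def local_cohomology_def)

lemma H_carrier:
  "carrier (H p n) = {K.cohom_class p c | c. (\<forall>T. card T = p \<longrightarrow> c T \<in> Loc T n) \<and> (\<forall>T. card T = Suc p \<longrightarrow> koszul_diff (\<lambda>_. 1) c T = 0)}"
proof -
  have "carrier (H p n) = (\<lambda>g. cech_coboundaries S M xs p +>\<^bsub>cech_module S M xs p\<^esub> g) `
      (cech_cocycles S M xs p \<inter> cech_component S M (extended_rees_component F) xs wt p n)"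
    by (simp add: rees_local_cohomology_component_def Let_def local_cohomology_component_def)
  also have "\<dots> = {K.cohom_class p c | c. K.cochain p c \<and> (\<forall>T. card T = p \<longrightarrow> c T \<in> Loc T n) \<and> (\<forall>T. card T = Suc p \<longrightarrow> koszul_diff (\<lambda>_. 1) c T = 0)}"
    (is "?L = ?R")
  proof (intro equalityI subsetI)
    fix A assume "A \<in> ?L"
    then obtain g where g: "A = cech_coboundaries S M xs p +>\<^bsub>cech_module S M xs p\<^esub> g" "g \<in> cech_cocycles S M xs p"
      "g \<in> cech_component S M (extended_rees_component F) xs wt p n" by blast
    from g(2) obtain c where c: "g = K.enc p c" "K.cochain p c" "\<forall>T. card T = Suc p \<longrightarrow> koszul_diff (\<lambda>_. 1) c T = 0"
      unfolding K.cocycles_eq by blast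
    show "A \<in> ?R" using g(3) c enc_component[OF c(2)] K.coset_eq[OF c(2)] g(1) by blast
  next
    fix A assume "A \<in> ?R"
    then obtain c where c: "A = K.cohom_class p c" "K.cochain p c" "\<forall>T. card T = p \<longrightarrow> c T \<in> Loc T n" "\<forall>T. card T = Suc p \<longrightarrow> koszul_diff (\<lambda>_. 1) c T = 0"
      by blast
    have "K.enc p c \<in> cech_cocycles S M xs p \<inter> cech_component S M (extended_rees_component F) xs wt p n"
      unfolding K.cocycles_eq using c enc_component[OF c(2)] by blast
    then show "A \<in> ?L" using c(1) K.coset_eq[OF c(2)] by blast
  qed
  finally have *: "carrier (H p n) = \<dots>" .
  \<comment> \<open>Homogeneous entries lie in the localizations, so \<open>cochain\<close> is
    implied.\<close>
  have eq: "K.cochain p c \<and> (\<forall>T. card T = p \<longrightarrow> c T \<in> Loc T n) \<longleftrightarrow> (\<forall>T. card T = p \<longrightarrow> c T \<in> Loc T n)" for c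
    unfolding K.cochain_def using Loc_D by blast
  show ?thesis unfolding * conj_assoc[symmetric] eq ..
qed

lemma Loc_zero: "0 \<in> Loc T n"
  by (rule submodD(1)[OF Q.submod_loc[OF J.a_mem finite]])

lemma boundary_Loc:
  assumes "\<And>T. Suc (card T) = p \<Longrightarrow> b T \<in> Loc T n" "\<And>T. card T = p \<Longrightarrow> c T = koszul_diff (\<lambda>_. 1) b T"
  shows "K.boundary p c"
  unfolding K.boundary_def
proof (intro exI[of _ b] conjI allI impI)
  show "b T \<in> K.D T" if "Suc (card T) = p" for T by (rule Loc_D[OF assms(1)[OF that]])
qed (rule assms(2))

text \<open>\<open>vanishing_large\<close> for the whole ring modulo zero with all indices, where
  the condition on the indices outside \<open>J\<close> is empty.\<close>

lemma H_vanishing: "for_all_large (\<lambda>n. carrier (H p n) = {\<zero>\<^bsub>H p n\<^esub>})"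
proof -
  obtain m where m: "\<And>n. m \<le> n \<Longrightarrow> cech_vanish aQ wt UNIV FQ (\<lambda>_. {0}) p n"
    using J.vanishing_large[OF Q.graded_ideal_F Q.graded_ideal_zero, of UNIV] addsubD(1)[OF Q.F_addsub] by auto
  \<comment> \<open>\<open>for_all_large\<close> asks for a nonnegative bound.\<close>
  obtain m' where m': "m \<le> m'" "0 \<le> m'" by (rule vec_upper_bound)
  have "carrier (H p n) = {\<zero>\<^bsub>H p n\<^esub>}" if n: "m' \<le> n" for n
    unfolding H_zero
  proof (intro equalityI subsetI)
    have zero: "t = 0" if "t \<in> loc aQ wt (\<lambda>_. {0}) T n" for t :: "((int, 'd) vec \<Rightarrow>\<^sub>0 'a) total_frac" and T
      using that unfolding loc_zero[where q = "aQ :: 'd \<Rightarrow> ((int, 'd) vec \<Rightarrow>\<^sub>0 'a) total_frac", OF J.a_unit] by simp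
    have z: "(0 :: ((int, 'd) vec \<Rightarrow>\<^sub>0 'a) total_frac) \<in> loc aQ wt (\<lambda>_. {0}) T n" for T by (auto simp: loc_def)
    fix A assume "A \<in> carrier (H p n)"
    then obtain c where c: "A = K.cohom_class p c" "\<forall>T. card T = p \<longrightarrow> c T \<in> Loc T n" "\<forall>T. card T = Suc p \<longrightarrow> koszul_diff (\<lambda>_. 1) c T = 0"
      unfolding H_carrier by blast
    have "\<exists>b. (\<forall>T. T \<subseteq> UNIV \<longrightarrow> Suc (card T) = p \<longrightarrow> b T \<in> Loc T n) \<and>
        (\<forall>T. T \<subseteq> UNIV \<longrightarrow> card T = p \<longrightarrow> c T - koszul_diff (\<lambda>_. 1) b T \<in> loc aQ wt (\<lambda>_. {0}) T n)"
      by (rule vanishD[OF m[OF order_trans[OF m'(1) n], unfolded cech_vanish_def]]) (use c z in auto)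
    then obtain b where b: "\<forall>T. Suc (card T) = p \<longrightarrow> b T \<in> Loc T n"
      "\<forall>T. card T = p \<longrightarrow> c T - koszul_diff (\<lambda>_. 1) b T \<in> loc aQ wt (\<lambda>_. {0}) T n" by auto
    have z2: "c T = koszul_diff (\<lambda>_. 1) b T" if "card T = p" for T
      using zero[of "c T - koszul_diff (\<lambda>_. 1) b T" T] b(2) that by simp
    have "K.boundary p c" by (rule boundary_Loc[where b = b and n = n, OF b(1)[rule_format] z2])
    then show "A \<in> {cech_coboundaries S M xs p}" unfolding c(1) by (simp add: K.cohom_class_boundary)
  next
    fix A assume "A \<in> {cech_coboundaries S M xs p}"
    then have "A = K.cohom_class p (\<lambda>_. 0)" using K.cohom_class_boundary[OF K.boundary_zero] by simp
    then show "A \<in> carrier (H p n)" unfolding H_carrier using Loc_zero by (auto simp: koszul_diff_def)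
  qed
  then show ?thesis unfolding for_all_large_def using m'(2) by blast
qed

lemma H_add: "A \<oplus>\<^bsub>H p n\<^esub> B = A <+>\<^bsub>cech_module S M xs p\<^esub> B"
  by (simp add: rees_local_cohomology_component_def Let_def local_cohomology_def)

lemma H_smult: "r \<odot>\<^bsub>H p n\<^esub> A = Poly_Mapping.single 0 r \<odot>\<^bsub>local_cohomology S M xs p\<^esub> A"
  by (simp add: rees_local_cohomology_component_def Let_def)

text \<open>A chain of submodules is pulled back to the localization at all indices, where its
  members contain the top coboundaries; the rank function then bounds its length.\<close>

lemma H_top_length:
  assumes strict: "strict_complete_reduction ring_of_type_algebra I F x" and n: "0 \<le> n"
  shows "module_length ring_of_type_algebra (H CARD('d) n) < \<infinity>"
proof -
  let ?p = "CARD('d)" and ?W = "Loc UNIV n"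
  obtain e E where sr: "strict_reduction FQ aQ uQ e E" using strict_reduction_exists[OF strict] by blast
  from strict_reduction.bounded_rank_a[OF sr n] obtain \<phi> b where \<phi>: "\<And>N. \<phi> N \<le> (b::nat)"
    "\<And>N N'. submod (FQ 0) (*) N \<Longrightarrow> submod (FQ 0) (*) N' \<Longrightarrow> cech_image aQ wt FQ n \<subseteq> N \<Longrightarrow> N \<subset> N' \<Longrightarrow> N' \<subseteq> ?W \<Longrightarrow> \<phi> N < (\<phi> N' :: nat)"
    unfolding bounded_rank_def by blast
  have W: "submod (FQ 0) (*) ?W" by (rule Q.submod_loc[OF J.a_mem finite])
  \<comment> \<open>In top degree a cochain amounts to its entry at \<open>UNIV\<close>, and each
    one is a cocycle, as no larger index set exists.\<close>
  have full: "T = UNIV" if "card T = ?p" for T :: "'d set" using that by (simp add: card_eq_UNIV_imp_eq_UNIV)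
  have nofull: "card T \<noteq> Suc ?p" for T :: "'d set" using card_mono[of UNIV T] by auto
  let ?cl = "\<lambda>q. K.cohom_class ?p (\<lambda>_. q)"
  have cochain: "K.cochain ?p (\<lambda>_. q)" if "q \<in> ?W" for q using Loc_D[OF that] full by (auto simp: K.cochain_def)
  have carrier: "carrier (H ?p n) = ?cl ` ?W"
  proof (intro equalityI subsetI)
    fix A assume "A \<in> carrier (H ?p n)"
    then obtain c where c: "A = K.cohom_class ?p c" "\<forall>T. card T = ?p \<longrightarrow> c T \<in> Loc T n" unfolding H_carrier by blast
    have "K.cohom_class ?p c = ?cl (c UNIV)" by (rule K.cohom_class_cong) (use full in blast)
    then show "A \<in> ?cl ` ?W" using c by blast
  next
    fix A assume "A \<in> ?cl ` ?W"
    then show "A \<in> carrier (H ?p n)" unfolding H_carrier using full nofull by blast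
  qed
  have len: "k \<le> b" if Hs: "\<forall>i\<le>k. submodule (N i) ring_of_type_algebra (H ?p n)" "\<forall>i<k. N i \<subset> N (Suc i)" for k N
  proof -
    define V where "V i = {q \<in> ?W. ?cl q \<in> N i}" for i
    have zero: "?cl 0 \<in> N i" and sub: "N i \<subseteq> ?cl ` ?W" and add: "A \<in> N i \<Longrightarrow> B \<in> N i \<Longrightarrow> A \<oplus>\<^bsub>H ?p n\<^esub> B \<in> N i"
      and scale: "A \<in> N i \<Longrightarrow> r \<odot>\<^bsub>H ?p n\<^esub> A \<in> N i" if "i \<le> k" for i A B r
    proof -
      have sm: "submodule (N i) ring_of_type_algebra (H ?p n)" using Hs(1) \<open>i \<le> k\<close> by blast
      have sg: "subgroup (N i) (add_monoid (H ?p n))" using sm by (rule submodule.axioms(1))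
      show "?cl 0 \<in> N i" using subgroup.one_closed[OF sg] H_zero[of ?p n] K.cohom_class_boundary[OF K.boundary_zero[of ?p]] by simp
      show "N i \<subseteq> ?cl ` ?W" using subgroup.subset[OF sg] carrier by simp
      show "A \<oplus>\<^bsub>H ?p n\<^esub> B \<in> N i" if "A \<in> N i" "B \<in> N i" using subgroup.m_closed[OF sg that] by simp
      show "r \<odot>\<^bsub>H ?p n\<^esub> A \<in> N i" if "A \<in> N i" using submodule.smult_closed[OF sm _ that, of r] by simp
    qed
    have Vsub: "submod (FQ 0) (*) (V i)" if i: "i \<le> k" for i
      unfolding submod_def
    proof (intro conjI ballI)
      show "0 \<in> V i" using zero[OF i] submodD(1)[OF W] by (simp add: V_def)
      show "q + q' \<in> V i" if q: "q \<in> V i" "q' \<in> V i" for q q'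
      proof -
        have "?cl (q + q') = ?cl q \<oplus>\<^bsub>H ?p n\<^esub> ?cl q'"
          unfolding H_add by (rule K.cohom_class_add[symmetric]) (use q cochain in \<open>auto simp: V_def\<close>)
        then show ?thesis using q add[OF i] submodD(2)[OF W] by (simp add: V_def)
      qed
      show "s * q \<in> V i" if s: "s \<in> FQ 0" and q: "q \<in> V i" for s q
      proof -
        obtain r where r: "s = frac_monom 0 r" "r \<in> F 0" using s by blast
        have "r \<odot>\<^bsub>H ?p n\<^esub> ?cl q = ?cl (to_frac (Poly_Mapping.single 0 r) * q)"
          unfolding H_smult
        proof (rule K.cohom_class_smult)
          show "Poly_Mapping.single 0 r * m \<in> extended_rees F" if "m \<in> extended_rees F" for m
            by (rule rees_mult[OF _ that]) (use r single_in_rees in blast)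
          show "K.cochain ?p (\<lambda>_. q)" using q cochain by (auto simp: V_def)
        qed
        then have "?cl (s * q) = r \<odot>\<^bsub>H ?p n\<^esub> ?cl q" by (simp add: r frac_monom_def)
        then show ?thesis using q scale[OF i] submodD(3)[OF W s] by (simp add: V_def)
      qed
    qed
    have im: "cech_image aQ wt FQ n \<subseteq> V i" if i: "i \<le> k" for i
    proof
      fix q assume "q \<in> cech_image aQ wt FQ n"
      then obtain c where c: "q = koszul_diff (\<lambda>_. 1) c UNIV" "\<And>T. Suc (card T) = ?p \<Longrightarrow> c T \<in> Loc T n" unfolding cech_image_def by blast
      have "K.boundary ?p (\<lambda>_. q)" by (rule boundary_Loc[OF c(2)]) (use c(1) full in auto)
      then have "?cl q = ?cl 0" using K.cohom_class_boundary K.boundary_zero by simp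
      moreover have "q \<in> ?W" unfolding c(1)
      proof (rule koszul_diff_mem[OF loc_addsub[OF J.a_op[OF Q.graded_ideal_F] finite]])
        show "1 * c (UNIV - {i}) \<in> ?W" for i
          using c(2)[of "UNIV - {i}"] loc_mono_set[OF J.a_op[OF Q.graded_ideal_F], of UNIV "UNIV - {i}" n] by auto
      qed
      ultimately show "q \<in> V i" using zero[OF i] by (simp add: V_def)
    qed
    have step: "V i \<subset> V (Suc i)" if i: "i < k" for i
    proof -
      obtain A where A: "A \<in> N (Suc i)" "A \<notin> N i" using Hs(2) i by blast
      obtain q where "A = ?cl q" "q \<in> ?W" using sub[of "Suc i"] A(1) i by auto
      then have "q \<in> V (Suc i)" "q \<notin> V i" using A by (auto simp: V_def)
      moreover have "V i \<subseteq> V (Suc i)" using Hs(2) i by (auto simp: V_def)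
      ultimately show ?thesis by blast
    qed
    \<comment> \<open>The rank grows by at least one along each strict inclusion, starting from at
      least zero.\<close>
    have "i \<le> \<phi> (V i)" if "i \<le> k" for i
      using that
    proof (induction i)
      case (Suc i)
      have "\<phi> (V i) < \<phi> (V (Suc i))"
        by (rule \<phi>(2)) (use Suc.prems Vsub im step in \<open>auto simp: V_def\<close>)
      then show ?case using Suc by simp
    qed simp
    then show ?thesis using \<phi>(1)[of "V k"] order_trans by blast
  qed
  have "module_length ring_of_type_algebra (H ?p n) \<le> enat b"
    unfolding module_length_def by (rule Sup_least) (use len in auto)
  then show ?thesis by (rule le_less_trans) simp
qed

end

theorem theorem1p1:
  fixes R :: "'a::comm_ring_1 ring"
    and \<mm> :: "'a set"
    and I :: "'d::{finite,linorder} \<Rightarrow> 'a set"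
    and F :: "int ^ 'd::{finite,linorder} \<Rightarrow> 'a set"
    and x :: "'d \<Rightarrow> 'd \<Rightarrow> 'a"
    and a :: "'d \<Rightarrow> 'a"
  assumes R: "R = ring_of_type_algebra"
    and CM: "cohen_macaulay_local_ring R \<mm>"
    and dim: "krull_dim R = enat CARD('d)"
    and I: "\<And>i. primary_to R \<mm> (I i)"
    and F: "admissible_filtration I F"
    and x: "complete_reduction R I F x"
    and a: "\<And>i. a i = x i i"
  shows "(\<forall>i. for_all_large (\<lambda>n.
            carrier (rees_local_cohomology_component I F a i n)
              = {\<zero>\<^bsub>rees_local_cohomology_component I F a i n\<^esub>}))
       \<and> (strict_complete_reduction R I F x \<longrightarrow>
            (\<forall>n\<ge>0. module_length R (rees_local_cohomology_component I F a CARD('d) n) < \<infinity>))"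
proof -
  interpret cm_reduction \<mm> I F x
    using CM dim I F x unfolding R by (rule cm_reduction.intro)
  have "a = (\<lambda>i. x i i)" using a by (simp add: fun_eq_iff)
  then show ?thesis using H_vanishing H_top_length unfolding R by simp
qed

end
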